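(* Let $\theta>1$, $\frac1\theta+\frac1{\theta'}=1$, $\mu\in\mathbb{R}$, $\sigma>0$, and let $X$ satisfy $$dX(t)=\mu\,dt+\sigma\,dW(t)-\frac{X(t-)}{\theta'}\,N(dt),$$ where $W$ is a standard Brownian motion and $N$ is a point process on the line with stochastic intensity $\Lambda(X(t-))$ with respect to the natural filtration of $X$. Assume that (i) the function $x\mapsto\Lambda(x)\ge 0$ is measurable; (ii) for all $0\le a<b<+\infty$, $\int_a^b\Lambda(X(t))\,dt<+\infty$ almost surely. Then the density $p(t,x)$ of $X(t)$ satisfies the non-local partial differential equation $$\frac{\partial p(t,x)}{\partial t}=\frac{\sigma^2}{2}\frac{\partial^2p(t,x)}{\partial x^2}-\mu\frac{\partial p(t,x)}{\partial x}-\Lambda(x)p(t,x)+\theta\Lambda(\theta x)p(t,\theta x).$$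
   Context: At each point $t$ of $N$ the process jumps from $X(t-)$ to $X(t-)/\theta$; between points of $N$ it evolves as a Brownian motion with drift $\mu$ and diffusion coefficient $\sigma$. The initial value is a deterministic $X(0)=x_0\in\mathbb{R}$. The function $\Lambda$ may be, e.g., a constant, $\lambda/|x|^\alpha$ with $0\le\alpha<1$, or $\min\{\lambda/|x|^\alpha,L\}$. The equation is understood for $t>0$ and at points $x$ where $\Lambda(x)$ and $\Lambda(\theta x)$ are finite.
   Formalization: W is Brownian for the completed natural filtration of X. The equation is proved in the sense of distributions; pointwise only where p is C^{1,2}, for a.e. (t,x), and at points where Λ is continuous at x and θx and p at (t,θx), as it can fail at other points for merely measurable Λ. *)

theory Defs
  imports "HOL-Probability.Probability"
begin

text \<open>
  Processes are functions \<open>real \<Rightarrow> 'a \<Rightarrow> real\<close> of which only the times \<open>t \<ge> 0\<close> matter.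

  The natural filtration is completed by the null events. Without this, neither the points of
  \<open>N\<close> nor \<open>W\<close> need be adapted to it: a point of \<open>N\<close> at a time with \<open>X(t-) = 0\<close>, and the behaviour
  on the null event where the equation fails, leave no trace in \<open>X\<close>.
\<close>

definition natural_filtration :: "'a measure \<Rightarrow> (real \<Rightarrow> 'a \<Rightarrow> real) \<Rightarrow> real \<Rightarrow> 'a measure" where
  "natural_filtration M X t =
     sigma (space M) ({X s -` A \<inter> space M |s A. 0 \<le> s \<and> s \<le> t \<and> A \<in> sets borel} \<union> null_sets M)"

definition brownian_motion ::
  "'a measure \<Rightarrow> (real \<Rightarrow> 'a measure) \<Rightarrow> (real \<Rightarrow> 'a \<Rightarrow> real) \<Rightarrow> bool" where
  "brownian_motion M F W \<longleftrightarrow>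
     (AE \<omega> in M. W 0 \<omega> = 0) \<and>
     (AE \<omega> in M. continuous_on {0..} (\<lambda>t. W t \<omega>)) \<and>
     (\<forall>t\<ge>0. W t \<in> borel_measurable (F t)) \<and>
     (\<forall>s t. 0 \<le> s \<and> s < t \<longrightarrow>
        distributed M lborel (\<lambda>\<omega>. W t \<omega> - W s \<omega>)
          (\<lambda>x. ennreal (normal_density 0 (sqrt (t - s)) x)) \<and>
        prob_space.indep_set M (sets (F s))
          {(\<lambda>\<omega>. W t \<omega> - W s \<omega>) -` B \<inter> space M |B. B \<in> sets borel})"

text \<open>A simple, locally finite point process on the half-line, given by its random set of points.\<close>

definition point_process :: "'a measure \<Rightarrow> ('a \<Rightarrow> real set) \<Rightarrow> bool" where
  "point_process M N \<longleftrightarrow>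
     (\<forall>\<omega>\<in>space M. N \<omega> \<subseteq> {0<..} \<and> (\<forall>t. finite (N \<omega> \<inter> {0<..t}))) \<and>
     (\<forall>t. (\<lambda>\<omega>. real (card (N \<omega> \<inter> {0<..t}))) \<in> borel_measurable M)"

definition predictable_sigma :: "'a measure \<Rightarrow> (real \<Rightarrow> 'a measure) \<Rightarrow> (real \<times> 'a) measure" where
  "predictable_sigma M F =
     sigma ({0<..} \<times> space M) {{s<..t} \<times> A |s t A. 0 \<le> s \<and> s \<le> t \<and> A \<in> sets (F s)}"

text \<open>
  Stochastic intensity in the sense of Bremaud: \<open>N\<close> is adapted and
  \<open>E \<integral> C(s) N(ds) = E \<integral> C(s) lam(s) ds\<close> for every nonnegative predictable \<open>C\<close>.
  The integral against \<open>N\<close> is the sum over the points of \<open>N\<close>. The almost sure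
  local integrability of \<open>lam\<close> is not part of this definition and has to be assumed separately.
\<close>

definition has_stochastic_intensity ::
  "'a measure \<Rightarrow> (real \<Rightarrow> 'a measure) \<Rightarrow> ('a \<Rightarrow> real set) \<Rightarrow> (real \<Rightarrow> 'a \<Rightarrow> ennreal) \<Rightarrow> bool" where
  "has_stochastic_intensity M F N lam \<longleftrightarrow>
     (\<forall>t\<ge>0. (\<lambda>\<omega>. real (card (N \<omega> \<inter> {0<..t}))) \<in> borel_measurable (F t)) \<and>
     (\<forall>C :: real \<times> 'a \<Rightarrow> ennreal. C \<in> borel_measurable (predictable_sigma M F) \<longrightarrow>
        (\<integral>\<^sup>+ \<omega>. (\<integral>\<^sup>+ s. C (s, \<omega>) \<partial>count_space (N \<omega>)) \<partial>M) =
        (\<integral>\<^sup>+ \<omega>. (\<integral>\<^sup>+ s\<in>{0<..}. C (s, \<omega>) * lam s \<omega> \<partial>lborel) \<partial>M))"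

definition left_lim :: "(real \<Rightarrow> 'a \<Rightarrow> real) \<Rightarrow> real \<Rightarrow> 'a \<Rightarrow> real" where
  "left_lim X t \<omega> = Lim (at_left t) (\<lambda>s. X s \<omega>)"

text \<open>
  The integrated form of \<open>dX(t) = \<mu> dt + \<sigma> dW(t) - X(t-)/\<theta>' N(dt)\<close>, \<open>X(0) = x0\<close>. As \<open>N\<close> is locally
  finite and \<open>W\<close> is continuous, it forces the paths of \<open>X\<close> to be right-continuous with left limits.
\<close>

definition solves_jump_sde ::
  "'a measure \<Rightarrow> real \<Rightarrow> real \<Rightarrow> real \<Rightarrow> real \<Rightarrow> (real \<Rightarrow> 'a \<Rightarrow> real) \<Rightarrow> ('a \<Rightarrow> real set) \<Rightarrow>
     (real \<Rightarrow> 'a \<Rightarrow> real) \<Rightarrow> bool" where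
  "solves_jump_sde M \<theta>' \<mu> \<sigma> x0 W N X \<longleftrightarrow>
     (AE \<omega> in M. \<forall>t\<ge>0. X t \<omega> =
        x0 + \<mu> * t + \<sigma> * W t \<omega> - (\<Sum>s\<in>N \<omega> \<inter> {0<..t}. left_lim X s \<omega> / \<theta>'))"

text \<open>\<open>p t\<close> is a Lebesgue density of \<open>X t\<close> for every \<open>t > 0\<close>, in a jointly measurable version.\<close>

definition density_of_process ::
  "'a measure \<Rightarrow> (real \<Rightarrow> 'a \<Rightarrow> real) \<Rightarrow> (real \<Rightarrow> real \<Rightarrow> real) \<Rightarrow> bool" where
  "density_of_process M X p \<longleftrightarrow>
     (\<lambda>(t, x). p t x) \<in> borel_measurable (restrict_space borel ({0<..} \<times> UNIV)) \<and>
     (\<forall>t>0. (\<forall>x. 0 \<le> p t x) \<and> distributed M lborel (X t) (\<lambda>x. ennreal (p t x)))"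

definition dt :: "(real \<Rightarrow> real \<Rightarrow> real) \<Rightarrow> real \<Rightarrow> real \<Rightarrow> real" where
  "dt f t x = deriv (\<lambda>s. f s x) t"

definition dx :: "(real \<Rightarrow> real \<Rightarrow> real) \<Rightarrow> real \<Rightarrow> real \<Rightarrow> real" where
  "dx f t x = deriv (\<lambda>y. f t y) x"

definition C12_on :: "(real \<times> real) set \<Rightarrow> (real \<Rightarrow> real \<Rightarrow> real) \<Rightarrow> bool" where
  "C12_on U f \<longleftrightarrow>
     (\<forall>(t, x)\<in>U. (\<lambda>s. f s x) field_differentiable at t \<and>
        (\<lambda>y. f t y) field_differentiable at x \<and>
        (\<lambda>y. dx f t y) field_differentiable at x) \<and>
     continuous_on U (\<lambda>(t, x). f t x) \<and>
     continuous_on U (\<lambda>(t, x). dt f t x) \<and>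
     continuous_on U (\<lambda>(t, x). dx f t x) \<and>
     continuous_on U (\<lambda>(t, x). dx (dx f) t x)"

definition forward_equation_at ::
  "(real \<Rightarrow> ennreal) \<Rightarrow> real \<Rightarrow> real \<Rightarrow> real \<Rightarrow> (real \<Rightarrow> real \<Rightarrow> real) \<Rightarrow> real \<Rightarrow> real \<Rightarrow> bool" where
  "forward_equation_at \<Lambda> \<theta> \<mu> \<sigma> p t x \<longleftrightarrow>
     dt p t x = \<sigma>\<^sup>2 / 2 * dx (dx p) t x - \<mu> * dx p t x
       - enn2real (\<Lambda> x) * p t x + \<theta> * enn2real (\<Lambda> (\<theta> * x)) * p t (\<theta> * x)"

definition locally_integrable_on :: "(real \<times> real) set \<Rightarrow> (real \<times> real \<Rightarrow> real) \<Rightarrow> bool" where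
  "locally_integrable_on U f \<longleftrightarrow> (\<forall>K. compact K \<and> K \<subseteq> U \<longrightarrow> set_integrable lborel K f)"

text \<open>
  The same equation on \<open>(0, \<infinity>) \<times> \<real>\<close> in the sense of distributions: multiply by a test function and
  move the derivatives of \<open>p\<close> onto it. All compactly supported functions of class \<open>C\<^sup>1\<close> in \<open>t\<close> and
  \<open>C\<^sup>2\<close> in \<open>x\<close> are admitted, in particular all smooth ones. Local integrability
  of the terms of order zero is part of the notion. The value 0 that \<open>enn2real\<close> assigns to \<open>\<infinity>\<close> is
  harmless: if \<open>\<integral> \<Lambda>(X(t)) dt\<close> is locally finite, then \<open>p\<close> vanishes almost everywhere on
  \<open>{\<Lambda> = \<infinity>}\<close>.
\<close>

definition forward_equation_distributional ::
  "(real \<Rightarrow> ennreal) \<Rightarrow> real \<Rightarrow> real \<Rightarrow> real \<Rightarrow> (real \<Rightarrow> real \<Rightarrow> real) \<Rightarrow> bool" where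
  "forward_equation_distributional \<Lambda> \<theta> \<mu> \<sigma> p \<longleftrightarrow>
     locally_integrable_on ({0<..} \<times> UNIV) (\<lambda>(t, x). p t x) \<and>
     locally_integrable_on ({0<..} \<times> UNIV) (\<lambda>(t, x). enn2real (\<Lambda> x) * p t x) \<and>
     locally_integrable_on ({0<..} \<times> UNIV) (\<lambda>(t, x). enn2real (\<Lambda> (\<theta> * x)) * p t (\<theta> * x)) \<and>
     (\<forall>\<phi> K. compact K \<and> K \<subseteq> {0<..} \<times> UNIV \<and> C12_on UNIV \<phi> \<and>
        (\<forall>t x. (t, x) \<notin> K \<longrightarrow> \<phi> t x = 0) \<longrightarrow>
        - (\<integral>(t, x)\<in>K. p t x * dt \<phi> t x \<partial>lborel) =
          \<sigma>\<^sup>2 / 2 * (\<integral>(t, x)\<in>K. p t x * dx (dx \<phi>) t x \<partial>lborel)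
          + \<mu> * (\<integral>(t, x)\<in>K. p t x * dx \<phi> t x \<partial>lborel)
          - (\<integral>(t, x)\<in>K. enn2real (\<Lambda> x) * p t x * \<phi> t x \<partial>lborel)
          + \<theta> * (\<integral>(t, x)\<in>K. enn2real (\<Lambda> (\<theta> * x)) * p t (\<theta> * x) * \<phi> t x \<partial>lborel))"

end

theory Submission imports Defs begin

text \<open>
  On the event that no jump occurs in \<open>(t - h, t]\<close>, \<open>X(t)\<close> is \<open>X(t - h)\<close> plus an independent Gaussian
  variable, and the probability of this event tends to 1 as \<open>h \<rightarrow> 0\<close>. Hence \<open>X(t)\<close> has a density.

  To test the equation one needs \<open>E \<integral>\<^sub>0\<^sup>T \<Lambda>(X(s)) ds < \<infinity>\<close>, which the almost sure hypothesis (ii)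
  does not give at once. A downward jump of \<open>\<bar>X\<bar>\<close> lowers a logarithmic barrier by a fixed amount, so
  Dynkin's formula for that barrier, stopped at the \<open>n\<close>-th jump, bounds the expected number of jumps made
  from outside a neighbourhood of the origin. Near the origin, the paths reach 0 with positive probability,
  and there the occupation density of Brownian motion and a Paley--Zygmund argument turn (ii) into the
  Lebesgue integrability of \<open>\<Lambda>\<close> around 0. Dynkin's formula for Newtonian potentials concentrated in \<open>(-e, e)\<close>
  bounds the occupation density of \<open>X\<close> there by a constant plus \<open>2e/\<sigma>\<^sup>2\<close> times the expected number of jumps
  from \<open>(-e, e)\<close>, and for small \<open>e\<close> this term can be absorbed.

  With this bound, Dynkin's formula passes to the limit \<open>n \<rightarrow> \<infinity>\<close> for every test function and is the equation
  in the sense of distributions; the substitution \<open>x \<mapsto> \<theta>x\<close> produces the non-local term. Where \<open>p\<close> is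
  smooth, test functions \<open>a(t) b(x)\<close> increasing to the indicator of a rectangle, and integration by parts,
  show that the difference of the two sides has integral 0 over every rectangle.
\<close>

section \<open>Paths of the process\<close>

text \<open>A jump from x moves the path by |x|/\<theta>' only, so near 0 no smooth barrier drops by
  a fixed amount per jump; this is why the origin needs a separate argument. The absorption there
  rests on two facts: the potential of a density h is Lipschitz with the integral of h as constant,
  and a jump from (-e, e) is shorter than e. Jumps therefore enter the occupation bound with a
  factor e, and integrability of \<Lambda> turns that bound back into one for the number of jumps.
  Absorbing requires a finite quantity, so everything is first restricted to the first n jumps,
  which contribute at most n. Stopping times and stochastic integrals are avoided: Dynkin's formula
  comes from a deterministic grid, with conditioning at grid times and jump counts in place of
  stopping, and near visits to 0 are caught by the first member of a finite set of times. \<Lambda>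
  must be integrable near 0 because otherwise, with probability bounded below, a visit within sqrt d
  of 0 would be followed by a jump within time d, for every d of a null sequence; then some jump
  would start from 0, yet the expected number of such jumps is 0, as X is at 0 for a null set of
  times.\<close>

lemma Int_greaterThanAtMost_eq:
  fixes s t :: real
  assumes "s \<le> t" "S \<inter> {s<..t} = {}"
  shows "S \<inter> {a<..s} = S \<inter> {a<..t}"
proof (intro equalityI subsetI)
  fix r assume "r \<in> S \<inter> {a<..t}"
  with assms(2) show "r \<in> S \<inter> {a<..s}" by (cases "r \<le> s") auto
qed (use assms(1) in auto)


text \<open>The finitely many points before \<open>s\<close> stay away from it. Sums over the points
  of \<open>N\<close> and the count are therefore constant just to the left of any time.\<close>

lemma card_Int_at_left:
  fixes S :: "real set"
  assumes fin: "\<And>t. finite (S \<inter> {0<..t})"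
  shows "eventually (\<lambda>r. S \<inter> {0<..r} = S \<inter> {0<..<s}) (at_left s)"
proof -
  have f: "finite (S \<inter> {0<..<s})" by (rule finite_subset[OF _ fin[of s]]) auto
  have "eventually (\<lambda>r. \<forall>x\<in>S \<inter> {0<..<s}. x < r) (at_left s)"
    using f by (intro eventually_ball_finite) (auto intro: order_tendstoD(1)[OF tendsto_ident_at])
  moreover have "eventually (\<lambda>r. r < s) (at_left s)"
    by (auto simp: eventually_at_filter)
  ultimately show ?thesis proof eventually_elim
    case (elim r)
    show ?case
    proof (intro equalityI subsetI)
      fix x assume "x \<in> S \<inter> {0<..<s}"
      with elim(1) show "x \<in> S \<inter> {0<..r}" by (auto intro: less_imp_le)
    qed (use elim(2) in auto)
  qed
qed

lemma card_Int_at_right: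
  fixes S :: "real set"
  assumes fin: "\<And>t. finite (S \<inter> {0<..t})" and s: "0 \<le> s"
  shows "eventually (\<lambda>r. S \<inter> {0<..r} = S \<inter> {0<..s}) (at_right s)"
proof -
  have f: "finite (S \<inter> {0<..s + 1} - {..s})" using fin[of "s+1"] by auto
  have "eventually (\<lambda>r. \<forall>x\<in>S \<inter> {0<..s + 1} - {..s}. r < x) (at_right s)"
    using f by (intro eventually_ball_finite) (auto intro: order_tendstoD(2)[OF tendsto_ident_at])
  moreover have "eventually (\<lambda>r. s < r) (at_right s)" by (rule eventually_at_right_less)
  moreover have "eventually (\<lambda>r. r < s + 1) (at_right s)"
    by (rule order_tendstoD(2)[OF tendsto_ident_at]) simp
  ultimately show ?thesis proof eventually_elim
    case (elim r)
    have "S \<inter> {s<..r} = {}"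
    proof (rule ccontr)
      assume "S \<inter> {s<..r} \<noteq> {}"
      then obtain x where x: "x \<in> S" "s < x" "x \<le> r" by auto
      have "x \<in> S \<inter> {0<..s + 1} - {..s}" using elim(3) x s by auto
      then have "r < x" using elim(1) by blast
      then show False using x by auto
    qed
    then show ?case using elim(2) by (intro Int_greaterThanAtMost_eq[symmetric]) auto
  qed
qed

text \<open>The path properties are required for every outcome; a solution is brought into this form by modifying it on a null set.\<close>

locale jump_diffusion = prob_space M for M :: "'a measure" +
  fixes F :: "real \<Rightarrow> 'a measure" and W X :: "real \<Rightarrow> 'a \<Rightarrow> real" and N :: "'a \<Rightarrow> real set"
    and \<Lambda> :: "real \<Rightarrow> ennreal" and \<theta> \<theta>' \<mu> \<sigma> x0 :: real
  assumes space_F: "space (F t) = space M" and sets_F: "sets (F t) \<subseteq> sets M"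
    and F_mono: "s \<le> t \<Longrightarrow> sets (F s) \<subseteq> sets (F t)"
    and X_adapted: "0 \<le> t \<Longrightarrow> X t \<in> borel_measurable (F t)"
    and W_adapted: "0 \<le> t \<Longrightarrow> W t \<in> borel_measurable (F t)"
    and N_adapted: "0 \<le> t \<Longrightarrow> (\<lambda>w. real (card (N w \<inter> {0<..t}))) \<in> borel_measurable (F t)"
    and W_0: "w \<in> space M \<Longrightarrow> W 0 w = 0"
    and W_cont: "w \<in> space M \<Longrightarrow> continuous_on {0..} (\<lambda>t. W t w)"
    and W_increment: "0 \<le> s \<Longrightarrow> s < t \<Longrightarrow> distributed M lborel (\<lambda>w. W t w - W s w)
          (\<lambda>x. ennreal (normal_density 0 (sqrt (t - s)) x))"
    and W_indep: "0 \<le> s \<Longrightarrow> s < t \<Longrightarrow> A \<in> sets (F s) \<Longrightarrow> B \<in> sets borel \<Longrightarrow>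
        prob (A \<inter> ((\<lambda>w. W t w - W s w) -` B \<inter> space M)) =
        prob A * prob ((\<lambda>w. W t w - W s w) -` B \<inter> space M)"
    and N_pos: "w \<in> space M \<Longrightarrow> N w \<subseteq> {0<..}"
    and N_finite: "w \<in> space M \<Longrightarrow> finite (N w \<inter> {0<..t})"
    and intensity: "C \<in> borel_measurable (predictable_sigma M F) \<Longrightarrow>
        (\<integral>\<^sup>+ w. (\<integral>\<^sup>+ s. C (s, w) \<partial>count_space (N w)) \<partial>M) =
        (\<integral>\<^sup>+ w. (\<integral>\<^sup>+ s\<in>{0<..}. C (s, w) * \<Lambda> (left_lim X s w) \<partial>lborel) \<partial>M)"
    and X_eq: "w \<in> space M \<Longrightarrow> 0 \<le> t \<Longrightarrow> X t w =
        x0 + \<mu> * t + \<sigma> * W t w - (\<Sum>s\<in>N w \<inter> {0<..t}. left_lim X s w / \<theta>')"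
    and \<theta>_gt_1: "\<theta> > 1" and \<theta>': "1 / \<theta> + 1 / \<theta>' = 1" and \<sigma>_pos: "\<sigma> > 0"
    and \<Lambda>_measurable [measurable]: "\<Lambda> \<in> borel_measurable borel"
    and \<Lambda>_finite: "0 \<le> a \<Longrightarrow> a < b \<Longrightarrow> AE w in M. (\<integral>\<^sup>+ t\<in>{a..b}. \<Lambda> (X t w) \<partial>lborel) < \<infinity>"
begin

abbreviation XL :: "real \<Rightarrow> 'a \<Rightarrow> real" where "XL \<equiv> left_lim X"

definition count :: "real \<Rightarrow> 'a \<Rightarrow> nat" where
  "count t w = card (N w \<inter> {0<..t})"

text \<open>The left limit of \<open>count\<close>. It is predictable, as the intensity formula
  requires, and equals k - 1 at the k-th point of \<open>N\<close>; so \<open>countL s w < n\<close>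
  singles out the first n jumps.\<close>

definition countL :: "real \<Rightarrow> 'a \<Rightarrow> nat" where
  "countL t w = card (N w \<inter> {0<..<t})"

lemma W_at_left: "w \<in> space M \<Longrightarrow> 0 < s \<Longrightarrow> ((\<lambda>t. W t w) \<longlongrightarrow> W s w) (at_left s)"
proof -
  assume a: "w \<in> space M" "0 < s"
  have "((\<lambda>t. W t w) \<longlongrightarrow> W s w) (at s within {0..})"
    using W_cont[OF a(1)] a by (auto simp: continuous_on_def)
  moreover have "at s within {0..} = at s"
    using a by (intro at_within_interior) auto
  ultimately show ?thesis by (auto intro: tendsto_within_subset)
qed

lemma W_at_right: "w \<in> space M \<Longrightarrow> 0 \<le> s \<Longrightarrow> ((\<lambda>t. W t w) \<longlongrightarrow> W s w) (at_right s)"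
proof -
  assume a: "w \<in> space M" "0 \<le> s"
  have "((\<lambda>t. W t w) \<longlongrightarrow> W s w) (at s within {0..})"
    using W_cont[OF a(1)] a by (auto simp: continuous_on_def)
  then show ?thesis by (rule tendsto_within_subset) (use a in auto)
qed

text \<open>\<open>left_lim\<close> is \<open>Lim\<close>, which says nothing unless the limit
  exists. Just below \<open>s\<close> no further point of \<open>N\<close> enters the sum, so the
  equation itself supplies the limit; its right-hand side contains only left limits at strictly
  earlier points.\<close>

lemma left_limit_formula:
  assumes w: "w \<in> space M" and s: "0 < s"
  shows "((\<lambda>t. X t w) \<longlongrightarrow> x0 + \<mu> * s + \<sigma> * W s w - (\<Sum>r\<in>N w \<inter> {0<..<s}. XL r w / \<theta>')) (at_left s)"
proof -
  have "((\<lambda>t. x0 + \<mu> * t + \<sigma> * W t w - (\<Sum>r\<in>N w \<inter> {0<..<s}. XL r w / \<theta>'))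
    \<longlongrightarrow> x0 + \<mu> * s + \<sigma> * W s w - (\<Sum>r\<in>N w \<inter> {0<..<s}. XL r w / \<theta>')) (at_left s)"
    by (intro tendsto_intros W_at_left w s)
  moreover have "eventually (\<lambda>t. X t w = x0 + \<mu> * t + \<sigma> * W t w - (\<Sum>r\<in>N w \<inter> {0<..<s}. XL r w / \<theta>')) (at_left s)"
    using card_Int_at_left[of "N w" s, OF N_finite[OF w]]
      order_tendstoD(1)[OF tendsto_ident_at s]
    by eventually_elim (simp add: X_eq[OF w])
  ultimately show ?thesis by (simp add: tendsto_cong)
qed

lemma X_at_left:
  assumes w: "w \<in> space M" and s: "0 < s"
  shows "((\<lambda>t. X t w) \<longlongrightarrow> XL s w) (at_left s)"
  using left_limit_formula[OF assms] tendsto_Lim[OF _ left_limit_formula[OF assms]]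
  by (simp add: left_lim_def)

lemma XL_formula:
  assumes w: "w \<in> space M" and s: "0 < s"
  shows "XL s w = x0 + \<mu> * s + \<sigma> * W s w - (\<Sum>r\<in>N w \<inter> {0<..<s}. XL r w / \<theta>')"
  using tendsto_Lim[OF _ left_limit_formula[OF assms]] by (simp add: left_lim_def)

lemma X_at_right:
  assumes w: "w \<in> space M" and s: "0 \<le> s"
  shows "((\<lambda>t. X t w) \<longlongrightarrow> X s w) (at_right s)"
proof -
  have "((\<lambda>t. x0 + \<mu> * t + \<sigma> * W t w - (\<Sum>r\<in>N w \<inter> {0<..s}. XL r w / \<theta>'))
    \<longlongrightarrow> x0 + \<mu> * s + \<sigma> * W s w - (\<Sum>r\<in>N w \<inter> {0<..s}. XL r w / \<theta>')) (at_right s)"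
    by (intro tendsto_intros W_at_right w s)
  moreover have "eventually (\<lambda>t. X t w = x0 + \<mu> * t + \<sigma> * W t w - (\<Sum>r\<in>N w \<inter> {0<..s}. XL r w / \<theta>')) (at_right s)"
    using card_Int_at_right[of "N w" s, OF N_finite[OF w] s] eventually_at_right_less[of s]
    by eventually_elim (use s in \<open>simp add: X_eq[OF w]\<close>)
  ultimately show ?thesis by (simp add: tendsto_cong X_eq[OF w s])
qed

lemma one_minus_inverse_\<theta>': "1 - 1 / \<theta>' = 1 / \<theta>"
  using \<theta>' by simp

text \<open>Compared with \<open>XL s w\<close> only the summand at \<open>s\<close> is new, and 1 -
  1/\<theta>' = 1/\<theta> turns the subtraction of \<open>XL s w / \<theta>'\<close> into a
  contraction.\<close>

lemma X_jump:
  assumes w: "w \<in> space M" and s: "s \<in> N w"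
  shows "X s w = XL s w / \<theta>"
proof -
  have s0: "0 < s" using N_pos[OF w] s by auto
  have f: "finite (N w \<inter> {0<..<s})" by (rule finite_subset[OF _ N_finite[OF w, of s]]) auto
  have "N w \<inter> {0<..s} = insert s (N w \<inter> {0<..<s})" using s s0 by auto
  then have "X s w = XL s w - XL s w / \<theta>'"
    using X_eq[OF w, of s] XL_formula[OF w s0] s0 f by simp
  also have "\<dots> = XL s w * (1 - 1 / \<theta>')" by (simp add: right_diff_distrib)
  finally show ?thesis by (simp add: one_minus_inverse_\<theta>')
qed

lemma X_no_jump:
  assumes w: "w \<in> space M" and s: "s \<notin> N w" "0 < s"
  shows "X s w = XL s w"
proof -
  have "N w \<inter> {0<..s} = N w \<inter> {0<..<s}" using s by (auto simp: less_le)
  then show ?thesis using X_eq[OF w, of s] XL_formula[OF w s(2)] s by simp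
qed

lemma count_no_jump: "s \<notin> N w \<Longrightarrow> count s w = countL s w"
proof -
  assume "s \<notin> N w"
  then have "N w \<inter> {0<..s} = N w \<inter> {0<..<s}" by (auto simp: less_le)
  then show ?thesis by (simp add: count_def countL_def)
qed

lemma count_at_left: "w \<in> space M \<Longrightarrow> eventually (\<lambda>r. count r w = countL s w) (at_left s)"
  using card_Int_at_left[of "N w" s, OF N_finite] unfolding count_def countL_def
  by (auto elim!: eventually_mono)

lemma count_at_right: "w \<in> space M \<Longrightarrow> 0 \<le> s \<Longrightarrow> eventually (\<lambda>r. count r w = count s w) (at_right s)"
  using card_Int_at_right[of "N w" s, OF N_finite] unfolding count_def countL_def
  by (auto elim!: eventually_mono)

lemma count_mono: "w \<in> space M \<Longrightarrow> s \<le> t \<Longrightarrow> count s w \<le> count t w"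
  unfolding count_def by (intro card_mono N_finite) auto

text \<open>Expresses the absence of points, a statement about a random set, by a measurable
  condition on counts.\<close>

lemma count_eq_iff:
  assumes "w \<in> space M" "0 \<le> s" "s \<le> t"
  shows "count s w = count t w \<longleftrightarrow> N w \<inter> {s<..t} = {}"
proof
  assume eq: "count s w = count t w"
  have "N w \<inter> {0<..s} = N w \<inter> {0<..t}"
    using eq assms unfolding count_def by (intro card_subset_eq N_finite) auto
  then have "\<not> (r \<in> N w \<and> s < r \<and> r \<le> t)" for r
    using assms(2) by (auto dest!: equalityD2 subsetD[where c = r])
  then show "N w \<inter> {s<..t} = {}" by auto
next
  assume "N w \<inter> {s<..t} = {}"
  then have "N w \<inter> {0<..s} = N w \<inter> {0<..t}" by (rule Int_greaterThanAtMost_eq[OF assms(3)])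
  then show "count s w = count t w" by (simp add: count_def)
qed

lemma X_increment:
  assumes "w \<in> space M" "0 \<le> s" "s \<le> t" "N w \<inter> {s<..t} = {}"
  shows "X t w = X s w + \<mu> * (t - s) + \<sigma> * (W t w - W s w)"
proof -
  have "N w \<inter> {0<..s} = N w \<inter> {0<..t}" using assms by (intro Int_greaterThanAtMost_eq) auto
  then show ?thesis using assms by (simp add: X_eq algebra_simps)
qed

lemma X_0: "w \<in> space M \<Longrightarrow> X 0 w = x0"
  by (simp add: X_eq W_0)

end

section \<open>Predictability and compensation\<close>

text \<open>\<open>grid_above k t\<close> and \<open>grid_below k t\<close> are the neighbours of
  \<open>t\<close> on the grid of mesh 1/(k + 1). They lie strictly on their side even if
  \<open>t\<close> is a grid point, so that one-sided limits apply to them.\<close>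

definition grid_above :: "nat \<Rightarrow> real \<Rightarrow> real" where
  "grid_above k t = (real (nat \<lfloor>real (Suc k) * t\<rfloor>) + 1) / real (Suc k)"

definition grid_below :: "nat \<Rightarrow> real \<Rightarrow> real" where
  "grid_below k t = (real (nat \<lceil>real (Suc k) * t\<rceil>) - 1) / real (Suc k)"

lemma grid_above: "0 \<le> t \<Longrightarrow> t < grid_above k t \<and> grid_above k t \<le> t + 1 / real (Suc k)"
proof -
  assume t: "0 \<le> t"
  let ?n = "real (Suc k)"
  have n: "?n > 0" by simp
  have "real (nat \<lfloor>?n * t\<rfloor>) = of_int \<lfloor>?n * t\<rfloor>" using t by (simp add: of_nat_nat)
  moreover have "of_int \<lfloor>?n * t\<rfloor> \<le> ?n * t" "?n * t < of_int \<lfloor>?n * t\<rfloor> + 1" by linarith+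
  ultimately show ?thesis unfolding grid_above_def using n
    by (simp add: field_simps del: of_nat_Suc)
qed

lemma grid_below:
  assumes t: "0 < t"
  shows "grid_below k t < t" "t - 1 / real (Suc k) \<le> grid_below k t" "0 \<le> grid_below k t"
proof -
  let ?n = "real (Suc k)"
  have n: "?n > 0" by simp
  have p: "?n * t > 0" using t n by simp
  have c: "1 \<le> \<lceil>?n * t\<rceil>" using p by linarith
  have e: "real (nat \<lceil>?n * t\<rceil>) = of_int \<lceil>?n * t\<rceil>" using c by (simp add: of_nat_nat)
  have "?n * t \<le> of_int \<lceil>?n * t\<rceil>" "of_int \<lceil>?n * t\<rceil> < ?n * t + 1" by linarith+
  then show "grid_below k t < t" "t - 1 / real (Suc k) \<le> grid_below k t" unfolding grid_below_def using n e
    by (simp_all add: field_simps del: of_nat_Suc)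
  show "0 \<le> grid_below k t" unfolding grid_below_def using n c e by simp
qed

lemma filterlim_grid_above: "0 \<le> t \<Longrightarrow> filterlim (\<lambda>k. grid_above k t) (at_right t) sequentially"
proof (rule tendsto_imp_filterlim_at_right)
  assume t: "0 \<le> t"
  show "(\<lambda>k. grid_above k t) \<longlonglongrightarrow> t"
  proof (rule tendsto_sandwich)
    show "eventually (\<lambda>k. t \<le> grid_above k t) sequentially"
      using grid_above[OF t] by (intro always_eventually allI less_imp_le) auto
    show "eventually (\<lambda>k. grid_above k t \<le> t + 1 / real (Suc k)) sequentially" using grid_above[OF t] by auto
    show "(\<lambda>k. t + 1 / real (Suc k)) \<longlonglongrightarrow> t"
      using tendsto_add[OF tendsto_const LIMSEQ_inverse_real_of_nat] by (simp add: inverse_eq_divide)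
  qed simp
  show "eventually (\<lambda>k. t < grid_above k t) sequentially" using grid_above[OF t] by auto
qed

lemma filterlim_grid_below: "0 < t \<Longrightarrow> filterlim (\<lambda>k. grid_below k t) (at_left t) sequentially"
proof (rule tendsto_imp_filterlim_at_left)
  assume t: "0 < t"
  show "(\<lambda>k. grid_below k t) \<longlonglongrightarrow> t"
  proof (rule tendsto_sandwich)
    show "eventually (\<lambda>k. t - 1 / real (Suc k) \<le> grid_below k t) sequentially"
      using grid_below[OF t] by auto
    show "eventually (\<lambda>k. grid_below k t \<le> t) sequentially" using grid_below[OF t] by (intro always_eventually allI less_imp_le) auto
    show "(\<lambda>k. t - 1 / real (Suc k)) \<longlonglongrightarrow> t"
      using tendsto_diff[OF tendsto_const LIMSEQ_inverse_real_of_nat] by (simp add: inverse_eq_divide)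
  qed simp
  show "eventually (\<lambda>k. grid_below k t < t) sequentially" using grid_below[OF t] by auto
qed

text \<open>The times \<open>grid_above k t\<close> form a countable set, at each of which the
  process is measurable, and right continuity passes to the limit. The \<open>max 0\<close> discards
  negative times, about which nothing is assumed.\<close>

lemma borel_measurable_pair_right_continuous:
  fixes Z :: "real \<Rightarrow> 'a \<Rightarrow> real"
  assumes Z: "\<And>t. 0 \<le> t \<Longrightarrow> Z t \<in> borel_measurable M"
    and rc: "\<And>w t. w \<in> space M \<Longrightarrow> 0 \<le> t \<Longrightarrow> ((\<lambda>s. Z s w) \<longlongrightarrow> Z t w) (at_right t)"
  shows "(\<lambda>(t, w). Z (max 0 t) w) \<in> borel_measurable (borel \<Otimes>\<^sub>M M)"
proof (rule borel_measurable_LIMSEQ_metric[where f = "\<lambda>k (t, w). Z (grid_above k (max 0 t)) w"])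
  fix k
  show "(\<lambda>(t, w). Z (grid_above k (max 0 t)) w) \<in> borel_measurable (borel \<Otimes>\<^sub>M M)"
  proof -
    have "(\<lambda>x. (\<lambda>i x. Z ((real i + 1) / real (Suc k)) (snd x)) (nat \<lfloor>real (Suc k) * max 0 (fst x)\<rfloor>) x)
      \<in> borel_measurable ((borel :: real measure) \<Otimes>\<^sub>M M)"
    proof (rule measurable_compose_countable[where f = "\<lambda>i x. Z ((real i + 1) / real (Suc k)) (snd x)"])
      show "(\<lambda>x. Z ((real i + 1) / real (Suc k)) (snd x)) \<in> borel_measurable ((borel :: real measure) \<Otimes>\<^sub>M M)" for i
        by (rule measurable_compose[OF measurable_snd Z]) simp
    qed measurable
    then show ?thesis by (simp add: grid_above_def split_beta del: of_nat_Suc)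
  qed
next
  fix x assume x: "x \<in> space ((borel :: real measure) \<Otimes>\<^sub>M M)"
  then have w: "snd x \<in> space M" by (auto simp: space_pair_measure)
  have "(\<lambda>k. Z (grid_above k (max 0 (fst x))) (snd x)) \<longlonglongrightarrow> Z (max 0 (fst x)) (snd x)"
    by (rule filterlim_compose[OF rc[OF w] filterlim_grid_above]) auto
  then show "(\<lambda>k. case x of (t, w) \<Rightarrow> Z (grid_above k (max 0 t)) w) \<longlonglongrightarrow> (case x of (t, w) \<Rightarrow> Z (max 0 t) w)"
    by (simp add: split_beta)
qed

text \<open>On a fine grid every point of the finite set \<open>S\<close> has a cell of its own and
  all other cells contribute 0, so the sum over cells becomes a sum over \<open>S\<close> whose
  cells shrink to their points. This is how sums over random jump times are reached from quantities
  at deterministic times.\<close>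

lemma grid_sum_tendsto:
  fixes r :: "real \<Rightarrow> real \<Rightarrow> real"
  assumes T: "0 < T" and S: "finite S" "S \<subseteq> {0<..T}"
    and zero: "\<And>a b. 0 \<le> a \<Longrightarrow> a < b \<Longrightarrow> b \<le> T \<Longrightarrow> S \<inter> {a<..b} = {} \<Longrightarrow> r a b = 0"
    and lim: "\<And>s a b. s \<in> S \<Longrightarrow> (\<And>m. 0 \<le> a m) \<Longrightarrow> (\<And>m. a m < s) \<Longrightarrow> (\<And>m. s \<le> b m) \<Longrightarrow> (\<And>m. b m \<le> T) \<Longrightarrow>
       a \<longlonglongrightarrow> s \<Longrightarrow> b \<longlonglongrightarrow> s \<Longrightarrow> (\<lambda>m. r (a m) (b m)) \<longlonglongrightarrow> l s"
  shows "(\<lambda>m. \<Sum>i<Suc m. r (T * real i / real (Suc m)) (T * real (Suc i) / real (Suc m))) \<longlonglongrightarrow> (\<Sum>s\<in>S. l s)"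
proof -
  \<comment> \<open>The index of the cell containing \<open>s\<close> is a ceiling minus 1, because
    the cells are open on the left and closed on the right.\<close>
  define idx where "idx m s = nat \<lceil>s * real (Suc m) / T\<rceil> - 1" for m s
  define A B where "A m s = T * real (idx m s) / real (Suc m)"
    and "B m s = T * real (Suc (idx m s)) / real (Suc m)" for m s
  have n0: "real (Suc m) > 0" for m by simp
  have idx: "A m s < s \<and> s \<le> B m s \<and> idx m s < Suc m" if "s \<in> S" for m s
  proof -
    let ?u = "s * real (Suc m) / T"
    have s: "0 < s" "s \<le> T" using that S by auto
    have u: "0 < ?u" "?u \<le> real (Suc m)" using s T n0[of m] mult_right_mono[of s T "real (Suc m)"]
      by (auto simp: pos_divide_le_eq mult.commute simp del: of_nat_Suc)
    have c: "1 \<le> \<lceil>?u\<rceil>" "\<lceil>?u\<rceil> \<le> int (Suc m)" using u by linarith+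
    have "1 \<le> nat \<lceil>?u\<rceil>" using c(1) by linarith
    then have e: "real (idx m s) = of_int \<lceil>?u\<rceil> - 1"
      using c(1) unfolding idx_def by (subst of_nat_diff) (auto simp: of_nat_nat simp del: of_nat_Suc)
    have "of_int \<lceil>?u\<rceil> < ?u + 1" "?u \<le> of_int \<lceil>?u\<rceil>" by linarith+
    then have "real (idx m s) < ?u" "?u \<le> real (Suc (idx m s))" using e by auto
    then have "T * real (idx m s) < s * real (Suc m)" "s * real (Suc m) \<le> T * real (Suc (idx m s))"
      using T by (simp_all add: pos_divide_le_eq pos_less_divide_eq mult.commute del: of_nat_Suc)
    moreover have "idx m s < Suc m" using c by (simp add: idx_def)
    ultimately show ?thesis using n0[of m] unfolding A_def B_def
      by (simp add: pos_divide_less_eq pos_le_divide_eq del: of_nat_Suc)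
  qed
  have BA: "B m s - A m s = T / real (Suc m)" for m s
    by (simp add: A_def B_def diff_divide_distrib[symmetric] algebra_simps)
  have uniq: "i = idx m s" if "s \<in> S" "T * real i / real (Suc m) < s" "s \<le> T * real (Suc i) / real (Suc m)" for i m s
  proof -
    have "T * real i / real (Suc m) < T * real (Suc (idx m s)) / real (Suc m)"
      "T * real (idx m s) / real (Suc m) < T * real (Suc i) / real (Suc m)"
      using idx[OF that(1), of m] that unfolding A_def B_def by linarith+
    then show ?thesis using T n0[of m] by (simp add: divide_strict_right_mono divide_less_cancel)
  qed
  have T0: "(\<lambda>m. T / real (Suc m)) \<longlonglongrightarrow> 0"
    using tendsto_mult_right_zero[OF LIMSEQ_inverse_real_of_nat, of T] by (simp add: divide_inverse)
  have Alim: "(\<lambda>m. A m s) \<longlonglongrightarrow> s" if "s \<in> S" for s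
  proof (rule tendsto_sandwich)
    show "eventually (\<lambda>m. s - T / real (Suc m) \<le> A m s) sequentially"
      using idx[OF that] BA by (intro always_eventually allI) (smt (verit))
    show "eventually (\<lambda>m. A m s \<le> s) sequentially" using idx[OF that] by (intro always_eventually allI less_imp_le) auto
    show "(\<lambda>m. s - T / real (Suc m)) \<longlonglongrightarrow> s" using tendsto_diff[OF tendsto_const T0] by simp
  qed simp
  have Blim: "(\<lambda>m. B m s) \<longlonglongrightarrow> s" if "s \<in> S" for s
  proof -
    have "(\<lambda>m. A m s + T / real (Suc m)) \<longlonglongrightarrow> s + 0" by (intro tendsto_add Alim that T0)
    moreover have "A m s + T / real (Suc m) = B m s" for m using BA[of m s] by simp
    ultimately show ?thesis by simp
  qed
  have BT: "B m s \<le> T" if "s \<in> S" for m s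
  proof -
    have "Suc (idx m s) \<le> Suc m" using idx[OF that, of m] by simp
    then have "real (Suc (idx m s)) \<le> real (Suc m)" by (rule of_nat_mono)
    then have "T * real (Suc (idx m s)) \<le> T * real (Suc m)" using T by (intro mult_left_mono) auto
    then show ?thesis unfolding B_def using n0[of m] by (simp add: pos_divide_le_eq del: of_nat_Suc)
  qed
  have "(\<lambda>m. \<Sum>s\<in>S. r (A m s) (B m s)) \<longlonglongrightarrow> (\<Sum>s\<in>S. l s)"
    using T idx BT Alim Blim by (intro tendsto_sum lim) (auto simp: A_def)
  \<comment> \<open>Two points share a cell only while their distance is below the mesh.\<close>
  moreover have "eventually (\<lambda>m. \<forall>s\<in>S. \<forall>s'\<in>S. s \<noteq> s' \<longrightarrow> idx m s \<noteq> idx m s') sequentially"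
  proof (intro eventually_ball_finite S ballI)
    fix s s' assume s: "s \<in> S" "s' \<in> S"
    show "eventually (\<lambda>m. s \<noteq> s' \<longrightarrow> idx m s \<noteq> idx m s') sequentially"
    proof (cases "s = s'")
      case False
      have "eventually (\<lambda>m. T / real (Suc m) < \<bar>s - s'\<bar>) sequentially"
        using order_tendstoD(2)[OF T0, of "\<bar>s - s'\<bar>"] False by simp
      then show ?thesis
      proof eventually_elim
        case (elim m)
        show ?case
        proof (intro impI notI)
          assume "idx m s = idx m s'"
          then have "A m s = A m s'" "B m s = B m s'" by (simp_all add: A_def B_def)
          then show False using idx[OF s(1), of m] idx[OF s(2), of m] BA[of m s] elim by linarith
        qed
      qed
    qed simp
  qed
  then have "eventually (\<lambda>m. (\<Sum>s\<in>S. r (A m s) (B m s)) =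
     (\<Sum>i<Suc m. r (T * real i / real (Suc m)) (T * real (Suc i) / real (Suc m)))) sequentially"
  proof eventually_elim
    case (elim m)
    have inj: "inj_on (idx m) S" using elim by (auto simp: inj_on_def)
    have "(\<Sum>i<Suc m. r (T * real i / real (Suc m)) (T * real (Suc i) / real (Suc m))) =
      (\<Sum>i\<in>idx m ` S. r (T * real i / real (Suc m)) (T * real (Suc i) / real (Suc m)))"
    proof (rule sum.mono_neutral_right)
      show "idx m ` S \<subseteq> {..<Suc m}" using idx by auto
      show "\<forall>i\<in>{..<Suc m} - idx m ` S. r (T * real i / real (Suc m)) (T * real (Suc i) / real (Suc m)) = 0"
      proof
        fix i assume i: "i \<in> {..<Suc m} - idx m ` S"
        have "real (Suc i) \<le> real (Suc m)" using i by (intro of_nat_mono) auto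
        then have "T * real (Suc i) \<le> T * real (Suc m)" using T by (intro mult_left_mono) auto
        then have "T * real (Suc i) / real (Suc m) \<le> T" using n0[of m] by (simp add: pos_divide_le_eq del: of_nat_Suc)
        moreover have "S \<inter> {T * real i / real (Suc m)<..T * real (Suc i) / real (Suc m)} = {}"
        proof (rule ccontr)
          assume "\<not> ?thesis"
          then obtain x where x: "x \<in> S" "T * real i / real (Suc m) < x" "x \<le> T * real (Suc i) / real (Suc m)"
            by auto
          then have "i = idx m x" by (rule uniq)
          then show False using i x(1) by blast
        qed
        ultimately show "r (T * real i / real (Suc m)) (T * real (Suc i) / real (Suc m)) = 0"
          using T by (intro zero) (auto intro!: divide_strict_right_mono mult_strict_left_mono)
      qed
    qed simp
    also have "\<dots> = (\<Sum>s\<in>S. r (A m s) (B m s))"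
      using inj by (simp add: sum.reindex A_def B_def del: of_nat_Suc)
    finally show ?case by simp
  qed
  ultimately show ?thesis by (rule Lim_transform_eventually)
qed

context jump_diffusion begin

lemma F_measurable: "f \<in> measurable (F t) S \<Longrightarrow> f \<in> measurable M S"
  using sets_F[of t] by (auto simp: measurable_def space_F)

lemma F_measurable_mono: "f \<in> measurable (F s) S \<Longrightarrow> s \<le> t \<Longrightarrow> f \<in> measurable (F t) S"
  using F_mono[of s t] by (auto simp: measurable_def space_F)

lemma X_measurable: "0 \<le> t \<Longrightarrow> X t \<in> borel_measurable M"
  by (rule F_measurable[OF X_adapted])

lemma W_measurable: "0 \<le> t \<Longrightarrow> W t \<in> borel_measurable M"
  by (rule F_measurable[OF W_adapted])

lemma measurable_count_F: "0 \<le> t \<Longrightarrow> count t \<in> measurable (F t) (count_space UNIV)"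
proof -
  assume "0 \<le> t"
  then have "(\<lambda>w. nat \<lfloor>real (count t w)\<rfloor>) \<in> measurable (F t) (count_space UNIV)"
    using N_adapted[of t] unfolding count_def by measurable
  then show ?thesis by simp
qed

lemma measurable_count: "0 \<le> t \<Longrightarrow> count t \<in> measurable M (count_space UNIV)"
  by (rule F_measurable[OF measurable_count_F])

lemma space_predictable: "space (predictable_sigma M F) = {0<..} \<times> space M"
  and predictable_rectangle: "0 \<le> s \<Longrightarrow> s \<le> t \<Longrightarrow> A \<in> sets (F s) \<Longrightarrow>
    {s<..t} \<times> A \<in> sets (predictable_sigma M F)"
proof -
  have sub: "{{s<..t} \<times> A |s t A. 0 \<le> s \<and> s \<le> t \<and> A \<in> sets (F s)} \<subseteq> Pow ({0<..} \<times> space M)"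
    using sets.sets_into_space space_F by fastforce
  show "space (predictable_sigma M F) = {0<..} \<times> space M"
    unfolding predictable_sigma_def by (rule space_measure_of[OF sub])
  show "0 \<le> s \<Longrightarrow> s \<le> t \<Longrightarrow> A \<in> sets (F s) \<Longrightarrow> {s<..t} \<times> A \<in> sets (predictable_sigma M F)"
    unfolding predictable_sigma_def using sub by (subst sets_measure_of) auto
qed

text \<open>On a cell (i/n, (i + 1)/n] with n = k + 1 the approximation is \<open>Z\<close> at time
  i/n, which is known at the left end. Its preimages are therefore countable unions of the
  rectangles that generate the predictable sigma-algebra.\<close>

lemma predictable_left_limit:
  fixes Z :: "real \<Rightarrow> 'a \<Rightarrow> real"
  assumes Z: "\<And>t. 0 \<le> t \<Longrightarrow> Z t \<in> borel_measurable (F t)"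
    and lim: "\<And>w s. w \<in> space M \<Longrightarrow> 0 < s \<Longrightarrow> ((\<lambda>r. Z r w) \<longlongrightarrow> L s w) (at_left s)"
  shows "(\<lambda>x. L (fst x) (snd x)) \<in> borel_measurable (predictable_sigma M F)"
proof (rule borel_measurable_LIMSEQ_metric[where f = "\<lambda>k x. Z (grid_below k (fst x)) (snd x)"])
  fix k
  let ?n = "real (Suc k)"
  have n: "?n > 0" by simp
  show "(\<lambda>x. Z (grid_below k (fst x)) (snd x)) \<in> borel_measurable (predictable_sigma M F)"
  proof (rule measurableI)
    fix A :: "real set" assume A: "A \<in> sets borel"
    define G where "G i = {real i / ?n<..(real i + 1) / ?n} \<times> (Z (real i / ?n) -` A \<inter> space M)" for i
    have gb: "grid_below k t = real i / ?n" if "real i / ?n < t" "t \<le> (real i + 1) / ?n" for i t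
    proof -
      have "real i < ?n * t" "?n * t \<le> real i + 1"
        using that n by (simp_all add: field_simps del: of_nat_Suc)
      then have "\<lceil>?n * t\<rceil> = int i + 1" by (intro ceiling_unique) auto
      then show ?thesis by (simp add: grid_below_def nat_add_distrib del: of_nat_Suc)
    qed
    have ex: "\<exists>i. real i / ?n < t \<and> t \<le> (real i + 1) / ?n" if "0 < t" for t
    proof -
      let ?i = "nat (\<lceil>?n * t\<rceil> - 1)"
      have p: "0 < ?n * t" using that n by simp
      have "0 \<le> \<lceil>?n * t\<rceil> - 1" using p by linarith
      then have e: "real ?i = of_int \<lceil>?n * t\<rceil> - 1" by (simp add: of_nat_nat)
      have "real ?i < ?n * t" "?n * t \<le> real ?i + 1" unfolding e by linarith+
      then have "real ?i / ?n < t \<and> t \<le> (real ?i + 1) / ?n" using n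
        by (simp add: pos_divide_less_eq pos_le_divide_eq mult.commute del: of_nat_Suc)
      then show ?thesis by blast
    qed
    have "(\<lambda>x. Z (grid_below k (fst x)) (snd x)) -` A \<inter> space (predictable_sigma M F) = (\<Union>i. G i)"
    proof (intro equalityI subsetI)
      fix x assume x: "x \<in> (\<lambda>x. Z (grid_below k (fst x)) (snd x)) -` A \<inter> space (predictable_sigma M F)"
      then have "0 < fst x" "snd x \<in> space M" by (auto simp: space_predictable)
      from ex[OF this(1)] obtain i where i: "real i / ?n < fst x \<and> fst x \<le> (real i + 1) / ?n" by blast
      have "x \<in> G i" using x gb[of i "fst x"] i \<open>snd x \<in> space M\<close>
        by (cases x) (auto simp: G_def simp del: of_nat_Suc)
      then show "x \<in> (\<Union>i. G i)" by blast
    next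
      fix x assume "x \<in> (\<Union>i. G i)"
      then obtain i where i: "x \<in> G i" by blast
      have "0 \<le> real i / ?n" by simp
      then have "0 < fst x" using i unfolding G_def mem_Times_iff greaterThanAtMost_iff by linarith
      then show "x \<in> (\<lambda>x. Z (grid_below k (fst x)) (snd x)) -` A \<inter> space (predictable_sigma M F)"
        using i gb[of i "fst x"] by (cases x) (auto simp: G_def space_predictable simp del: of_nat_Suc)
    qed
    moreover have "G i \<in> sets (predictable_sigma M F)" for i
    proof -
      have "Z (real i / ?n) -` A \<inter> space (F (real i / ?n)) \<in> sets (F (real i / ?n))"
        by (rule measurable_sets[OF Z A]) simp
      then show ?thesis unfolding G_def space_F
        by (intro predictable_rectangle) (auto intro!: divide_right_mono)
    qed
    ultimately show "(\<lambda>x. Z (grid_below k (fst x)) (snd x)) -` A \<inter> space (predictable_sigma M F) \<in> sets (predictable_sigma M F)"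
      by auto
  qed simp
next
  fix x assume "x \<in> space (predictable_sigma M F)"
  then have x: "snd x \<in> space M" "0 < fst x" by (auto simp: space_predictable)
  show "(\<lambda>k. Z (grid_below k (fst x)) (snd x)) \<longlonglongrightarrow> L (fst x) (snd x)"
    by (rule filterlim_compose[OF lim[OF x] filterlim_grid_below[OF x(2)]])
qed

text \<open>Measurable functions of this triple are the integrands to which the intensity formula
  will be applied.\<close>

lemma measurable_predictable_left_values:
  "(\<lambda>x. (fst x, XL (fst x) (snd x), countL (fst x) (snd x)))
    \<in> measurable (predictable_sigma M F) (borel \<Otimes>\<^sub>M borel \<Otimes>\<^sub>M count_space UNIV)"
proof -
  have [measurable]: "(\<lambda>x. XL (fst x) (snd x)) \<in> borel_measurable (predictable_sigma M F)"
    by (rule predictable_left_limit[OF X_adapted X_at_left])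
  have "(\<lambda>x. real (countL (fst x) (snd x))) \<in> borel_measurable (predictable_sigma M F)"
  proof (rule predictable_left_limit)
    show "0 \<le> t \<Longrightarrow> (\<lambda>w. real (count t w)) \<in> borel_measurable (F t)" for t
      unfolding count_def by (rule N_adapted)
    show "((\<lambda>r. real (count r w)) \<longlongrightarrow> real (countL s w)) (at_left s)" if "w \<in> space M" for w s
      using count_at_left[OF that, of s] by (intro tendsto_eventually) (auto elim: eventually_mono)
  qed
  then have "(\<lambda>x. nat \<lfloor>real (countL (fst x) (snd x))\<rfloor>) \<in> measurable (predictable_sigma M F) (count_space UNIV)"
    by measurable
  then have [measurable]: "(\<lambda>x. countL (fst x) (snd x)) \<in> measurable (predictable_sigma M F) (count_space UNIV)"
    by simp
  have [measurable]: "fst \<in> borel_measurable (predictable_sigma M F)"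
    using predictable_left_limit[of "\<lambda>t _. t" "\<lambda>t _. t"] by simp
  show ?thesis by measurable
qed

lemma countable_N: "w \<in> space M \<Longrightarrow> countable (N w)"
proof -
  assume w: "w \<in> space M"
  have "N w = (\<Union>n::nat. N w \<inter> {0<..real n})"
    using N_pos[OF w] by (auto simp: subset_eq intro: real_arch_simple)
  moreover have "countable (\<Union>n::nat. N w \<inter> {0<..real n})"
    using N_finite[OF w] by (intro countable_UN) (auto intro: countable_finite)
  ultimately show ?thesis by simp
qed

lemma AE_not_jump: "w \<in> space M \<Longrightarrow> AE s in lborel. s \<notin> N w"
  by (rule AE_not_in) (use countable_N in \<open>auto intro: countable_imp_null_set_lborel\<close>)

text \<open>The intensity formula for a predictable integrand built from left limits. On the right
  the left limits may be replaced by \<open>X\<close> and \<open>count\<close>, because each path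
  jumps at countably many times only, a Lebesgue null set.\<close>

theorem compensation:
  fixes f :: "real \<times> real \<times> nat \<Rightarrow> ennreal"
  assumes f [measurable]: "f \<in> borel_measurable (borel \<Otimes>\<^sub>M borel \<Otimes>\<^sub>M count_space UNIV)"
  shows "(\<integral>\<^sup>+ w. (\<Sum>s\<in>N w \<inter> {0<..T}. f (s, XL s w, countL s w)) \<partial>M) =
    (\<integral>\<^sup>+ w. (\<integral>\<^sup>+ s\<in>{0<..T}. f (s, X s w, count s w) * \<Lambda> (X s w) \<partial>lborel) \<partial>M)"
proof -
  let ?C = "\<lambda>x. indicator {0<..T} (fst x) * f (fst x, XL (fst x) (snd x), countL (fst x) (snd x))"
  let ?g = "\<lambda>y. indicator {0<..T} (fst y) * f y"
  have "(\<lambda>x. ?g ((\<lambda>x. (fst x, XL (fst x) (snd x), countL (fst x) (snd x))) x)) \<in> borel_measurable (predictable_sigma M F)"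
    by (rule measurable_compose[OF measurable_predictable_left_values]) measurable
  then have "?C \<in> borel_measurable (predictable_sigma M F)" by simp
  from intensity[OF this]
  have "(\<integral>\<^sup>+ w. (\<integral>\<^sup>+ s. ?C (s, w) \<partial>count_space (N w)) \<partial>M) =
        (\<integral>\<^sup>+ w. (\<integral>\<^sup>+ s\<in>{0<..}. ?C (s, w) * \<Lambda> (XL s w) \<partial>lborel) \<partial>M)" .
  moreover have "(\<integral>\<^sup>+ s. ?C (s, w) \<partial>count_space (N w)) = (\<Sum>s\<in>N w \<inter> {0<..T}. f (s, XL s w, countL s w))"
    if w: "w \<in> space M" for w
  proof -
    have "(\<integral>\<^sup>+ s. ?C (s, w) \<partial>count_space (N w)) = (\<Sum>s\<in>N w \<inter> {0<..T}. ?C (s, w))"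
      by (rule nn_integral_count_space') (use N_finite[OF w] in auto)
    then show ?thesis by simp
  qed
  moreover have "(\<integral>\<^sup>+ s\<in>{0<..}. ?C (s, w) * \<Lambda> (XL s w) \<partial>lborel) =
     (\<integral>\<^sup>+ s\<in>{0<..T}. f (s, X s w, count s w) * \<Lambda> (X s w) \<partial>lborel)" if w: "w \<in> space M" for w
    by (rule nn_integral_cong_AE, use AE_not_jump[OF w] in eventually_elim)
      (auto simp: X_no_jump[OF w] count_no_jump split: split_indicator)
  ultimately show ?thesis by (simp cong: nn_integral_cong)
qed

lemma measurable_pair_X [measurable]:
  "(\<lambda>x. X (max 0 (fst x)) (snd x)) \<in> borel_measurable (borel \<Otimes>\<^sub>M M)"
  using borel_measurable_pair_right_continuous[OF X_measurable X_at_right] by (simp add: split_beta)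

lemma measurable_pair_W [measurable]:
  "(\<lambda>x. W (max 0 (fst x)) (snd x)) \<in> borel_measurable (borel \<Otimes>\<^sub>M M)"
  using borel_measurable_pair_right_continuous[OF W_measurable W_at_right] by (simp add: split_beta)

lemma measurable_pair_count [measurable]:
  "(\<lambda>x. count (max 0 (fst x)) (snd x)) \<in> measurable (borel \<Otimes>\<^sub>M M) (count_space UNIV)"
proof -
  have "(\<lambda>(t, w). real (count (max 0 t) w)) \<in> borel_measurable (borel \<Otimes>\<^sub>M M)"
  proof (rule borel_measurable_pair_right_continuous)
    show "0 \<le> t \<Longrightarrow> (\<lambda>w. real (count t w)) \<in> borel_measurable M" for t
      using measurable_count by measurable
    show "((\<lambda>r. real (count r w)) \<longlongrightarrow> real (count s w)) (at_right s)" if "w \<in> space M" "0 \<le> s" for w s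
      using count_at_right[OF that] by (intro tendsto_eventually) (auto elim: eventually_mono)
  qed
  then have "(\<lambda>x. nat \<lfloor>real (count (max 0 (fst x)) (snd x))\<rfloor>) \<in> measurable (borel \<Otimes>\<^sub>M M) (count_space UNIV)"
    unfolding split_beta by measurable
  then show ?thesis by simp
qed

section \<open>Independence of the past and the Brownian increments\<close>

definition gauss :: "real \<Rightarrow> real measure" where
  "gauss h = density lborel (\<lambda>x. ennreal (normal_density 0 (sqrt h) x))"

lemma distr_increment: "0 \<le> s \<Longrightarrow> s < t \<Longrightarrow> distr M borel (\<lambda>w. W t w - W s w) = gauss (t - s)"
proof -
  assume "0 \<le> s" "s < t"
  then have "distr M lborel (\<lambda>w. W t w - W s w) = gauss (t - s)"
    using distributed_distr_eq_density[OF W_increment] unfolding gauss_def by blast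
  moreover have "distr M borel (\<lambda>w. W t w - W s w) = distr M lborel (\<lambda>w. W t w - W s w)"
    by (rule distr_cong) auto
  ultimately show ?thesis by simp
qed

lemma sets_gauss [measurable_cong, simp]: "sets (gauss h) = sets borel"
  by (simp add: gauss_def)

lemma space_gauss [simp]: "space (gauss h) = UNIV"
  by (simp add: gauss_def)

lemma prob_space_gauss: "0 < h \<Longrightarrow> prob_space (gauss h)"
  unfolding gauss_def by (intro prob_space_normal_density) simp

lemma increment_measurable: "0 \<le> s \<Longrightarrow> s < t \<Longrightarrow> (\<lambda>w. W t w - W s w) \<in> borel_measurable M"
  using W_measurable[of s] W_measurable[of t] by simp

text \<open>Independence is given for events. Product sets determine a law on a product space, so it
  extends to the joint law with any variable of the past.\<close>

lemma distr_past_increment: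
  assumes st: "0 \<le> s" "s < t" and Z: "Z \<in> measurable (F s) S"
  shows "distr M (S \<Otimes>\<^sub>M borel) (\<lambda>w. (Z w, W t w - W s w)) = distr M S Z \<Otimes>\<^sub>M gauss (t - s)"
proof -
  let ?D = "\<lambda>w. W t w - W s w"
  have D: "?D \<in> borel_measurable M" by (rule increment_measurable[OF st])
  have ZM: "Z \<in> measurable M S" by (rule F_measurable[OF Z])
  interpret G: prob_space "gauss (t - s)" using st by (intro prob_space_gauss) simp
  interpret Z: prob_space "distr M S Z" by (rule prob_space_distr[OF ZM])
  have "distr M S Z \<Otimes>\<^sub>M gauss (t - s) = distr M (S \<Otimes>\<^sub>M borel) (\<lambda>w. (Z w, ?D w))"
  proof (rule pair_measure_eqI)
    show "sigma_finite_measure (distr M S Z)" "sigma_finite_measure (gauss (t - s))" by unfold_locales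
    show "sets (distr M S Z \<Otimes>\<^sub>M gauss (t - s)) = sets (distr M (S \<Otimes>\<^sub>M borel) (\<lambda>w. (Z w, ?D w)))"
      by (simp cong: sets_pair_measure_cong)
  next
    fix A B assume "A \<in> sets (distr M S Z)" "B \<in> sets (gauss (t - s))"
    then have A: "A \<in> sets S" and B: "B \<in> sets borel" by auto
    have ZA: "Z -` A \<inter> space M \<in> sets (F s)" using measurable_sets[OF Z A] by (simp add: space_F)
    have "emeasure (distr M (S \<Otimes>\<^sub>M borel) (\<lambda>w. (Z w, ?D w))) (A \<times> B) =
      emeasure M ((Z -` A \<inter> space M) \<inter> (?D -` B \<inter> space M))"
      using A B ZM D by (subst emeasure_distr) (auto intro!: arg_cong[where f = "emeasure M"])
    also have "\<dots> = emeasure M (Z -` A \<inter> space M) * emeasure M (?D -` B \<inter> space M)"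
      unfolding emeasure_eq_measure W_indep[OF st ZA B] by (simp add: ennreal_mult)
    also have "\<dots> = emeasure (distr M S Z) A * emeasure (gauss (t - s)) B"
      unfolding distr_increment[OF st, symmetric] using A B ZM D by (simp add: emeasure_distr)
    finally show "emeasure (distr M S Z) A * emeasure (gauss (t - s)) B =
      emeasure (distr M (S \<Otimes>\<^sub>M borel) (\<lambda>w. (Z w, ?D w))) (A \<times> B)" by simp
  qed
  then show ?thesis by simp
qed

text \<open>Replaces conditional expectation given \<open>F s\<close>: under the product law the
  increment is integrated out first, with the past held fixed.\<close>

lemma nn_integral_past_increment:
  assumes st: "0 \<le> s" "s < t" and Z: "Z \<in> measurable (F s) S"
    and g [measurable]: "g \<in> borel_measurable (S \<Otimes>\<^sub>M borel)"
  shows "(\<integral>\<^sup>+ w. g (Z w, W t w - W s w) \<partial>M) = (\<integral>\<^sup>+ w. (\<integral>\<^sup>+ x. g (Z w, x) \<partial>gauss (t - s)) \<partial>M)"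
proof -
  interpret G: prob_space "gauss (t - s)" using st by (intro prob_space_gauss) simp
  have D [measurable]: "(\<lambda>w. W t w - W s w) \<in> borel_measurable M" by (rule increment_measurable[OF st])
  have ZM [measurable]: "Z \<in> measurable M S" by (rule F_measurable[OF Z])
  have "(\<integral>\<^sup>+ w. g (Z w, W t w - W s w) \<partial>M) = (\<integral>\<^sup>+ y. g y \<partial>distr M (S \<Otimes>\<^sub>M borel) (\<lambda>w. (Z w, W t w - W s w)))"
    by (subst nn_integral_distr) auto
  also have "\<dots> = (\<integral>\<^sup>+ z. (\<integral>\<^sup>+ x. g (z, x) \<partial>gauss (t - s)) \<partial>distr M S Z)"
    unfolding distr_past_increment[OF st Z] by (subst G.nn_integral_fst[symmetric]) auto
  also have "\<dots> = (\<integral>\<^sup>+ w. (\<integral>\<^sup>+ x. g (Z w, x) \<partial>gauss (t - s)) \<partial>M)"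
    by (subst nn_integral_distr) auto
  finally show ?thesis .
qed

lemma integral_past_increment:
  fixes g :: "_ \<Rightarrow> real"
  assumes st: "0 \<le> s" "s < t" and Z: "Z \<in> measurable (F s) S"
    and g [measurable]: "g \<in> borel_measurable (S \<Otimes>\<^sub>M borel)" and B: "\<And>y. \<bar>g y\<bar> \<le> B"
  shows "(\<integral>w. g (Z w, W t w - W s w) \<partial>M) = (\<integral>w. (\<integral>x. g (Z w, x) \<partial>gauss (t - s)) \<partial>M)"
proof -
  interpret G: prob_space "gauss (t - s)" using st by (intro prob_space_gauss) simp
  have D [measurable]: "(\<lambda>w. W t w - W s w) \<in> borel_measurable M" by (rule increment_measurable[OF st])
  have ZM [measurable]: "Z \<in> measurable M S" by (rule F_measurable[OF Z])
  interpret Z: prob_space "distr M S Z" by (rule prob_space_distr) simp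
  interpret P: pair_prob_space "distr M S Z" "gauss (t - s)" ..
  have "(\<integral>w. g (Z w, W t w - W s w) \<partial>M) = (\<integral>y. g y \<partial>distr M (S \<Otimes>\<^sub>M borel) (\<lambda>w. (Z w, W t w - W s w)))"
    by (subst integral_distr) auto
  also have "\<dots> = (\<integral>z. (\<integral>x. g (z, x) \<partial>gauss (t - s)) \<partial>distr M S Z)"
    unfolding distr_past_increment[OF st Z]
    by (rule P.integral_fst'[symmetric], rule P.integrable_const_bound[where B = B]) (use B in auto)
  also have "\<dots> = (\<integral>w. (\<integral>x. g (Z w, x) \<partial>gauss (t - s)) \<partial>M)"
    by (subst integral_distr) auto
  finally show ?thesis .
qed

end

section \<open>Absolute continuity of the one-dimensional laws\<close>

text \<open>Take for \<open>B\<close> the sets where \<open>q\<close> is nonnegative and where it is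
  negative; each contributes at most \<open>J\<close>.\<close>

lemma integral_abs_le_of_set_integrals:
  fixes q :: "'b \<Rightarrow> real"
  assumes q [measurable]: "integrable M q"
    and J: "\<And>B. B \<in> sets M \<Longrightarrow> \<bar>\<integral>x. indicator B x * q x \<partial>M\<bar> \<le> J"
  shows "(\<integral>x. \<bar>q x\<bar> \<partial>M) \<le> 2 * J"
proof -
  let ?A = "{x \<in> space M. 0 \<le> q x}" and ?B = "{x \<in> space M. q x < 0}"
  have m [measurable]: "q \<in> borel_measurable M" using q by auto
  have i: "integrable M (\<lambda>x. indicator A x * q x)" if "A \<in> sets M" for A
    using integrable_mult_indicator[OF that q] by simp
  have "(\<integral>x. \<bar>q x\<bar> \<partial>M) = (\<integral>x. indicator ?A x * q x - indicator ?B x * q x \<partial>M)"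
    by (rule Bochner_Integration.integral_cong) (auto split: split_indicator)
  also have "\<dots> = (\<integral>x. indicator ?A x * q x \<partial>M) - (\<integral>x. indicator ?B x * q x \<partial>M)"
    by (rule Bochner_Integration.integral_diff) (auto intro!: i)
  finally show ?thesis using J[of ?A] J[of ?B] by simp
qed

text \<open>Summable L1 distances make the sum over k of |f k - g| integrable, hence finite almost
  everywhere, and there its terms tend to 0. No subsequence has to be chosen.\<close>

lemma AE_tendsto_of_summable_L1:
  fixes f :: "nat \<Rightarrow> 'b \<Rightarrow> real"
  assumes f [measurable]: "\<And>k. integrable M (f k)" and g [measurable]: "integrable M g"
    and b: "\<And>k. (\<integral>x. \<bar>f k x - g x\<bar> \<partial>M) \<le> b k" and s: "summable b"
  shows "AE x in M. (\<lambda>k. f k x) \<longlonglongrightarrow> g x"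
proof -
  have [measurable]: "f k \<in> borel_measurable M" "g \<in> borel_measurable M" for k using f g by auto
  have "(\<integral>\<^sup>+ x. (\<Sum>k. ennreal \<bar>f k x - g x\<bar>) \<partial>M) = (\<Sum>k. \<integral>\<^sup>+ x. ennreal \<bar>f k x - g x\<bar> \<partial>M)"
    by (rule nn_integral_suminf) simp
  also have "\<dots> = (\<Sum>k. ennreal (\<integral>x. \<bar>f k x - g x\<bar> \<partial>M))"
    using f g by (intro suminf_cong nn_integral_eq_integral) auto
  also have "\<dots> \<le> (\<Sum>k. ennreal (b k))" by (intro suminf_le ennreal_leI b) auto
  also have "\<dots> = ennreal (\<Sum>k. b k)"
  proof (rule suminf_ennreal2[OF _ s])
    show "0 \<le> b k" for k by (rule order_trans[OF integral_nonneg_AE b]) simp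
  qed
  finally have "(\<integral>\<^sup>+ x. (\<Sum>k. ennreal \<bar>f k x - g x\<bar>) \<partial>M) \<noteq> \<infinity>"
    by (auto simp: top_unique)
  then have "AE x in M. (\<Sum>k. ennreal \<bar>f k x - g x\<bar>) \<noteq> \<infinity>"
    by (intro nn_integral_noteq_infinite) auto
  then show ?thesis
  proof eventually_elim
    case (elim x)
    then have "summable (\<lambda>k. \<bar>f k x - g x\<bar>)" by (intro summable_suminf_not_top) auto
    then have "(\<lambda>k. \<bar>f k x - g x\<bar>) \<longlonglongrightarrow> 0" by (rule summable_LIMSEQ_zero)
    then show "(\<lambda>k. f k x) \<longlonglongrightarrow> g x" by (simp add: tendsto_rabs_zero_iff LIM_zero_iff)
  qed
qed

lemma measurable_normal_density [measurable (raw)]: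
  "f \<in> borel_measurable K \<Longrightarrow> g \<in> borel_measurable K \<Longrightarrow> (\<lambda>x. normal_density (f x) s (g x)) \<in> borel_measurable K"
  unfolding normal_density_def by (measurable; simp)

lemma measurable_nat_eq:
  fixes f g :: "'b \<Rightarrow> nat"
  assumes f: "f \<in> measurable K (count_space UNIV)" and g: "g \<in> measurable K (count_space UNIV)"
  shows "Measurable.pred K (\<lambda>x. f x = g x)"
proof (rule measurable_compose_countable[where f = "\<lambda>i x. f x = i"])
  show "Measurable.pred K (\<lambda>x. f x = i)" for i using f by measurable
qed (rule g)

context jump_diffusion begin

lemma measurable_X_comp [measurable (raw)]:
  "f \<in> borel_measurable K \<Longrightarrow> g \<in> measurable K M \<Longrightarrow> (\<lambda>x. X (max 0 (f x)) (g x)) \<in> borel_measurable K"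
  using measurable_compose[OF measurable_Pair measurable_pair_X] by simp

lemma measurable_W_comp [measurable (raw)]:
  "f \<in> borel_measurable K \<Longrightarrow> g \<in> measurable K M \<Longrightarrow> (\<lambda>x. W (max 0 (f x)) (g x)) \<in> borel_measurable K"
  using measurable_compose[OF measurable_Pair measurable_pair_W] by simp

lemma measurable_count_comp [measurable (raw)]:
  "f \<in> borel_measurable K \<Longrightarrow> g \<in> measurable K M \<Longrightarrow>
    (\<lambda>x. count (max 0 (f x)) (g x)) \<in> measurable K (count_space UNIV)"
  using measurable_compose[OF measurable_Pair measurable_pair_count] by simp

lemma measurable_count_eq [measurable (raw)]:
  assumes f: "f \<in> borel_measurable K" "f' \<in> borel_measurable K" and g: "g \<in> measurable K M"
  shows "Measurable.pred K (\<lambda>x. count (max 0 (f x)) (g x) = count (max 0 (f' x)) (g x))"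
  by (intro measurable_nat_eq measurable_count_comp assms)

lemma measurable_countL: "0 < t \<Longrightarrow> countL t \<in> measurable M (count_space UNIV)"
proof -
  assume t: "0 < t"
  have "(\<lambda>w. real (countL t w)) \<in> borel_measurable M"
  proof (rule borel_measurable_LIMSEQ_metric[where f = "\<lambda>k w. real (count (grid_below k t) w)"])
    show "(\<lambda>w. real (count (grid_below k t) w)) \<in> borel_measurable M" for k
      using measurable_count[OF grid_below(3)[OF t]] by measurable
    fix w assume "w \<in> space M"
    then have "eventually (\<lambda>k. count (grid_below k t) w = countL t w) sequentially"
      using count_at_left filterlim_grid_below[OF t] by (auto simp: filterlim_iff)
    then show "(\<lambda>k. real (count (grid_below k t) w)) \<longlonglongrightarrow> real (countL t w)"
      by (intro tendsto_eventually) (auto elim: eventually_mono)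
  qed
  then have "(\<lambda>w. nat \<lfloor>real (countL t w)\<rfloor>) \<in> measurable M (count_space UNIV)" by measurable
  then show ?thesis by simp
qed

text \<open>Describes a jump at \<open>t\<close> by two measurable counts.\<close>

lemma jump_iff: "w \<in> space M \<Longrightarrow> 0 < t \<Longrightarrow> t \<in> N w \<longleftrightarrow> count t w \<noteq> countL t w"
proof
  assume w: "w \<in> space M" "0 < t" "t \<in> N w"
  have "N w \<inter> {0<..t} = insert t (N w \<inter> {0<..<t})" using w by auto
  moreover have "finite (N w \<inter> {0<..<t})" by (rule finite_subset[OF _ N_finite[OF w(1), of t]]) auto
  ultimately show "count t w \<noteq> countL t w" by (simp add: count_def countL_def)
qed (use count_no_jump in auto)

text \<open>Compensation for the indicator of the single time \<open>t\<close>: the expected number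
  of points at \<open>t\<close> is a Lebesgue integral over one point.\<close>

lemma AE_not_jump_at:
  assumes t: "0 < t"
  shows "AE w in M. t \<notin> N w"
proof -
  note [measurable] = measurable_nat_eq[OF measurable_count[OF less_imp_le[OF t]] measurable_countL[OF t]]
  have "(\<integral>\<^sup>+ w. (\<Sum>s\<in>N w \<inter> {0<..t}. indicator {t} s) \<partial>M) =
    (\<integral>\<^sup>+ w. (\<integral>\<^sup>+ s\<in>{0<..t}. indicator {t} s * \<Lambda> (X s w) \<partial>lborel) \<partial>M)"
    using compensation[of "\<lambda>x. indicator {t} (fst x)" t] by simp
  also have "\<dots> = (\<integral>\<^sup>+ w. 0 \<partial>M)"
  proof (rule nn_integral_cong)
    fix w
    have "(\<integral>\<^sup>+ s\<in>{0<..t}. indicator {t} s * \<Lambda> (X s w) \<partial>lborel) = (\<integral>\<^sup>+ (s::real). 0 \<partial>lborel)"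
    proof (intro nn_integral_cong_AE)
      show "AE s in lborel. indicator {t} s * \<Lambda> (X s w) * indicator {0<..t} s = 0"
        using AE_lborel_singleton[of t] by eventually_elim simp
    qed
    then show "(\<integral>\<^sup>+ s\<in>{0<..t}. indicator {t} s * \<Lambda> (X s w) \<partial>lborel) = 0" by simp
  qed
  finally have "(\<integral>\<^sup>+ w. (\<Sum>s\<in>N w \<inter> {0<..t}. indicator {t} s) \<partial>M) = 0" by simp
  also have "(\<integral>\<^sup>+ w. (\<Sum>s\<in>N w \<inter> {0<..t}. indicator {t} s) \<partial>M) =
    (\<integral>\<^sup>+ w. (if count t w = countL t w then 0 else 1) \<partial>M)"
  proof (rule nn_integral_cong)
    fix w assume w: "w \<in> space M"
    have "(\<Sum>s\<in>N w \<inter> {0<..t}. indicator {t} s) = (\<Sum>s\<in>N w \<inter> {0<..t}. if s = t then 1 else 0 :: ennreal)"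
      by (rule sum.cong) auto
    also have "\<dots> = (if t \<in> N w then 1 else 0)" using N_finite[OF w, of t] t by (subst sum.delta) auto
    finally show "(\<Sum>s\<in>N w \<inter> {0<..t}. indicator {t} s) = (if count t w = countL t w then 0 else 1 :: ennreal)"
      using jump_iff[OF w t] by simp
  qed
  finally have "AE w in M. (if count t w = countL t w then 0 else 1 :: ennreal) = 0"
    by (subst (asm) nn_integral_0_iff_AE) measurable
  then show ?thesis by (auto elim!: AE_mp intro!: AE_I2 simp: jump_iff[OF _ t] split: if_splits)
qed

text \<open>The probability of a jump in (t - h, t], written as an integral so that measurability in
  \<open>t\<close> follows from that of parameter integrals. It bounds the change of any probability
  when these jumps are suppressed.\<close>

definition jump_prob :: "real \<Rightarrow> real \<Rightarrow> real" where
  "jump_prob h t = (\<integral>w. (if count (max 0 (t - h)) w = count (max 0 t) w then 0 else 1) \<partial>M)"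

lemma measurable_jump_prob [measurable]: "jump_prob h \<in> borel_measurable borel"
  unfolding jump_prob_def by measurable

text \<open>Almost surely \<open>t\<close> is no jump time, and the jumps before \<open>t\<close> do
  not accumulate at it; so a short interval ending at \<open>t\<close> contains none.\<close>

lemma jump_prob_tendsto_0: "0 < t \<Longrightarrow> (\<lambda>k. jump_prob (1 / real (Suc k)) t) \<longlonglongrightarrow> 0"
proof -
  assume t: "0 < t"
  let ?f = "\<lambda>k w. (if count (max 0 (t - 1 / real (Suc k))) w = count (max 0 t) w then 0 else 1 :: real)"
  have "(\<lambda>k. \<integral>w. ?f k w \<partial>M) \<longlonglongrightarrow> (\<integral>w. 0 \<partial>M)"
  proof (rule integral_dominated_convergence[where w = "\<lambda>_. 1"])
    show "AE w in M. (\<lambda>k. ?f k w) \<longlonglongrightarrow> 0"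
      using AE_not_jump_at[OF t] AE_space
    proof eventually_elim
      case (elim w)
      have "filterlim (\<lambda>k. max 0 (t - 1 / real (Suc k))) (at_left t) sequentially"
      proof (rule tendsto_imp_filterlim_at_left)
        have "(\<lambda>k. max 0 (t - inverse (real (Suc k)))) \<longlonglongrightarrow> max 0 (t - 0)"
          by (intro tendsto_intros LIMSEQ_inverse_real_of_nat)
        then show "(\<lambda>k. max 0 (t - 1 / real (Suc k))) \<longlonglongrightarrow> t"
          using t by (simp add: inverse_eq_divide)
      qed (use t in simp)
      then have "eventually (\<lambda>k. count (max 0 (t - 1 / real (Suc k))) w = countL t w) sequentially"
        using count_at_left[OF elim(2), of t] by (auto simp: filterlim_iff)
      then have "eventually (\<lambda>k. ?f k w = 0) sequentially"
        by eventually_elim (use elim jump_iff[OF elim(2) t] t in auto)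
      then show "(\<lambda>k. ?f k w) \<longlonglongrightarrow> 0" by (rule tendsto_eventually)
    qed
  qed auto
  then show ?thesis by (simp add: jump_prob_def)
qed

lemma nn_integral_gauss_affine:
  fixes f :: "real \<Rightarrow> ennreal"
  assumes h: "0 < h" and f [measurable]: "f \<in> borel_measurable borel"
  shows "(\<integral>\<^sup>+ x. f (a + \<sigma> * x) \<partial>gauss h) = (\<integral>\<^sup>+ y. f y * ennreal (normal_density a (\<sigma> * sqrt h) y) \<partial>lborel)"
proof -
  have nd: "normal_density a (\<sigma> * sqrt h) (a + \<sigma> * x) = normal_density 0 (sqrt h) x / \<sigma>" for x
  proof -
    have "sqrt (2 * pi * (\<sigma> * sqrt h)\<^sup>2) = \<sigma> * sqrt (2 * pi * (sqrt h)\<^sup>2)"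
      using \<sigma>_pos by (simp add: power_mult_distrib real_sqrt_mult mult_ac)
    moreover have "(a + \<sigma> * x - a)\<^sup>2 / (2 * (\<sigma> * sqrt h)\<^sup>2) = (x - 0)\<^sup>2 / (2 * (sqrt h)\<^sup>2)"
      using \<sigma>_pos by (simp add: power_mult_distrib)
    ultimately show ?thesis unfolding normal_density_def by simp
  qed
  have "(\<integral>\<^sup>+ y. f y * ennreal (normal_density a (\<sigma> * sqrt h) y) \<partial>lborel) =
    \<bar>\<sigma>\<bar> * (\<integral>\<^sup>+ x. f (a + \<sigma> * x) * ennreal (normal_density a (\<sigma> * sqrt h) (a + \<sigma> * x)) \<partial>lborel)"
    using \<sigma>_pos by (intro nn_integral_real_affine) auto
  also have "\<dots> = (\<integral>\<^sup>+ x. ennreal (normal_density 0 (sqrt h) x) * f (a + \<sigma> * x) \<partial>lborel)"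
  proof -
    have "ennreal \<bar>\<sigma>\<bar> * (f (a + \<sigma> * x) * ennreal (normal_density a (\<sigma> * sqrt h) (a + \<sigma> * x))) =
      ennreal (normal_density 0 (sqrt h) x) * f (a + \<sigma> * x)" for x
    proof -
      have "ennreal \<bar>\<sigma>\<bar> * ennreal (normal_density 0 (sqrt h) x / \<sigma>) = ennreal (normal_density 0 (sqrt h) x)"
        using \<sigma>_pos by (subst ennreal_mult'[symmetric]) auto
      then show ?thesis unfolding nd by (metis mult.assoc mult.commute)
    qed
    then show ?thesis by (subst nn_integral_cmult[symmetric]) auto
  qed
  also have "\<dots> = (\<integral>\<^sup>+ x. f (a + \<sigma> * x) \<partial>gauss h)"
    unfolding gauss_def by (subst nn_integral_density) auto
  finally show ?thesis by simp
qed

text \<open>The density at time \<open>t\<close> when the jumps in (t - h, t] are suppressed: a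
  mixture of normal densities over the value of X at t - h. Being explicit, it is jointly measurable
  in (t, x).\<close>

definition smoothed :: "real \<Rightarrow> real \<Rightarrow> real \<Rightarrow> real" where
  "smoothed h t x = (\<integral>w. normal_density (X (max 0 (t - h)) w + \<mu> * h) (\<sigma> * sqrt h) x \<partial>M)"

lemma normal_density_le: "normal_density m s x \<le> 1 / sqrt (2 * pi * s\<^sup>2)"
  unfolding normal_density_def by (auto intro!: mult_left_le simp: divide_right_mono)

lemma measurable_smoothed [measurable]: "(\<lambda>x. smoothed h (fst x) (snd x)) \<in> borel_measurable (borel \<Otimes>\<^sub>M borel)"
  unfolding smoothed_def by measurable

lemma ennreal_smoothed:
  "ennreal (smoothed h t x) = (\<integral>\<^sup>+ w. ennreal (normal_density (X (max 0 (t - h)) w + \<mu> * h) (\<sigma> * sqrt h) x) \<partial>M)"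
  unfolding smoothed_def
  by (rule nn_integral_eq_integral[symmetric], rule integrable_const_bound[where B = "1 / sqrt (2 * pi * (\<sigma> * sqrt h)\<^sup>2)"])
    (auto simp: normal_density_le)

lemma smoothed_nonneg: "0 \<le> smoothed h t x"
  unfolding smoothed_def by (intro integral_nonneg_AE) auto

text \<open>Integrating the increment out and exchanging expectation with the space integral
  identifies \<open>smoothed h t\<close> as the density of the jump-free step.\<close>

lemma prob_no_jump_step:
  assumes h: "0 < h" "h \<le> t" and B [measurable]: "B \<in> sets borel"
  shows "(\<integral>\<^sup>+ y. indicator B y * ennreal (smoothed h t y) \<partial>lborel) =
    emeasure M {w \<in> space M. X (t - h) w + \<mu> * h + \<sigma> * (W t w - W (t - h) w) \<in> B}"
proof -
  have th: "0 \<le> t - h" "t - h < t" using h by auto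
  note [measurable] = X_measurable[OF th(1)] increment_measurable[OF th]
  have "emeasure M {w \<in> space M. X (t - h) w + \<mu> * h + \<sigma> * (W t w - W (t - h) w) \<in> B} =
    (\<integral>\<^sup>+ w. (\<lambda>(z, x). indicator B (z + \<mu> * h + \<sigma> * x)) (X (t - h) w, W t w - W (t - h) w) \<partial>M)"
  proof -
    have "{w \<in> space M. X (t - h) w + \<mu> * h + \<sigma> * (W t w - W (t - h) w) \<in> B} \<in> sets M" by measurable
    then show ?thesis
      by (subst nn_integral_indicator[symmetric], assumption, intro nn_integral_cong) (auto split: split_indicator)
  qed
  also have "\<dots> = (\<integral>\<^sup>+ w. (\<integral>\<^sup>+ x. (\<lambda>(z, x). indicator B (z + \<mu> * h + \<sigma> * x)) (X (t - h) w, x) \<partial>gauss (t - (t - h))) \<partial>M)"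
    by (rule nn_integral_past_increment[OF th X_adapted[OF th(1)]]) measurable
  also have "\<dots> = (\<integral>\<^sup>+ w. (\<integral>\<^sup>+ y. indicator B y * ennreal (normal_density (X (t - h) w + \<mu> * h) (\<sigma> * sqrt h) y) \<partial>lborel) \<partial>M)"
    using nn_integral_gauss_affine[OF h(1), of "indicator B"] by simp
  also have "\<dots> = (\<integral>\<^sup>+ y. (\<integral>\<^sup>+ w. indicator B y * ennreal (normal_density (X (t - h) w + \<mu> * h) (\<sigma> * sqrt h) y) \<partial>M) \<partial>lborel)"
  proof -
    interpret P: pair_sigma_finite lborel M ..
    show ?thesis by (rule P.Fubini') measurable
  qed
  also have "\<dots> = (\<integral>\<^sup>+ y. indicator B y * ennreal (smoothed h t y) \<partial>lborel)"
    using th by (simp add: nn_integral_cmult ennreal_smoothed max_def)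
  finally show ?thesis by simp
qed

lemma prob_eq_integral:
  assumes [measurable]: "f \<in> borel_measurable M" "B \<in> sets borel"
  shows "prob {w \<in> space M. f w \<in> B} = (\<integral>w. indicator B (f w) \<partial>M)"
proof -
  have "(\<integral>w. indicator B (f w) \<partial>M) = (\<integral>w. indicator {w \<in> space M. f w \<in> B} w \<partial>M :: real)"
    by (intro Bochner_Integration.integral_cong) (auto split: split_indicator)
  then show ?thesis by (simp add: Int_absorb2)
qed

text \<open>The two variables coincide unless a jump falls into (t - h, t].\<close>

lemma smoothed_close:
  assumes h: "0 < h" "h \<le> t" and B [measurable]: "B \<in> sets borel"
  shows "\<bar>prob {w \<in> space M. X (t - h) w + \<mu> * h + \<sigma> * (W t w - W (t - h) w) \<in> B} -
    prob {w \<in> space M. X t w \<in> B}\<bar> \<le> jump_prob h t"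
proof -
  have th: "0 \<le> t - h" "t - h < t" "0 \<le> t" using h by auto
  note [measurable] = X_measurable[OF th(1)] increment_measurable[OF th(1,2)] X_measurable[OF th(3)]
    measurable_count[OF th(1)] measurable_count[OF th(3)]
  let ?Y = "\<lambda>w. X (t - h) w + \<mu> * h + \<sigma> * (W t w - W (t - h) w)"
  have i: "integrable M (\<lambda>w. indicator B (?Y w) :: real)" "integrable M (\<lambda>w. indicator B (X t w) :: real)"
    by (auto intro!: integrable_const_bound[where B = 1])
  have e: "prob {w \<in> space M. ?Y w \<in> B} = (\<integral>w. indicator B (?Y w) \<partial>M)"
    "prob {w \<in> space M. X t w \<in> B} = (\<integral>w. indicator B (X t w) \<partial>M)"
    by (rule prob_eq_integral; measurable)+
  have "\<bar>prob {w \<in> space M. ?Y w \<in> B} - prob {w \<in> space M. X t w \<in> B}\<bar> =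
    \<bar>\<integral>w. indicator B (?Y w) - indicator B (X t w) \<partial>M\<bar>"
    unfolding e using i by simp
  also have "\<dots> \<le> (\<integral>w. \<bar>indicator B (?Y w) - indicator B (X t w)\<bar> \<partial>M)" by (rule integral_abs_bound)
  also have "\<dots> \<le> jump_prob h t" unfolding jump_prob_def
  proof (rule integral_mono)
    show "integrable M (\<lambda>w. \<bar>indicator B (?Y w) - indicator B (X t w)\<bar> :: real)" using i by auto
    show "integrable M (\<lambda>w. if count (max 0 (t - h)) w = count (max 0 t) w then 0 else 1 :: real)"
      by (rule integrable_const_bound[where B = 1]) auto
    fix w assume w: "w \<in> space M"
    show "\<bar>indicator B (?Y w) - indicator B (X t w)\<bar> \<le> (if count (max 0 (t - h)) w = count (max 0 t) w then 0 else 1 :: real)"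
      using X_increment[OF w th(1), of t] count_eq_iff[OF w th(1), of t] h
      by (auto split: split_indicator simp: max_def)
  qed
  finally show ?thesis .
qed

lemma smoothed_integral:
  assumes h: "0 < h" "h \<le> t" and B [measurable]: "B \<in> sets borel"
  shows "(\<integral>y. indicator B y * smoothed h t y \<partial>lborel) =
     prob {w \<in> space M. X (t - h) w + \<mu> * h + \<sigma> * (W t w - W (t - h) w) \<in> B}"
    and smoothed_integrable: "integrable lborel (smoothed h t)"
proof -
  have [measurable]: "smoothed h t \<in> borel_measurable borel"
    unfolding smoothed_def by measurable
  have "(\<integral>\<^sup>+ y. ennreal (indicator B y * smoothed h t y) \<partial>lborel) = (\<integral>\<^sup>+ y. indicator B y * ennreal (smoothed h t y) \<partial>lborel)"
    by (rule nn_integral_cong) (auto split: split_indicator)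
  then show "(\<integral>y. indicator B y * smoothed h t y \<partial>lborel) =
     prob {w \<in> space M. X (t - h) w + \<mu> * h + \<sigma> * (W t w - W (t - h) w) \<in> B}"
    unfolding prob_no_jump_step[OF h B]
    by (intro integral_eq_nn_integral[THEN trans]) (auto simp: smoothed_nonneg measure_def)
  show "integrable lborel (smoothed h t)"
    using prob_no_jump_step[OF h, of UNIV] by (intro integrableI_nonneg) (auto simp: smoothed_nonneg emeasure_space_1)
qed

text \<open>The law with suppressed jumps has a density and gives a null set mass 0; the error
  \<open>jump_prob h t\<close> tends to 0 with \<open>h\<close>.\<close>

theorem X_absolutely_continuous:
  assumes t: "0 < t" and B: "B \<in> null_sets lborel"
  shows "AE w in M. X t w \<notin> B"
proof -
  have Bm [measurable]: "B \<in> sets borel" using B by auto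
  note [measurable] = X_measurable[OF less_imp_le[OF t]]
  have "eventually (\<lambda>k. inverse (real (Suc k)) < t) sequentially"
    using order_tendstoD(2)[OF LIMSEQ_inverse_real_of_nat] t by blast
  then have "eventually (\<lambda>k. prob {w \<in> space M. X t w \<in> B} \<le> jump_prob (1 / real (Suc k)) t) sequentially"
  proof eventually_elim
    case (elim k)
    let ?h = "1 / real (Suc k)"
    have h: "0 < ?h" "?h \<le> t" using elim by (auto simp: inverse_eq_divide)
    have "(\<integral>y. indicator B y * smoothed ?h t y \<partial>lborel) = 0"
      using AE_not_in[OF B] by (intro integral_eq_zero_AE) (auto elim!: eventually_mono)
    then show ?case using smoothed_close[OF h Bm] smoothed_integral[OF h Bm] by simp
  qed
  then have "prob {w \<in> space M. X t w \<in> B} \<le> 0"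
    by (rule tendsto_lowerbound[OF jump_prob_tendsto_0[OF t]]) simp
  then have "prob {w \<in> space M. X t w \<in> B} = 0" by (simp add: measure_le_0_iff)
  then show ?thesis by (subst (asm) prob_eq_0) auto
qed

text \<open>The bound for the probabilities of sets becomes an L1 bound for the densities at the
  cost of a factor 2.\<close>

lemma smoothed_L1_close:
  assumes h: "0 < h" "h \<le> t" and D: "distributed M lborel (X t) (\<lambda>x. ennreal (\<rho> x))" and \<rho>: "\<And>x. 0 \<le> \<rho> x"
  shows "(\<integral>x. \<bar>smoothed h t x - \<rho> x\<bar> \<partial>lborel) \<le> 2 * jump_prob h t" and "integrable lborel \<rho>"
proof -
  have [measurable]: "(\<lambda>x. ennreal (\<rho> x)) \<in> borel_measurable borel"
    using distributed_borel_measurable[OF D] by simp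
  then have "(\<lambda>x. enn2real (ennreal (\<rho> x))) \<in> borel_measurable borel" by measurable
  then have \<rho>m [measurable]: "\<rho> \<in> borel_measurable borel" using \<rho> by simp
  have Xm: "X t \<in> measurable M lborel" using distributed_measurable[OF D] .
  have dP: "(\<integral>\<^sup>+ x. ennreal (\<rho> x) * indicator B x \<partial>lborel) = prob {w \<in> space M. X t w \<in> B}" if B: "B \<in> sets borel" for B
  proof -
    have "X t -` B \<inter> space M = {w \<in> space M. X t w \<in> B}" by auto
    then show ?thesis using distributed_emeasure[OF D, of B] B by (simp add: emeasure_eq_measure)
  qed
  show i: "integrable lborel \<rho>"
    using dP[of UNIV] by (intro integrableI_nonneg) (auto simp: \<rho>)
  have dR: "(\<integral>x. indicator B x * \<rho> x \<partial>lborel) = prob {w \<in> space M. X t w \<in> B}" if B [measurable]: "B \<in> sets borel" for B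
  proof -
    have "(\<integral>\<^sup>+ y. ennreal (indicator B y * \<rho> y) \<partial>lborel) = (\<integral>\<^sup>+ x. ennreal (\<rho> x) * indicator B x \<partial>lborel)"
      by (rule nn_integral_cong) (auto split: split_indicator)
    then show ?thesis unfolding dP[OF B]
      by (intro integral_eq_nn_integral[THEN trans]) (auto simp: \<rho>)
  qed
  have si: "integrable lborel (smoothed h t)" by (rule smoothed_integrable[OF h sets.top]) 
  show "(\<integral>x. \<bar>smoothed h t x - \<rho> x\<bar> \<partial>lborel) \<le> 2 * jump_prob h t"
  proof (rule integral_abs_le_of_set_integrals)
    show "integrable lborel (\<lambda>x. smoothed h t x - \<rho> x)" using i si by simp
    fix B :: "real set" assume "B \<in> sets lborel"
    then have B: "B \<in> sets borel" by simp
    have "integrable lborel (\<lambda>x. indicator B x * smoothed h t x)" "integrable lborel (\<lambda>x. indicator B x * \<rho> x)"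
      using integrable_mult_indicator[of B lborel "smoothed h t"] integrable_mult_indicator[of B lborel \<rho>] si i B by simp_all
    then have "(\<integral>x. indicator B x * (smoothed h t x - \<rho> x) \<partial>lborel) =
      (\<integral>x. indicator B x * smoothed h t x \<partial>lborel) - (\<integral>x. indicator B x * \<rho> x \<partial>lborel)"
      by (simp add: right_diff_distrib)
    also have "\<bar>\<dots>\<bar> \<le> jump_prob h t"
      unfolding smoothed_integral[OF h B] dR[OF B] by (rule smoothed_close[OF h B])
    finally show "\<bar>\<integral>x. indicator B x * (smoothed h t x - \<rho> x) \<partial>lborel\<bar> \<le> jump_prob h t" .
  qed
qed

text \<open>Radon--Nikodym at one fixed time. The versions obtained for different \<open>t\<close>
  are unrelated, so joint measurability needs a separate construction.\<close>

lemma ex_density: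
  assumes t: "0 < t"
  shows "\<exists>\<rho>. (\<forall>x. 0 \<le> \<rho> x) \<and> distributed M lborel (X t) (\<lambda>x. ennreal (\<rho> x))"
proof -
  have Xm [measurable]: "X t \<in> borel_measurable M" using t by (intro X_measurable) simp
  have "absolutely_continuous lborel (distr M lborel (X t))"
    unfolding absolutely_continuous_def
  proof
    fix B :: "real set" assume B: "B \<in> null_sets lborel"
    then have [measurable]: "B \<in> sets borel" by auto
    have "emeasure M (X t -` B \<inter> space M) = 0"
      using X_absolutely_continuous[OF t B] by (subst (asm) AE_iff_measurable[OF _ refl]) (auto simp: vimage_def Int_def conj_commute)
    then show "B \<in> null_sets (distr M lborel (X t))" by (auto simp: null_sets_def emeasure_distr)
  qed
  from sigma_finite_measure.Radon_Nikodym[OF _ this] obtain f where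
    f [measurable]: "f \<in> borel_measurable lborel" "density lborel f = distr M lborel (X t)"
    by (auto intro: sigma_finite_lborel)
  interpret D: prob_space "distr M lborel (X t)" by (rule prob_space_distr) simp
  have "(\<integral>\<^sup>+ x. f x \<partial>lborel) = emeasure (density lborel f) UNIV" by (simp add: emeasure_density)
  also have "\<dots> = 1" unfolding f(2) using D.emeasure_space_1 by simp
  finally have "AE x in lborel. f x \<noteq> \<infinity>" by (intro nn_integral_noteq_infinite) auto
  then have "density lborel f = density lborel (\<lambda>x. ennreal (enn2real (f x)))"
    by (intro density_cong) (auto simp: less_top elim!: eventually_mono)
  then have "distributed M lborel (X t) (\<lambda>x. ennreal (enn2real (f x)))"
    unfolding distributed_def using f by auto
  then show ?thesis by (intro exI[of _ "\<lambda>x. enn2real (f x)"]) auto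
qed

text \<open>Taking the least admissible index, not an arbitrary one, keeps the choice measurable in
  \<open>t\<close>. The bound (1/2)^k makes the L1 errors summable.\<close>

definition scale :: "nat \<Rightarrow> real \<Rightarrow> nat" where
  "scale k t = (LEAST n. 1 / real (Suc n) \<le> t \<and> jump_prob (1 / real (Suc n)) t \<le> (1/2) ^ k)"

lemma measurable_scale [measurable]: "scale k \<in> measurable borel (count_space UNIV)"
  unfolding scale_def by measurable

lemma scale:
  assumes t: "0 < t"
  shows "1 / real (Suc (scale k t)) \<le> t" "jump_prob (1 / real (Suc (scale k t))) t \<le> (1/2) ^ k"
proof -
  have "eventually (\<lambda>n. inverse (real (Suc n)) < t) sequentially"
    using order_tendstoD(2)[OF LIMSEQ_inverse_real_of_nat] t by blast
  moreover have "eventually (\<lambda>n. jump_prob (1 / real (Suc n)) t < (1/2) ^ k) sequentially"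
    using order_tendstoD(2)[OF jump_prob_tendsto_0[OF t]] by simp
  ultimately have "eventually (\<lambda>n. 1 / real (Suc n) \<le> t \<and> jump_prob (1 / real (Suc n)) t \<le> (1/2) ^ k) sequentially"
    by eventually_elim (simp add: inverse_eq_divide)
  then obtain n where "1 / real (Suc n) \<le> t \<and> jump_prob (1 / real (Suc n)) t \<le> (1/2) ^ k"
    by (auto simp: eventually_sequentially)
  from LeastI[of "\<lambda>n. 1 / real (Suc n) \<le> t \<and> jump_prob (1 / real (Suc n)) t \<le> (1/2) ^ k", OF this]
  show "1 / real (Suc (scale k t)) \<le> t" "jump_prob (1 / real (Suc (scale k t))) t \<le> (1/2) ^ k"
    unfolding scale_def by auto
qed

text \<open>For each \<open>t\<close> the functions \<open>f k t\<close> are within 2 (1/2)^k of the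
  density in L1, so they converge to it almost everywhere, and their pointwise limit is jointly
  measurable. \<open>max 0\<close> keeps this version nonnegative where \<open>lim\<close> has no
  meaning.\<close>

theorem ex_joint_density: "\<exists>p. density_of_process M X p"
proof -
  define f where "f k t x = smoothed (1 / real (Suc (scale k t))) t x" for k t x
  define p where "p t x = max 0 (lim (\<lambda>k. f k t x))" for t x
  have [measurable]: "(\<lambda>y. f k (fst y) (snd y)) \<in> borel_measurable (borel \<Otimes>\<^sub>M borel)" for k
  proof -
    have "(\<lambda>y. (\<lambda>n y. smoothed (1 / real (Suc n)) (fst y) (snd y)) (scale k (fst y)) y) \<in> borel_measurable (borel \<Otimes>\<^sub>M borel)"
      by (rule measurable_compose_countable[where f = "\<lambda>n y. smoothed (1 / real (Suc n)) (fst y) (snd y)"]) measurable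
    then show ?thesis by (simp add: f_def)
  qed
  have pm [measurable]: "(\<lambda>y. p (fst y) (snd y)) \<in> borel_measurable (borel \<Otimes>\<^sub>M borel)"
    unfolding p_def by measurable
  have D: "distributed M lborel (X t) (\<lambda>x. ennreal (p t x))" if t: "0 < t" for t
  proof -
    obtain \<rho> where \<rho>: "\<And>x. 0 \<le> \<rho> x" and D: "distributed M lborel (X t) (\<lambda>x. ennreal (\<rho> x))"
      using ex_density[OF t] by blast
    have "AE x in lborel. (\<lambda>k. f k t x) \<longlonglongrightarrow> \<rho> x"
    proof (rule AE_tendsto_of_summable_L1)
      show "integrable lborel (f k t)" for k
        unfolding f_def using scale[OF t] by (intro smoothed_integrable[OF _ _ sets.top]) auto
      show "integrable lborel \<rho>" by (rule smoothed_L1_close(2)[OF t order_refl D \<rho>])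
      show "(\<integral>x. \<bar>f k t x - \<rho> x\<bar> \<partial>lborel) \<le> 2 * (1/2) ^ k" for k
        using smoothed_L1_close(1)[OF _ scale(1)[OF t] D \<rho>, of k] scale(2)[OF t, of k]
        unfolding f_def by simp
      show "summable (\<lambda>k. 2 * (1/2 :: real) ^ k)" by (intro summable_mult summable_geometric) simp
    qed
    then have "AE x in lborel. p t x = \<rho> x"
      by eventually_elim (auto simp: p_def \<rho> limI max_def intro: antisym)
    moreover have [measurable]: "p t \<in> borel_measurable borel" unfolding p_def f_def smoothed_def by measurable
    moreover have "(\<lambda>x. ennreal (\<rho> x)) \<in> borel_measurable borel" using distributed_borel_measurable[OF D] by simp
    ultimately show ?thesis using D unfolding distributed_def
      by (auto intro!: density_cong elim!: eventually_mono)
  qed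
  have "(\<lambda>(t, x). p t x) \<in> borel_measurable (restrict_space borel ({0<..} \<times> UNIV))"
    using pm by (intro measurable_restrict_space1) (simp add: borel_prod split_beta)
  moreover have "0 \<le> p t x" for t x by (simp add: p_def)
  ultimately show ?thesis using D unfolding density_of_process_def by auto
qed

end

section \<open>Integrability of the rate near the origin\<close>

context jump_diffusion begin

lemma nn_integral_iterated:
  assumes g [measurable]: "g \<in> borel_measurable (lborel \<Otimes>\<^sub>M M)"
  shows "(\<integral>\<^sup>+ w. (\<integral>\<^sup>+ s. g (s, w) \<partial>lborel) \<partial>M) = (\<integral>\<^sup>+ z. g z \<partial>(lborel \<Otimes>\<^sub>M M))"
proof -
  interpret P: pair_sigma_finite lborel M ..
  show ?thesis using P.Fubini[OF g] nn_integral_fst[OF g] by simp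
qed

lemma nn_integral_time_space:
  assumes f [measurable]: "f \<in> borel_measurable (borel \<Otimes>\<^sub>M borel \<Otimes>\<^sub>M count_space UNIV)"
  shows "(\<integral>\<^sup>+ w. (\<integral>\<^sup>+ s\<in>{0<..T}. f (s, X s w, count s w) \<partial>lborel) \<partial>M) =
    (\<integral>\<^sup>+ z. f (fst z, X (max 0 (fst z)) (snd z), count (max 0 (fst z)) (snd z)) * indicator {0<..T} (fst z) \<partial>(lborel \<Otimes>\<^sub>M M))"
proof -
  have "(\<integral>\<^sup>+ w. (\<integral>\<^sup>+ s\<in>{0<..T}. f (s, X s w, count s w) \<partial>lborel) \<partial>M) =
    (\<integral>\<^sup>+ w. (\<integral>\<^sup>+ s. (\<lambda>z. f (fst z, X (max 0 (fst z)) (snd z), count (max 0 (fst z)) (snd z)) * indicator {0<..T} (fst z)) (s, w) \<partial>lborel) \<partial>M)"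
    by (intro nn_integral_cong) (auto split: split_indicator)
  also have "\<dots> = (\<integral>\<^sup>+ z. f (fst z, X (max 0 (fst z)) (snd z), count (max 0 (fst z)) (snd z)) * indicator {0<..T} (fst z) \<partial>(lborel \<Otimes>\<^sub>M M))"
    by (rule nn_integral_iterated) measurable
  finally show ?thesis .
qed

lemma AE_pair_X_not_in_null:
  assumes B: "B \<in> null_sets lborel"
  shows "AE z in lborel \<Otimes>\<^sub>M M. 0 < fst z \<longrightarrow> X (max 0 (fst z)) (snd z) \<notin> B"
proof -
  have [measurable]: "B \<in> sets borel" using B by auto
  interpret P: pair_sigma_finite lborel M ..
  show ?thesis
  proof (rule P.AE_pair_measure)
    show "{x \<in> space (lborel \<Otimes>\<^sub>M M). 0 < fst x \<longrightarrow> X (max 0 (fst x)) (snd x) \<notin> B} \<in> sets (lborel \<Otimes>\<^sub>M M)"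
      by measurable
    show "AE x in lborel. AE y in M. 0 < fst (x, y) \<longrightarrow> X (max 0 (fst (x, y))) (snd (x, y)) \<notin> B"
    proof (rule AE_I2)
      fix t :: real
      show "AE y in M. 0 < fst (t, y) \<longrightarrow> X (max 0 (fst (t, y))) (snd (t, y)) \<notin> B"
        using X_absolutely_continuous[OF _ B, of t] by (cases "0 < t") (auto simp: max_def)
    qed
  qed
qed

text \<open>\<open>countL\<close> increases strictly from one jump to the next, so it numbers these
  jumps injectively by naturals below \<open>n\<close>.\<close>

lemma card_jumps_le:
  assumes w: "w \<in> space M"
  shows "card {s \<in> N w \<inter> {0<..T}. countL s w < n} \<le> n"
proof -
  have less: "countL s w < countL s' w" if "s \<in> N w" "s < s'" for s s'
  proof -
    have "0 < s" using N_pos[OF w] that by auto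
    then have "N w \<inter> {0<..<s} \<subset> N w \<inter> {0<..<s'}" using that by (intro psubsetI) (auto simp: set_eq_iff)
    moreover have "finite (N w \<inter> {0<..<s'})" by (rule finite_subset[OF _ N_finite[OF w, of s']]) auto
    ultimately show ?thesis unfolding countL_def by (rule psubset_card_mono[rotated])
  qed
  have "inj_on (\<lambda>s. countL s w) {s \<in> N w \<inter> {0<..T}. countL s w < n}"
  proof (rule inj_onI)
    fix s s' assume a: "s \<in> {s \<in> N w \<inter> {0<..T}. countL s w < n}" "s' \<in> {s \<in> N w \<inter> {0<..T}. countL s w < n}"
      "countL s w = countL s' w"
    then show "s = s'" using less[of s s'] less[of s' s] by (cases s s' rule: linorder_cases) auto
  qed
  then have "card {s \<in> N w \<inter> {0<..T}. countL s w < n} \<le> card {..<n}"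
    by (rule card_inj_on_le) auto
  then show ?thesis by simp
qed

lemma sum_jumps_le:
  fixes f :: "real \<Rightarrow> 'b::{linordered_semidom}"
  assumes w: "w \<in> space M" and f: "\<And>s. s \<in> N w \<Longrightarrow> countL s w < n \<Longrightarrow> f s \<le> B" and B: "0 \<le> B"
  shows "(\<Sum>s\<in>N w \<inter> {0<..T}. if countL s w < n then f s else 0) \<le> of_nat n * B"
proof -
  have fin: "finite (N w \<inter> {0<..T})" by (rule N_finite[OF w])
  have "(\<Sum>s\<in>N w \<inter> {0<..T}. if countL s w < n then f s else 0) = (\<Sum>s\<in>{s \<in> N w \<inter> {0<..T}. countL s w < n}. f s)"
    using fin by (subst sum.inter_filter) auto
  also have "\<dots> \<le> of_nat (card {s \<in> N w \<inter> {0<..T}. countL s w < n}) * B"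
    using f by (intro sum_bounded_above) auto
  also have "\<dots> \<le> of_nat n * B"
    using card_jumps_le[OF w] B by (intro mult_right_mono of_nat_mono) auto
  finally show ?thesis .
qed

text \<open>The sum runs over a random set, so its measurability is not visible. It is a limit of
  grid sums in which a cell contributes if the count changes over it, with \<psi> evaluated at the
  left end.\<close>

lemma measurable_jump_sum:
  fixes \<psi> :: "real \<Rightarrow> real \<Rightarrow> real"
  assumes c: "continuous_on UNIV (\<lambda>z. \<psi> (fst z) (snd z))" and T: "0 < T"
  shows "(\<lambda>w. \<Sum>s\<in>N w \<inter> {0<..T}. if countL s w < n then \<psi> s (XL s w) else 0) \<in> borel_measurable M"
proof -
  define r where "r w a b = (if count a w = count b w \<or> \<not> count a w < n then 0 else \<psi> a (X a w))" for w a b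
  define S where "S m w = (\<Sum>i<Suc m. r w (T * real i / real (Suc m)) (T * real (Suc i) / real (Suc m)))" for m w
  show ?thesis
  proof (rule borel_measurable_LIMSEQ_metric[where f = S])
    fix m
    have [measurable]: "(\<lambda>z. \<psi> (fst z) (snd z)) \<in> borel_measurable (borel \<Otimes>\<^sub>M borel)"
      using borel_measurable_continuous_onI[OF c] by (simp add: borel_prod)
    have "(\<lambda>w. r w a b) \<in> borel_measurable M" if "0 \<le> a" "0 \<le> b" for a b
    proof -
      note [measurable] = X_measurable[OF that(1)] measurable_count[OF that(1)]
        measurable_nat_eq[OF measurable_count[OF that(1)] measurable_count[OF that(2)]]
      have [measurable]: "(\<lambda>w. \<psi> a (X a w)) \<in> borel_measurable M"
        using measurable_compose[of "\<lambda>w. (a, X a w)" M "borel \<Otimes>\<^sub>M borel" "\<lambda>z. \<psi> (fst z) (snd z)" borel] by simp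
      show ?thesis unfolding r_def by measurable
    qed
    then show "S m \<in> borel_measurable M" unfolding S_def using T by (intro borel_measurable_sum) auto
  next
    fix w assume w: "w \<in> space M"
    show "(\<lambda>m. S m w) \<longlonglongrightarrow> (\<Sum>s\<in>N w \<inter> {0<..T}. if countL s w < n then \<psi> s (XL s w) else 0)"
      unfolding S_def
    proof (rule grid_sum_tendsto[OF T N_finite[OF w]])
      fix a b :: real assume ab: "0 \<le> a" "a < b" "b \<le> T" "N w \<inter> {0<..T} \<inter> {a<..b} = {}"
      then have "N w \<inter> {a<..b} = {}" by auto
      then show "r w a b = 0" using count_eq_iff[OF w ab(1), of b] ab by (simp add: r_def)
    next
      fix s and a b :: "nat \<Rightarrow> real"
      assume s: "s \<in> N w \<inter> {0<..T}" and a: "\<And>m. 0 \<le> a m" "\<And>m. a m < s" "a \<longlonglongrightarrow> s"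
        and b: "\<And>m. s \<le> b m" "\<And>m. b m \<le> T"
      have al: "filterlim a (at_left s) sequentially" using a by (intro tendsto_imp_filterlim_at_left) auto
      have "count (a m) w \<noteq> count (b m) w" for m
        using count_eq_iff[OF w a(1)[of m], of "b m"] a(2)[of m] b(1)[of m] s by fastforce
      then have r: "r w (a m) (b m) = (if count (a m) w < n then \<psi> (a m) (X (a m) w) else 0)" for m
        by (simp add: r_def)
      have e: "eventually (\<lambda>m. count (a m) w = countL s w) sequentially"
        using count_at_left[OF w, of s] al by (auto simp: filterlim_iff)
      have Xl: "(\<lambda>m. X (a m) w) \<longlonglongrightarrow> XL s w"
        using s by (intro filterlim_compose[OF X_at_left[OF w] al]) auto
      have "(\<lambda>m. (\<lambda>z. \<psi> (fst z) (snd z)) (a m, X (a m) w)) \<longlonglongrightarrow> (\<lambda>z. \<psi> (fst z) (snd z)) (s, XL s w)"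
        by (rule continuous_on_tendsto_compose[OF c]) (auto intro!: tendsto_Pair a Xl)
      then have "(\<lambda>m. if countL s w < n then \<psi> (a m) (X (a m) w) else 0) \<longlonglongrightarrow> (if countL s w < n then \<psi> s (XL s w) else 0)"
        by auto
      moreover have "eventually (\<lambda>m. (if countL s w < n then \<psi> (a m) (X (a m) w) else 0) = r w (a m) (b m)) sequentially"
        using e by eventually_elim (simp add: r)
      ultimately show "(\<lambda>m. r w (a m) (b m)) \<longlonglongrightarrow> (if countL s w < n then \<psi> s (XL s w) else 0)"
        by (rule Lim_transform_eventually)
    qed auto
  qed
qed

text \<open>By compensation the expected number of jumps from near 0 is an integral over the time
  spent there, and X is at 0 for a null set of times because its laws have densities. The tents
  \<open>\<psi> j\<close> decreasing to the indicator of 0 are continuous, as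
  \<open>measurable_jump_sum\<close> demands; admitting only \<open>n\<close> jumps gives the finite
  integral that decreasing convergence needs.\<close>

lemma AE_jumps_not_from_0_aux:
  assumes T: "0 < T"
  shows "AE w in M. \<forall>s\<in>N w \<inter> {0<..T}. countL s w < n \<longrightarrow> XL s w \<noteq> 0"
proof -
  define \<psi> where "\<psi> j x = max 0 (1 - real j * \<bar>x\<bar>)" for j and x :: real
  define H where "H j w = (\<Sum>s\<in>N w \<inter> {0<..T}. if countL s w < n then \<psi> j (XL s w) else 0)" for j w
  have \<psi>01: "0 \<le> \<psi> j x" "\<psi> j x \<le> 1" for j x by (auto simp: \<psi>_def)
  have [measurable]: "\<psi> j \<in> borel_measurable borel" for j unfolding \<psi>_def by measurable
  have Hm [measurable]: "H j \<in> borel_measurable M" for j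
    unfolding H_def \<psi>_def by (rule measurable_jump_sum[OF _ T, where \<psi> = "\<lambda>_ x. max 0 (1 - real j * \<bar>x\<bar>)"])
      (intro continuous_intros)
  define G where "G j z = ennreal (if count (max 0 (fst z)) (snd z) < n then \<psi> j (X (max 0 (fst z)) (snd z)) else 0) *
    \<Lambda> (X (max 0 (fst z)) (snd z)) * indicator {0<..T} (fst z)" for j z
  have [measurable]: "G j \<in> borel_measurable (lborel \<Otimes>\<^sub>M M)" for j unfolding G_def by measurable
  have HG: "(\<integral>\<^sup>+ w. ennreal (H j w) \<partial>M) = (\<integral>\<^sup>+ z. G j z \<partial>(lborel \<Otimes>\<^sub>M M))" for j
  proof -
    let ?f = "\<lambda>(s :: real, x, k). ennreal (if k < n then \<psi> j x else 0)"
    have "(\<integral>\<^sup>+ w. ennreal (H j w) \<partial>M) = (\<integral>\<^sup>+ w. (\<Sum>s\<in>N w \<inter> {0<..T}. ?f (s, XL s w, countL s w)) \<partial>M)"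
      unfolding H_def by (intro nn_integral_cong, subst sum_ennreal[symmetric]) (auto simp: \<psi>01)
    also have "\<dots> = (\<integral>\<^sup>+ w. (\<integral>\<^sup>+ s\<in>{0<..T}. ?f (s, X s w, count s w) * \<Lambda> (X s w) \<partial>lborel) \<partial>M)"
      by (rule compensation) measurable
    also have "\<dots> = (\<integral>\<^sup>+ z. G j z \<partial>(lborel \<Otimes>\<^sub>M M))"
      using nn_integral_time_space[of "\<lambda>(s, x, k). ennreal (if k < n then \<psi> j x else 0) * \<Lambda> x" T]
      by (simp add: G_def)
    finally show ?thesis .
  qed
  have HB: "H j w \<le> real n" if "w \<in> space M" for j w
    unfolding H_def using sum_jumps_le[OF that, of n "\<lambda>s. \<psi> j (XL s w)" 1 T] \<psi>01 by simp
  have dec: "decseq G"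
  proof (rule decseq_SucI)
    fix j
    have "\<psi> (Suc j) x \<le> \<psi> j x" for x by (auto simp: \<psi>_def algebra_simps)
    then show "G (Suc j) \<le> G j"
      unfolding le_fun_def G_def by (auto intro!: mult_right_mono ennreal_leI)
  qed
  have "(\<integral>\<^sup>+ w. (INF j. ennreal (H j w)) \<partial>M) \<le> (INF j. (\<integral>\<^sup>+ z. G j z \<partial>(lborel \<Otimes>\<^sub>M M)))"
    unfolding HG[symmetric] by (intro INF_greatest nn_integral_mono INF_lower) auto
  also have "\<dots> = (\<integral>\<^sup>+ z. (INF j. G j z) \<partial>(lborel \<Otimes>\<^sub>M M))"
  proof (rule nn_integral_monotone_convergence_INF_decseq[OF dec, symmetric])
    have "(\<integral>\<^sup>+ z. G 0 z \<partial>(lborel \<Otimes>\<^sub>M M)) \<le> (\<integral>\<^sup>+ w. ennreal (real n) \<partial>M)"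
      unfolding HG[symmetric] by (intro nn_integral_mono ennreal_leI HB)
    then show "(\<integral>\<^sup>+ z. G 0 z \<partial>(lborel \<Otimes>\<^sub>M M)) < \<infinity>" by (simp add: emeasure_space_1 le_less_trans)
  qed auto
  also have "\<dots> = (\<integral>\<^sup>+ (z :: real \<times> 'a). 0 \<partial>(lborel \<Otimes>\<^sub>M M))"
  proof (rule nn_integral_cong_AE)
    have "{0::real} \<in> null_sets lborel" by (rule finite_imp_null_set_lborel) simp
    from AE_pair_X_not_in_null[OF this]
    show "AE z in lborel \<Otimes>\<^sub>M M. (INF j. G j z) = 0"
    proof eventually_elim
      case (elim z)
      show ?case
      proof (cases "0 < fst z")
        case True
        then have x: "X (max 0 (fst z)) (snd z) \<noteq> 0" using elim by auto
        obtain j where "1 < real j * \<bar>X (max 0 (fst z)) (snd z)\<bar>"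
          using reals_Archimedean3[of "\<bar>X (max 0 (fst z)) (snd z)\<bar>"] x by auto
        then have "G j z = 0" by (simp add: G_def \<psi>_def max_def)
        then have "(INF j. G j z) \<le> 0" by (metis INF_lower UNIV_I)
        then show ?thesis by simp
      qed (simp add: G_def)
    qed
  qed
  finally have "(\<integral>\<^sup>+ w. (INF j. ennreal (H j w)) \<partial>M) = 0" by simp
  then have "AE w in M. (INF j. ennreal (H j w)) = 0" by (subst (asm) nn_integral_0_iff_AE) measurable
  with AE_space show ?thesis
  proof eventually_elim
    case (elim w)
    show ?case
    proof (intro ballI impI notI)
      fix s assume s: "s \<in> N w \<inter> {0<..T}" "countL s w < n" "XL s w = 0"
      have "1 \<le> H j w" for j
      proof -
        have "(if countL s w < n then \<psi> j (XL s w) else 0) \<le> H j w"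
          unfolding H_def using N_finite[OF elim(1)] s \<psi>01 by (intro member_le_sum) auto
        then show ?thesis using s by (simp add: \<psi>_def)
      qed
      then have "1 \<le> (INF j. ennreal (H j w))" by (intro INF_greatest) (metis ennreal_1 ennreal_leI)
      then show False using elim(2) by simp
    qed
  qed
qed

theorem AE_jumps_not_from_0: "AE w in M. \<forall>s\<in>N w. XL s w \<noteq> 0"
proof -
  have "AE w in M. \<forall>n T::nat. \<forall>s\<in>N w \<inter> {0<..real (Suc T)}. countL s w < n \<longrightarrow> XL s w \<noteq> 0"
    unfolding AE_all_countable by (intro allI AE_jumps_not_from_0_aux) simp
  with AE_space show ?thesis
  proof eventually_elim
    case (elim w)
    show ?case
    proof
      fix s assume s: "s \<in> N w"
      obtain T :: nat where "s \<le> real T" using real_arch_simple by blast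
      then have "s \<in> N w \<inter> {0<..real (Suc T)}" using s N_pos[OF elim(1)] by auto
      then show "XL s w \<noteq> 0" using elim(2) by (auto dest: spec[where x = "Suc (countL s w)"])
    qed
  qed
qed

end

text \<open>The heat kernel is at most of order (v - u)^(-1/2); that this is integrable in time
  makes the second moment of the occupation time finite.\<close>

lemma nn_integral_inverse_sqrt:
  assumes "0 < d"
  shows "(\<integral>\<^sup>+ v\<in>{u<..<u + d}. ennreal (1 / sqrt (v - u)) \<partial>lborel) = ennreal (2 * sqrt d)"
proof -
  have "(\<integral>\<^sup>+ v\<in>{u<..<u + d}. ennreal (1 / sqrt (v - u)) \<partial>lborel) =
    (\<integral>\<^sup>+ v. ennreal (1 / sqrt v) * indicator {0<..<d} v \<partial>lborel)"
    by (subst nn_integral_real_affine[where c = 1 and t = u]) (auto intro!: nn_integral_cong split: split_indicator)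
  also have "\<dots> = (\<integral>\<^sup>+ v. ennreal (indicator {0..d} v * v powr (-1/2)) \<partial>lborel)"
  proof (rule nn_integral_cong_AE)
    show "AE v in lborel. ennreal (1 / sqrt v) * indicator {0<..<d} v = ennreal (indicator {0..d} v * v powr (-1/2))"
      using AE_lborel_singleton[of 0] AE_lborel_singleton[of d]
      by eventually_elim (auto split: split_indicator simp: powr_minus powr_half_sqrt inverse_eq_divide)
  qed
  also have "\<dots> = ennreal (d powr (-1/2 + 1) / (-1/2 + 1))"
    using assms by (intro nn_integral_has_integral_lebesgue has_integral_powr_from_0) auto
  also have "d powr (-1/2 + 1) / (-1/2 + 1) = 2 * sqrt d" using assms by (simp add: powr_half_sqrt)
  finally show ?thesis .
qed

text \<open>The Paley--Zygmund inequality, integrated over the event \<open>A\<close>.\<close>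

lemma (in finite_measure) second_moment_lower_bound:
  fixes Z :: "'a \<Rightarrow> ennreal" and m v :: real
  assumes Z [measurable]: "Z \<in> borel_measurable M" and A [measurable]: "A \<in> sets M" and mv: "0 < m" "0 < v"
    and m: "ennreal m * emeasure M A \<le> (\<integral>\<^sup>+ w. indicator A w * Z w \<partial>M)"
    and v: "(\<integral>\<^sup>+ w. indicator A w * (Z w * Z w) \<partial>M) \<le> ennreal v * emeasure M A"
  shows "m\<^sup>2 / (4 * v) * measure M A \<le> measure M (A \<inter> {w \<in> space M. ennreal (m / 2) < Z w})"
proof -
  define E where "E = {w \<in> space M. ennreal (m / 2) < Z w}"
  have [measurable]: "E \<in> sets M" unfolding E_def by measurable
  \<comment> \<open>Pointwise z \<le> l z^2/2 + 1/(2 l) replaces the Cauchy--Schwarz inequality.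
    With this \<open>l\<close> the quadratic term costs m/4, half of what the truncation at m/2
    leaves.\<close>
  define l where "l = m / (2 * v)"
  have l: "0 < l" using mv by (simp add: l_def)
  have pw: "Z w \<le> ennreal (m / 2) + ennreal (l / 2) * (Z w * Z w) + ennreal (1 / (2 * l)) * indicator E w"
    if w: "w \<in> space M" for w
  proof (cases "Z w")
    case (real z)
    have "z \<le> m / 2 + l / 2 * (z * z) + 1 / (2 * l) * indicator E w"
    proof (cases "w \<in> E")
      case True
      have "0 \<le> (l * z - 1)\<^sup>2 / (2 * l)" using l by simp
      also have "\<dots> = l / 2 * (z * z) + 1 / (2 * l) - z"
        using l by (simp add: power2_eq_square field_simps)
      finally show ?thesis using True mv by simp
    next
      case False
      then have "z \<le> m / 2" using real w mv by (auto simp: E_def not_less ennreal_le_iff)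
      moreover have "0 \<le> l / 2 * (z * z)" using l by simp
      ultimately show ?thesis using False by simp
    qed
    then have "ennreal z \<le> ennreal (m / 2 + l / 2 * (z * z) + 1 / (2 * l) * indicator E w)" by (rule ennreal_leI)
    also have "\<dots> = ennreal (m / 2) + ennreal (l / 2) * (Z w * Z w) + ennreal (1 / (2 * l)) * indicator E w"
      using l mv real by (cases "w \<in> E") (simp_all add: ennreal_mult[symmetric] ennreal_plus[symmetric] del: ennreal_plus)
    finally show ?thesis using real by simp
  next
    case top
    then show ?thesis using l by (simp add: ennreal_mult_eq_top_iff)
  qed
  have "ennreal m * emeasure M A \<le> (\<integral>\<^sup>+ w. indicator A w * Z w \<partial>M)" by (rule m)
  also have "\<dots> \<le> (\<integral>\<^sup>+ w. ennreal (m / 2) * indicator A w + ennreal (l / 2) * (indicator A w * (Z w * Z w)) +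
      ennreal (1 / (2 * l)) * indicator (A \<inter> E) w \<partial>M)"
  proof (rule nn_integral_mono)
    fix w assume "w \<in> space M"
    from pw[OF this] show "indicator A w * Z w \<le> ennreal (m / 2) * indicator A w + ennreal (l / 2) * (indicator A w * (Z w * Z w)) +
      ennreal (1 / (2 * l)) * indicator (A \<inter> E) w"
      by (auto split: split_indicator)
  qed
  also have "\<dots> = ennreal (m / 2) * emeasure M A + ennreal (l / 2) * (\<integral>\<^sup>+ w. indicator A w * (Z w * Z w) \<partial>M) +
      ennreal (1 / (2 * l)) * emeasure M (A \<inter> E)"
    by (simp add: nn_integral_add nn_integral_cmult)
  also have "\<dots> \<le> ennreal (m / 2) * emeasure M A + ennreal (l / 2) * (ennreal v * emeasure M A) +
      ennreal (1 / (2 * l)) * emeasure M (A \<inter> E)"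
    by (intro add_mono mult_left_mono v order_refl) auto
  also have "\<dots> = ennreal (m / 2 * measure M A + l / 2 * (v * measure M A) + 1 / (2 * l) * measure M (A \<inter> E))"
    using mv l by (simp add: emeasure_eq_measure ennreal_mult[symmetric] ennreal_plus[symmetric] del: ennreal_plus)
  finally have "ennreal (m * measure M A) \<le> ennreal (m / 2 * measure M A + l / 2 * (v * measure M A) + 1 / (2 * l) * measure M (A \<inter> E))"
    using mv by (simp add: emeasure_eq_measure ennreal_mult)
  then have "m * measure M A \<le> m / 2 * measure M A + l / 2 * (v * measure M A) + 1 / (2 * l) * measure M (A \<inter> E)"
    using mv l by (subst (asm) ennreal_le_iff) auto
  also have "l / 2 * (v * measure M A) = m / 4 * measure M A" using mv by (simp add: l_def field_simps)
  finally have "m / 4 * measure M A \<le> 1 / (2 * l) * measure M (A \<inter> E)" by (simp add: field_simps)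
  then have "m / 4 * measure M A * (m / v) \<le> 1 / (2 * l) * measure M (A \<inter> E) * (m / v)"
    using mv by (intro mult_right_mono) auto
  moreover have "1 / (2 * l) * measure M (A \<inter> E) * (m / v) = measure M (A \<inter> E)"
    using mv by (simp add: l_def)
  moreover have "m / 4 * measure M A * (m / v) = m\<^sup>2 / (4 * v) * measure M A" by (simp add: power2_eq_square)
  ultimately show ?thesis unfolding E_def[symmetric] by argo
qed

section \<open>Occupation of a neighbourhood of 0 by the jump-free path\<close>

context jump_diffusion begin

text \<open>The path continued after time \<open>q\<close> as if no further jump occurred. It equals
  \<open>X (q + u)\<close> as long as no point of \<open>N\<close> lies in (q, q + u].\<close>

definition free_path :: "real \<Rightarrow> real \<Rightarrow> 'a \<Rightarrow> real" where
  "free_path q u w = X q w + \<mu> * u + \<sigma> * (W (q + u) w - W q w)"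

lemma measurable_free_path_F: "0 \<le> q \<Longrightarrow> 0 \<le> u \<Longrightarrow> free_path q u \<in> borel_measurable (F (q + u))"
proof -
  assume "0 \<le> q" "0 \<le> u"
  then have [measurable]: "X q \<in> borel_measurable (F (q + u))" "W q \<in> borel_measurable (F (q + u))"
    "W (q + u) \<in> borel_measurable (F (q + u))"
    by (auto intro: F_measurable_mono[OF X_adapted] F_measurable_mono[OF W_adapted] W_adapted)
  show ?thesis unfolding free_path_def by measurable
qed

lemma measurable_free_path [measurable]:
  assumes "0 \<le> q"
  shows "(\<lambda>z. free_path q (max 0 (fst z)) (snd z)) \<in> borel_measurable (borel \<Otimes>\<^sub>M M)"
proof -
  have [measurable]: "X q \<in> borel_measurable M" "W q \<in> borel_measurable M"
    using assms by (auto intro: X_measurable W_measurable)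
  have "(\<lambda>z. X q (snd z) + \<mu> * max 0 (fst z) + \<sigma> * (W (max 0 (q + max 0 (fst z))) (snd z) - W q (snd z))) \<in> borel_measurable (borel \<Otimes>\<^sub>M M)"
    by measurable
  then show ?thesis using assms by (simp add: free_path_def max_def)
qed

text \<open>The Markov property of the jump-free path in integrated form; the weight
  \<open>Z\<close> may depend on everything up to time q + u.\<close>

lemma free_path_step:
  assumes q: "0 \<le> q" and uv: "0 \<le> u" "u < v" and Z: "Z \<in> borel_measurable (F (q + u))"
    and g [measurable]: "g \<in> borel_measurable borel"
  shows "(\<integral>\<^sup>+ w. Z w * g (free_path q v w) \<partial>M) =
    (\<integral>\<^sup>+ w. Z w * (\<integral>\<^sup>+ y. g y * ennreal (normal_density (free_path q u w + \<mu> * (v - u)) (\<sigma> * sqrt (v - u)) y) \<partial>lborel) \<partial>M)"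
proof -
  have qu: "0 \<le> q + u" "q + u < q + v" using q uv by auto
  let ?g = "\<lambda>p. fst (fst p) * g (snd (fst p) + \<mu> * (v - u) + \<sigma> * snd p) :: ennreal"
  have m: "(\<lambda>w. (Z w, free_path q u w)) \<in> measurable (F (q + u)) (borel \<Otimes>\<^sub>M borel)"
    using Z measurable_free_path_F[OF q uv(1)] by measurable
  have fp: "free_path q v w = free_path q u w + \<mu> * (v - u) + \<sigma> * (W (q + v) w - W (q + u) w)" for w
    by (simp add: free_path_def algebra_simps)
  have "(\<integral>\<^sup>+ w. Z w * g (free_path q v w) \<partial>M) = (\<integral>\<^sup>+ w. ?g ((Z w, free_path q u w), W (q + v) w - W (q + u) w) \<partial>M)"
    by (simp add: fp)
  also have "\<dots> = (\<integral>\<^sup>+ w. (\<integral>\<^sup>+ x. ?g ((Z w, free_path q u w), x) \<partial>gauss (q + v - (q + u))) \<partial>M)"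
    by (rule nn_integral_past_increment[OF qu m]) measurable
  also have "\<dots> = (\<integral>\<^sup>+ w. Z w * (\<integral>\<^sup>+ x. g (free_path q u w + \<mu> * (v - u) + \<sigma> * x) \<partial>gauss (v - u)) \<partial>M)"
    by (simp add: nn_integral_cmult)
  also have "\<dots> = (\<integral>\<^sup>+ w. Z w * (\<integral>\<^sup>+ y. g y * ennreal (normal_density (free_path q u w + \<mu> * (v - u)) (\<sigma> * sqrt (v - u)) y) \<partial>lborel) \<partial>M)"
    using uv by (simp add: nn_integral_gauss_affine)
  finally show ?thesis .
qed

definition heat_const :: real where "heat_const = 1 / sqrt (2 * pi * \<sigma>\<^sup>2)"

lemma heat_const_pos: "0 < heat_const"
  using \<sigma>_pos by (simp add: heat_const_def)

lemma sqrt_variance: "0 < u \<Longrightarrow> 1 / sqrt (2 * pi * (\<sigma> * sqrt u)\<^sup>2) = heat_const / sqrt u"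
  using \<sigma>_pos by (simp add: heat_const_def power_mult_distrib real_sqrt_mult)

text \<open>A normal density is at most its value at the mean, wherever the mean lies; so the past
  enters only through the integral of \<open>Z\<close>.\<close>

lemma free_path_upper:
  assumes q: "0 \<le> q" and uv: "0 \<le> u" "u < v" and Z [measurable]: "Z \<in> borel_measurable (F (q + u))"
    and g [measurable]: "g \<in> borel_measurable borel"
  shows "(\<integral>\<^sup>+ w. Z w * g (free_path q v w) \<partial>M) \<le>
    (\<integral>\<^sup>+ w. Z w \<partial>M) * ((\<integral>\<^sup>+ y. g y \<partial>lborel) * ennreal (heat_const * (1 / sqrt (v - u))))"
proof -
  have [measurable]: "Z \<in> borel_measurable M" by (rule F_measurable[OF Z])
  have "(\<integral>\<^sup>+ y. g y * ennreal (normal_density m (\<sigma> * sqrt (v - u)) y) \<partial>lborel) \<le>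
    (\<integral>\<^sup>+ y. g y * ennreal (heat_const * (1 / sqrt (v - u))) \<partial>lborel)" for m
    using normal_density_le[of m "\<sigma> * sqrt (v - u)"] sqrt_variance[of "v - u"] uv
    by (intro nn_integral_mono mult_left_mono ennreal_leI) auto
  then show ?thesis unfolding free_path_step[OF q uv Z g]
    by (subst nn_integral_multc[symmetric], measurable)
      (intro nn_integral_mono mult_left_mono, auto simp: nn_integral_multc)
qed

text \<open>Parabolic scaling: \<open>x\<close> and \<open>y\<close> differ by at most 2 sqrt d and
  the drift adds at most sqrt d, so the exponent is at most 9 d/(2 \<sigma>^2 u), which is below
  9/\<sigma>^2 since u > d/2. Apart from 1/sqrt d the bound is the same at all scales.\<close>

lemma normal_density_lower:
  assumes d: "0 < d" "\<bar>\<mu>\<bar> * sqrt d \<le> 1" and u: "d / 2 < u" "u < d" and x: "\<bar>x\<bar> \<le> sqrt d" and y: "\<bar>y\<bar> \<le> sqrt d"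
  shows "heat_const * exp (- 9 / \<sigma>\<^sup>2) / sqrt d \<le> normal_density (x + \<mu> * u) (\<sigma> * sqrt u) y"
proof -
  have u0: "0 < u" using d u by simp
  have "\<bar>\<mu> * u\<bar> \<le> \<bar>\<mu>\<bar> * d" using u u0 by (auto simp: abs_mult intro!: mult_left_mono)
  also have "\<dots> = (\<bar>\<mu>\<bar> * sqrt d) * sqrt d" using d by simp
  also have "\<dots> \<le> 1 * sqrt d" using d by (intro mult_right_mono) auto
  finally have "\<bar>y - (x + \<mu> * u)\<bar> \<le> 3 * sqrt d" using x y by linarith
  then have "(y - (x + \<mu> * u))\<^sup>2 \<le> (3 * sqrt d)\<^sup>2" by (metis abs_ge_zero power2_abs power_mono)
  then have "(y - (x + \<mu> * u))\<^sup>2 \<le> 9 * d" using d by (simp add: power_mult_distrib)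
  then have "(y - (x + \<mu> * u))\<^sup>2 / (2 * (\<sigma> * sqrt u)\<^sup>2) \<le> (9 * d) / (2 * (\<sigma> * sqrt u)\<^sup>2)"
    by (intro divide_right_mono) auto
  also have "\<dots> \<le> (9 * d) / (\<sigma>\<^sup>2 * d)"
    using u u0 d \<sigma>_pos by (intro divide_left_mono) (auto simp: power_mult_distrib)
  also have "\<dots> = 9 / \<sigma>\<^sup>2" using d by simp
  finally have e: "exp (- 9 / \<sigma>\<^sup>2) \<le> exp (- ((y - (x + \<mu> * u))\<^sup>2 / (2 * (\<sigma> * sqrt u)\<^sup>2)))" by simp
  have "heat_const / sqrt d \<le> heat_const / sqrt u"
    using heat_const_pos u u0 d by (intro divide_left_mono) (auto intro: less_imp_le)
  then have "heat_const / sqrt d * exp (- 9 / \<sigma>\<^sup>2) \<le> heat_const / sqrt u * exp (- ((y - (x + \<mu> * u))\<^sup>2 / (2 * (\<sigma> * sqrt u)\<^sup>2)))"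
    using e heat_const_pos u0 by (intro mult_mono) auto
  then show ?thesis unfolding normal_density_def sqrt_variance[OF u0] by (simp add: mult_ac)
qed

end

text \<open>By symmetry the square is twice the integral over u < v, an order in which the later
  time can be conditioned on the earlier one.\<close>

lemma nn_integral_square:
  fixes k :: "real \<Rightarrow> ennreal"
  assumes k [measurable]: "k \<in> borel_measurable borel"
  shows "(\<integral>\<^sup>+ u. k u \<partial>lborel) * (\<integral>\<^sup>+ u. k u \<partial>lborel) =
    2 * (\<integral>\<^sup>+ u. (\<integral>\<^sup>+ v. k u * k v * indicator {u<..} v \<partial>lborel) \<partial>lborel)"
proof -
  have [measurable]: "Measurable.pred (borel \<Otimes>\<^sub>M borel) (\<lambda>x. snd x < (fst x :: real))" by measurable
  have [measurable]: "(\<lambda>(u, v). k u * k v * indicator {u<..} v) \<in> borel_measurable (lborel \<Otimes>\<^sub>M lborel)"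
    "(\<lambda>(u, v). k u * k v * indicator {..<u} v) \<in> borel_measurable (lborel \<Otimes>\<^sub>M lborel)"
    by (simp_all add: indicator_def, measurable)
  have "(\<integral>\<^sup>+ u. k u \<partial>lborel) * (\<integral>\<^sup>+ u. k u \<partial>lborel) = (\<integral>\<^sup>+ u. (\<integral>\<^sup>+ v. k u * k v \<partial>lborel) \<partial>lborel)"
    by (simp add: nn_integral_cmult nn_integral_multc)
  also have "\<dots> = (\<integral>\<^sup>+ u. (\<integral>\<^sup>+ v. k u * k v * indicator {u<..} v + k u * k v * indicator {..<u} v \<partial>lborel) \<partial>lborel)"
  proof (rule nn_integral_cong, rule nn_integral_cong_AE)
    fix u :: real
    show "AE v in lborel. k u * k v = k u * k v * indicator {u<..} v + k u * k v * indicator {..<u} v"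
      using AE_lborel_singleton[of u] by eventually_elim (auto split: split_indicator)
  qed
  also have "\<dots> = (\<integral>\<^sup>+ u. (\<integral>\<^sup>+ v. k u * k v * indicator {u<..} v \<partial>lborel) \<partial>lborel) +
      (\<integral>\<^sup>+ u. (\<integral>\<^sup>+ v. k u * k v * indicator {..<u} v \<partial>lborel) \<partial>lborel)"
    by (simp add: nn_integral_add)
  also have "(\<integral>\<^sup>+ u. (\<integral>\<^sup>+ v. k u * k v * indicator {..<u} v \<partial>lborel) \<partial>lborel) =
      (\<integral>\<^sup>+ v. (\<integral>\<^sup>+ u. k u * k v * indicator {..<u} v \<partial>lborel) \<partial>lborel)"
    by (rule lborel_pair.Fubini') measurable
  also have "\<dots> = (\<integral>\<^sup>+ u. (\<integral>\<^sup>+ v. k u * k v * indicator {u<..} v \<partial>lborel) \<partial>lborel)"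
    by (intro nn_integral_cong) (auto simp: mult_ac split: split_indicator)
  finally show ?thesis by (simp add: mult_2)
qed

context jump_diffusion begin

definition occ :: "real \<Rightarrow> real \<Rightarrow> (real \<Rightarrow> ennreal) \<Rightarrow> 'a \<Rightarrow> ennreal" where
  "occ q d g w = (\<integral>\<^sup>+ u. g (free_path q (max 0 u) w) * indicator {0<..<d} u \<partial>lborel)"

definition near_const :: real where "near_const = heat_const * exp (- 9 / \<sigma>\<^sup>2)"

text \<open>The Paley--Zygmund constant m^2/(4 v) for the moments of \<open>occ\<close>, where m =
  sqrt d/2 * \<open>near_const\<close> * I and v = 8 * \<open>heat_const\<close>^2 * d * I^2, with I
  the integral of g. Both d and I cancel, so one lower bound serves all scales and all truncations
  of \<Lambda>.\<close>

definition hit_const :: real where "hit_const = near_const\<^sup>2 / (128 * heat_const\<^sup>2)"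

lemma near_const_pos: "0 < near_const"
  using heat_const_pos by (simp add: near_const_def)

context
  fixes q d :: real and A :: "'a set" and g :: "real \<Rightarrow> ennreal"
  assumes q: "0 \<le> q" and d: "0 < d" "\<bar>\<mu>\<bar> * sqrt d \<le> 1"
    and A: "A \<in> sets (F q)" and Aq: "\<And>w. w \<in> A \<Longrightarrow> \<bar>X q w\<bar> \<le> sqrt d"
    and g [measurable]: "g \<in> borel_measurable borel" and supp: "\<And>x. sqrt d < \<bar>x\<bar> \<Longrightarrow> g x = 0"
begin

lemma A_events [measurable]: "A \<in> sets M"
  using A sets_F by auto

lemma free_path_measurable_pair [measurable]:
  "(\<lambda>z. free_path q (max 0 (fst z)) (snd z)) \<in> borel_measurable (borel \<Otimes>\<^sub>M M)"
  by (rule measurable_free_path[OF q])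

lemma free_path_measurable_comp [measurable (raw)]:
  "f \<in> borel_measurable K \<Longrightarrow> h \<in> measurable K M \<Longrightarrow> (\<lambda>x. free_path q (max 0 (f x)) (h x)) \<in> borel_measurable K"
  using measurable_compose[OF measurable_Pair measurable_free_path[OF q]] by simp

lemma measurable_occ [measurable]: "occ q d g \<in> borel_measurable M"
  unfolding occ_def by measurable

text \<open>Only the times in (d/2, d) are used, where the kernel is at least
  \<open>near_const / sqrt d\<close>; they have total length d/2.\<close>

lemma first_moment:
  "ennreal (sqrt d / 2 * near_const) * (\<integral>\<^sup>+ y. g y \<partial>lborel) * emeasure M A \<le> (\<integral>\<^sup>+ w. indicator A w * occ q d g w \<partial>M)"
proof -
  interpret P: pair_sigma_finite lborel M ..
  have step: "ennreal (near_const / sqrt d) * (\<integral>\<^sup>+ y. g y \<partial>lborel) * emeasure M A \<le> (\<integral>\<^sup>+ w. indicator A w * g (free_path q u w) \<partial>M)"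
    if u: "d / 2 < u" "u < d" for u
  proof -
    have u0: "0 < u" using u d by simp
    have "ennreal (near_const / sqrt d) * (\<integral>\<^sup>+ y. g y \<partial>lborel) * emeasure M A =
       (\<integral>\<^sup>+ w. indicator A w * (\<integral>\<^sup>+ y. g y * ennreal (near_const / sqrt d) \<partial>lborel) \<partial>M)"
      by (simp add: nn_integral_multc mult_ac)
    also have "\<dots> \<le> (\<integral>\<^sup>+ w. indicator A w * (\<integral>\<^sup>+ y. g y * ennreal (normal_density (free_path q 0 w + \<mu> * (u - 0)) (\<sigma> * sqrt (u - 0)) y) \<partial>lborel) \<partial>M)"
    proof (intro nn_integral_mono)
      fix w
      have "w \<in> A \<Longrightarrow> (\<integral>\<^sup>+ y. g y * ennreal (near_const / sqrt d) \<partial>lborel) \<le>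
        (\<integral>\<^sup>+ y. g y * ennreal (normal_density (free_path q 0 w + \<mu> * (u - 0)) (\<sigma> * sqrt (u - 0)) y) \<partial>lborel)"
      proof (rule nn_integral_mono)
        fix y assume w: "w \<in> A"
        show "g y * ennreal (near_const / sqrt d) \<le> g y * ennreal (normal_density (free_path q 0 w + \<mu> * (u - 0)) (\<sigma> * sqrt (u - 0)) y)"
        proof (cases "\<bar>y\<bar> \<le> sqrt d")
          case True
          then show ?thesis using normal_density_lower[OF d u Aq[OF w] True]
            by (intro mult_left_mono ennreal_leI) (auto simp: free_path_def near_const_def)
        qed (simp add: supp)
      qed
      then show "indicator A w * (\<integral>\<^sup>+ y. g y * ennreal (near_const / sqrt d) \<partial>lborel) \<le>
        indicator A w * (\<integral>\<^sup>+ y. g y * ennreal (normal_density (free_path q 0 w + \<mu> * (u - 0)) (\<sigma> * sqrt (u - 0)) y) \<partial>lborel)"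
        by (auto split: split_indicator)
    qed
    also have "\<dots> = (\<integral>\<^sup>+ w. indicator A w * g (free_path q u w) \<partial>M)"
      by (rule free_path_step[OF q _ u0 _ g, symmetric]) (use A in auto)
    finally show ?thesis .
  qed
  have "ennreal (sqrt d / 2 * near_const) * (\<integral>\<^sup>+ y. g y \<partial>lborel) * emeasure M A =
    (\<integral>\<^sup>+ u. ennreal (near_const / sqrt d) * (\<integral>\<^sup>+ y. g y \<partial>lborel) * emeasure M A * indicator {d/2<..<d} u \<partial>lborel)"
  proof -
    have "near_const / sqrt d * (d / 2) = sqrt d / 2 * near_const"
      using d by (simp add: field_simps real_sqrt_mult[symmetric])
    then have "ennreal (near_const / sqrt d) * ennreal (d / 2) = ennreal (sqrt d / 2 * near_const)"
      using d near_const_pos by (subst ennreal_mult[symmetric]) auto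
    then show ?thesis using d by (simp add: nn_integral_cmult mult_ac)
  qed
  also have "\<dots> \<le> (\<integral>\<^sup>+ u. (\<integral>\<^sup>+ w. indicator A w * (g (free_path q (max 0 u) w) * indicator {0<..<d} u) \<partial>M) \<partial>lborel)"
    using step d by (intro nn_integral_mono) (auto split: split_indicator simp: max_def)
  also have "\<dots> = (\<integral>\<^sup>+ w. (\<integral>\<^sup>+ u. indicator A w * (g (free_path q (max 0 u) w) * indicator {0<..<d} u) \<partial>lborel) \<partial>M)"
    by (rule P.Fubini'[symmetric]) measurable
  also have "\<dots> = (\<integral>\<^sup>+ w. indicator A w * occ q d g w \<partial>M)"
    unfolding occ_def by (intro nn_integral_cong nn_integral_cmult) measurable
  finally show ?thesis .
qed

text \<open>For u < v the kernel bound is applied at \<open>v\<close> given the past of q + u, then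
  at \<open>u\<close> given the past of \<open>q\<close>. The two time integrals give 2 sqrt d each,
  and the restriction to u < v gives the remaining factor 2 in 8 d.\<close>

lemma second_moment:
  assumes I: "(\<integral>\<^sup>+ y. g y \<partial>lborel) = ennreal I" "0 \<le> I"
  shows "(\<integral>\<^sup>+ w. indicator A w * (occ q d g w * occ q d g w) \<partial>M) \<le> ennreal (8 * heat_const\<^sup>2 * d * I\<^sup>2) * emeasure M A"
proof -
  interpret P: pair_sigma_finite lborel M ..
  let ?k = "\<lambda>w u. g (free_path q (max 0 u) w) * indicator {0<..<d} u"
  have pair: "(\<integral>\<^sup>+ w. indicator A w * (?k w u * ?k w v * indicator {u<..} v) \<partial>M) \<le>
     emeasure M A * ennreal (I\<^sup>2 * heat_const\<^sup>2) * (ennreal (1 / sqrt (u - 0)) * indicator {0<..<0 + d} u) * (ennreal (1 / sqrt (v - u)) * indicator {u<..<u + d} v)" for u v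
  proof (cases "0 < u \<and> u < v \<and> v < d")
    case True
    then have u: "0 \<le> u" "0 < u" "u < v" "v < d" "u < d" by auto
    note [measurable] = measurable_free_path_F[OF q u(1)]
    have [measurable]: "A \<in> sets (F (q + u))" using A F_mono[of q "q + u"] u by auto
    have "(\<integral>\<^sup>+ w. indicator A w * (?k w u * ?k w v * indicator {u<..} v) \<partial>M) =
       (\<integral>\<^sup>+ w. (indicator A w * g (free_path q u w)) * g (free_path q v w) \<partial>M)"
      using u by (simp add: mult_ac max_def)
    also have "\<dots> \<le> (\<integral>\<^sup>+ w. indicator A w * g (free_path q u w) \<partial>M) * (ennreal I * ennreal (heat_const * (1 / sqrt (v - u))))"
      unfolding I(1)[symmetric] by (rule free_path_upper[OF q u(1,3) _ g]) measurable
    also have "\<dots> \<le> (\<integral>\<^sup>+ w. indicator A w \<partial>M) * (ennreal I * ennreal (heat_const * (1 / sqrt (u - 0)))) * (ennreal I * ennreal (heat_const * (1 / sqrt (v - u))))"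
      unfolding I(1)[symmetric] by (intro mult_right_mono free_path_upper[OF q _ u(2) _ g]) (use A in auto)
    also have "\<dots> = emeasure M A * ennreal (I\<^sup>2 * heat_const\<^sup>2) * ennreal (1 / sqrt (u - 0)) * ennreal (1 / sqrt (v - u))"
      using I u heat_const_pos by (simp add: ennreal_mult power2_eq_square mult_ac divide_inverse)
    finally show ?thesis using u by simp
  qed (auto split: split_indicator)
  have "(\<integral>\<^sup>+ w. indicator A w * (occ q d g w * occ q d g w) \<partial>M) =
    (\<integral>\<^sup>+ w. indicator A w * (2 * (\<integral>\<^sup>+ u. (\<integral>\<^sup>+ v. ?k w u * ?k w v * indicator {u<..} v \<partial>lborel) \<partial>lborel)) \<partial>M)"
    unfolding occ_def by (intro nn_integral_cong, subst nn_integral_square) auto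
  also have "\<dots> = (\<integral>\<^sup>+ w. 2 * (\<integral>\<^sup>+ u. (\<integral>\<^sup>+ v. indicator A w * (?k w u * ?k w v * indicator {u<..} v) \<partial>lborel) \<partial>lborel) \<partial>M)"
    by (intro nn_integral_cong) (auto split: split_indicator)
  also have "\<dots> = 2 * (\<integral>\<^sup>+ w. (\<integral>\<^sup>+ u. (\<integral>\<^sup>+ v. indicator A w * (?k w u * ?k w v * indicator {u<..} v) \<partial>lborel) \<partial>lborel) \<partial>M)"
    by (rule nn_integral_cmult) (simp add: indicator_def, measurable)
  finally have eq: "(\<integral>\<^sup>+ w. indicator A w * (occ q d g w * occ q d g w) \<partial>M) =
    2 * (\<integral>\<^sup>+ w. (\<integral>\<^sup>+ u. (\<integral>\<^sup>+ v. indicator A w * (?k w u * ?k w v * indicator {u<..} v) \<partial>lborel) \<partial>lborel) \<partial>M)" .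
  have "(\<integral>\<^sup>+ w. (\<integral>\<^sup>+ u. (\<integral>\<^sup>+ v. indicator A w * (?k w u * ?k w v * indicator {u<..} v) \<partial>lborel) \<partial>lborel) \<partial>M) =
    (\<integral>\<^sup>+ u. (\<integral>\<^sup>+ w. (\<integral>\<^sup>+ v. indicator A w * (?k w u * ?k w v * indicator {u<..} v) \<partial>lborel) \<partial>M) \<partial>lborel)"
    by (rule P.Fubini') (simp add: indicator_def, measurable)
  also have "\<dots> = (\<integral>\<^sup>+ u. (\<integral>\<^sup>+ v. (\<integral>\<^sup>+ w. indicator A w * (?k w u * ?k w v * indicator {u<..} v) \<partial>M) \<partial>lborel) \<partial>lborel)"
    by (intro nn_integral_cong P.Fubini') measurable
  also have "\<dots> \<le> (\<integral>\<^sup>+ u. (\<integral>\<^sup>+ v. emeasure M A * ennreal (I\<^sup>2 * heat_const\<^sup>2) * (ennreal (1 / sqrt (u - 0)) * indicator {0<..<0 + d} u) * (ennreal (1 / sqrt (v - u)) * indicator {u<..<u + d} v) \<partial>lborel) \<partial>lborel)"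
    by (intro nn_integral_mono pair)
  also have "\<dots> = emeasure M A * ennreal (I\<^sup>2 * heat_const\<^sup>2) * ennreal (2 * sqrt d) * ennreal (2 * sqrt d)"
  proof -
    define C where "C = emeasure M A * ennreal (I\<^sup>2 * heat_const\<^sup>2)"
    define b where "b u v = ennreal (1 / sqrt (v - u)) * indicator {u<..<u + d} v" for u v :: real
    have [measurable]: "b u \<in> borel_measurable borel" for u unfolding b_def by measurable
    have bi: "(\<integral>\<^sup>+ v. b u v \<partial>lborel) = ennreal (2 * sqrt d)" for u
      unfolding b_def by (rule nn_integral_inverse_sqrt[OF d(1)])
    have "(\<integral>\<^sup>+ u. (\<integral>\<^sup>+ v. C * b 0 u * b u v \<partial>lborel) \<partial>lborel) = (\<integral>\<^sup>+ u. C * b 0 u * ennreal (2 * sqrt d) \<partial>lborel)"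
      by (intro nn_integral_cong trans[OF nn_integral_cmult]) (simp_all add: bi)
    also have "\<dots> = (\<integral>\<^sup>+ u. C * b 0 u \<partial>lborel) * ennreal (2 * sqrt d)" by (rule nn_integral_multc) simp
    also have "(\<integral>\<^sup>+ u. C * b 0 u \<partial>lborel) = C * ennreal (2 * sqrt d)"
      by (rule trans[OF nn_integral_cmult]) (simp_all add: bi)
    finally show ?thesis unfolding b_def C_def .
  qed
  finally have "(\<integral>\<^sup>+ w. indicator A w * (occ q d g w * occ q d g w) \<partial>M) \<le>
    2 * (emeasure M A * ennreal (I\<^sup>2 * heat_const\<^sup>2) * ennreal (2 * sqrt d) * ennreal (2 * sqrt d))"
    unfolding eq by (rule mult_left_mono) simp
  also have "\<dots> = ennreal (8 * heat_const\<^sup>2 * d * I\<^sup>2) * emeasure M A"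
  proof -
    define B C where "B = 2 * sqrt d" and "C = I\<^sup>2 * heat_const\<^sup>2"
    have BC: "0 \<le> B" "0 \<le> C" using d by (auto simp: B_def C_def)
    have e: "8 * heat_const\<^sup>2 * d * I\<^sup>2 = 2 * (C * (B * B))" using d by (simp add: B_def C_def)
    show ?thesis using BC unfolding B_def[symmetric] C_def[symmetric] e
      by (simp add: ennreal_mult mult_ac)
  qed
  finally show ?thesis .
qed

lemma prob_occ_large:
  assumes I: "(\<integral>\<^sup>+ y. g y \<partial>lborel) = ennreal I" "0 < I"
  shows "hit_const * prob A \<le> prob (A \<inter> {w \<in> space M. ennreal (sqrt d / 4 * near_const * I) < occ q d g w})"
proof -
  have "(sqrt d / 2 * near_const * I)\<^sup>2 / (4 * (8 * heat_const\<^sup>2 * d * I\<^sup>2)) * prob A \<le>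
    prob (A \<inter> {w \<in> space M. ennreal (sqrt d / 2 * near_const * I / 2) < occ q d g w})"
  proof (rule second_moment_lower_bound)
    show "0 < sqrt d / 2 * near_const * I" "0 < 8 * heat_const\<^sup>2 * d * I\<^sup>2" using d I near_const_pos heat_const_pos by auto
    show "ennreal (sqrt d / 2 * near_const * I) * emeasure M A \<le> (\<integral>\<^sup>+ w. indicator A w * occ q d g w \<partial>M)"
    proof -
      have "ennreal (sqrt d / 2 * near_const * I) = ennreal (sqrt d / 2 * near_const) * ennreal I"
        using d I near_const_pos by (intro ennreal_mult) auto
      then show ?thesis using first_moment unfolding I(1) by simp
    qed
    show "(\<integral>\<^sup>+ w. indicator A w * (occ q d g w * occ q d g w) \<partial>M) \<le> ennreal (8 * heat_const\<^sup>2 * d * I\<^sup>2) * emeasure M A"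
      using second_moment I by simp
  qed measurable
  moreover have "(sqrt d / 2 * near_const * I)\<^sup>2 / (4 * (8 * heat_const\<^sup>2 * d * I\<^sup>2)) = hit_const"
    using d I heat_const_pos by (simp add: hit_const_def power_mult_distrib power_divide field_simps)
  moreover have "sqrt d / 2 * near_const * I / 2 = sqrt d / 4 * near_const * I" by simp
  ultimately show ?thesis by (simp only:)
qed

end

lemma hit_const_pos: "0 < hit_const"
  using near_const_pos heat_const_pos by (simp add: hit_const_def)

context
  fixes q d :: real and A :: "'a set"
  assumes q: "0 \<le> q" and d: "0 < d" "\<bar>\<mu>\<bar> * sqrt d \<le> 1"
    and A: "A \<in> sets (F q)" and Aq: "\<And>w. w \<in> A \<Longrightarrow> \<bar>X q w\<bar> \<le> sqrt d"
    and infinite: "(\<integral>\<^sup>+ x. \<Lambda> x * indicator {- sqrt d..sqrt d} x \<partial>lborel) = \<infinity>"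
begin

text \<open>Truncate \<Lambda> at the level n. Its integral over the window grows without bound, and
  so does the threshold in \<open>prob_occ_large\<close>, while the lower bound for the probability
  stays the same.\<close>

lemma prob_occ_infinite:
  "hit_const * prob A \<le> prob (A \<inter> {w \<in> space M. occ q d \<Lambda> w = \<infinity>})"
proof -
  note [measurable] = measurable_free_path[OF q]
  have [measurable]: "A \<in> sets M" using A sets_F by auto
  have om [measurable]: "occ q d \<Lambda> \<in> borel_measurable M"
  proof -
    have "(\<lambda>z. \<Lambda> (free_path q (max 0 (snd z)) (fst z)) * indicator {0<..<d} (snd z)) \<in> borel_measurable (M \<Otimes>\<^sub>M lborel)"
      using measurable_compose[OF measurable_Pair[OF measurable_snd measurable_fst] measurable_free_path[OF q]]
      by simp
    then show ?thesis unfolding occ_def by (intro lborel.borel_measurable_nn_integral) (simp add: split_beta')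
  qed
  define g where "g n x = min (\<Lambda> x) (of_nat n) * indicator {- sqrt d..sqrt d} x" for n x
  have gm [measurable]: "g n \<in> borel_measurable borel" for n unfolding g_def by measurable
  have fin: "(\<integral>\<^sup>+ x. g n x \<partial>lborel) < \<infinity>" for n
  proof -
    have "(\<integral>\<^sup>+ x. g n x \<partial>lborel) \<le> (\<integral>\<^sup>+ x. of_nat n * indicator {- sqrt d..sqrt d} x \<partial>lborel)"
      unfolding g_def by (intro nn_integral_mono mult_right_mono) auto
    also have "\<dots> < \<infinity>" using d by (simp add: nn_integral_cmult ennreal_mult_less_top of_nat_less_top)
    finally show ?thesis .
  qed
  have lim: "(SUP n. (\<integral>\<^sup>+ x. g n x \<partial>lborel)) = \<infinity>"
  proof -
    have "(\<integral>\<^sup>+ x. \<Lambda> x * indicator {- sqrt d..sqrt d} x \<partial>lborel) = (\<integral>\<^sup>+ x. (SUP n. g n x) \<partial>lborel)"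
    proof (rule nn_integral_cong)
      fix x
      have "(SUP n. min (\<Lambda> x) (of_nat n)) = \<Lambda> x"
      proof (cases "\<Lambda> x = \<infinity>")
        case True
        then show ?thesis by (simp add: ennreal_SUP_of_nat_eq_top min_def top_unique)
      next
        case False
        then obtain n where n: "\<Lambda> x \<le> of_nat n"
          using ennreal_Ex_less_of_nat[of "\<Lambda> x"] by (auto simp: less_top intro: less_imp_le)
        show ?thesis
        proof (rule antisym)
          show "\<Lambda> x \<le> (SUP n. min (\<Lambda> x) (of_nat n))" by (rule SUP_upper2[of n]) (use n in auto)
        qed (auto intro: SUP_least)
      qed
      then show "\<Lambda> x * indicator {- sqrt d..sqrt d} x = (SUP n. g n x)"
        unfolding g_def by (simp add: SUP_mult_right_ennreal[symmetric])
    qed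
    also have "\<dots> = (SUP n. (\<integral>\<^sup>+ x. g n x \<partial>lborel))"
      by (intro nn_integral_monotone_convergence_SUP incseq_SucI)
        (auto simp: le_fun_def g_def intro!: mult_right_mono min.mono)
    finally show ?thesis using infinite by simp
  qed
  have K: "hit_const * prob A \<le> prob (A \<inter> {w \<in> space M. of_nat K < occ q d \<Lambda> w})" for K :: nat
  proof -
    \<comment> \<open>An integral I above \<open>L\<close> puts the threshold sqrt d/4 *
      \<open>near_const\<close> * I above K + 1.\<close>
    define L where "L = (real K + 1) / (sqrt d / 4 * near_const)"
    have L: "0 < L" using d near_const_pos by (auto simp: L_def)
    have "ennreal L < (SUP n. (\<integral>\<^sup>+ x. g n x \<partial>lborel))" unfolding lim by simp
    then obtain n where n: "ennreal L < (\<integral>\<^sup>+ x. g n x \<partial>lborel)" by (auto simp: less_SUP_iff)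
    obtain I where I: "(\<integral>\<^sup>+ x. g n x \<partial>lborel) = ennreal I" "0 \<le> I" using fin[of n] by (cases "\<integral>\<^sup>+ x. g n x \<partial>lborel") auto
    have LI: "L < I" using n I L by (simp add: ennreal_less_iff)
    have "hit_const * prob A \<le> prob (A \<inter> {w \<in> space M. ennreal (sqrt d / 4 * near_const * I) < occ q d (g n) w})"
      by (rule prob_occ_large[OF q d A Aq gm _ I(1)]) (use L LI in \<open>auto simp: g_def indicator_def\<close>)
    also have "\<dots> \<le> prob (A \<inter> {w \<in> space M. of_nat K < occ q d \<Lambda> w})"
    proof (rule finite_measure_mono)
      show "A \<inter> {w \<in> space M. ennreal (sqrt d / 4 * near_const * I) < occ q d (g n) w} \<subseteq> A \<inter> {w \<in> space M. of_nat K < occ q d \<Lambda> w}"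
      proof (intro Int_mono order_refl Collect_mono impI, elim conjE, intro conjI)
        fix w assume "ennreal (sqrt d / 4 * near_const * I) < occ q d (g n) w"
        moreover have "occ q d (g n) w \<le> occ q d \<Lambda> w"
          unfolding occ_def g_def by (intro nn_integral_mono mult_right_mono) (auto split: split_indicator)
        moreover have "of_nat K \<le> ennreal (sqrt d / 4 * near_const * I)"
        proof -
          have p: "0 < sqrt d / 4 * near_const" using d near_const_pos by simp
          have "real K + 1 = sqrt d / 4 * near_const * L" using d near_const_pos by (simp add: L_def)
          also have "\<dots> \<le> sqrt d / 4 * near_const * I" using LI p by (intro mult_left_mono) auto
          finally show ?thesis unfolding ennreal_of_nat_eq_real_of_nat by (intro ennreal_leI) simp
        qed
        ultimately show "of_nat K < occ q d \<Lambda> w" by simp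
      qed
    qed measurable
    finally show ?thesis .
  qed
  have "(\<lambda>K. prob (A \<inter> {w \<in> space M. of_nat K < occ q d \<Lambda> w})) \<longlonglongrightarrow> prob (\<Inter>K. A \<inter> {w \<in> space M. of_nat K < occ q d \<Lambda> w})"
  proof (rule finite_Lim_measure_decseq)
    show "decseq (\<lambda>K. A \<inter> {w \<in> space M. of_nat K < occ q d \<Lambda> w})"
      by (rule decseq_SucI) (auto intro: order.strict_trans1[rotated] intro!: of_nat_mono)
  qed auto
  then have "hit_const * prob A \<le> prob (\<Inter>K. A \<inter> {w \<in> space M. of_nat K < occ q d \<Lambda> w})"
    by (rule tendsto_lowerbound) (use K in \<open>auto intro: always_eventually\<close>)
  also have "(\<Inter>K. A \<inter> {w \<in> space M. of_nat K < occ q d \<Lambda> w}) = A \<inter> {w \<in> space M. occ q d \<Lambda> w = \<infinity>}"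
  proof (intro equalityI subsetI)
    fix w assume w: "w \<in> (\<Inter>K. A \<inter> {w \<in> space M. of_nat K < occ q d \<Lambda> w})"
    have "occ q d \<Lambda> w = \<infinity>"
    proof (rule ccontr)
      assume "occ q d \<Lambda> w \<noteq> \<infinity>"
      then obtain K :: nat where "occ q d \<Lambda> w < of_nat K" using ennreal_Ex_less_of_nat[of "occ q d \<Lambda> w"] by (auto simp: less_top)
      moreover have "of_nat K < occ q d \<Lambda> w" using w by auto
      ultimately show False by simp
    qed
    then show "w \<in> A \<inter> {w \<in> space M. occ q d \<Lambda> w = \<infinity>}" using w by auto
  qed (auto simp: of_nat_less_top)
  finally show ?thesis .
qed

text \<open>Without a jump in (q, q + d] the path is the jump-free one, along which the integral of
  \<Lambda> is infinite with conditional probability at least \<open>hit_const\<close> given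
  \<open>A\<close>. Hypothesis (ii) excludes that, so a jump must occur.\<close>

lemma prob_jump_after_near_0:
  "hit_const * prob A \<le> prob (A \<inter> {w \<in> space M. count q w \<noteq> count (q + d) w})"
proof -
  have qd: "0 \<le> q + d" using q d by simp
  have [measurable]: "A \<in> sets M" using A sets_F by auto
  note [measurable] = measurable_nat_eq[OF measurable_count[OF q] measurable_count[OF qd]]
  have "AE w in M. (\<integral>\<^sup>+ t\<in>{q..q+d}. \<Lambda> (X t w) \<partial>lborel) < \<infinity>"
    using q d by (intro \<Lambda>_finite) auto
  then have "AE w in M. w \<in> A \<inter> {w \<in> space M. occ q d \<Lambda> w = \<infinity>} \<longrightarrow> w \<in> A \<inter> {w \<in> space M. count q w \<noteq> count (q + d) w}"
  proof eventually_elim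
    case (elim w)
    show ?case
    proof (intro impI)
      assume w: "w \<in> A \<inter> {w \<in> space M. occ q d \<Lambda> w = \<infinity>}"
      have "count q w \<noteq> count (q + d) w"
      proof
        assume "count q w = count (q + d) w"
        then have nj: "N w \<inter> {q<..q + d} = {}" using count_eq_iff[of w q "q + d"] w q d by auto
        have "occ q d \<Lambda> w = (\<integral>\<^sup>+ u. \<Lambda> (X (q + u) w) * indicator {0<..<d} u \<partial>lborel)"
          unfolding occ_def
        proof (rule nn_integral_cong)
          fix u
          show "\<Lambda> (free_path q (max 0 u) w) * indicator {0<..<d} u = \<Lambda> (X (q + u) w) * indicator {0<..<d} u"
          proof (cases "0 < u \<and> u < d")
            case True
            then have "N w \<inter> {q<..q + u} = {}" using nj by auto
            then have "X (q + u) w = free_path q u w"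
              using X_increment[of w q "q + u"] w q True by (simp add: free_path_def)
            then show ?thesis using True by (simp add: max_def)
          qed auto
        qed
        also have "\<dots> = (\<integral>\<^sup>+ t. \<Lambda> (X (max 0 t) w) * indicator {q<..<q + d} t \<partial>lborel)"
        proof -
          have "(\<lambda>t. X (max 0 t) w) \<in> borel_measurable borel"
            using w measurable_compose[OF measurable_Pair[OF measurable_ident_sets[OF refl] measurable_const] measurable_pair_X] by auto
          then show ?thesis using q
            by (subst nn_integral_real_affine[where c = 1 and t = q, of "\<lambda>t. \<Lambda> (X (max 0 t) w) * indicator {q<..<q + d} t"])
              (auto intro!: nn_integral_cong split: split_indicator simp: max_def)
        qed
        also have "\<dots> \<le> (\<integral>\<^sup>+ t\<in>{q..q+d}. \<Lambda> (X t w) \<partial>lborel)"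
          using q by (intro nn_integral_mono) (auto split: split_indicator simp: max_def)
        finally show False using elim w by simp
      qed
      then show "w \<in> A \<inter> {w \<in> space M. count q w \<noteq> count (q + d) w}" using w by auto
    qed
  qed
  then have "prob (A \<inter> {w \<in> space M. occ q d \<Lambda> w = \<infinity>}) \<le> prob (A \<inter> {w \<in> space M. count q w \<noteq> count (q + d) w})"
    by (rule finite_measure_mono_AE) measurable
  then show ?thesis using prob_occ_infinite by simp
qed

end

text \<open>The events that a given time is the first of \<open>Q\<close> with |X| \<le> sqrt d are
  disjoint and known at that time, so the estimate for a single time adds up. This takes the place
  of the strong Markov property at a hitting time.\<close>

lemma prob_union_near_0:
  assumes d: "0 < d" "\<bar>\<mu>\<bar> * sqrt d \<le> 1"
    and infinite: "(\<integral>\<^sup>+ x. \<Lambda> x * indicator {- sqrt d..sqrt d} x \<partial>lborel) = \<infinity>"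
    and Q: "finite Q" "Q \<subseteq> {0..}"
  shows "hit_const * prob (\<Union>q\<in>Q. {w \<in> space M. \<bar>X q w\<bar> \<le> sqrt d}) \<le>
    prob (\<Union>q\<in>Q. {w \<in> space M. \<bar>X q w\<bar> \<le> sqrt d \<and> count q w \<noteq> count (q + d) w})"
  using Q
proof (induction Q rule: finite_linorder_max_induct)
  case empty
  then show ?case by simp
next
  case (insert b Q)
  define H where "H q = {w \<in> space M. \<bar>X q w\<bar> \<le> sqrt d}" for q
  define J where "J q = {w \<in> space M. count q w \<noteq> count (q + d) w}" for q
  have b: "0 \<le> b" and Q0: "\<And>q. q \<in> Q \<Longrightarrow> 0 \<le> q" using insert by auto
  have HF: "H q \<in> sets (F b)" if "q \<in> insert b Q" for q
  proof -
    have "0 \<le> q" "q \<le> b" using that insert by (auto intro: less_imp_le)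
    then have [measurable]: "X q \<in> borel_measurable (F b)" by (intro F_measurable_mono[OF X_adapted]) auto
    have "{w \<in> space (F b). \<bar>X q w\<bar> \<le> sqrt d} \<in> sets (F b)" by measurable
    then show ?thesis by (simp add: H_def space_F)
  qed
  have Jm: "J q \<in> sets M" if "q \<in> insert b Q" for q
  proof -
    have "0 \<le> q" "0 \<le> q + d" using that b Q0 d by auto
    note [measurable] = measurable_nat_eq[OF measurable_count[OF this(1)] measurable_count[OF this(2)]]
    show ?thesis unfolding J_def by measurable
  qed
  have Hm: "H q \<in> sets M" if "q \<in> insert b Q" for q using HF[OF that] sets_F by auto
  define A where "A = H b - (\<Union>q\<in>Q. H q)"
  have A: "A \<in> sets (F b)" unfolding A_def using HF insert(1) by (intro sets.Diff sets.finite_UN) auto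
  have Am: "A \<in> sets M" using A sets_F by auto
  have Um: "(\<Union>q\<in>Q. H q) \<in> sets M" "(\<Union>q\<in>Q. H q \<inter> J q) \<in> sets M"
    using Hm Jm insert(1) by (auto intro!: sets.finite_UN)
  have step: "hit_const * prob A \<le> prob (A \<inter> J b)"
    unfolding J_def by (rule prob_jump_after_near_0[OF b d A _ infinite]) (auto simp: A_def H_def)
  have "prob (\<Union>q\<in>insert b Q. H q) = prob ((\<Union>q\<in>Q. H q) \<union> A)"
    by (rule arg_cong[where f = prob]) (auto simp: A_def)
  also have "\<dots> = prob (\<Union>q\<in>Q. H q) + prob A"
    using Um Am by (intro finite_measure_Union) (auto simp: A_def)
  finally have "hit_const * prob (\<Union>q\<in>insert b Q. H q) = hit_const * prob (\<Union>q\<in>Q. H q) + hit_const * prob A"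
    by (simp add: algebra_simps)
  also have "\<dots> \<le> prob (\<Union>q\<in>Q. H q \<inter> J q) + prob (A \<inter> J b)"
  proof (rule add_mono[OF _ step])
    have "H q \<inter> J q = {w \<in> space M. \<bar>X q w\<bar> \<le> sqrt d \<and> count q w \<noteq> count (q + d) w}" for q
      by (auto simp: H_def J_def)
    then show "hit_const * prob (\<Union>q\<in>Q. H q) \<le> prob (\<Union>q\<in>Q. H q \<inter> J q)"
      using insert(3,4) by (simp add: H_def)
  qed
  also have "\<dots> = prob ((\<Union>q\<in>Q. H q \<inter> J q) \<union> (A \<inter> J b))"
    using Um Am Jm[of b] by (intro finite_measure_Union[symmetric]) (auto simp: A_def)
  also have "\<dots> \<le> prob (\<Union>q\<in>insert b Q. H q \<inter> J q)"
    using Um Hm[of b] Jm[of b] by (intro finite_measure_mono) (auto simp: A_def)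
  also have "(\<Union>q\<in>insert b Q. H q \<inter> J q) = (\<Union>q\<in>insert b Q. {w \<in> space M. \<bar>X q w\<bar> \<le> sqrt d \<and> count q w \<noteq> count (q + d) w})"
    by (auto simp: H_def J_def)
  finally show ?case by (simp only: H_def)
qed

text \<open>A jump moves X toward 0 without changing its sign. If the path kept distance
  \<open>r\<close> from 0, its sign would be \<open>s\<close> throughout [0, 1], every jump would
  subtract a nonnegative amount from s X, and s X(1) would lie below the endpoint without jumps,
  which is negative.\<close>

lemma path_reaches_0:
  assumes w: "w \<in> space M" and s: "s = 1 \<or> s = (-1 :: real)" and start: "0 \<le> s * x0"
    and fin: "s * (x0 + \<mu> + \<sigma> * W 1 w) < 0" and r: "0 < r"
  shows "\<exists>t\<in>{0..1}. \<bar>X t w\<bar> < r"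
proof (rule ccontr)
  assume "\<not> ?thesis"
  then have away: "r \<le> \<bar>X t w\<bar>" if "0 \<le> t" "t \<le> 1" for t using that by force
  have abs_s: "\<bar>s * y\<bar> = \<bar>y\<bar>" for y using s by auto
  have pos: "0 < s * X t w" if t: "0 \<le> t" "t \<le> 1" for t
  proof (rule ccontr)
    define B where "B = {t. 0 \<le> t \<and> t \<le> 1 \<and> s * X t w \<le> 0}"
    assume "\<not> 0 < s * X t w"
    then have B: "t \<in> B" using t by (auto simp: B_def)
    \<comment> \<open>The first time with s X \<le> 0. As X avoids a neighbourhood of 0, the value
      there is negative, but neither continuous motion nor a contraction by 1/\<theta> leads to it
      from a left limit with s X(\<tau>-) \<ge> 0.\<close>
    define \<tau> where "\<tau> = Inf B"
    have bdd: "bdd_below B" by (rule bdd_belowI[of _ 0]) (auto simp: B_def)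
    have "\<tau> \<le> t" unfolding \<tau>_def by (rule cInf_lower[OF B bdd])
    moreover have "0 \<le> \<tau>" unfolding \<tau>_def by (rule cInf_greatest) (use B in \<open>auto simp: B_def\<close>)
    ultimately have \<tau>: "0 \<le> \<tau>" "\<tau> \<le> 1" using t by auto
    have before: "0 < s * X u w" if u: "0 \<le> u" "u < \<tau>" for u
    proof (rule ccontr)
      assume "\<not> 0 < s * X u w"
      then have "u \<in> B" using u \<tau> by (simp add: B_def)
      then have "\<tau> \<le> u" unfolding \<tau>_def by (rule cInf_lower[OF _ bdd])
      then show False using u by simp
    qed
    have at: "s * X \<tau> w \<le> 0"
    proof (rule ccontr)
      assume a: "\<not> ?thesis"
      have "((\<lambda>u. s * X u w) \<longlongrightarrow> s * X \<tau> w) (at_right \<tau>)"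
        by (intro tendsto_mult tendsto_const X_at_right w \<tau>)
      then have "eventually (\<lambda>u. 0 < s * X u w) (at_right \<tau>)" by (rule order_tendstoD(1)) (use a in auto)
      then obtain b where b: "\<tau> < b" "\<And>u. \<tau> < u \<Longrightarrow> u < b \<Longrightarrow> 0 < s * X u w"
        by (auto simp: eventually_at_right_field)
      have "b \<le> Inf B"
      proof (rule cInf_greatest)
        show "B \<noteq> {}" using B by auto
        fix u assume u: "u \<in> B"
        then have "\<tau> \<le> u" using cInf_lower[OF u bdd] by (simp add: \<tau>_def)
        moreover have "u \<noteq> \<tau>" using u a by (auto simp: B_def)
        ultimately have "\<tau> < u" by simp
        show "b \<le> u"
        proof (rule ccontr)
          assume "\<not> b \<le> u"
          then have "0 < s * X u w" using b(2)[OF \<open>\<tau> < u\<close>] by simp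
          then show False using u by (simp add: B_def)
        qed
      qed
      then show False using b(1) by (simp add: \<tau>_def)
    qed
    have neg: "s * X \<tau> w < 0" using at away[OF \<tau>] abs_s[of "X \<tau> w"] r by linarith
    then have \<tau>0: "0 < \<tau>" using X_0[OF w] start \<tau> by (cases "\<tau> = 0") auto
    have "((\<lambda>u. s * X u w) \<longlongrightarrow> s * XL \<tau> w) (at_left \<tau>)"
      by (intro tendsto_mult tendsto_const X_at_left w \<tau>0)
    moreover have "eventually (\<lambda>u. 0 \<le> s * X u w) (at_left \<tau>)"
    proof -
      have "eventually (\<lambda>u. u \<in> {0<..<\<tau>}) (at_left \<tau>)" using \<tau>0 by (intro eventually_at_leftI[of 0]) auto
      then show ?thesis by eventually_elim (use before in \<open>auto intro: less_imp_le\<close>)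
    qed
    ultimately have L: "0 \<le> s * XL \<tau> w" by (intro tendsto_lowerbound) auto
    show False
    proof (cases "\<tau> \<in> N w")
      case True
      then have "s * X \<tau> w = (s * XL \<tau> w) / \<theta>" by (simp add: X_jump[OF w])
      then show False using neg L \<theta>_gt_1 by (simp add: divide_less_0_iff)
    next
      case False
      then show False using neg L X_no_jump[OF w _ \<tau>0] by simp
    qed
  qed
  have XL0: "0 \<le> s * XL u w" if "0 < u" "u \<le> 1" for u
  proof -
    have "((\<lambda>v. s * X v w) \<longlongrightarrow> s * XL u w) (at_left u)"
      by (intro tendsto_mult tendsto_const X_at_left w that)
    moreover have "eventually (\<lambda>v. 0 \<le> s * X v w) (at_left u)"
    proof -
      have "eventually (\<lambda>v. v \<in> {0<..<u}) (at_left u)" using that by (intro eventually_at_leftI[of 0]) auto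
      then show ?thesis by eventually_elim (use pos that in \<open>auto intro: less_imp_le\<close>)
    qed
    ultimately show ?thesis by (intro tendsto_lowerbound) auto
  qed
  have \<theta>'0: "0 < \<theta>'"
  proof -
    have "1 / \<theta>' = 1 - 1 / \<theta>" using \<theta>' by simp
    also have "\<dots> > 0" using \<theta>_gt_1 by simp
    finally show ?thesis by (simp add: zero_less_divide_iff)
  qed
  have "s * X 1 w = s * (x0 + \<mu> + \<sigma> * W 1 w) - (\<Sum>u\<in>N w \<inter> {0<..1}. s * XL u w / \<theta>')"
    by (simp add: X_eq[OF w] right_diff_distrib sum_distrib_left)
  also have "\<dots> \<le> s * (x0 + \<mu> + \<sigma> * W 1 w)"
    using XL0 \<theta>'0 by (auto intro!: sum_nonneg divide_nonneg_pos)
  finally show False using fin pos[of 1] by simp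
qed

text \<open>\<open>a\<close> is the value of W(1) at which the endpoint is 0, and the normal law
  charges the unit interval \<open>S\<close> on the required side of it.\<close>

lemma prob_endpoint_pos:
  assumes s: "s = 1 \<or> s = (-1 :: real)"
  shows "0 < prob {w \<in> space M. s * (x0 + \<mu> + \<sigma> * W 1 w) < 0}"
proof -
  note [measurable] = W_measurable[of 1, simplified]
  define a where "a = - (x0 + \<mu>) / \<sigma>"
  define S where "S = (if s = 1 then {a - 1<..<a} else {a<..<a + 1})"
  have S [measurable]: "S \<in> sets borel" by (simp add: S_def)
  have sub: "{w \<in> space M. W 1 w - W 0 w \<in> S} \<subseteq> {w \<in> space M. s * (x0 + \<mu> + \<sigma> * W 1 w) < 0}"
    using s \<sigma>_pos by (auto simp: S_def a_def W_0 field_simps split: if_splits)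
  have inc [measurable]: "(\<lambda>w. W 1 w - W 0 w) \<in> borel_measurable M" by (rule increment_measurable) auto
  have "emeasure M {w \<in> space M. W 1 w - W 0 w \<in> S} = emeasure (gauss 1) S"
    using distr_increment[of 0 1] emeasure_distr[OF inc S] by (simp add: vimage_def Int_def conj_commute)
  moreover have "emeasure (gauss 1) S \<noteq> 0"
  proof
    assume "emeasure (gauss 1) S = 0"
    then have "AE x in lborel. ennreal (normal_density 0 (sqrt 1) x) * indicator S x = 0"
      unfolding gauss_def by (subst (asm) emeasure_density, simp, simp, subst (asm) nn_integral_0_iff_AE) auto
    then have "AE x in lborel. x \<notin> S"
    proof eventually_elim
      case (elim x)
      then show ?case using normal_density_pos[of 1 0 x] by (auto split: split_indicator_asm)
    qed
    then have "S \<in> null_sets lborel" by (subst AE_iff_null_sets) auto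
    then show False by (auto simp: S_def null_sets_def split: if_splits)
  qed
  ultimately have "0 < prob {w \<in> space M. W 1 w - W 0 w \<in> S}"
    by (metis emeasure_eq_measure ennreal_0 zero_less_measure_iff)
  also have "\<dots> \<le> prob {w \<in> space M. s * (x0 + \<mu> + \<sigma> * W 1 w) < 0}"
    by (rule finite_measure_mono[OF sub]) measurable
  finally show ?thesis .
qed

text \<open>Otherwise, at every scale \<open>d k\<close>, a near visit to 0 is followed by a jump
  within time \<open>d k\<close> with probability bounded below; with positive probability this
  happens for infinitely many k. As only finitely many jumps are available, one of them is preceded
  by values of X tending to 0 at times tending to it, so it starts from 0.\<close>

theorem \<Lambda>_integrable_near_0:
  "\<exists>r>0. (\<integral>\<^sup>+ x. \<Lambda> x * indicator {-r..r} x \<partial>lborel) < \<infinity>"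
proof (rule ccontr)
  assume "\<not> ?thesis"
  then have inf: "(\<integral>\<^sup>+ x. \<Lambda> x * indicator {-r..r} x \<partial>lborel) = \<infinity>" if "0 < r" for r
    using that by (metis infinity_ennreal_def less_top)
  \<comment> \<open>The factor 1 + \<mu>^2 ensures |\<mu>| sqrt (d k) \<le> 1 together with d k
    \<le> 1 for every k.\<close>
  define d where "d k = 1 / ((1 + \<mu>\<^sup>2) * real (Suc k))" for k
  have mu1: "0 < 1 + \<mu>\<^sup>2" by (simp add: add_pos_nonneg)
  have d0: "0 < d k" for k using mu1 by (simp add: d_def)
  have d1: "d k \<le> 1" for k
  proof -
    have "1 * 1 \<le> (1 + \<mu>\<^sup>2) * real (Suc k)" by (intro mult_mono) auto
    then show ?thesis using mu1 by (simp add: d_def)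
  qed
  have dmu: "\<bar>\<mu>\<bar> * sqrt (d k) \<le> 1" for k
  proof -
    have "\<mu>\<^sup>2 \<le> (1 + \<mu>\<^sup>2) * real (Suc k)"
      using mult_mono[of "\<mu>\<^sup>2" "1 + \<mu>\<^sup>2" 1 "real (Suc k)"] by simp
    then have "\<mu>\<^sup>2 * d k \<le> 1" using mu1 by (simp add: d_def divide_le_eq_1)
    then have "sqrt (\<mu>\<^sup>2 * d k) \<le> 1" by simp
    then show ?thesis by (simp add: real_sqrt_mult)
  qed
  have dlim: "d \<longlonglongrightarrow> 0"
  proof -
    have "(\<lambda>k. (1 / (1 + \<mu>\<^sup>2)) * inverse (real (Suc k))) \<longlonglongrightarrow> (1 / (1 + \<mu>\<^sup>2)) * 0"
      by (intro tendsto_mult tendsto_const LIMSEQ_inverse_real_of_nat)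
    then show ?thesis by (simp add: d_def[abs_def] inverse_eq_divide)
  qed
  \<comment> \<open>Countably many deterministic times. They reach up to 2 because right continuity
    moves a near visit in [0, 1] to a rational time strictly after it.\<close>
  define Q where "Q = \<rat> \<inter> {0..2::real}"
  have cQ: "countable Q" "Q \<noteq> {}" using countable_rat by (auto simp: Q_def intro!: exI[of _ 0])
  define q where "q = from_nat_into Q"
  have q: "q i \<in> Q" "0 \<le> q i" "q i \<le> 2" for i using from_nat_into[OF cQ(2), of i] by (auto simp: q_def Q_def)
  have rq: "range q = Q" using range_from_nat_into[OF cQ(2,1)] by (simp add: q_def)
  define H where "H k i = {w \<in> space M. \<bar>X (q i) w\<bar> \<le> sqrt (d k)}" for k i
  define G where "G k i = {w \<in> space M. \<bar>X (q i) w\<bar> \<le> sqrt (d k) \<and> count (q i) w \<noteq> count (q i + d k) w}" for k i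
  have Hm [measurable]: "H k i \<in> sets M" for k i
    using X_measurable[OF q(2)] unfolding H_def by measurable
  have Gm [measurable]: "G k i \<in> sets M" for k i
  proof -
    have "0 \<le> q i + d k" using q(2) d0 by (simp add: add_nonneg_nonneg less_imp_le)
    note [measurable] = measurable_nat_eq[OF measurable_count[OF q(2)] measurable_count[OF this]] X_measurable[OF q(2)]
    show ?thesis unfolding G_def by measurable
  qed
  define s :: real where "s = (if 0 \<le> x0 then 1 else -1)"
  have s: "s = 1 \<or> s = -1" "0 \<le> s * x0" by (auto simp: s_def)
  define p0 where "p0 = prob {w \<in> space M. s * (x0 + \<mu> + \<sigma> * W 1 w) < 0}"
  have p0: "0 < p0" unfolding p0_def by (rule prob_endpoint_pos[OF s(1)])
  have HU: "p0 \<le> prob (\<Union>i. H k i)" for k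
    unfolding p0_def
  proof (rule finite_measure_mono)
    show "{w \<in> space M. s * (x0 + \<mu> + \<sigma> * W 1 w) < 0} \<subseteq> (\<Union>i. H k i)"
    proof
      fix w assume w: "w \<in> {w \<in> space M. s * (x0 + \<mu> + \<sigma> * W 1 w) < 0}"
      then have wM: "w \<in> space M" by simp
      obtain t where t: "0 \<le> t" "t \<le> 1" "\<bar>X t w\<bar> < sqrt (d k)"
        using path_reaches_0[OF wM s, of "sqrt (d k)"] w d0[of k] by auto
      have "((\<lambda>u. \<bar>X u w\<bar>) \<longlongrightarrow> \<bar>X t w\<bar>) (at_right t)" by (intro tendsto_rabs X_at_right wM t)
      then have "eventually (\<lambda>u. \<bar>X u w\<bar> < sqrt (d k)) (at_right t)" by (rule order_tendstoD(2)) (rule t(3))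
      then obtain b where b: "t < b" "\<And>u. t < u \<Longrightarrow> u < b \<Longrightarrow> \<bar>X u w\<bar> < sqrt (d k)"
        by (auto simp: eventually_at_right_field)
      obtain u where u: "u \<in> \<rat>" "t < u" "u < min b 2" using Rats_dense_in_real[of t "min b 2"] b t by auto
      then have "u \<in> Q" using t by (auto simp: Q_def)
      then obtain i where "u = q i" using rq by auto
      then show "w \<in> (\<Union>i. H k i)" using b(2)[of u] u wM by (auto simp: H_def intro!: exI[of _ i] less_imp_le)
    qed
  qed auto
  have GU: "hit_const * p0 \<le> prob (\<Union>i. G k i)" for k
  proof -
    have lim: "(\<lambda>n. hit_const * prob (\<Union>i<n. H k i)) \<longlonglongrightarrow> hit_const * prob (\<Union>n. \<Union>i<n. H k i)"
      by (intro tendsto_mult tendsto_const finite_Lim_measure_incseq)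
        (auto simp: incseq_def intro: less_le_trans)
    have "hit_const * prob (\<Union>i<n. H k i) \<le> prob (\<Union>i. G k i)" for n
    proof -
      have "hit_const * prob (\<Union>x\<in>q ` {..<n}. {w \<in> space M. \<bar>X x w\<bar> \<le> sqrt (d k)}) \<le>
        prob (\<Union>x\<in>q ` {..<n}. {w \<in> space M. \<bar>X x w\<bar> \<le> sqrt (d k) \<and> count x w \<noteq> count (x + d k) w})"
        by (rule prob_union_near_0[OF d0 dmu inf]) (use d0 q in auto)
      then have "hit_const * prob (\<Union>i<n. H k i) \<le> prob (\<Union>i<n. G k i)" by (simp add: H_def G_def)
      also have "\<dots> \<le> prob (\<Union>i. G k i)" by (rule finite_measure_mono) auto
      finally show ?thesis .
    qed
    then have "hit_const * prob (\<Union>n. \<Union>i<n. H k i) \<le> prob (\<Union>i. G k i)"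
      by (intro tendsto_upperbound[OF lim]) auto
    moreover have "(\<Union>n. \<Union>i<n. H k i) = (\<Union>i. H k i)" by auto
    ultimately show ?thesis using HU[of k] hit_const_pos
      by (metis (no_types, lifting) less_imp_le mult_left_mono order_trans)
  qed
  \<comment> \<open>The intersection of the \<open>U n\<close> is the limit superior of the events;
    continuity from above keeps its probability at least \<open>hit_const * p0\<close>.\<close>
  define U where "U n = (\<Union>k\<in>{n..}. \<Union>i. G k i)" for n
  have Um [measurable]: "U n \<in> sets M" for n unfolding U_def by measurable
  have "(\<lambda>n. prob (U n)) \<longlonglongrightarrow> prob (\<Inter>n. U n)"
    by (rule finite_Lim_measure_decseq) (auto simp: decseq_def U_def, metis atLeast_iff order_trans)
  then have "hit_const * p0 \<le> prob (\<Inter>n. U n)"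
  proof (rule tendsto_lowerbound)
    show "eventually (\<lambda>n. hit_const * p0 \<le> prob (U n)) sequentially"
    proof (intro always_eventually allI)
      fix n
      have "prob (\<Union>i. G n i) \<le> prob (U n)" by (rule finite_measure_mono) (auto simp: U_def)
      then show "hit_const * p0 \<le> prob (U n)" using GU[of n] by simp
    qed
  qed simp
  then have pos: "0 < prob (\<Inter>n. U n)" using p0 hit_const_pos by (meson less_le_trans mult_pos_pos)
  have "AE w in M. w \<notin> (\<Inter>n. U n)"
    using AE_jumps_not_from_0 AE_space
  proof eventually_elim
    case (elim w)
    show ?case
    proof
      assume "w \<in> (\<Inter>n. U n)"
      then have Un: "w \<in> U n" for n by blast
      have "\<forall>n. \<exists>k i. n \<le> k \<and> w \<in> G k i"
      proof
        fix n
        from Un[of n] obtain k i where "k \<in> {n..}" "w \<in> G k i" unfolding U_def by blast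
        then show "\<exists>k i. n \<le> k \<and> w \<in> G k i" by auto
      qed
      then obtain k i where ki: "\<And>n. n \<le> k n" "\<And>n. w \<in> G (k n) (i n)" by metis
      have "\<exists>u. u \<in> N w \<and> q (i n) < u \<and> u \<le> q (i n) + d (k n)" for n
        using ki(2)[of n] count_eq_iff[OF elim(2) q(2), of "i n" "q (i n) + d (k n)"] d0[of "k n"]
        by (fastforce simp: G_def)
      then obtain u where u: "\<And>n. u n \<in> N w" "\<And>n. q (i n) < u n" "\<And>n. u n \<le> q (i n) + d (k n)" by metis
      have mem: "u n \<in> N w \<inter> {0<..3}" for n
        using u[of n] q(2,3)[of "i n"] d1[of "k n"] by auto
      have "finite (range u)" by (rule finite_subset[OF _ N_finite[OF elim(2), of 3]]) (use mem in blast)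
      \<comment> \<open>All jump times found lie in (0, 3], so one of them serves infinitely many
        scales.\<close>
      then obtain v where v: "infinite {n. u n = v}"
        using pigeonhole_infinite[of UNIV u] by auto
      then obtain m where "u m = v" by (metis (mono_tags, lifting) Collect_empty_eq finite.emptyI)
      then have vN: "v \<in> N w" using u(1) by auto
      then have v0: "0 < v" using N_pos[OF elim(2)] by auto
      \<comment> \<open>Left of \<open>v\<close> the path stays above e/2 in absolute value for some
        time. A near visit preceding \<open>v\<close> by at most a small \<open>d k\<close> falls
        into that time and has |X| \<le> sqrt (d k) < e/2.\<close>
      define e where "e = \<bar>XL v w\<bar>"
      have e: "0 < e" using elim(1) vN by (auto simp: e_def)
      have "((\<lambda>u. \<bar>X u w\<bar>) \<longlongrightarrow> e) (at_left v)" unfolding e_def by (intro tendsto_rabs X_at_left elim v0)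
      then have "eventually (\<lambda>u. e / 2 < \<bar>X u w\<bar>) (at_left v)" by (rule order_tendstoD(1)) (use e in simp)
      then obtain b where b: "b < v" "\<And>u. b < u \<Longrightarrow> u < v \<Longrightarrow> e / 2 < \<bar>X u w\<bar>"
        by (auto simp: eventually_at_left_field)
      have "eventually (\<lambda>n. d n < min (v - b) ((e / 2)\<^sup>2)) sequentially"
        using order_tendstoD(2)[OF dlim, of "min (v - b) ((e / 2)\<^sup>2)"] b e by simp
      then obtain n0 where n0: "\<And>n. n0 \<le> n \<Longrightarrow> d n < min (v - b) ((e / 2)\<^sup>2)" by (auto simp: eventually_sequentially)
      obtain n where n: "n0 \<le> n" "u n = v" using v by (metis (mono_tags, lifting) infinite_nat_iff_unbounded_le mem_Collect_eq)
      have dk: "d (k n) < min (v - b) ((e / 2)\<^sup>2)" using n0 ki(1)[of n] n by auto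
      have "\<bar>X (q (i n)) w\<bar> \<le> sqrt (d (k n))" using ki(2)[of n] by (auto simp: G_def)
      also have "\<dots> < e / 2" using dk e by (intro real_less_lsqrt) auto
      finally show False using b(2)[of "q (i n)"] u(2,3)[of n] n dk by auto
    qed
  qed
  then have "(\<Inter>n. U n) \<in> null_sets M" by (subst AE_iff_null_sets) auto
  then have "prob (\<Inter>n. U n) = 0" by (rule measure_eq_0_null_sets)
  then show False using pos by simp
qed

end

section \<open>Dynkin's formula up to the n-th jump\<close>

text \<open>The derivatives are explicit arguments, so that no \<open>deriv\<close> enters the
  estimates. \<open>B0\<close> bounds the function alone and measures the error from the event of at
  least n jumps; \<open>B\<close> governs the generator. Uniform continuity of \<phi>t and \<phi>xx
  makes the Taylor remainder uniform over the plane.\<close>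

definition test_function ::
  "(real \<Rightarrow> real \<Rightarrow> real) \<Rightarrow> (real \<Rightarrow> real \<Rightarrow> real) \<Rightarrow> (real \<Rightarrow> real \<Rightarrow> real) \<Rightarrow> (real \<Rightarrow> real \<Rightarrow> real) \<Rightarrow> real \<Rightarrow> real \<Rightarrow> bool" where
  "test_function \<phi> \<phi>t \<phi>x \<phi>xx B0 B \<longleftrightarrow>
     (\<forall>t x. ((\<lambda>s. \<phi> s x) has_real_derivative \<phi>t t x) (at t) \<and>
        (\<phi> t has_real_derivative \<phi>x t x) (at x) \<and>
        (\<phi>x t has_real_derivative \<phi>xx t x) (at x) \<and>
        \<bar>\<phi> t x\<bar> \<le> B0 \<and> \<bar>\<phi>t t x\<bar> \<le> B \<and> \<bar>\<phi>x t x\<bar> \<le> B \<and> \<bar>\<phi>xx t x\<bar> \<le> B) \<and>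
     continuous_on UNIV (\<lambda>z. \<phi> (fst z) (snd z)) \<and>
     continuous_on UNIV (\<lambda>z. \<phi>x (fst z) (snd z)) \<and>
     uniformly_continuous_on UNIV (\<lambda>z. \<phi>t (fst z) (snd z)) \<and>
     uniformly_continuous_on UNIV (\<lambda>z. \<phi>xx (fst z) (snd z))"

text \<open>At distances below the modulus \<open>d\<close> the difference is below
  \<open>e\<close>; beyond it the trivial bound 2 B is at most 2 B (dist/d)^2. A polynomial bound
  can be integrated against normal increments, which are unbounded.\<close>

lemma uniformly_continuous_quadratic_modulus:
  fixes f :: "'b::metric_space \<Rightarrow> real"
  assumes u: "uniformly_continuous_on UNIV f" and b: "\<And>x. \<bar>f x\<bar> \<le> B" and e: "0 < e"
  shows "\<exists>C\<ge>0. \<forall>x y. \<bar>f x - f y\<bar> \<le> e + C * (dist x y)\<^sup>2"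
proof -
  obtain d where d: "0 < d" "\<And>x y. dist x y < d \<Longrightarrow> \<bar>f x - f y\<bar> < e"
    using u e unfolding uniformly_continuous_on_def by (metis UNIV_I dist_commute dist_real_def)
  have B: "0 \<le> B" using b[of undefined] by (meson abs_ge_zero order_trans)
  show ?thesis
  proof (intro exI[of _ "2 * B / d\<^sup>2"] conjI allI)
    show "0 \<le> 2 * B / d\<^sup>2" using B by simp
    fix x y
    show "\<bar>f x - f y\<bar> \<le> e + 2 * B / d\<^sup>2 * (dist x y)\<^sup>2"
    proof (cases "dist x y < d")
      case True
      then have "\<bar>f x - f y\<bar> \<le> e" using d(2) by (auto intro: less_imp_le)
      moreover have "0 \<le> 2 * B / d\<^sup>2 * (dist x y)\<^sup>2" using B by simp
      ultimately show ?thesis by linarith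
    next
      case False
      then have "d\<^sup>2 \<le> (dist x y)\<^sup>2" using d by (intro power_mono) auto
      then have "2 * B * 1 \<le> 2 * B * ((dist x y)\<^sup>2 / d\<^sup>2)"
        using B d by (intro mult_left_mono) (auto simp: le_divide_eq)
      moreover have "\<bar>f x - f y\<bar> \<le> 2 * B" using b[of x] b[of y] by linarith
      ultimately show ?thesis using e by simp
    qed
  qed
qed

text \<open>Mean value theorem in time at the displaced point x + z, then a second-order Taylor
  expansion in space at time t. The quadratic moduli turn both remainders into polynomials of degree
  at most four in z.\<close>

lemma second_order_expansion:
  assumes \<phi>: "test_function \<phi> \<phi>t \<phi>x \<phi>xx B0 B" and e: "0 < e"
  shows "\<exists>C\<ge>0. \<forall>t x h z. 0 < h \<longrightarrow> \<bar>\<phi> (t + h) (x + z) - \<phi> t x - (h * \<phi>t t x + z * \<phi>x t x + z\<^sup>2 / 2 * \<phi>xx t x)\<bar> \<le>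
    h * (e + C * (h\<^sup>2 + z\<^sup>2)) + z\<^sup>2 * (e + C * z\<^sup>2)"
proof -
  have b: "\<bar>\<phi>t t x\<bar> \<le> B" "\<bar>\<phi>xx t x\<bar> \<le> B" for t x using \<phi> by (auto simp: test_function_def)
  have uc: "uniformly_continuous_on UNIV (\<lambda>z. \<phi>t (fst z) (snd z))" "uniformly_continuous_on UNIV (\<lambda>z. \<phi>xx (fst z) (snd z))"
    using \<phi> by (auto simp: test_function_def)
  obtain C1 where C1: "0 \<le> C1" "\<And>p q. \<bar>\<phi>t (fst p) (snd p) - \<phi>t (fst q) (snd q)\<bar> \<le> e + C1 * (dist p q)\<^sup>2"
    using uniformly_continuous_quadratic_modulus[OF uc(1) _ e] b by blast
  obtain C2 where C2: "0 \<le> C2" "\<And>p q. \<bar>\<phi>xx (fst p) (snd p) - \<phi>xx (fst q) (snd q)\<bar> \<le> e + C2 * (dist p q)\<^sup>2"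
    using uniformly_continuous_quadratic_modulus[OF uc(2) _ e] b by blast
  show ?thesis
  proof (intro exI[of _ "C1 + C2"] conjI allI impI)
    show "0 \<le> C1 + C2" using C1 C2 by simp
    fix t x h z :: real assume h: "0 < h"
    have "\<exists>r>t. r < t + h \<and> \<phi> (t + h) (x + z) - \<phi> t (x + z) = (t + h - t) * \<phi>t r (x + z)"
      using h \<phi> by (intro MVT2) (auto simp: test_function_def)
    then obtain r where r: "t < r" "r < t + h" "\<phi> (t + h) (x + z) - \<phi> t (x + z) = h * \<phi>t r (x + z)" by auto
    have "\<bar>\<phi>t r (x + z) - \<phi>t t x\<bar> \<le> e + C1 * ((r - t)\<^sup>2 + z\<^sup>2)"
      using C1(2)[of "(r, x + z)" "(t, x)"] by (simp add: dist_Pair_Pair dist_real_def)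
    also have "\<dots> \<le> e + C1 * (h\<^sup>2 + z\<^sup>2)"
      using C1 r by (intro add_left_mono mult_left_mono add_right_mono power_mono) auto
    finally have r1: "\<bar>\<phi>t r (x + z) - \<phi>t t x\<bar> \<le> e + C1 * (h\<^sup>2 + z\<^sup>2)" .
    have t1: "\<bar>h * (\<phi>t r (x + z) - \<phi>t t x)\<bar> \<le> h * (e + C1 * (h\<^sup>2 + z\<^sup>2))"
      using r1 h by (simp add: abs_mult)
    have t2: "\<bar>\<phi> t (x + z) - \<phi> t x - (z * \<phi>x t x + z\<^sup>2 / 2 * \<phi>xx t x)\<bar> \<le> z\<^sup>2 / 2 * (e + C2 * z\<^sup>2)"
    proof (cases "z = 0")
      case False
      define diff where "diff m = (if m = 0 then \<phi> t else if m = 1 then \<phi>x t else \<phi>xx t)" for m :: nat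
      have "\<exists>y. (if x + z < x then x + z < y \<and> y < x else x < y \<and> y < x + z) \<and>
        \<phi> t (x + z) = (\<Sum>m<2. (diff m x / fact m) * (x + z - x) ^ m) + (diff 2 y / fact 2) * (x + z - x) ^ 2"
      proof (rule Taylor[where a = "x - \<bar>z\<bar>" and b = "x + \<bar>z\<bar>"])
        show "\<forall>m y. m < 2 \<and> x - \<bar>z\<bar> \<le> y \<and> y \<le> x + \<bar>z\<bar> \<longrightarrow> DERIV (diff m) y :> diff (Suc m) y"
          using \<phi> by (auto simp: diff_def test_function_def less_2_cases_iff)
      qed (use False in \<open>auto simp: diff_def\<close>)
      then obtain y where y: "(if x + z < x then x + z < y \<and> y < x else x < y \<and> y < x + z)"
        "\<phi> t (x + z) = (\<Sum>m<2. (diff m x / fact m) * (x + z - x) ^ m) + (diff 2 y / fact 2) * (x + z - x) ^ 2" by blast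
      have eq: "\<phi> t (x + z) = \<phi> t x + \<phi>x t x * z + \<phi>xx t y / 2 * z\<^sup>2"
        using y(2) by (simp add: diff_def numeral_2_eq_2)
      have "\<bar>y - x\<bar> \<le> \<bar>z\<bar>" using y(1) by (auto split: if_splits)
      then have "(y - x)\<^sup>2 \<le> z\<^sup>2" by (simp add: abs_le_square_iff)
      have "\<bar>\<phi>xx t y - \<phi>xx t x\<bar> \<le> e + C2 * (y - x)\<^sup>2"
        using C2(2)[of "(t, y)" "(t, x)"] by (simp add: dist_Pair_Pair dist_real_def)
      also have "\<dots> \<le> e + C2 * z\<^sup>2" using C2 \<open>(y - x)\<^sup>2 \<le> z\<^sup>2\<close> by (intro add_left_mono mult_left_mono) auto
      finally have "\<bar>z\<^sup>2 / 2 * (\<phi>xx t y - \<phi>xx t x)\<bar> \<le> z\<^sup>2 / 2 * (e + C2 * z\<^sup>2)"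
        by (simp add: abs_mult mult_left_mono)
      moreover have "\<phi> t (x + z) - \<phi> t x - (z * \<phi>x t x + z\<^sup>2 / 2 * \<phi>xx t x) = z\<^sup>2 / 2 * (\<phi>xx t y - \<phi>xx t x)"
        unfolding eq by (simp add: field_simps)
      ultimately show ?thesis by (simp only:)
    qed simp
    have "z\<^sup>2 / 2 * (e + C2 * z\<^sup>2) \<le> z\<^sup>2 * (e + (C1 + C2) * z\<^sup>2)"
      using C1 C2 e by (intro mult_mono add_left_mono mult_right_mono) auto
    moreover have "h * (e + C1 * (h\<^sup>2 + z\<^sup>2)) \<le> h * (e + (C1 + C2) * (h\<^sup>2 + z\<^sup>2))"
      using C2 h by (intro mult_left_mono add_left_mono mult_right_mono) auto
    moreover have "\<phi> (t + h) (x + z) - \<phi> t x - (h * \<phi>t t x + z * \<phi>x t x + z\<^sup>2 / 2 * \<phi>xx t x) =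
      h * (\<phi>t r (x + z) - \<phi>t t x) + (\<phi> t (x + z) - \<phi> t x - (z * \<phi>x t x + z\<^sup>2 / 2 * \<phi>xx t x))"
      using r(3) by (simp add: algebra_simps)
    ultimately show "\<bar>\<phi> (t + h) (x + z) - \<phi> t x - (h * \<phi>t t x + z * \<phi>x t x + z\<^sup>2 / 2 * \<phi>xx t x)\<bar> \<le>
      h * (e + (C1 + C2) * (h\<^sup>2 + z\<^sup>2)) + z\<^sup>2 * (e + (C1 + C2) * z\<^sup>2)"
      using t1 t2 by linarith
  qed
qed

context jump_diffusion begin

lemma gauss_moments:
  assumes h: "0 < h"
  shows "has_bochner_integral (gauss h) (\<lambda>y. y) 0" "has_bochner_integral (gauss h) (\<lambda>y. y\<^sup>2) h"
    "has_bochner_integral (gauss h) (\<lambda>y. y ^ 4) (3 * h\<^sup>2)"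
proof -
  have s: "0 < sqrt h" using h by simp
  have *: "has_bochner_integral (gauss h) f c" if "has_bochner_integral lborel (\<lambda>x. normal_density 0 (sqrt h) x * f x) c"
    and [measurable]: "f \<in> borel_measurable borel" for f :: "real \<Rightarrow> real" and c
    unfolding gauss_def using that(1) by (intro has_bochner_integral_density) auto
  show "has_bochner_integral (gauss h) (\<lambda>y. y) 0"
    using normal_moment_odd[OF s, of 0 0] by (intro *) auto
  show "has_bochner_integral (gauss h) (\<lambda>y. y\<^sup>2) h"
    using normal_moment_even[OF s, of 0 1] h by (intro *) (auto simp: fact_numeral)
  have "fact (2 * 2) / ((2 / (sqrt h)\<^sup>2)\<^sup>2 * fact 2) = 3 * h\<^sup>2"
    using h by (simp add: fact_numeral power_divide field_simps)
  then show "has_bochner_integral (gauss h) (\<lambda>y. y ^ 4) (3 * h\<^sup>2)"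
    using normal_moment_even[OF s, of 0 2] h by (intro *) auto
qed

text \<open>The fourth moment is of order h^2, hence negligible against h; this controls the z^4
  term of the Taylor remainder.\<close>

lemma diffusion_step_moments:
  assumes h: "0 < h"
  shows "has_bochner_integral (gauss h) (\<lambda>y. \<mu> * h + \<sigma> * y) (\<mu> * h)"
    and "has_bochner_integral (gauss h) (\<lambda>y. (\<mu> * h + \<sigma> * y)\<^sup>2) (\<mu>\<^sup>2 * h\<^sup>2 + \<sigma>\<^sup>2 * h)"
    and "integrable (gauss h) (\<lambda>y. (\<mu> * h + \<sigma> * y) ^ 4)"
    and "(\<integral>y. (\<mu> * h + \<sigma> * y) ^ 4 \<partial>gauss h) \<le> 8 * (\<mu> ^ 4 * h ^ 4 + 3 * \<sigma> ^ 4 * h\<^sup>2)"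
proof -
  interpret G: prob_space "gauss h" by (rule prob_space_gauss[OF h])
  note m = gauss_moments[OF h]
  have c: "has_bochner_integral (gauss h) (\<lambda>y. c) c" for c :: real
    using has_bochner_integral_integrable[of "gauss h" "\<lambda>y. c"] by (simp add: G.prob_space[unfolded space_gauss])
  show "has_bochner_integral (gauss h) (\<lambda>y. \<mu> * h + \<sigma> * y) (\<mu> * h)"
    using has_bochner_integral_add[OF c[of "\<mu> * h"] has_bochner_integral_mult_right[OF m(1), of \<sigma>]] by simp
  have "(\<lambda>y. (\<mu> * h + \<sigma> * y)\<^sup>2) = (\<lambda>y. \<mu>\<^sup>2 * h\<^sup>2 + (2 * \<mu> * h * \<sigma>) * y + \<sigma>\<^sup>2 * y\<^sup>2)"
    by (auto simp: power2_eq_square algebra_simps)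
  then show "has_bochner_integral (gauss h) (\<lambda>y. (\<mu> * h + \<sigma> * y)\<^sup>2) (\<mu>\<^sup>2 * h\<^sup>2 + \<sigma>\<^sup>2 * h)"
    using has_bochner_integral_add[OF has_bochner_integral_add[OF c[of "\<mu>\<^sup>2 * h\<^sup>2"]
      has_bochner_integral_mult_right[OF m(1), of "2 * \<mu> * h * \<sigma>"]] has_bochner_integral_mult_right[OF m(2), of "\<sigma>\<^sup>2"]] by simp
  have b: "has_bochner_integral (gauss h) (\<lambda>y. 8 * (\<mu> ^ 4 * h ^ 4 + \<sigma> ^ 4 * y ^ 4)) (8 * (\<mu> ^ 4 * h ^ 4 + \<sigma> ^ 4 * (3 * h\<^sup>2)))"
    by (intro has_bochner_integral_mult_right has_bochner_integral_add c m)
  have le: "(\<mu> * h + \<sigma> * y) ^ 4 \<le> 8 * (\<mu> ^ 4 * h ^ 4 + \<sigma> ^ 4 * y ^ 4)" for y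
  proof -
    have sq: "(a + b)\<^sup>2 \<le> 2 * (a\<^sup>2 + b\<^sup>2)" for a b :: real
      using zero_le_power2[of "a - b"] by (simp add: power2_eq_square algebra_simps)
    have "(\<mu> * h + \<sigma> * y) ^ 4 = ((\<mu> * h + \<sigma> * y)\<^sup>2)\<^sup>2" by simp
    also have "\<dots> \<le> (2 * ((\<mu> * h)\<^sup>2 + (\<sigma> * y)\<^sup>2))\<^sup>2" by (intro power_mono sq) simp
    also have "\<dots> = 4 * ((\<mu> * h)\<^sup>2 + (\<sigma> * y)\<^sup>2)\<^sup>2" by (subst power_mult_distrib) simp
    also have "\<dots> \<le> 4 * (2 * (((\<mu> * h)\<^sup>2)\<^sup>2 + ((\<sigma> * y)\<^sup>2)\<^sup>2))" by (intro mult_left_mono sq) simp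
    also have "\<dots> = 8 * (\<mu> ^ 4 * h ^ 4 + \<sigma> ^ 4 * y ^ 4)" by (simp add: power_mult_distrib)
    finally show ?thesis .
  qed
  show i: "integrable (gauss h) (\<lambda>y. (\<mu> * h + \<sigma> * y) ^ 4)"
    by (rule Bochner_Integration.integrable_bound[OF has_bochner_integral_iff[THEN iffD1, OF b, THEN conjunct1]]) (use le in auto)
  show "(\<integral>y. (\<mu> * h + \<sigma> * y) ^ 4 \<partial>gauss h) \<le> 8 * (\<mu> ^ 4 * h ^ 4 + 3 * \<sigma> ^ 4 * h\<^sup>2)"
    using integral_mono[OF i _ le] b unfolding has_bochner_integral_iff by simp
qed

end

section \<open>Sums over a time grid\<close>

lemma grid_cell:
  assumes T: "0 < T" and s: "0 < s" "s \<le> T"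
  shows "T * real i / real (Suc m) < s \<and> s \<le> T * real (Suc i) / real (Suc m) \<longleftrightarrow> i = nat \<lceil>real (Suc m) * (s / T)\<rceil> - 1"
    and "nat \<lceil>real (Suc m) * (s / T)\<rceil> - 1 < Suc m"
    and "T * grid_below m (s / T) = T * real (nat \<lceil>real (Suc m) * (s / T)\<rceil> - 1) / real (Suc m)"
proof -
  let ?u = "real (Suc m) * (s / T)"
  have n0: "0 < real (Suc m)" by simp
  have u: "0 < ?u" "?u \<le> real (Suc m)"
    using s T mult_left_mono[of "s / T" 1 "real (Suc m)"] by auto
  have c: "1 \<le> \<lceil>?u\<rceil>" "\<lceil>?u\<rceil> \<le> int (Suc m)" using u by linarith+
  have n: "1 \<le> nat \<lceil>?u\<rceil>" using c(1) by linarith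
  have e: "real (nat \<lceil>?u\<rceil> - 1) = of_int \<lceil>?u\<rceil> - 1"
    using n c(1) by (subst of_nat_diff) (auto simp: of_nat_nat simp del: of_nat_Suc)
  have cell: "T * real i / real (Suc m) < s \<and> s \<le> T * real (Suc i) / real (Suc m) \<longleftrightarrow> real i < ?u \<and> ?u \<le> real i + 1"
  proof -
    have S: "real (Suc i) = real i + 1" by simp
    show ?thesis unfolding S using T n0
      by (simp add: pos_divide_less_eq pos_le_divide_eq pos_less_divide_eq pos_divide_le_eq mult.commute del: of_nat_Suc)
  qed
  show "T * real i / real (Suc m) < s \<and> s \<le> T * real (Suc i) / real (Suc m) \<longleftrightarrow> i = nat \<lceil>?u\<rceil> - 1"
  proof -
    have "real i < ?u \<and> ?u \<le> real i + 1 \<longleftrightarrow> \<lceil>?u\<rceil> = int i + 1" by (simp add: ceiling_eq_iff)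
    also have "\<dots> \<longleftrightarrow> i = nat \<lceil>?u\<rceil> - 1" using c by linarith
    finally show ?thesis unfolding cell .
  qed
  show "nat \<lceil>?u\<rceil> - 1 < Suc m" using c by linarith
  have "real (nat \<lceil>?u\<rceil>) - 1 = real (nat \<lceil>?u\<rceil> - 1)" using n by (simp add: of_nat_diff)
  then show "T * grid_below m (s / T) = T * real (nat \<lceil>?u\<rceil> - 1) / real (Suc m)"
    unfolding grid_below_def by (simp del: of_nat_Suc)
qed

text \<open>As the integral of a step function, which evaluates \<open>f\<close> at the grid point
  strictly left of \<open>s\<close>, the Riemann sum becomes accessible to dominated
  convergence.\<close>

lemma riemann_sum_eq_integral:
  fixes f :: "real \<Rightarrow> real"
  assumes T: "0 < T"
  shows "(\<Sum>i<Suc m. T / real (Suc m) * f (T * real i / real (Suc m))) =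
    (\<integral>s. indicator {0<..T} s * f (T * grid_below m (s / T)) \<partial>lborel)"
proof -
  let ?a = "\<lambda>i. T * real i / real (Suc m)"
  have n0: "0 < real (Suc m)" by simp
  have mono: "?a i \<le> ?a j" if "i \<le> j" for i j using T that by (intro divide_right_mono mult_left_mono) auto
  have aT: "?a (Suc m) = T" using n0 by (simp del: of_nat_Suc)
  have len: "?a (Suc i) - ?a i = T / real (Suc m)" for i by (simp add: diff_divide_distrib[symmetric] algebra_simps)
  have pw: "indicator {0<..T} s * f (T * grid_below m (s / T)) = (\<Sum>i<Suc m. indicator {?a i<..?a (Suc i)} s * f (?a i))" for s
  proof (cases "0 < s \<and> s \<le> T")
    case True
    define k where "k = nat \<lceil>real (Suc m) * (s / T)\<rceil> - 1"
    have "(\<Sum>i<Suc m. indicator {?a i<..?a (Suc i)} s * f (?a i)) = (\<Sum>i<Suc m. if i = k then f (?a k) else 0)"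
    proof (rule sum.cong)
      fix i
      have "s \<in> {?a i<..?a (Suc i)} \<longleftrightarrow> i = k"
        using grid_cell(1)[OF T, of s i m] True unfolding k_def greaterThanAtMost_iff by blast
      then show "indicator {?a i<..?a (Suc i)} s * f (?a i) = (if i = k then f (?a k) else 0)"
        by (simp add: indicator_def del: of_nat_Suc greaterThanAtMost_iff)
    qed simp
    also have "\<dots> = f (?a k)" using grid_cell(2)[OF T, of s m] True by (subst sum.delta) (auto simp: k_def)
    finally show ?thesis using grid_cell(3)[OF T, of s m] True by (simp add: k_def del: of_nat_Suc)
  next
    case False
    have "s \<notin> {?a i<..?a (Suc i)}" if "i < Suc m" for i
    proof
      assume "s \<in> {?a i<..?a (Suc i)}"
      then have "?a 0 < s" "s \<le> ?a (Suc m)" using mono[of 0 i] mono[of "Suc i" "Suc m"] that by (auto simp del: of_nat_Suc)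
      then show False using False aT by simp
    qed
    then show ?thesis using False by (auto simp del: of_nat_Suc)
  qed
  have i: "has_bochner_integral lborel (\<lambda>s. indicator {?a i<..?a (Suc i)} s * f (?a i)) (T / real (Suc m) * f (?a i))" for i
  proof -
    have "has_bochner_integral lborel (indicator {?a i<..?a (Suc i)}) (measure lborel {?a i<..?a (Suc i)})"
      by (rule has_bochner_integral_real_indicator) (auto simp del: of_nat_Suc simp: emeasure_lborel_Ioc[OF mono])
    then have "has_bochner_integral lborel (indicator {?a i<..?a (Suc i)}) (T / real (Suc m))"
      using mono[of i "Suc i"] len[of i] by (simp del: of_nat_Suc)
    then show ?thesis by (rule has_bochner_integral_mult_left)
  qed
  have "has_bochner_integral lborel (\<lambda>s. \<Sum>i<Suc m. indicator {?a i<..?a (Suc i)} s * f (?a i)) (\<Sum>i<Suc m. T / real (Suc m) * f (?a i))"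
    by (rule has_bochner_integral_sum) (rule i)
  then show ?thesis unfolding pw by (rule has_bochner_integral_integral_eq[symmetric])
qed

text \<open>With \<open>c\<close> the count at grid times, the summands vanish once n jumps have
  occurred, so the sum telescopes up to an index \<open>j\<close>, which is the last one if fewer
  than n jumps occur at all.\<close>

lemma stopped_telescope:
  fixes a :: "nat \<Rightarrow> real" and c :: "nat \<Rightarrow> nat"
  assumes "mono c"
  shows "\<exists>j\<le>M. (\<Sum>i<M. if c i < n then a (Suc i) - a i else 0) = a j - a 0 \<and> (c M < n \<longrightarrow> j = M)"
proof (induction M)
  case (Suc M)
  then obtain j where j: "j \<le> M" "(\<Sum>i<M. if c i < n then a (Suc i) - a i else 0) = a j - a 0" "c M < n \<longrightarrow> j = M" by blast
  have "c M \<le> c (Suc M)" using assms by (simp add: monoD)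
  then show ?case using j by (cases "c M < n") (auto intro!: exI[of _ "if c M < n then Suc M else j"])
qed simp

text \<open>Every counted step starts below \<open>n\<close> and raises the count by at least
  one.\<close>

lemma card_increase_le:
  fixes c :: "nat \<Rightarrow> nat"
  assumes "mono c"
  shows "(\<Sum>i<M. if c i < n \<and> c i \<noteq> c (Suc i) then 1 else 0) \<le> min n (c M)"
proof (induction M)
  case (Suc M)
  have "c M \<le> c (Suc M)" using assms by (simp add: monoD)
  then show ?case using Suc by auto
qed simp

context jump_diffusion begin

text \<open>The generator of time and diffusion between the jumps; the jump part is kept
  apart.\<close>

definition generator :: "(real \<Rightarrow> real \<Rightarrow> real) \<Rightarrow> (real \<Rightarrow> real \<Rightarrow> real) \<Rightarrow> (real \<Rightarrow> real \<Rightarrow> real) \<Rightarrow> real \<Rightarrow> real \<Rightarrow> real" where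
  "generator \<phi>t \<phi>x \<phi>xx t x = \<phi>t t x + \<mu> * \<phi>x t x + \<sigma>\<^sup>2 / 2 * \<phi>xx t x"

text \<open>The error of a step is h times a small number, so T/h steps together contribute little.
  \<open>K\<close> depends on \<open>e\<close> but not on h, and comes with a second factor
  h.\<close>

lemma one_step_estimate:
  assumes \<phi>: "test_function \<phi> \<phi>t \<phi>x \<phi>xx B0 B" and e: "0 < e"
  shows "\<exists>K\<ge>0. \<forall>t x h. 0 < h \<and> h \<le> 1 \<longrightarrow>
    \<bar>(\<integral>y. \<phi> (t + h) (x + \<mu> * h + \<sigma> * y) \<partial>gauss h) - \<phi> t x - h * generator \<phi>t \<phi>x \<phi>xx t x\<bar> \<le> h * (e * (1 + \<mu>\<^sup>2 + \<sigma>\<^sup>2) + K * h)"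
proof -
  obtain C where C: "0 \<le> C" "\<And>t x h z. 0 < h \<Longrightarrow> \<bar>\<phi> (t + h) (x + z) - \<phi> t x - (h * \<phi>t t x + z * \<phi>x t x + z\<^sup>2 / 2 * \<phi>xx t x)\<bar> \<le>
    h * (e + C * (h\<^sup>2 + z\<^sup>2)) + z\<^sup>2 * (e + C * z\<^sup>2)"
    using second_order_expansion[OF \<phi> e] by blast
  have b: "\<bar>\<phi> t x\<bar> \<le> B0" "\<bar>\<phi>xx t x\<bar> \<le> B" for t x using \<phi> by (auto simp: test_function_def)
  have B: "0 \<le> B" using b(2)[of 0 0] by linarith
  have c: "continuous_on UNIV (\<lambda>z. \<phi> (fst z) (snd z))" using \<phi> by (simp add: test_function_def)
  \<comment> \<open>Everything of order h^2: the remainder terms with \<open>C\<close>, and the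
    squared drift in the second moment, which the generator does not contain.\<close>
  define K where "K = C * (1 + \<mu>\<^sup>2 + \<sigma>\<^sup>2) + 8 * C * (\<mu> ^ 4 + 3 * \<sigma> ^ 4) + \<mu>\<^sup>2 * B / 2"
  show ?thesis
  proof (intro exI[of _ K] conjI allI impI)
    show "0 \<le> K" using C B by (simp add: K_def)
    fix t x h :: real assume "0 < h \<and> h \<le> 1"
    then have h: "0 < h" "h \<le> 1" by auto
    interpret G: prob_space "gauss h" by (rule prob_space_gauss[OF h(1)])
    note m = diffusion_step_moments[OF h(1)]
    let ?z = "\<lambda>y. \<mu> * h + \<sigma> * y"
    let ?P = "\<lambda>y. h * \<phi>t t x + ?z y * \<phi>x t x + (?z y)\<^sup>2 / 2 * \<phi>xx t x"
    have const: "has_bochner_integral (gauss h) (\<lambda>y. c) c" for c :: real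
      using has_bochner_integral_integrable[of "gauss h" "\<lambda>y. c"] by (simp add: G.prob_space[unfolded space_gauss])
    have cont: "continuous_on UNIV (\<lambda>y. \<phi> (t + h) (x + ?z y))"
      by (rule continuous_on_compose2[OF c, of UNIV "\<lambda>y. (t + h, x + ?z y)", simplified]) (intro continuous_intros)
    have [measurable]: "(\<lambda>y. \<phi> (t + h) (x + ?z y)) \<in> borel_measurable borel"
      by (rule borel_measurable_continuous_onI[OF cont])
    have i\<phi>: "integrable (gauss h) (\<lambda>y. \<phi> (t + h) (x + ?z y))"
      by (rule G.integrable_const_bound[where B = B0]) (auto simp: b)
    have P: "has_bochner_integral (gauss h) ?P (h * \<phi>t t x + \<mu> * h * \<phi>x t x + (\<mu>\<^sup>2 * h\<^sup>2 + \<sigma>\<^sup>2 * h) / 2 * \<phi>xx t x)"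
      by (intro has_bochner_integral_add const has_bochner_integral_mult_left has_bochner_integral_divide m)
    have D: "has_bochner_integral (gauss h) (\<lambda>y. \<phi> (t + h) (x + ?z y) - \<phi> t x - ?P y)
      ((\<integral>y. \<phi> (t + h) (x + ?z y) \<partial>gauss h) - \<phi> t x - (h * \<phi>t t x + \<mu> * h * \<phi>x t x + (\<mu>\<^sup>2 * h\<^sup>2 + \<sigma>\<^sup>2 * h) / 2 * \<phi>xx t x))"
      by (intro has_bochner_integral_diff const P has_bochner_integral_integrable i\<phi>)
    have z2: "integrable (gauss h) (\<lambda>y. (?z y)\<^sup>2)" "(\<integral>y. (?z y)\<^sup>2 \<partial>gauss h) = \<mu>\<^sup>2 * h\<^sup>2 + \<sigma>\<^sup>2 * h"
      using m(2) by (auto simp: has_bochner_integral_iff)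
    have R: "has_bochner_integral (gauss h) (\<lambda>y. (h * e + C * h * h\<^sup>2) + (C * h + e) * (?z y)\<^sup>2 + C * (?z y) ^ 4)
      ((h * e + C * h * h\<^sup>2) + (C * h + e) * (\<mu>\<^sup>2 * h\<^sup>2 + \<sigma>\<^sup>2 * h) + C * (\<integral>y. (?z y) ^ 4 \<partial>gauss h))"
      by (intro has_bochner_integral_add const has_bochner_integral_mult_right has_bochner_integral_integrable m)
    have pw: "\<bar>\<phi> (t + h) (x + ?z y) - \<phi> t x - ?P y\<bar> \<le> (h * e + C * h * h\<^sup>2) + (C * h + e) * (?z y)\<^sup>2 + C * (?z y) ^ 4" for y
    proof -
      have "h * (e + C * (h\<^sup>2 + (?z y)\<^sup>2)) + (?z y)\<^sup>2 * (e + C * (?z y)\<^sup>2) =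
        (h * e + C * h * h\<^sup>2) + (C * h + e) * (?z y)\<^sup>2 + C * ((?z y)\<^sup>2 * (?z y)\<^sup>2)" by (simp add: algebra_simps)
      also have "(?z y)\<^sup>2 * (?z y)\<^sup>2 = (?z y) ^ 4" by (simp add: power_add[symmetric])
      finally show ?thesis using C(2)[OF h(1), of t x "?z y"] by simp
    qed
    have "\<bar>(\<integral>y. \<phi> (t + h) (x + ?z y) \<partial>gauss h) - \<phi> t x - (h * \<phi>t t x + \<mu> * h * \<phi>x t x + (\<mu>\<^sup>2 * h\<^sup>2 + \<sigma>\<^sup>2 * h) / 2 * \<phi>xx t x)\<bar> =
      \<bar>\<integral>y. \<phi> (t + h) (x + ?z y) - \<phi> t x - ?P y \<partial>gauss h\<bar>"
      using D by (simp add: has_bochner_integral_iff)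
    also have "\<dots> \<le> (\<integral>y. \<bar>\<phi> (t + h) (x + ?z y) - \<phi> t x - ?P y\<bar> \<partial>gauss h)" by (rule integral_abs_bound)
    also have "\<dots> \<le> (\<integral>y. (h * e + C * h * h\<^sup>2) + (C * h + e) * (?z y)\<^sup>2 + C * (?z y) ^ 4 \<partial>gauss h)"
      using D R by (intro integral_mono pw) (auto simp: has_bochner_integral_iff)
    also have "\<dots> = (h * e + C * h * h\<^sup>2) + (C * h + e) * (\<mu>\<^sup>2 * h\<^sup>2 + \<sigma>\<^sup>2 * h) + C * (\<integral>y. (?z y) ^ 4 \<partial>gauss h)"
      using R by (simp add: has_bochner_integral_iff)
    also have "\<dots> \<le> (h * e + C * h * h\<^sup>2) + (C * h + e) * (\<mu>\<^sup>2 * h\<^sup>2 + \<sigma>\<^sup>2 * h) + C * (8 * (\<mu> ^ 4 * h ^ 4 + 3 * \<sigma> ^ 4 * h\<^sup>2))"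
      using C m(4) by (intro add_left_mono mult_left_mono) auto
    finally have 1: "\<bar>(\<integral>y. \<phi> (t + h) (x + ?z y) \<partial>gauss h) - \<phi> t x - (h * \<phi>t t x + \<mu> * h * \<phi>x t x + (\<mu>\<^sup>2 * h\<^sup>2 + \<sigma>\<^sup>2 * h) / 2 * \<phi>xx t x)\<bar>
      \<le> (h * e + C * h * h\<^sup>2) + (C * h + e) * (\<mu>\<^sup>2 * h\<^sup>2 + \<sigma>\<^sup>2 * h) + C * (8 * (\<mu> ^ 4 * h ^ 4 + 3 * \<sigma> ^ 4 * h\<^sup>2))" .
    have h2: "h\<^sup>2 \<le> h" using h by (simp add: power2_eq_square mult_left_le)
    have h3: "h * h\<^sup>2 \<le> h\<^sup>2" using h by (intro mult_left_le_one_le) auto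
    have h4: "h ^ 4 \<le> h\<^sup>2" using h by (intro power_decreasing) auto
    have mh: "\<mu>\<^sup>2 * h\<^sup>2 + \<sigma>\<^sup>2 * h \<le> (\<mu>\<^sup>2 + \<sigma>\<^sup>2) * h"
      using mult_left_mono[OF h2, of "\<mu>\<^sup>2"] by (simp add: algebra_simps)
    have "(h * e + C * h * h\<^sup>2) + (C * h + e) * (\<mu>\<^sup>2 * h\<^sup>2 + \<sigma>\<^sup>2 * h) + C * (8 * (\<mu> ^ 4 * h ^ 4 + 3 * \<sigma> ^ 4 * h\<^sup>2))
      \<le> (h * e + C * h\<^sup>2) + (C * h + e) * ((\<mu>\<^sup>2 + \<sigma>\<^sup>2) * h) + C * (8 * (\<mu> ^ 4 * h\<^sup>2 + 3 * \<sigma> ^ 4 * h\<^sup>2))"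
      using C e h h3 h4 mh by (intro add_mono mult_left_mono order_refl) (auto simp: mult.assoc intro!: mult_left_mono)
    also have "\<dots> = h * (e * (1 + \<mu>\<^sup>2 + \<sigma>\<^sup>2)) + (C * (1 + \<mu>\<^sup>2 + \<sigma>\<^sup>2) + 8 * C * (\<mu> ^ 4 + 3 * \<sigma> ^ 4)) * h\<^sup>2"
      by (simp add: algebra_simps power2_eq_square)
    finally have 2: "(h * e + C * h * h\<^sup>2) + (C * h + e) * (\<mu>\<^sup>2 * h\<^sup>2 + \<sigma>\<^sup>2 * h) + C * (8 * (\<mu> ^ 4 * h ^ 4 + 3 * \<sigma> ^ 4 * h\<^sup>2))
      \<le> h * (e * (1 + \<mu>\<^sup>2 + \<sigma>\<^sup>2)) + (C * (1 + \<mu>\<^sup>2 + \<sigma>\<^sup>2) + 8 * C * (\<mu> ^ 4 + 3 * \<sigma> ^ 4)) * h\<^sup>2" .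
    have 3: "\<bar>\<mu>\<^sup>2 * h\<^sup>2 / 2 * \<phi>xx t x\<bar> \<le> \<mu>\<^sup>2 * h\<^sup>2 / 2 * B"
      using b(2)[of t x] by (simp add: abs_mult mult_left_mono)
    have "(\<integral>y. \<phi> (t + h) (x + ?z y) \<partial>gauss h) - \<phi> t x - h * generator \<phi>t \<phi>x \<phi>xx t x =
      ((\<integral>y. \<phi> (t + h) (x + ?z y) \<partial>gauss h) - \<phi> t x - (h * \<phi>t t x + \<mu> * h * \<phi>x t x + (\<mu>\<^sup>2 * h\<^sup>2 + \<sigma>\<^sup>2 * h) / 2 * \<phi>xx t x))
      + \<mu>\<^sup>2 * h\<^sup>2 / 2 * \<phi>xx t x"
      by (simp add: generator_def algebra_simps add_divide_distrib)
    then have "\<bar>(\<integral>y. \<phi> (t + h) (x + ?z y) \<partial>gauss h) - \<phi> t x - h * generator \<phi>t \<phi>x \<phi>xx t x\<bar> \<le>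
      h * (e * (1 + \<mu>\<^sup>2 + \<sigma>\<^sup>2)) + (C * (1 + \<mu>\<^sup>2 + \<sigma>\<^sup>2) + 8 * C * (\<mu> ^ 4 + 3 * \<sigma> ^ 4)) * h\<^sup>2 + \<mu>\<^sup>2 * h\<^sup>2 / 2 * B"
      using 1 2 3 by linarith
    also have "\<dots> = h * (e * (1 + \<mu>\<^sup>2 + \<sigma>\<^sup>2) + K * h)" by (simp add: K_def algebra_simps power2_eq_square)
    finally show "\<bar>(\<integral>y. \<phi> (t + h) (x + \<mu> * h + \<sigma> * y) \<partial>gauss h) - \<phi> t x - h * generator \<phi>t \<phi>x \<phi>xx t x\<bar> \<le> h * (e * (1 + \<mu>\<^sup>2 + \<sigma>\<^sup>2) + K * h)"
      by (simp add: add.assoc)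
  qed
qed

end

lemma integrable_indicator_mult_bounded:
  fixes f :: "real \<Rightarrow> real" and T :: real
  assumes T: "0 < T" and [measurable]: "f \<in> borel_measurable borel" and b: "\<And>s. \<bar>f s\<bar> \<le> C"
  shows "integrable lborel (\<lambda>s. indicator {0<..T} s * f s)" "\<bar>\<integral>s. indicator {0<..T} s * f s \<partial>lborel\<bar> \<le> C * T"
proof -
  have i: "integrable lborel (\<lambda>s. C * indicator {0<..T} s)" using T by simp
  show j: "integrable lborel (\<lambda>s. indicator {0<..T} s * f s)"
    by (rule Bochner_Integration.integrable_bound[OF i]) (use b in \<open>auto split: split_indicator intro: order_trans[OF b abs_ge_self]\<close>)
  have "\<bar>\<integral>s. indicator {0<..T} s * f s \<partial>lborel\<bar> \<le> (\<integral>s. \<bar>indicator {0<..T} s * f s\<bar> \<partial>lborel)" by (rule integral_abs_bound)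
  also have "\<dots> \<le> (\<integral>s. C * indicator {0<..T} s \<partial>lborel)"
    using j i b by (intro integral_mono) (auto split: split_indicator)
  also have "\<dots> = C * T" using T by simp
  finally show "\<bar>\<integral>s. indicator {0<..T} s * f s \<partial>lborel\<bar> \<le> C * T" .
qed

section \<open>Passage to the limit over the grids\<close>

context jump_diffusion begin

context
  fixes \<phi> \<phi>t \<phi>x \<phi>xx :: "real \<Rightarrow> real \<Rightarrow> real" and B0 B T :: real and n :: nat
  assumes \<phi>: "test_function \<phi> \<phi>t \<phi>x \<phi>xx B0 B" and T: "0 < T"
begin

lemma test_function_bounds:
  "\<bar>\<phi> t x\<bar> \<le> B0" "\<bar>\<phi>t t x\<bar> \<le> B" "\<bar>\<phi>x t x\<bar> \<le> B" "\<bar>\<phi>xx t x\<bar> \<le> B"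
  using \<phi> by (auto simp: test_function_def)

lemma B0_nonneg: "0 \<le> B0" and B_nonneg: "0 \<le> B"
  using test_function_bounds(1,2)[of 0 0] by linarith+

lemma continuous_\<phi>: "continuous_on UNIV (\<lambda>z. \<phi> (fst z) (snd z))"
  using \<phi> by (simp add: test_function_def)

lemma continuous_generator: "continuous_on UNIV (\<lambda>z. generator \<phi>t \<phi>x \<phi>xx (fst z) (snd z))"
  using \<phi> unfolding generator_def test_function_def
  by (intro continuous_intros) (auto intro: uniformly_continuous_imp_continuous)

lemma generator_bound: "\<bar>generator \<phi>t \<phi>x \<phi>xx t x\<bar> \<le> B + \<bar>\<mu>\<bar> * B + \<sigma>\<^sup>2 / 2 * B"
proof -
  have "\<bar>generator \<phi>t \<phi>x \<phi>xx t x\<bar> \<le> \<bar>\<phi>t t x\<bar> + \<bar>\<mu>\<bar> * \<bar>\<phi>x t x\<bar> + \<sigma>\<^sup>2 / 2 * \<bar>\<phi>xx t x\<bar>"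
    unfolding generator_def
    using abs_triangle_ineq[of "\<phi>t t x + \<mu> * \<phi>x t x" "\<sigma>\<^sup>2 / 2 * \<phi>xx t x"] abs_triangle_ineq[of "\<phi>t t x" "\<mu> * \<phi>x t x"]
    by (simp add: abs_mult)
  also have "\<dots> \<le> B + \<bar>\<mu>\<bar> * B + \<sigma>\<^sup>2 / 2 * B"
    by (intro add_mono mult_left_mono test_function_bounds) auto
  finally show ?thesis .
qed

lemma measurable_\<phi> [measurable]: "(\<lambda>z. \<phi> (fst z) (snd z)) \<in> borel_measurable (borel \<Otimes>\<^sub>M borel)"
  using borel_measurable_continuous_onI[OF continuous_\<phi>] by (simp add: borel_prod)

lemma measurable_\<phi>_comp [measurable (raw)]:
  "f \<in> borel_measurable K \<Longrightarrow> g \<in> borel_measurable K \<Longrightarrow> (\<lambda>x. \<phi> (f x) (g x)) \<in> borel_measurable K"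
  using measurable_compose[OF measurable_Pair measurable_\<phi>] by simp

lemma measurable_generator_comp [measurable (raw)]:
  assumes "f \<in> borel_measurable K" "g \<in> borel_measurable K"
  shows "(\<lambda>x. generator \<phi>t \<phi>x \<phi>xx (f x) (g x)) \<in> borel_measurable K"
proof -
  have "(\<lambda>z. generator \<phi>t \<phi>x \<phi>xx (fst z) (snd z)) \<in> borel_measurable (borel \<Otimes>\<^sub>M borel)"
    using borel_measurable_continuous_onI[OF continuous_generator] by (simp add: borel_prod)
  from measurable_compose[OF measurable_Pair[OF assms] this] show ?thesis by simp
qed

definition "tg m i = T * real i / real (Suc m)" for m i :: nat

lemma tg: "0 \<le> tg m i" "tg m i \<le> tg m (Suc i)" "tg m i < tg m (Suc i)" "tg m (Suc i) - tg m i = T / real (Suc m)"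
  "tg m 0 = 0" "tg m (Suc m) = T"
  using T unfolding tg_def
  by (auto simp: diff_divide_distrib[symmetric] algebra_simps simp del: of_nat_Suc intro!: divide_right_mono divide_strict_right_mono)
    (auto simp: algebra_simps)

text \<open>Over a cell (a, b] the increment of \<phi>(t, X(t)) is the sum of
  \<open>diff_part\<close>, computed with the jump-free continuation from \<open>a\<close>, and
  \<open>jump_part\<close>, the correction if the cell contains a jump. Both are switched off once n
  jumps have occurred by time \<open>a\<close>.\<close>

definition "jump_part w a b = (if count a w < n \<and> count a w \<noteq> count b w
  then \<phi> b (X b w) - \<phi> b (X a w + \<mu> * (b - a) + \<sigma> * (W b w - W a w)) else 0)" for w a b

definition "diff_part w a b = (if count a w < n
  then \<phi> b (X a w + \<mu> * (b - a) + \<sigma> * (W b w - W a w)) - \<phi> a (X a w) else 0)" for w a b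

definition "V t w = (if count (max 0 t) w < n then generator \<phi>t \<phi>x \<phi>xx t (X (max 0 t) w) else 0)" for t w

lemma measurable_parts:
  assumes "0 \<le> a" "0 \<le> b"
  shows "(\<lambda>w. jump_part w a b) \<in> borel_measurable M" "(\<lambda>w. diff_part w a b) \<in> borel_measurable M"
proof -
  note [measurable] = X_measurable[OF assms(1)] X_measurable[OF assms(2)] W_measurable[OF assms(1)] W_measurable[OF assms(2)]
    measurable_count[OF assms(1)] measurable_nat_eq[OF measurable_count[OF assms(1)] measurable_count[OF assms(2)]]
  show "(\<lambda>w. jump_part w a b) \<in> borel_measurable M" unfolding jump_part_def by measurable
  show "(\<lambda>w. diff_part w a b) \<in> borel_measurable M" unfolding diff_part_def by measurable
qed

lemma abs_\<phi>_diff: "\<bar>\<phi> t x - \<phi> s y\<bar> \<le> 2 * B0"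
  using test_function_bounds(1)[of t x] test_function_bounds(1)[of s y] by linarith

lemma mono_count_tg: "w \<in> space M \<Longrightarrow> mono (\<lambda>i. count (tg m i) w)"
  by (intro mono_iff_le_Suc[THEN iffD2] allI count_mono tg)

text \<open>At most \<open>n\<close> cells contribute, each at most 2 B0. The bound is uniform in
  the grid and dominates the passage to the limit.\<close>

lemma jump_parts_bound:
  assumes w: "w \<in> space M"
  shows "\<bar>\<Sum>i<Suc m. jump_part w (tg m i) (tg m (Suc i))\<bar> \<le> 2 * B0 * real n"
proof -
  have "\<bar>\<Sum>i<Suc m. jump_part w (tg m i) (tg m (Suc i))\<bar> \<le> (\<Sum>i<Suc m. \<bar>jump_part w (tg m i) (tg m (Suc i))\<bar>)"
    by (rule sum_abs)
  also have "\<dots> \<le> (\<Sum>i<Suc m. 2 * B0 * real (if count (tg m i) w < n \<and> count (tg m i) w \<noteq> count (tg m (Suc i)) w then 1 else 0))"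
    by (intro sum_mono) (auto simp: jump_part_def abs_\<phi>_diff)
  also have "\<dots> = 2 * B0 * real (\<Sum>i<Suc m. if count (tg m i) w < n \<and> count (tg m i) w \<noteq> count (tg m (Suc i)) w then 1 else 0)"
    unfolding of_nat_sum sum_distrib_left ..
  also have "\<dots> \<le> 2 * B0 * real n"
    using card_increase_le[where c = "\<lambda>i. count (tg m i) w" and n = n and M = "Suc m", OF mono_count_tg[OF w]] B0_nonneg
    by (intro mult_left_mono of_nat_mono) (auto simp del: sum.lessThan_Suc)
  finally show ?thesis .
qed

text \<open>As the cell around a jump time \<open>s\<close> shrinks, X at its right end tends to
  \<open>XL s w / \<theta>\<close> and the jump-free continuation tends to
  \<open>XL s w\<close>.\<close>

lemma jump_parts_tendsto:
  assumes w: "w \<in> space M"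
  shows "(\<lambda>m. \<Sum>i<Suc m. jump_part w (tg m i) (tg m (Suc i))) \<longlonglongrightarrow>
    (\<Sum>s\<in>N w \<inter> {0<..T}. if countL s w < n then \<phi> s (XL s w / \<theta>) - \<phi> s (XL s w) else 0)"
  unfolding tg_def
proof (rule grid_sum_tendsto[OF T N_finite[OF w]])
  fix a b :: real assume ab: "0 \<le> a" "a < b" "b \<le> T" "N w \<inter> {0<..T} \<inter> {a<..b} = {}"
  then have "N w \<inter> {a<..b} = {}" by auto
  then show "jump_part w a b = 0" using count_eq_iff[OF w ab(1), of b] ab by (simp add: jump_part_def)
next
  fix s and a b :: "nat \<Rightarrow> real"
  assume s: "s \<in> N w \<inter> {0<..T}" and a: "\<And>m. 0 \<le> a m" "\<And>m. a m < s" "a \<longlonglongrightarrow> s"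
    and b: "\<And>m. s \<le> b m" "\<And>m. b m \<le> T" "b \<longlonglongrightarrow> s"
  have s0: "0 < s" using s by auto
  have al: "filterlim a (at_left s) sequentially" using a by (intro tendsto_imp_filterlim_at_left) auto
  \<comment> \<open>The right ends \<open>b m\<close> may equal \<open>s\<close>, so the limit from
    the right is used in the form of continuity within {s..}.\<close>
  have rc: "(\<lambda>m. y (b m)) \<longlonglongrightarrow> y s" if "(y \<longlongrightarrow> y s) (at_right s)" for y :: "real \<Rightarrow> real"
  proof -
    have "continuous (at s within {s..}) y"
      using that by (simp add: continuous_within at_within_Ici_at_right)
    then show ?thesis
      by (rule continuous_within_tendsto_compose[OF _ _ b(3)]) (use b in auto)
  qed
  have Xa: "(\<lambda>m. X (a m) w) \<longlonglongrightarrow> XL s w" by (rule filterlim_compose[OF X_at_left[OF w s0] al])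
  have Wa: "(\<lambda>m. W (a m) w) \<longlonglongrightarrow> W s w" by (rule filterlim_compose[OF W_at_left[OF w s0] al])
  have Xb: "(\<lambda>m. X (b m) w) \<longlonglongrightarrow> XL s w / \<theta>"
    using rc[of "\<lambda>t. X t w"] X_at_right[OF w, of s] s0 X_jump[OF w, of s] s by simp
  have Wb: "(\<lambda>m. W (b m) w) \<longlonglongrightarrow> W s w" using rc[of "\<lambda>t. W t w"] W_at_right[OF w, of s] s0 by simp
  have D: "(\<lambda>m. X (a m) w + \<mu> * (b m - a m) + \<sigma> * (W (b m) w - W (a m) w)) \<longlonglongrightarrow> XL s w + \<mu> * (s - s) + \<sigma> * (W s w - W s w)"
    by (intro tendsto_intros Xa Wa Wb a b)
  have \<phi>lim: "(\<lambda>m. \<phi> (b m) (y m)) \<longlonglongrightarrow> \<phi> s y0" if "y \<longlonglongrightarrow> y0" for y y0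
    using continuous_on_tendsto_compose[OF continuous_\<phi> tendsto_Pair[OF b(3) that]] by simp
  have "(\<lambda>m. \<phi> (b m) (X (b m) w) - \<phi> (b m) (X (a m) w + \<mu> * (b m - a m) + \<sigma> * (W (b m) w - W (a m) w))) \<longlonglongrightarrow>
    \<phi> s (XL s w / \<theta>) - \<phi> s (XL s w)"
    using D by (intro tendsto_diff \<phi>lim Xb) auto
  then have "(\<lambda>m. if countL s w < n then \<phi> (b m) (X (b m) w) - \<phi> (b m) (X (a m) w + \<mu> * (b m - a m) + \<sigma> * (W (b m) w - W (a m) w)) else 0) \<longlonglongrightarrow>
    (if countL s w < n then \<phi> s (XL s w / \<theta>) - \<phi> s (XL s w) else 0)" by auto
  moreover have "eventually (\<lambda>m. (if countL s w < n then \<phi> (b m) (X (b m) w) - \<phi> (b m) (X (a m) w + \<mu> * (b m - a m) + \<sigma> * (W (b m) w - W (a m) w)) else 0) =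
    jump_part w (a m) (b m)) sequentially"
  proof -
    have "eventually (\<lambda>m. count (a m) w = countL s w) sequentially"
      using count_at_left[OF w, of s] al by (auto simp: filterlim_iff)
    then show ?thesis
    proof eventually_elim
      case (elim m)
      have "s \<in> N w \<inter> {a m<..b m}" using s a(2)[of m] b(1)[of m] by auto
      moreover have "a m \<le> b m" using a(2)[of m] b(1)[of m] by linarith
      ultimately have "count (a m) w \<noteq> count (b m) w"
        using count_eq_iff[OF w a(1)[of m], of "b m"] by blast
      then show ?case using elim by (simp add: jump_part_def)
    qed
  qed
  ultimately show "(\<lambda>m. jump_part w (a m) (b m)) \<longlonglongrightarrow> (if countL s w < n then \<phi> s (XL s w / \<theta>) - \<phi> s (XL s w) else 0)"
    by (rule Lim_transform_eventually)
qed auto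

text \<open>X and the count at time \<open>a\<close> belong to the past, so the increment after
  \<open>a\<close> is integrated out.\<close>

lemma expectation_diff_part:
  assumes a: "0 \<le> a" "a < b"
  shows "(\<integral>w. diff_part w a b \<partial>M) =
    (\<integral>w. (if count a w < n then (\<integral>y. \<phi> (a + (b - a)) (X a w + \<mu> * (b - a) + \<sigma> * y) \<partial>gauss (b - a)) - \<phi> a (X a w) else 0) \<partial>M)"
proof -
  interpret G: prob_space "gauss (b - a)" using a by (intro prob_space_gauss) simp
  define g where "g = (\<lambda>p. if snd (fst p) < n then \<phi> b (fst (fst p) + \<mu> * (b - a) + \<sigma> * snd p) - \<phi> a (fst (fst p)) else 0)"
  have gm: "g \<in> borel_measurable ((borel \<Otimes>\<^sub>M count_space UNIV) \<Otimes>\<^sub>M borel)" unfolding g_def by measurable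
  have Z: "(\<lambda>w. (X a w, count a w)) \<in> measurable (F a) (borel \<Otimes>\<^sub>M count_space UNIV)"
    using X_adapted[OF a(1)] measurable_count_F[OF a(1)] by measurable
  have "(\<integral>w. diff_part w a b \<partial>M) = (\<integral>w. g ((X a w, count a w), W b w - W a w) \<partial>M)"
    by (simp add: diff_part_def g_def cong: if_cong)
  also have "\<dots> = (\<integral>w. (\<integral>y. g ((X a w, count a w), y) \<partial>gauss (b - a)) \<partial>M)"
    by (rule integral_past_increment[OF a Z gm, of "2 * B0"]) (use abs_\<phi>_diff B0_nonneg in \<open>auto simp: g_def\<close>)
  also have "\<dots> = (\<integral>w. (if count a w < n then (\<integral>y. \<phi> (a + (b - a)) (X a w + \<mu> * (b - a) + \<sigma> * y) \<partial>gauss (b - a)) - \<phi> a (X a w) else 0) \<partial>M)"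
  proof (rule Bochner_Integration.integral_cong)
    fix w
    have "integrable (gauss (b - a)) (\<lambda>y. \<phi> b (X a w + \<mu> * (b - a) + \<sigma> * y))"
      by (rule G.integrable_const_bound[where B = B0]) (auto simp: test_function_bounds)
    then show "(\<integral>y. g ((X a w, count a w), y) \<partial>gauss (b - a)) =
      (if count a w < n then (\<integral>y. \<phi> (a + (b - a)) (X a w + \<mu> * (b - a) + \<sigma> * y) \<partial>gauss (b - a)) - \<phi> a (X a w) else 0)"
      by (simp add: g_def G.prob_space[unfolded space_gauss])
  qed simp
  finally show ?thesis .
qed

lemma measurable_V [measurable (raw)]:
  assumes [measurable]: "f \<in> borel_measurable K" "g \<in> measurable K M"
  shows "(\<lambda>x. V (f x) (g x)) \<in> borel_measurable K"
  unfolding V_def by measurable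

lemma V_bound: "\<bar>V t w\<bar> \<le> B + \<bar>\<mu>\<bar> * B + \<sigma>\<^sup>2 / 2 * B"
proof -
  have "0 \<le> B + \<bar>\<mu>\<bar> * B + \<sigma>\<^sup>2 / 2 * B" using B_nonneg by simp
  then show ?thesis using generator_bound unfolding V_def by auto
qed

text \<open>At almost every \<open>s\<close>, namely off the jump times, X and the count at grid
  points left of \<open>s\<close> converge to their values at \<open>s\<close>. Dominated
  convergence is applied once in time and once on the probability space.\<close>

lemma V_sums_tendsto:
  "(\<lambda>m. \<Sum>i<Suc m. T / real (Suc m) * (\<integral>w. V (tg m i) w \<partial>M)) \<longlonglongrightarrow>
    (\<integral>w. (\<integral>s. indicator {0<..T} s * V s w \<partial>lborel) \<partial>M)"
proof -
  let ?C = "B + \<bar>\<mu>\<bar> * B + \<sigma>\<^sup>2 / 2 * B"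
  have [measurable]: "(\<lambda>s. V (T * grid_below m (s / T)) w) \<in> borel_measurable borel" "(\<lambda>s. V s w) \<in> borel_measurable borel"
    if "w \<in> space M" for m w
    using that unfolding grid_below_def by measurable
  have [measurable]: "(\<lambda>w. \<integral>s. indicator {0<..T} s * V (T * grid_below m (s / T)) w \<partial>lborel) \<in> borel_measurable M" for m
    unfolding grid_below_def by measurable
  have eq: "(\<Sum>i<Suc m. T / real (Suc m) * (\<integral>w. V (tg m i) w \<partial>M)) =
    (\<integral>w. (\<integral>s. indicator {0<..T} s * V (T * grid_below m (s / T)) w \<partial>lborel) \<partial>M)" for m
  proof -
    have i: "integrable M (\<lambda>w. V (tg m i) w)" for i
      by (rule integrable_const_bound[where B = ?C]) (use V_bound in auto)
    have "(\<Sum>i<Suc m. T / real (Suc m) * (\<integral>w. V (tg m i) w \<partial>M)) = (\<integral>w. (\<Sum>i<Suc m. T / real (Suc m) * V (tg m i) w) \<partial>M)"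
      using i by (subst Bochner_Integration.integral_sum) auto
    also have "\<dots> = (\<integral>w. (\<integral>s. indicator {0<..T} s * V (T * grid_below m (s / T)) w \<partial>lborel) \<partial>M)"
      unfolding tg_def by (intro Bochner_Integration.integral_cong refl riemann_sum_eq_integral T)
    finally show ?thesis .
  qed
  show ?thesis unfolding eq
  proof (rule integral_dominated_convergence[where w = "\<lambda>_. ?C * T"])
    show "AE w in M. norm (\<integral>s. indicator {0<..T} s * V (T * grid_below m (s / T)) w \<partial>lborel) \<le> ?C * T" for m
      using integrable_indicator_mult_bounded(2)[OF T] V_bound by (intro AE_I2) simp
    show "AE w in M. (\<lambda>m. \<integral>s. indicator {0<..T} s * V (T * grid_below m (s / T)) w \<partial>lborel) \<longlonglongrightarrow> (\<integral>s. indicator {0<..T} s * V s w \<partial>lborel)"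
    proof (rule AE_I2)
      fix w assume w: "w \<in> space M"
      show "(\<lambda>m. \<integral>s. indicator {0<..T} s * V (T * grid_below m (s / T)) w \<partial>lborel) \<longlonglongrightarrow> (\<integral>s. indicator {0<..T} s * V s w \<partial>lborel)"
      proof (rule integral_dominated_convergence[where w = "\<lambda>s. ?C * indicator {0<..T} s"])
        show "integrable lborel (\<lambda>s. ?C * indicator {0<..T} s)" using T by simp
        show "AE s in lborel. norm (indicator {0<..T} s * V (T * grid_below m (s / T)) w) \<le> ?C * indicator {0<..T} s" for m
          using V_bound by (intro AE_I2) (auto split: split_indicator)
        show "AE s in lborel. (\<lambda>m. indicator {0<..T} s * V (T * grid_below m (s / T)) w) \<longlonglongrightarrow> indicator {0<..T} s * V s w"
          using AE_not_jump[OF w]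
        proof eventually_elim
          case (elim s)
          show ?case
          proof (cases "s \<in> {0<..T}")
            case True
            then have s: "0 < s" "0 < s / T" using T by auto
            have gl: "filterlim (\<lambda>m. T * grid_below m (s / T)) (at_left s) sequentially"
            proof (rule tendsto_imp_filterlim_at_left)
              have "(\<lambda>m. grid_below m (s / T)) \<longlonglongrightarrow> s / T"
                using filterlim_grid_below[OF s(2)] by (simp add: filterlim_at)
              then have "(\<lambda>m. T * grid_below m (s / T)) \<longlonglongrightarrow> T * (s / T)" by (intro tendsto_intros)
              then show "(\<lambda>m. T * grid_below m (s / T)) \<longlonglongrightarrow> s" using T by simp
              show "eventually (\<lambda>m. T * grid_below m (s / T) < s) sequentially"
                using grid_below(1)[OF s(2)] T by (auto simp: field_simps)
            qed
            have nn: "max 0 (T * grid_below m (s / T)) = T * grid_below m (s / T)" for m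
              using grid_below(3)[OF s(2), of m] T by (simp add: max_def)
            have "(\<lambda>m. X (T * grid_below m (s / T)) w) \<longlonglongrightarrow> X s w"
              using filterlim_compose[OF X_at_left[OF w s(1)] gl] X_no_jump[OF w elim s(1)] by simp
            moreover have "(\<lambda>m. T * grid_below m (s / T)) \<longlonglongrightarrow> s" using gl by (simp add: filterlim_at)
            ultimately have "(\<lambda>m. generator \<phi>t \<phi>x \<phi>xx (T * grid_below m (s / T)) (X (T * grid_below m (s / T)) w)) \<longlonglongrightarrow> generator \<phi>t \<phi>x \<phi>xx s (X s w)"
              using continuous_on_tendsto_compose[OF continuous_generator tendsto_Pair] by fastforce
            then have "(\<lambda>m. if count s w < n then generator \<phi>t \<phi>x \<phi>xx (T * grid_below m (s / T)) (X (T * grid_below m (s / T)) w) else 0) \<longlonglongrightarrow> V s w"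
              using s by (auto simp: V_def max_def)
            moreover have "eventually (\<lambda>m. count (T * grid_below m (s / T)) w = count s w) sequentially"
              using count_at_left[OF w, of s] gl count_no_jump[OF elim] by (auto simp: filterlim_iff)
            then have "eventually (\<lambda>m. (if count s w < n then generator \<phi>t \<phi>x \<phi>xx (T * grid_below m (s / T)) (X (T * grid_below m (s / T)) w) else 0)
              = V (T * grid_below m (s / T)) w) sequentially"
              by eventually_elim (simp add: V_def nn)
            ultimately have "(\<lambda>m. V (T * grid_below m (s / T)) w) \<longlonglongrightarrow> V s w" by (rule Lim_transform_eventually)
            then show ?thesis using True by simp
          qed simp
        qed
      qed (use w in measurable)
    qed
  qed measurable
qed

text \<open>Conditioned at its left end, each cell contributes the mesh times the generator up to
  the one-step error, and these errors sum to something arbitrarily small.\<close>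

lemma diff_parts_tendsto:
  "(\<lambda>m. \<Sum>i<Suc m. \<integral>w. diff_part w (tg m i) (tg m (Suc i)) \<partial>M) \<longlonglongrightarrow>
    (\<integral>w. (\<integral>s. indicator {0<..T} s * V s w \<partial>lborel) \<partial>M)"
proof -
  let ?h = "\<lambda>m. T / real (Suc m)"
  define E where "E m i = (\<integral>w. diff_part w (tg m i) (tg m (Suc i)) \<partial>M) - ?h m * (\<integral>w. V (tg m i) w \<partial>M)" for m i
  have h0: "0 < ?h m" for m using T by simp
  have hlim: "?h \<longlonglongrightarrow> 0" using tendsto_mult_right_zero[OF LIMSEQ_inverse_real_of_nat, of T] by (simp add: divide_inverse)
  have "(\<lambda>m. \<Sum>i<Suc m. E m i) \<longlonglongrightarrow> 0"
  proof (rule LIMSEQ_I)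
    fix r :: real assume r: "0 < r"
    define S where "S = 1 + \<mu>\<^sup>2 + \<sigma>\<^sup>2"
    have S: "0 < S" by (simp add: S_def add_pos_nonneg)
    \<comment> \<open>Over all cells the error is at most T S e plus T K times the mesh; each of the
      two is made at most r/4.\<close>
    define e where "e = r / (4 * T * S)"
    have e: "0 < e" using r T S by (simp add: e_def)
    obtain K where K: "0 \<le> K" "\<And>t x h. 0 < h \<Longrightarrow> h \<le> 1 \<Longrightarrow>
      \<bar>(\<integral>y. \<phi> (t + h) (x + \<mu> * h + \<sigma> * y) \<partial>gauss h) - \<phi> t x - h * generator \<phi>t \<phi>x \<phi>xx t x\<bar> \<le> h * (e * S + K * h)"
      using one_step_estimate[OF \<phi> e] unfolding S_def by blast
    have "0 < min 1 (r / (4 * T * (K + 1)))" using r T K by simp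
    then have "eventually (\<lambda>m. ?h m < min 1 (r / (4 * T * (K + 1)))) sequentially" by (rule order_tendstoD(2)[OF hlim])
    then obtain m0 where m0: "\<And>m. m0 \<le> m \<Longrightarrow> ?h m < min 1 (r / (4 * T * (K + 1)))" by (auto simp: eventually_sequentially)
    show "\<exists>m0. \<forall>m\<ge>m0. norm ((\<Sum>i<Suc m. E m i) - 0) < r"
    proof (intro exI[of _ m0] allI impI)
      fix m assume m: "m0 \<le> m"
      have hm: "?h m \<le> 1" "?h m < r / (4 * T * (K + 1))" using m0[OF m] by auto
      have Ei: "\<bar>E m i\<bar> \<le> ?h m * (e * S + K * ?h m)" for i
      proof -
        let ?a = "tg m i" and ?b = "tg m (Suc i)"
        note ta = tg(1)[of m i] and tab = tg(3)[of m i] and tl = tg(4)[of m i]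
        note [measurable] = X_measurable[OF ta] measurable_count[OF ta]
        interpret G: prob_space "gauss (?h m)" by (rule prob_space_gauss[OF h0])
        let ?f = "\<lambda>w. if count ?a w < n then (\<integral>y. \<phi> (?a + ?h m) (X ?a w + \<mu> * ?h m + \<sigma> * y) \<partial>gauss (?h m)) - \<phi> ?a (X ?a w) else 0"
        have fm [measurable]: "?f \<in> borel_measurable M"
          by measurable
        have fb: "\<bar>?f w\<bar> \<le> 2 * B0" for w
        proof -
          have "\<bar>\<integral>y. \<phi> (?a + ?h m) (X ?a w + \<mu> * ?h m + \<sigma> * y) \<partial>gauss (?h m)\<bar> \<le> (\<integral>y. \<bar>\<phi> (?a + ?h m) (X ?a w + \<mu> * ?h m + \<sigma> * y)\<bar> \<partial>gauss (?h m))"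
            by (rule integral_abs_bound)
          also have "\<dots> \<le> (\<integral>y. B0 \<partial>gauss (?h m))"
            by (intro integral_mono G.integrable_const_bound[where B = B0]) (auto simp: test_function_bounds B0_nonneg)
          also have "\<dots> = B0" by (simp add: G.prob_space[unfolded space_gauss] del: of_nat_Suc)
          finally have "\<bar>\<integral>y. \<phi> (?a + ?h m) (X ?a w + \<mu> * ?h m + \<sigma> * y) \<partial>gauss (?h m)\<bar> \<le> B0" .
          moreover have "\<bar>\<phi> ?a (X ?a w)\<bar> \<le> B0" by (rule test_function_bounds)
          ultimately have "\<bar>(\<integral>y. \<phi> (?a + ?h m) (X ?a w + \<mu> * ?h m + \<sigma> * y) \<partial>gauss (?h m)) - \<phi> ?a (X ?a w)\<bar> \<le> 2 * B0" by linarith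
          then show ?thesis using B0_nonneg by auto
        qed
        have fi: "integrable M ?f" by (rule integrable_const_bound[where B = "2 * B0"]) (use fb in auto)
        have Vi: "integrable M (\<lambda>w. ?h m * V ?a w)"
          by (intro integrable_mult_right integrable_const_bound[where B = "B + \<bar>\<mu>\<bar> * B + \<sigma>\<^sup>2 / 2 * B"]) (use V_bound in auto)
        have Eeq: "E m i = (\<integral>w. ?f w - ?h m * V ?a w \<partial>M)"
          unfolding E_def expectation_diff_part[OF ta tab] tl using fi Vi by simp
        have "\<bar>E m i\<bar> \<le> (\<integral>w. \<bar>?f w - ?h m * V ?a w\<bar> \<partial>M)"
          unfolding Eeq by (rule integral_abs_bound)
        also have "\<dots> \<le> (\<integral>w. ?h m * (e * S + K * ?h m) \<partial>M)"
        proof (rule integral_mono)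
          show "integrable M (\<lambda>w. \<bar>?f w - ?h m * V ?a w\<bar>)" using fi Vi by auto
          fix w
          have "0 \<le> ?h m" using h0[of m] by (rule less_imp_le)
          then have "0 \<le> ?h m * (e * S + K * ?h m)"
            using e S K by (intro mult_nonneg_nonneg add_nonneg_nonneg) (auto intro: less_imp_le)
          then show "\<bar>?f w - ?h m * V ?a w\<bar> \<le> ?h m * (e * S + K * ?h m)"
            using K(2)[OF h0 hm(1), of ?a "X ?a w"] ta by (auto simp: V_def max_def)
        qed simp
        finally show ?thesis by (simp add: prob_space)
      qed
      have "\<bar>\<Sum>i<Suc m. E m i\<bar> \<le> (\<Sum>i<Suc m. \<bar>E m i\<bar>)" by (rule sum_abs)
      also have "\<dots> \<le> (\<Sum>i<Suc m. ?h m * (e * S + K * ?h m))" by (intro sum_mono Ei)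
      also have "\<dots> = (real (Suc m) * ?h m) * (e * S + K * ?h m)" by (simp only: sum_constant card_lessThan mult.assoc)
      also have "real (Suc m) * ?h m = T" by (simp del: of_nat_Suc)
      also have "T * (e * S + K * ?h m) = T * (e * S) + T * K * ?h m" by (simp only: distrib_left mult.assoc)
      also have "\<dots> < r"
      proof -
        have "T * (e * S) = r / 4" using T S by (simp add: e_def)
        moreover have "T * K * ?h m \<le> r / 4"
        proof -
          have "T * K * ?h m \<le> T * (K + 1) * (r / (4 * T * (K + 1)))"
            using hm(2) T K h0[of m] by (intro mult_mono) auto
          also have "\<dots> = r / 4"
          proof -
            have "0 < T * (K + 1)" using T K by simp
            then show ?thesis by (simp add: field_simps)
          qed
          finally show ?thesis .
        qed
        ultimately show ?thesis using r by linarith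
      qed
      finally show "norm ((\<Sum>i<Suc m. E m i) - 0) < r" by simp
    qed
  qed
  from tendsto_add[OF this V_sums_tendsto] show ?thesis
    by (simp add: E_def sum_subtractf del: sum.lessThan_Suc)
qed

text \<open>The stopped telescoping sum ends at \<phi>(T, X(T)) unless n jumps have occurred by T,
  and then the two values of \<phi> differ by at most 2 B0. An inequality with the probability of
  that event replaces the formula at a stopping time.\<close>

lemma dynkin_localized_aux:
  "\<bar>(\<integral>w. (\<Sum>s\<in>N w \<inter> {0<..T}. if countL s w < n then \<phi> s (XL s w / \<theta>) - \<phi> s (XL s w) else 0) \<partial>M) +
    (\<integral>w. (\<integral>s. indicator {0<..T} s * V s w \<partial>lborel) \<partial>M) - ((\<integral>w. \<phi> T (X T w) \<partial>M) - \<phi> 0 x0)\<bar>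
    \<le> 2 * B0 * prob {w \<in> space M. n \<le> count T w}"
proof -
  let ?J = "\<lambda>w. \<Sum>s\<in>N w \<inter> {0<..T}. if countL s w < n then \<phi> s (XL s w / \<theta>) - \<phi> s (XL s w) else 0"
  let ?Jm = "\<lambda>m w. \<Sum>i<Suc m. jump_part w (tg m i) (tg m (Suc i))"
  have [measurable]: "(\<lambda>w. jump_part w (tg m i) (tg m (Suc i))) \<in> borel_measurable M"
    "(\<lambda>w. diff_part w (tg m i) (tg m (Suc i))) \<in> borel_measurable M" for m i
    by (auto intro!: measurable_parts tg)
  have Jm: "?J \<in> borel_measurable M"
  proof (rule borel_measurable_LIMSEQ_metric[where f = ?Jm])
    show "?Jm m \<in> borel_measurable M" for m by measurable
  qed (rule jump_parts_tendsto)
  have Jlim: "(\<lambda>m. \<integral>w. ?Jm m w \<partial>M) \<longlonglongrightarrow> (\<integral>w. ?J w \<partial>M)"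
    by (rule integral_dominated_convergence[where w = "\<lambda>_. 2 * B0 * real n"])
      (use Jm jump_parts_bound jump_parts_tendsto in \<open>auto intro!: AE_I2 simp del: sum.lessThan_Suc\<close>)
  note T0 = less_imp_le[OF T]
  note [measurable] = X_measurable[OF T0] measurable_count[OF T0]
  have \<phi>T: "integrable M (\<lambda>w. \<phi> T (X T w))" by (rule integrable_const_bound[where B = B0]) (auto simp: test_function_bounds)
  have bound: "\<bar>(\<integral>w. ?Jm m w \<partial>M) + (\<Sum>i<Suc m. \<integral>w. diff_part w (tg m i) (tg m (Suc i)) \<partial>M) -
      ((\<integral>w. \<phi> T (X T w) \<partial>M) - \<phi> 0 x0)\<bar> \<le> 2 * B0 * prob {w \<in> space M. n \<le> count T w}" for m
  proof -
    let ?D = "\<lambda>w. \<Sum>i<Suc m. diff_part w (tg m i) (tg m (Suc i))"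
    have di: "integrable M (\<lambda>w. diff_part w (tg m i) (tg m (Suc i)))" for i
    proof (rule integrable_const_bound[where B = "2 * B0"])
      show "AE w in M. norm (diff_part w (tg m i) (tg m (Suc i))) \<le> 2 * B0"
        using abs_\<phi>_diff B0_nonneg by (intro AE_I2) (auto simp: diff_part_def)
    qed measurable
    have Ji: "integrable M (?Jm m)"
      by (rule integrable_const_bound[where B = "2 * B0 * real n"]) (use jump_parts_bound in \<open>auto intro!: AE_I2 simp del: sum.lessThan_Suc\<close>)
    have eq: "(\<integral>w. ?Jm m w \<partial>M) + (\<Sum>i<Suc m. \<integral>w. diff_part w (tg m i) (tg m (Suc i)) \<partial>M) - ((\<integral>w. \<phi> T (X T w) \<partial>M) - \<phi> 0 x0) =
      (\<integral>w. ?Jm m w + ?D w - (\<phi> T (X T w) - \<phi> 0 x0) \<partial>M)"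
      using Ji di \<phi>T by (simp add: Bochner_Integration.integral_sum prob_space del: sum.lessThan_Suc)
    have "\<bar>(\<integral>w. ?Jm m w \<partial>M) + (\<Sum>i<Suc m. \<integral>w. diff_part w (tg m i) (tg m (Suc i)) \<partial>M) - ((\<integral>w. \<phi> T (X T w) \<partial>M) - \<phi> 0 x0)\<bar>
      \<le> (\<integral>w. \<bar>?Jm m w + ?D w - (\<phi> T (X T w) - \<phi> 0 x0)\<bar> \<partial>M)"
      unfolding eq by (rule integral_abs_bound)
    also have "\<dots> \<le> (\<integral>w. 2 * B0 * indicator {w \<in> space M. n \<le> count T w} w \<partial>M)"
    proof (rule integral_mono)
      show "integrable M (\<lambda>w. \<bar>?Jm m w + ?D w - (\<phi> T (X T w) - \<phi> 0 x0)\<bar>)"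
        by (intro integrable_abs Bochner_Integration.integrable_diff[OF Bochner_Integration.integrable_add[OF Ji Bochner_Integration.integrable_sum[OF di]]]
          Bochner_Integration.integrable_diff \<phi>T integrable_const)
      show "integrable M (\<lambda>w. 2 * B0 * indicator {w \<in> space M. n \<le> count T w} w)"
        by (intro integrable_mult_right integrable_real_indicator) (auto simp: emeasure_eq_measure)
      fix w assume w: "w \<in> space M"
      let ?a = "\<lambda>i. \<phi> (tg m i) (X (tg m i) w)"
      have "jump_part w (tg m i) (tg m (Suc i)) + diff_part w (tg m i) (tg m (Suc i)) =
        (if count (tg m i) w < n then ?a (Suc i) - ?a i else 0)" for i
        using X_increment[OF w tg(1,2)[of m i]] count_eq_iff[OF w tg(1,2)[of m i]]
        by (auto simp: jump_part_def diff_part_def)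
      then have "?Jm m w + ?D w = (\<Sum>i<Suc m. if count (tg m i) w < n then ?a (Suc i) - ?a i else 0)"
        by (simp add: sum.distrib[symmetric] del: sum.lessThan_Suc)
      moreover obtain j where "(\<Sum>i<Suc m. if count (tg m i) w < n then ?a (Suc i) - ?a i else 0) = ?a j - ?a 0"
        "count (tg m (Suc m)) w < n \<longrightarrow> j = Suc m"
        using stopped_telescope[OF mono_count_tg[OF w], of "Suc m" m n ?a] by blast
      ultimately have *: "?Jm m w + ?D w = ?a j - \<phi> 0 x0" "count T w < n \<longrightarrow> j = Suc m"
        by (simp_all add: tg X_0[OF w] del: sum.lessThan_Suc)
      show "\<bar>?Jm m w + ?D w - (\<phi> T (X T w) - \<phi> 0 x0)\<bar> \<le> 2 * B0 * indicator {w \<in> space M. n \<le> count T w} w"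
        unfolding *(1) using *(2) w abs_\<phi>_diff[of "tg m j" "X (tg m j) w" T "X T w"]
        by (cases "count T w < n") (auto simp: tg)
    qed
    also have "\<dots> = 2 * B0 * prob {w \<in> space M. n \<le> count T w}" by (simp add: Int_absorb2)
    finally show ?thesis .
  qed
  have "(\<lambda>m. \<bar>(\<integral>w. ?Jm m w \<partial>M) + (\<Sum>i<Suc m. \<integral>w. diff_part w (tg m i) (tg m (Suc i)) \<partial>M) -
      ((\<integral>w. \<phi> T (X T w) \<partial>M) - \<phi> 0 x0)\<bar>) \<longlonglongrightarrow>
    \<bar>(\<integral>w. ?J w \<partial>M) + (\<integral>w. (\<integral>s. indicator {0<..T} s * V s w \<partial>lborel) \<partial>M) - ((\<integral>w. \<phi> T (X T w) \<partial>M) - \<phi> 0 x0)\<bar>"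
    by (intro tendsto_rabs tendsto_diff tendsto_add tendsto_const Jlim diff_parts_tendsto)
  then show ?thesis by (rule tendsto_upperbound) (auto intro!: always_eventually bound simp del: sum.lessThan_Suc)
qed

theorem dynkin_localized:
  "\<bar>(\<integral>w. (\<Sum>s\<in>N w \<inter> {0<..T}. if countL s w < n then \<phi> s (XL s w / \<theta>) - \<phi> s (XL s w) else 0) \<partial>M) +
    (\<integral>w. (\<integral>s. indicator {0<..T} s * (if count (max 0 s) w < n then generator \<phi>t \<phi>x \<phi>xx s (X (max 0 s) w) else 0) \<partial>lborel) \<partial>M)
      - ((\<integral>w. \<phi> T (X T w) \<partial>M) - \<phi> 0 x0)\<bar>
    \<le> 2 * B0 * prob {w \<in> space M. n \<le> count T w}"
  using dynkin_localized_aux unfolding V_def .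

end

declare measurable_\<phi>_comp [measurable del (raw)] measurable_generator_comp [measurable del (raw)]
  measurable_\<phi> [measurable del]

end

section \<open>Finiteness of the expected number of jumps\<close>

lemma test_function_of_space:
  assumes "\<And>x. (v has_real_derivative v1 x) (at x)" "\<And>x. (v1 has_real_derivative v2 x) (at x)"
    and "\<And>x. \<bar>v x\<bar> \<le> B0" "\<And>x. \<bar>v1 x\<bar> \<le> B" "\<And>x. \<bar>v2 x\<bar> \<le> B" "uniformly_continuous_on UNIV v2"
  shows "test_function (\<lambda>_. v) (\<lambda>_ _. 0) (\<lambda>_. v1) (\<lambda>_. v2) B0 B"
proof -
  have "0 \<le> B" using assms(4)[of 0] by linarith
  moreover have "continuous_on UNIV v" "continuous_on UNIV v1"
    using assms(1,2) by (auto intro!: continuous_at_imp_continuous_on DERIV_isCont)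
  then have "continuous_on UNIV (\<lambda>z :: real \<times> real. v (snd z))" "continuous_on UNIV (\<lambda>z :: real \<times> real. v1 (snd z))"
    by (auto intro: continuous_on_compose2[OF _ continuous_on_snd[OF continuous_on_id]])
  moreover have "uniformly_continuous_on UNIV (\<lambda>z :: real \<times> real. v2 (snd z))"
    using uniformly_continuous_on_compose[OF bounded_linear.uniformly_continuous_on[OF bounded_linear_snd uniformly_continuous_on_id], of UNIV v2]
      assms(6) by (simp add: o_def)
  moreover have "uniformly_continuous_on UNIV (\<lambda>z :: real \<times> real. 0 :: real)" by (simp add: uniformly_continuous_on_const)
  ultimately show ?thesis using assms unfolding test_function_def by auto
qed

text \<open>A smooth substitute for ln |x| at distances above \<open>a\<close> from 0, where
  dividing x by \<theta> lowers it by an amount bounded away from 0.\<close>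

definition log_barrier :: "real \<Rightarrow> real \<Rightarrow> real" where
  "log_barrier a x = ln (1 + x\<^sup>2 / a\<^sup>2) / 2"

lemma sum_squares_pos: "0 < (a::real) \<Longrightarrow> 0 < a\<^sup>2 + x\<^sup>2"
  by (simp add: add_pos_nonneg)

lemma log_barrier_derivatives:
  assumes a: "0 < a"
  shows "(log_barrier a has_real_derivative x / (a\<^sup>2 + x\<^sup>2)) (at x)"
    and "((\<lambda>x. x / (a\<^sup>2 + x\<^sup>2)) has_real_derivative (a\<^sup>2 - x\<^sup>2) / (a\<^sup>2 + x\<^sup>2)\<^sup>2) (at x)"
    and "((\<lambda>x. (a\<^sup>2 - x\<^sup>2) / (a\<^sup>2 + x\<^sup>2)\<^sup>2) has_real_derivative - 2 * x * (3 * a\<^sup>2 - x\<^sup>2) / (a\<^sup>2 + x\<^sup>2) ^ 3) (at x)"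
proof -
  note p = sum_squares_pos[OF a, of x]
  have q: "0 < 1 + x\<^sup>2 / a\<^sup>2" by (intro add_pos_nonneg) auto
  have d2: "((\<lambda>x. a\<^sup>2 + x\<^sup>2) has_real_derivative 2 * x) (at x)"
    using DERIV_add[OF DERIV_const[of "a\<^sup>2"] DERIV_power[OF DERIV_ident, of 2]] by simp
  have d1: "((\<lambda>x. 1 + x\<^sup>2 / a\<^sup>2) has_real_derivative 2 * x / a\<^sup>2) (at x)"
    using DERIV_add[OF DERIV_const[of 1] DERIV_cdivide[OF DERIV_power[OF DERIV_ident, of 2], of "a\<^sup>2"]] by simp
  have "(log_barrier a has_real_derivative (2 * x / a\<^sup>2) * inverse (1 + x\<^sup>2 / a\<^sup>2) / 2) (at x)"
    using DERIV_cdivide[OF DERIV_chain2[OF DERIV_ln[OF q] d1], of 2] unfolding log_barrier_def[abs_def]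
    by (simp only: mult.commute)
  moreover have "(2 * x / a\<^sup>2) * inverse (1 + x\<^sup>2 / a\<^sup>2) / 2 = x / (a\<^sup>2 + x\<^sup>2)"
    using a p q by (simp add: field_simps)
  ultimately show "(log_barrier a has_real_derivative x / (a\<^sup>2 + x\<^sup>2)) (at x)" by simp
  have "((\<lambda>x. x / (a\<^sup>2 + x\<^sup>2)) has_real_derivative (1 * (a\<^sup>2 + x\<^sup>2) - x * (2 * x)) / ((a\<^sup>2 + x\<^sup>2) * (a\<^sup>2 + x\<^sup>2))) (at x)"
    by (rule DERIV_divide[OF DERIV_ident d2 less_imp_neq[OF p, THEN not_sym]])
  then show "((\<lambda>x. x / (a\<^sup>2 + x\<^sup>2)) has_real_derivative (a\<^sup>2 - x\<^sup>2) / (a\<^sup>2 + x\<^sup>2)\<^sup>2) (at x)"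
    by (simp add: power2_eq_square)
  have "((\<lambda>x. (a\<^sup>2 - x\<^sup>2) / (a\<^sup>2 + x\<^sup>2)\<^sup>2) has_real_derivative
    ((- (2 * x)) * (a\<^sup>2 + x\<^sup>2)\<^sup>2 - (a\<^sup>2 - x\<^sup>2) * (2 * (a\<^sup>2 + x\<^sup>2) * (2 * x))) / ((a\<^sup>2 + x\<^sup>2)\<^sup>2 * (a\<^sup>2 + x\<^sup>2)\<^sup>2)) (at x)"
  proof -
    have d3: "((\<lambda>x. a\<^sup>2 - x\<^sup>2) has_real_derivative - (2 * x)) (at x)"
      using DERIV_diff[OF DERIV_const[of "a\<^sup>2"] DERIV_power[OF DERIV_ident, of 2]] by simp
    have d4: "((\<lambda>x. (a\<^sup>2 + x\<^sup>2)\<^sup>2) has_real_derivative 2 * (a\<^sup>2 + x\<^sup>2) * (2 * x)) (at x)"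
      using DERIV_power[OF d2, of 2] by (simp add: mult_ac)
    show ?thesis by (rule DERIV_divide[OF d3 d4 power_not_zero[OF less_imp_neq[OF p, THEN not_sym]]])
  qed
  moreover have "((- (2 * x)) * (a\<^sup>2 + x\<^sup>2)\<^sup>2 - (a\<^sup>2 - x\<^sup>2) * (2 * (a\<^sup>2 + x\<^sup>2) * (2 * x))) / ((a\<^sup>2 + x\<^sup>2)\<^sup>2 * (a\<^sup>2 + x\<^sup>2)\<^sup>2) =
    - 2 * x * (3 * a\<^sup>2 - x\<^sup>2) / (a\<^sup>2 + x\<^sup>2) ^ 3"
  proof -
    define y where "y = a\<^sup>2 + x\<^sup>2"
    have num: "(- (2 * x)) * y\<^sup>2 - (a\<^sup>2 - x\<^sup>2) * (2 * y * (2 * x)) = (- 2 * x * (3 * a\<^sup>2 - x\<^sup>2)) * y"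
      by (simp add: y_def power2_eq_square algebra_simps)
    have den: "y\<^sup>2 * y\<^sup>2 = y ^ 3 * y" by (simp add: power2_eq_square power3_eq_cube)
    have "y \<noteq> 0" unfolding y_def by (rule less_imp_neq[OF p, THEN not_sym])
    then show ?thesis unfolding y_def[symmetric] num den by simp
  qed
  ultimately show "((\<lambda>x. (a\<^sup>2 - x\<^sup>2) / (a\<^sup>2 + x\<^sup>2)\<^sup>2) has_real_derivative - 2 * x * (3 * a\<^sup>2 - x\<^sup>2) / (a\<^sup>2 + x\<^sup>2) ^ 3) (at x)"
    by simp
qed

text \<open>The bound for the third derivative serves the uniform continuity of the second.\<close>

lemma log_barrier_derivative_bounds:
  fixes a x :: real
  assumes a: "0 < a"
  shows "\<bar>x / (a\<^sup>2 + x\<^sup>2)\<bar> \<le> 1 / a" "\<bar>(a\<^sup>2 - x\<^sup>2) / (a\<^sup>2 + x\<^sup>2)\<^sup>2\<bar> \<le> 1 / a\<^sup>2"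
    "\<bar>- 2 * x * (3 * a\<^sup>2 - x\<^sup>2) / (a\<^sup>2 + x\<^sup>2) ^ 3\<bar> \<le> 6 / a ^ 3"
proof -
  note p = sum_squares_pos[OF a, of x]
  have ax: "a * \<bar>x\<bar> \<le> a\<^sup>2 + x\<^sup>2"
    using sum_squares_bound[of a "\<bar>x\<bar>"] a p mult_nonneg_nonneg[of a "\<bar>x\<bar>"] by auto
  show 1: "\<bar>x / (a\<^sup>2 + x\<^sup>2)\<bar> \<le> 1 / a"
    using ax a p by (simp add: abs_mult field_simps)
  have i: "1 / (a\<^sup>2 + x\<^sup>2) \<le> 1 / a\<^sup>2" using a p by (intro divide_left_mono) auto
  have "\<bar>a\<^sup>2 - x\<^sup>2\<bar> \<le> a\<^sup>2 + x\<^sup>2" by (simp add: abs_le_iff)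
  then have "\<bar>(a\<^sup>2 - x\<^sup>2) / (a\<^sup>2 + x\<^sup>2)\<^sup>2\<bar> \<le> (a\<^sup>2 + x\<^sup>2) / (a\<^sup>2 + x\<^sup>2)\<^sup>2"
    by (simp add: divide_right_mono)
  also have "\<dots> = 1 / (a\<^sup>2 + x\<^sup>2)" using p by (simp add: power2_eq_square)
  finally show "\<bar>(a\<^sup>2 - x\<^sup>2) / (a\<^sup>2 + x\<^sup>2)\<^sup>2\<bar> \<le> 1 / a\<^sup>2" using i by simp
  have "\<bar>- 2 * x * (3 * a\<^sup>2 - x\<^sup>2) / (a\<^sup>2 + x\<^sup>2) ^ 3\<bar> = 2 * \<bar>x / (a\<^sup>2 + x\<^sup>2)\<bar> * (\<bar>3 * a\<^sup>2 - x\<^sup>2\<bar> / (a\<^sup>2 + x\<^sup>2)\<^sup>2)"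
    using p by (simp add: abs_mult power2_eq_square power3_eq_cube)
  also have "\<dots> \<le> 2 * (1 / a) * (3 * (a\<^sup>2 + x\<^sup>2) / (a\<^sup>2 + x\<^sup>2)\<^sup>2)"
    using 1 a by (intro mult_mono divide_right_mono) (auto simp: abs_le_iff)
  also have "3 * (a\<^sup>2 + x\<^sup>2) / (a\<^sup>2 + x\<^sup>2)\<^sup>2 = 3 * (1 / (a\<^sup>2 + x\<^sup>2))"
  proof -
    have "3 * y / y\<^sup>2 = 3 * (1 / y)" if "0 < y" for y :: real using that by (simp add: power2_eq_square)
    then show ?thesis using p by blast
  qed
  also have "2 * (1 / a) * (3 * (1 / (a\<^sup>2 + x\<^sup>2))) \<le> 2 * (1 / a) * (3 * (1 / a\<^sup>2))"
    using i a by (intro mult_left_mono) auto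
  also have "\<dots> = 6 / a ^ 3" by (simp add: power2_eq_square power3_eq_cube)
  finally show "\<bar>- 2 * x * (3 * a\<^sup>2 - x\<^sup>2) / (a\<^sup>2 + x\<^sup>2) ^ 3\<bar> \<le> 6 / a ^ 3" .
qed

lemma uniformly_continuous_of_bounded_derivative:
  fixes f :: "real \<Rightarrow> real"
  assumes d: "\<And>x. (f has_real_derivative f' x) (at x)" and b: "\<And>x. \<bar>f' x\<bar> \<le> C"
  shows "uniformly_continuous_on UNIV f"
proof -
  have "\<bar>f x - f y\<bar> \<le> C * \<bar>x - y\<bar>" for x y
    using field_differentiable_bound[of UNIV f f' C x y] d b by simp
  moreover have "0 \<le> C" using b[of 0] by linarith
  ultimately have "C-lipschitz_on UNIV f" by (auto simp: lipschitz_on_def dist_real_def)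
  then show ?thesis by (rule lipschitz_on_uniformly_continuous)
qed

text \<open>The barrier itself is unbounded. Subtracting the one at the larger scale
  \<open>R\<close> bounds it by ln (R/a), while the bounds 2/a and 2/a^2 for the derivatives do not
  involve \<open>R\<close>.\<close>

lemma log_barrier_diff_test_function:
  assumes a: "0 < a" "a < R"
  defines "v \<equiv> \<lambda>x. log_barrier a x - log_barrier R x"
    and "v1 \<equiv> \<lambda>x. x / (a\<^sup>2 + x\<^sup>2) - x / (R\<^sup>2 + x\<^sup>2)"
    and "v2 \<equiv> \<lambda>x. (a\<^sup>2 - x\<^sup>2) / (a\<^sup>2 + x\<^sup>2)\<^sup>2 - (R\<^sup>2 - x\<^sup>2) / (R\<^sup>2 + x\<^sup>2)\<^sup>2"
  shows "\<bar>v1 x\<bar> \<le> 2 / a" "\<bar>v2 x\<bar> \<le> 2 / a\<^sup>2" "0 \<le> v x" "v x \<le> ln (R / a)"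
    and "test_function (\<lambda>_. v) (\<lambda>_ _. 0) (\<lambda>_. v1) (\<lambda>_. v2) (ln (R / a)) (2 / a + 2 / a\<^sup>2)"
proof -
  have R: "0 < R" using a by simp
  have v1: "\<bar>v1 x\<bar> \<le> 2 / a" for x
  proof -
    have "1 / R \<le> 1 / a" using a by (intro divide_left_mono) auto
    then show ?thesis
      using log_barrier_derivative_bounds(1)[OF a(1), of x] log_barrier_derivative_bounds(1)[OF R, of x] unfolding v1_def by linarith
  qed
  have v2: "\<bar>v2 x\<bar> \<le> 2 / a\<^sup>2" for x
  proof -
    have "1 / R\<^sup>2 \<le> 1 / a\<^sup>2" using a by (intro divide_left_mono power_mono) auto
    then show ?thesis
      using log_barrier_derivative_bounds(2)[OF a(1), of x] log_barrier_derivative_bounds(2)[OF R, of x] unfolding v2_def by linarith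
  qed
  have aR: "a\<^sup>2 \<le> R\<^sup>2" using a by (intro power_mono) auto
  have pos: "0 < 1 + x\<^sup>2 / c\<^sup>2" for x c :: real by (intro add_pos_nonneg) auto
  have v0: "0 \<le> v x" for x
  proof -
    have "x\<^sup>2 / R\<^sup>2 \<le> x\<^sup>2 / a\<^sup>2" using a aR by (intro divide_left_mono) auto
    then have "ln (1 + x\<^sup>2 / R\<^sup>2) \<le> ln (1 + x\<^sup>2 / a\<^sup>2)" using pos by (subst ln_le_cancel_iff) auto
    then show ?thesis by (simp add: v_def log_barrier_def)
  qed
  have vle: "v x \<le> ln (R / a)" for x
  proof -
    have "(R / a)\<^sup>2 * (1 + x\<^sup>2 / R\<^sup>2) = (R / a)\<^sup>2 + x\<^sup>2 / a\<^sup>2"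
      using a R by (simp add: power_divide distrib_left)
    moreover have "1 \<le> (R / a)\<^sup>2" using a by (intro one_le_power) simp
    ultimately have "1 + x\<^sup>2 / a\<^sup>2 \<le> (R / a)\<^sup>2 * (1 + x\<^sup>2 / R\<^sup>2)" by simp
    then have "ln (1 + x\<^sup>2 / a\<^sup>2) \<le> ln ((R / a)\<^sup>2 * (1 + x\<^sup>2 / R\<^sup>2))"
      using pos[of x a] pos[of x R] a R by (subst ln_le_cancel_iff) auto
    also have "\<dots> = 2 * ln (R / a) + ln (1 + x\<^sup>2 / R\<^sup>2)"
      using pos[of x R] a R by (simp add: ln_mult ln_realpow)
    finally show ?thesis by (simp add: v_def log_barrier_def)
  qed
  show "\<bar>v1 x\<bar> \<le> 2 / a" "\<bar>v2 x\<bar> \<le> 2 / a\<^sup>2" "0 \<le> v x" "v x \<le> ln (R / a)" by (fact v1 v2 v0 vle)+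
  show "test_function (\<lambda>_. v) (\<lambda>_ _. 0) (\<lambda>_. v1) (\<lambda>_. v2) (ln (R / a)) (2 / a + 2 / a\<^sup>2)"
  proof (rule test_function_of_space)
    show "(v has_real_derivative v1 x) (at x)" for x
      unfolding v_def v1_def by (intro DERIV_diff log_barrier_derivatives a R)
    show "(v1 has_real_derivative v2 x) (at x)" for x
      unfolding v1_def v2_def by (intro DERIV_diff log_barrier_derivatives a R)
    have "0 \<le> 2 / a" "0 \<le> 2 / a\<^sup>2" using a by auto
    then show "\<bar>v1 x\<bar> \<le> 2 / a + 2 / a\<^sup>2" "\<bar>v2 x\<bar> \<le> 2 / a + 2 / a\<^sup>2" for x using v1[of x] v2[of x] by linarith+
    show "\<bar>v x\<bar> \<le> ln (R / a)" for x using v0[of x] vle[of x] by simp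
    show "uniformly_continuous_on UNIV v2"
      unfolding v2_def
      by (intro uniformly_continuous_on_diff
        uniformly_continuous_of_bounded_derivative[OF log_barrier_derivatives(3)[OF a(1)] log_barrier_derivative_bounds(3)[OF a(1)]]
        uniformly_continuous_of_bounded_derivative[OF log_barrier_derivatives(3)[OF R] log_barrier_derivative_bounds(3)[OF R]])
  qed
qed

text \<open>\<open>c\<close> is the drop of \<open>log_barrier a\<close> at |x| = a, where it is
  smallest among |x| \<ge> a. The subtracted barrier drops by at most its own value, which is at
  most x^2/(2 R^2) and thus at most c/2 for |x| \<le> R sqrt c.\<close>

lemma log_barrier_drop:
  assumes a: "0 < a" "a < R" and s: "0 \<le> s" "s < 1"
  defines "v \<equiv> \<lambda>x. log_barrier a x - log_barrier R x" and "c \<equiv> ln (2 / (1 + s\<^sup>2)) / 2"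
  shows "0 \<le> v x - v (s * x)" and "0 < c"
    and "a \<le> \<bar>x\<bar> \<Longrightarrow> \<bar>x\<bar> \<le> R * sqrt c \<Longrightarrow> c / 2 \<le> v x - v (s * x)"
proof -
  have R: "0 < R" using a by simp
  have pos: "0 < b\<^sup>2 + y\<^sup>2" if "0 < b" for b y :: real using that by (rule sum_squares_pos)
  have s2: "s\<^sup>2 < 1" using s by (simp add: abs_square_less_1)
  show c0: "0 < c" unfolding c_def using s2 by (simp add: add_pos_nonneg)
  have drop: "log_barrier b x - log_barrier b (s * x) = ln ((b\<^sup>2 + x\<^sup>2) / (b\<^sup>2 + (s * x)\<^sup>2)) / 2" if b: "0 < b" for b
  proof -
    have "1 + y\<^sup>2 / b\<^sup>2 = (b\<^sup>2 + y\<^sup>2) / b\<^sup>2" for y using b by (simp add: field_simps)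
    then have lb: "log_barrier b y = (ln (b\<^sup>2 + y\<^sup>2) - ln (b\<^sup>2)) / 2" for y
      using pos[OF b, of y] b by (simp add: log_barrier_def ln_div)
    have "ln ((b\<^sup>2 + x\<^sup>2) / (b\<^sup>2 + (s * x)\<^sup>2)) = ln (b\<^sup>2 + x\<^sup>2) - ln (b\<^sup>2 + (s * x)\<^sup>2)"
      by (rule ln_divide_pos[OF pos[OF b] pos[OF b]])
    then show ?thesis unfolding lb by argo
  qed
  have sx: "(s * x)\<^sup>2 \<le> x\<^sup>2" using s s2 by (simp add: power_mult_distrib mult_left_le_one_le)
  have aR: "a\<^sup>2 \<le> R\<^sup>2" using a by (intro power_mono) auto
  have "(R\<^sup>2 + x\<^sup>2) / (R\<^sup>2 + (s * x)\<^sup>2) \<le> (a\<^sup>2 + x\<^sup>2) / (a\<^sup>2 + (s * x)\<^sup>2)"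
  proof -
    have "0 \<le> (R\<^sup>2 - a\<^sup>2) * (x\<^sup>2 - (s * x)\<^sup>2)" using sx aR by (intro mult_nonneg_nonneg) auto
    then have "(R\<^sup>2 + x\<^sup>2) * (a\<^sup>2 + (s * x)\<^sup>2) \<le> (a\<^sup>2 + x\<^sup>2) * (R\<^sup>2 + (s * x)\<^sup>2)" by (simp add: algebra_simps)
    then show ?thesis using pos[OF a(1)] pos[OF R] by (simp add: divide_le_eq pos_le_divide_eq mult.commute)
  qed
  then have "ln ((R\<^sup>2 + x\<^sup>2) / (R\<^sup>2 + (s * x)\<^sup>2)) \<le> ln ((a\<^sup>2 + x\<^sup>2) / (a\<^sup>2 + (s * x)\<^sup>2))"
    using pos[OF a(1)] pos[OF R] by (subst ln_le_cancel_iff) auto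
  then show "0 \<le> v x - v (s * x)"
    using drop[OF a(1)] drop[OF R] by (simp add: v_def)
  assume x: "a \<le> \<bar>x\<bar>" "\<bar>x\<bar> \<le> R * sqrt c"
  have "2 / (1 + s\<^sup>2) \<le> (a\<^sup>2 + x\<^sup>2) / (a\<^sup>2 + (s * x)\<^sup>2)"
  proof -
    have "a\<^sup>2 \<le> x\<^sup>2" using x a by (simp add: abs_le_square_iff[symmetric])
    then have "0 \<le> (x\<^sup>2 - a\<^sup>2) * (1 - s\<^sup>2)" using s2 by (intro mult_nonneg_nonneg) auto
    then have "2 * (a\<^sup>2 + (s * x)\<^sup>2) \<le> (a\<^sup>2 + x\<^sup>2) * (1 + s\<^sup>2)" by (simp add: algebra_simps power_mult_distrib)
    then show ?thesis using pos[OF a(1), of "s * x"] by (simp add: divide_le_eq pos_le_divide_eq add_pos_nonneg mult.commute)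
  qed
  then have "ln (2 / (1 + s\<^sup>2)) \<le> ln ((a\<^sup>2 + x\<^sup>2) / (a\<^sup>2 + (s * x)\<^sup>2))"
    using pos[OF a(1)] by (subst ln_le_cancel_iff) (auto intro!: divide_pos_pos add_pos_nonneg)
  then have 1: "c \<le> log_barrier a x - log_barrier a (s * x)" unfolding drop[OF a(1)] c_def by simp
  have "log_barrier R x - log_barrier R (s * x) \<le> log_barrier R x"
    unfolding log_barrier_def by (simp add: ln_ge_zero)
  also have "\<dots> \<le> (x\<^sup>2 / R\<^sup>2) / 2" unfolding log_barrier_def by (intro divide_right_mono ln_add_one_self_le_self) auto
  also have "x\<^sup>2 / R\<^sup>2 \<le> c"
  proof -
    have "\<bar>x\<bar>\<^sup>2 \<le> (R * sqrt c)\<^sup>2" using x by (intro power_mono) auto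
    then show ?thesis using R c0 by (simp add: power_mult_distrib pos_divide_le_eq mult.commute)
  qed
  finally show "c / 2 \<le> v x - v (s * x)" using 1 by (simp add: v_def)
qed

section \<open>Newtonian potentials of bump functions\<close>

lemma antiderivative_exists:
  fixes f :: "real \<Rightarrow> real"
  assumes "continuous_on UNIV f"
  shows "\<exists>F. \<forall>x. (F has_real_derivative f x) (at x)"
  using einterval_antiderivative[of "-\<infinity>" \<infinity> f] assms
  by (auto simp: continuous_on_eq_continuous_at has_real_derivative_iff_has_vector_derivative)

lemma antiderivative_of_bump:
  fixes f :: "real \<Rightarrow> real"
  assumes e: "0 < e" and c: "continuous_on UNIV f" and nn: "\<And>x. 0 \<le> f x" and supp: "\<And>x. e \<le> \<bar>x\<bar> \<Longrightarrow> f x = 0"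
  obtains F where "\<And>x. (F has_real_derivative f x) (at x)" "\<And>x. 0 \<le> F x" "\<And>x. F x \<le> (\<integral>x. f x \<partial>lborel)"
    "\<And>x. x \<le> - e \<Longrightarrow> F x = 0" "\<And>x. e \<le> x \<Longrightarrow> F x = (\<integral>x. f x \<partial>lborel)"
proof -
  obtain G where G: "\<And>x. (G has_real_derivative f x) (at x)" using antiderivative_exists[OF c] by blast
  define F where "F x = G x - G (- e)" for x
  have F: "(F has_real_derivative f x) (at x)" for x
    using DERIV_diff[OF G DERIV_const[of "G (- e)"]] by (simp add: F_def[abs_def])
  have mono: "F x \<le> F y" if "x \<le> y" for x y
    by (rule DERIV_nonneg_imp_nondecreasing[OF that]) (use F nn in blast)
  have const: "F x = F y" if "x \<le> y" "\<And>z. x < z \<Longrightarrow> z < y \<Longrightarrow> f z = 0" for x y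
  proof (cases "x < y")
    case True
    then obtain z where "x < z" "z < y" "F y - F x = (y - x) * f z" using MVT2[of x y F f] F by auto
    then show ?thesis using that(2) by simp
  qed (use that in auto)
  have lo: "F x = 0" if "x \<le> - e" for x
    using const[of x "- e"] that supp by (auto simp: F_def)
  have hi: "F x = F e" if "e \<le> x" for x
    using const[of e x] that supp by auto
  have "(\<integral>x. f x * indicator {- e..e} x \<partial>lborel) = F e - F (- e)"
    by (rule integral_FTC_Icc_real) (use e F c in \<open>auto simp: continuous_on_eq_continuous_at\<close>)
  moreover have "f x * indicator {- e..e} x = f x" for x
    using supp[of x] by (cases "e \<le> \<bar>x\<bar>") (auto simp: indicator_def)
  ultimately have I: "(\<integral>x. f x \<partial>lborel) = F e" using lo[of "- e"] by simp
  show ?thesis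
  proof (rule that[OF F])
    show "0 \<le> F x" for x using mono[of "- e" x] lo[of "- e"] lo[of x] by (cases "x \<le> - e") auto
    show "F x \<le> (\<integral>x. f x \<partial>lborel)" for x unfolding I using mono[of x e] hi[of x] by (cases "x \<le> e") auto
    show "x \<le> - e \<Longrightarrow> F x = 0" for x by (rule lo)
    show "e \<le> x \<Longrightarrow> F x = (\<integral>x. f x \<partial>lborel)" for x unfolding I by (rule hi)
  qed
qed

text \<open>A fixed continuous charge on (-e, e) for neutralising potentials; only its height and a
  lower bound of its mass matter.\<close>

definition tent :: "real \<Rightarrow> real \<Rightarrow> real" where
  "tent e x = max 0 (e - \<bar>x\<bar>)"

lemma uniformly_continuous_tent: "uniformly_continuous_on UNIV (tent e)"
proof -
  have "1-lipschitz_on UNIV (tent e)" by (auto simp: lipschitz_on_def dist_real_def tent_def)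
  then show ?thesis by (rule lipschitz_on_uniformly_continuous)
qed

lemma measurable_tent [measurable]: "tent e \<in> borel_measurable borel"
  unfolding tent_def[abs_def] by measurable

lemma integrable_of_bounded_support:
  fixes f :: "real \<Rightarrow> real"
  assumes "f \<in> borel_measurable borel" "\<And>x. \<bar>f x\<bar> \<le> B" "\<And>x. e \<le> \<bar>x\<bar> \<Longrightarrow> f x = 0"
  shows "integrable lborel f"
proof (rule Bochner_Integration.integrable_bound)
  show "integrable lborel (\<lambda>x. B * indicator {- \<bar>e\<bar>..\<bar>e\<bar>} x)" by simp
  show "AE x in lborel. norm (f x) \<le> norm (B * indicator {- \<bar>e\<bar>..\<bar>e\<bar>} x)"
  proof (rule AE_I2)
    fix x
    show "norm (f x) \<le> norm (B * indicator {- \<bar>e\<bar>..\<bar>e\<bar>} x)"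
      using assms(2)[of x] assms(3)[of x] by (cases "\<bar>x\<bar> \<le> \<bar>e\<bar>") (auto simp: indicator_def abs_le_iff)
  qed
qed (use assms in simp)

lemma tent_integral_ge: "0 < e \<Longrightarrow> e\<^sup>2 / 2 \<le> (\<integral>x. tent e x \<partial>lborel)"
proof -
  assume e: "0 < e"
  have i: "integrable lborel (tent e)"
    by (rule integrable_of_bounded_support[of _ e e]) (use e in \<open>auto, auto simp: tent_def\<close>)
  have "e\<^sup>2 / 2 = (\<integral>x. e / 2 * indicator {- (e/2)..e/2} x \<partial>lborel)" using e by (simp add: power2_eq_square)
  also have "\<dots> \<le> (\<integral>x. tent e x \<partial>lborel)"
  proof (rule integral_mono)
    show "integrable lborel (\<lambda>x. e / 2 * indicator {- (e/2)..e/2} x)" by (intro integrable_mult_right integrable_real_indicator) (use e in auto)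
    show "integrable lborel (tent e)" by (rule i)
  qed (auto simp: tent_def indicator_def)
  finally show ?thesis .
qed

text \<open>The potential of \<open>h\<close>, with its charge neutralised by a multiple of \<open>tent e\<close> so that the potential stays bounded.\<close>

lemma neutral_potential:
  fixes h :: "real \<Rightarrow> real"
  assumes e: "0 < e" and uc: "uniformly_continuous_on UNIV h" and h: "\<And>x. 0 \<le> h x" "\<And>x. h x \<le> 1"
    and supp: "\<And>x. e \<le> \<bar>x\<bar> \<Longrightarrow> h x = 0"
  defines "I \<equiv> \<integral>x. h x \<partial>lborel" and "k \<equiv> \<lambda>x. tent e x / (\<integral>x. tent e x \<partial>lborel)"
  shows "\<exists>v v1 B. test_function (\<lambda>_. v) (\<lambda>_ _. 0) (\<lambda>_. v1) (\<lambda>_ x. h x - I * k x) (2 * e * I) B \<and>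
    (\<forall>x. \<bar>v1 x\<bar> \<le> I) \<and> (\<forall>x y. \<bar>v x - v y\<bar> \<le> I * \<bar>x - y\<bar>)"
    and "0 \<le> k x" "k x \<le> 2 / e" "0 \<le> I"
proof -
  define c where "c = (\<integral>x. tent e x \<partial>lborel)"
  have "0 < e\<^sup>2 / 2" using e by simp
  then have c: "e\<^sup>2 / 2 \<le> c" "0 < c" using tent_integral_ge[OF e] unfolding c_def by linarith+
  have k_def': "k x = tent e x / c" for x by (simp add: k_def c_def)
  show k0: "0 \<le> k x" for x using c by (simp add: k_def' tent_def)
  show k2: "k x \<le> 2 / e" for x
  proof -
    have "tent e x * e \<le> e * e" using e by (intro mult_right_mono) (auto simp: tent_def)
    also have "\<dots> \<le> 2 * c" using c by (simp add: power2_eq_square)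
    finally show ?thesis using c e by (simp add: k_def' field_simps)
  qed
  have cont: "continuous_on UNIV h" by (rule uniformly_continuous_imp_continuous[OF uc])
  have hi: "integrable lborel h"
    by (rule integrable_of_bounded_support[of _ 1 e]) (use h supp borel_measurable_continuous_onI[OF cont] in auto)
  show I0: "0 \<le> I" unfolding I_def using h by (intro integral_nonneg_AE) auto
  have tc: "continuous_on UNIV (tent e)" by (rule uniformly_continuous_imp_continuous[OF uniformly_continuous_tent])
  have t0: "0 \<le> tent e x" for x by (simp add: tent_def)
  have ts: "e \<le> \<bar>x\<bar> \<Longrightarrow> tent e x = 0" for x by (simp add: tent_def)
  obtain H where H: "\<And>x. (H has_real_derivative h x) (at x)" "\<And>x. 0 \<le> H x" "\<And>x. H x \<le> I"
    "\<And>x. x \<le> - e \<Longrightarrow> H x = 0" "\<And>x. e \<le> x \<Longrightarrow> H x = I"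
    using antiderivative_of_bump[OF e cont h(1) supp] unfolding I_def by blast
  obtain G where G: "\<And>x. (G has_real_derivative tent e x) (at x)" "\<And>x. 0 \<le> G x" "\<And>x. G x \<le> c"
    "\<And>x. x \<le> - e \<Longrightarrow> G x = 0" "\<And>x. e \<le> x \<Longrightarrow> G x = c"
    using antiderivative_of_bump[OF e tc t0 ts] unfolding c_def by blast
  \<comment> \<open>\<open>H\<close> and I G/c both increase by I in total, so \<open>v1\<close>
    vanishes outside (-e, e). Its primitive is constant on either side and hence bounded.\<close>
  define v1 where "v1 x = H x - I * (G x / c)" for x
  have v1d: "(v1 has_real_derivative h x - I * k x) (at x)" for x
    unfolding v1_def[abs_def] k_def' by (intro DERIV_diff DERIV_cmult DERIV_cdivide H G)
  have v1b: "\<bar>v1 x\<bar> \<le> I" for x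
  proof -
    have "0 \<le> I * (G x / c)" "I * (G x / c) \<le> I * 1"
      using G(2,3)[of x] c(2) I0 by (intro mult_nonneg_nonneg divide_nonneg_pos mult_left_mono; simp)+
    then show ?thesis using H(2,3)[of x] by (simp add: v1_def abs_le_iff)
  qed
  have v1z: "v1 x = 0" if "e \<le> \<bar>x\<bar>" for x
    using that H(4,5)[of x] G(4,5)[of x] c by (cases "0 \<le> x") (auto simp: v1_def)
  have v1c: "continuous_on UNIV v1" using v1d by (auto intro!: continuous_at_imp_continuous_on DERIV_isCont)
  obtain u where u: "\<And>x. (u has_real_derivative v1 x) (at x)" using antiderivative_exists[OF v1c] by blast
  define v where "v x = u x - u (- e)" for x
  have v: "(v has_real_derivative v1 x) (at x)" for x
    using DERIV_diff[OF u DERIV_const[of "u (- e)"]] by (simp add: v_def[abs_def])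
  have lip: "\<bar>v x - v y\<bar> \<le> I * \<bar>x - y\<bar>" for x y
    using field_differentiable_bound[of UNIV v v1 I x y] v v1b by simp
  have const: "v x = v y" if "x \<le> y" "\<And>z. x < z \<Longrightarrow> z < y \<Longrightarrow> v1 z = 0" for x y
  proof (cases "x < y")
    case True
    then obtain z where "x < z" "z < y" "v y - v x = (y - x) * v1 z" using MVT2[of x y v v1] v by auto
    then show ?thesis using that(2) by simp
  qed (use that in auto)
  have vme: "v (- e) = 0" by (simp add: v_def)
  have mid: "\<bar>v x\<bar> \<le> 2 * e * I" if "- e \<le> x" "x \<le> e" for x
  proof -
    have "\<bar>v x\<bar> \<le> I * \<bar>x - - e\<bar>" using lip[of x "- e"] vme by simp
    also have "\<dots> \<le> I * (2 * e)" using that I0 by (intro mult_left_mono) auto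
    finally show ?thesis by (simp add: mult_ac)
  qed
  have vb: "\<bar>v x\<bar> \<le> 2 * e * I" for x
  proof -
    consider "x \<le> - e" | "- e \<le> x" "x \<le> e" | "e \<le> x" by linarith
    then show ?thesis
    proof cases
      case 1
      then have "v x = v (- e)" using v1z by (intro const) auto
      then show ?thesis using vme I0 e by simp
    next
      case 3
      then have "v e = v x" using v1z e by (intro const) auto
      then show ?thesis using mid[of e] e by simp
    qed (rule mid)
  qed
  have "test_function (\<lambda>_. v) (\<lambda>_ _. 0) (\<lambda>_. v1) (\<lambda>_ x. h x - I * k x) (2 * e * I) (I + 1 + I * (2 / e))"
  proof (rule test_function_of_space[OF v v1d vb])
    have e0: "0 \<le> I * (2 / e)" using I0 e by simp
    show "\<bar>v1 x\<bar> \<le> I + 1 + I * (2 / e)" for x using v1b[of x] e0 by linarith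
    show "\<bar>h x - I * k x\<bar> \<le> I + 1 + I * (2 / e)" for x
      using h[of x] mult_left_mono[OF k2[of x] I0] mult_nonneg_nonneg[OF I0 k0[of x]] I0 by (simp add: abs_le_iff)
    show "uniformly_continuous_on UNIV (\<lambda>x. h x - I * k x)"
      unfolding k_def' using uniformly_continuous_on_cmul[OF uniformly_continuous_tent[of e], of "I / c"]
      by (intro uniformly_continuous_on_diff uc) (simp add: mult_ac)
  qed
  then show "\<exists>v v1 B. test_function (\<lambda>_. v) (\<lambda>_ _. 0) (\<lambda>_. v1) (\<lambda>_ x. h x - I * k x) (2 * e * I) B \<and>
    (\<forall>x. \<bar>v1 x\<bar> \<le> I) \<and> (\<forall>x y. \<bar>v x - v y\<bar> \<le> I * \<bar>x - y\<bar>)"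
    using v1b lip by blast
qed

text \<open>By outer regularity it suffices to test against continuous functions.\<close>

lemma nn_integral_le_of_test_functions:
  fixes m :: "real measure"
  assumes m [measurable_cong]: "sets m = sets borel" and e: "0 < e" and K: "0 \<le> K"
    and bound: "\<And>h. uniformly_continuous_on UNIV h \<Longrightarrow> (\<And>x. 0 \<le> h x) \<Longrightarrow> (\<And>x. h x \<le> 1) \<Longrightarrow> (\<And>x. e \<le> \<bar>x\<bar> \<Longrightarrow> h x = 0) \<Longrightarrow>
      (\<integral>\<^sup>+ x. ennreal (h x) \<partial>m) \<le> ennreal (K * (\<integral>x. h x \<partial>lborel))"
    and f [measurable]: "f \<in> borel_measurable borel"
  shows "(\<integral>\<^sup>+ x. f x * indicator {- e<..<e} x \<partial>m) \<le> ennreal K * (\<integral>\<^sup>+ x. f x * indicator {- e<..<e} x \<partial>lborel)"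
proof -
  let ?E = "{- e<..<e}"
  have open_bound: "emeasure m U \<le> ennreal K * emeasure lborel U" if U: "open U" "U \<subseteq> ?E" for U
  proof -
    have ne: "- U \<noteq> {}" using U e by (auto simp: subset_eq intro!: exI[of _ e])
    have cl: "closed (- U)" by (rule closed_Compl[OF U(1)])
    \<comment> \<open>Lipschitz functions that vanish off \<open>U\<close> and increase to its
      indicator.\<close>
    define h where "h j x = min 1 (real j * infdist x (- U))" for j x
    have [measurable]: "U \<in> sets borel" using U by simp
    have hc: "uniformly_continuous_on UNIV (h j)" for j
    proof -
      have "(real j)-lipschitz_on UNIV (h j)"
      proof (rule lipschitz_onI)
        fix x y :: real
        have "\<bar>infdist x (- U) - infdist y (- U)\<bar> \<le> dist x y"
          using infdist_triangle[of x "- U" y] infdist_triangle[of y "- U" x] by (simp add: dist_commute abs_le_iff)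
        then have "real j * \<bar>infdist x (- U) - infdist y (- U)\<bar> \<le> real j * dist x y" by (rule mult_left_mono) simp
        then have "\<bar>real j * infdist x (- U) - real j * infdist y (- U)\<bar> \<le> real j * dist x y"
          by (simp add: abs_mult right_diff_distrib[symmetric])
        then show "dist (h j x) (h j y) \<le> real j * dist x y" by (auto simp: h_def dist_real_def)
      qed simp
      then show ?thesis by (rule lipschitz_on_uniformly_continuous)
    qed
    then have hm [measurable]: "h j \<in> borel_measurable borel" for j
      by (intro borel_measurable_continuous_onI uniformly_continuous_imp_continuous)
    have h01: "0 \<le> h j x" "h j x \<le> 1" for j x by (auto simp: h_def infdist_nonneg)
    have hU: "h j x = 0" if "x \<notin> U" for j x using that by (simp add: h_def)
    have hs: "e \<le> \<bar>x\<bar> \<Longrightarrow> h j x = 0" for j x using U by (intro hU) (auto simp: subset_eq abs_le_iff)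
    have hi: "integrable lborel (h j)" for j by (rule integrable_of_bounded_support[of _ 1 e]) (use h01 hs in auto)
    have Uf: "emeasure lborel U < \<infinity>"
    proof -
      have "emeasure lborel U \<le> emeasure lborel ?E" using U by (intro emeasure_mono) auto
      also have "\<dots> < \<infinity>" using e by simp
      finally show ?thesis .
    qed
    have "emeasure m U = (\<integral>\<^sup>+ x. indicator U x \<partial>m)" by simp
    also have "\<dots> = (\<integral>\<^sup>+ x. (SUP j. ennreal (h j x)) \<partial>m)"
    proof (rule nn_integral_cong)
      fix x
      show "indicator U x = (SUP j. ennreal (h j x))"
      proof (cases "x \<in> U")
        case True
        then have "0 < infdist x (- U)" using infdist_pos_not_in_closed[OF cl ne, of x] by simp
        then obtain j :: nat where "1 < real j * infdist x (- U)" using reals_Archimedean3 by blast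
        then have "h j x = 1" by (simp add: h_def)
        then have "1 \<le> (SUP j. ennreal (h j x))" by (metis SUP_upper UNIV_I ennreal_1)
        moreover have "(SUP j. ennreal (h j x)) \<le> 1" using h01 by (intro SUP_least) (metis ennreal_1 ennreal_leI)
        ultimately have "(SUP j. ennreal (h j x)) = 1" by (intro antisym)
        then show ?thesis using True by simp
      qed (simp add: hU)
    qed
    also have "\<dots> = (SUP j. (\<integral>\<^sup>+ x. ennreal (h j x) \<partial>m))"
    proof (rule nn_integral_monotone_convergence_SUP)
      show "incseq (\<lambda>j x. ennreal (h j x))"
        unfolding h_def by (intro incseq_SucI le_funI ennreal_leI min.mono order_refl mult_right_mono) (auto simp: infdist_nonneg)
    qed measurable
    also have "\<dots> \<le> ennreal K * emeasure lborel U"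
    proof (rule SUP_least)
      fix j
      have "(\<integral>\<^sup>+ x. ennreal (h j x) \<partial>m) \<le> ennreal (K * (\<integral>x. h j x \<partial>lborel))"
        by (rule bound[OF hc h01 hs])
      also have "\<dots> = ennreal K * ennreal (\<integral>x. h j x \<partial>lborel)" using K h01 by (intro ennreal_mult integral_nonneg_AE) auto
      also have "\<dots> \<le> ennreal K * emeasure lborel U"
      proof (rule mult_left_mono)
        have "ennreal (\<integral>x. h j x \<partial>lborel) = (\<integral>\<^sup>+ x. ennreal (h j x) \<partial>lborel)"
          using hi h01 by (intro nn_integral_eq_integral[symmetric]) auto
        also have "\<dots> \<le> (\<integral>\<^sup>+ x. indicator U x \<partial>lborel)"
          using h01 hU by (intro nn_integral_mono) (auto split: split_indicator simp: ennreal_le_1)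
        finally show "ennreal (\<integral>x. h j x \<partial>lborel) \<le> emeasure lborel U" by simp
      qed simp
      finally show "(\<integral>\<^sup>+ x. ennreal (h j x) \<partial>m) \<le> ennreal K * emeasure lborel U" .
    qed
    finally show ?thesis .
  qed
  have set_bound: "emeasure m B \<le> ennreal K * emeasure lborel B" if B: "B \<in> sets borel" "B \<subseteq> ?E" for B
  proof (rule ennreal_le_epsilon)
    fix d :: real assume d: "0 < d" "ennreal K * emeasure lborel B < top"
    \<comment> \<open>Dividing by K + 1 gives K d' \<le> d, also for K = 0.\<close>
    define d' where "d' = d / (K + 1)"
    have d': "0 < d'" using d K by (simp add: d'_def)
    obtain U where U: "open U" "B \<subseteq> U" "emeasure lborel (U - B) < ennreal d'"
      using outer_regular_lborel[OF B(1) d'] by blast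
    let ?U = "U \<inter> ?E"
    have Ub: "?U \<in> sets borel" using U by auto
    have "emeasure lborel ?U \<le> emeasure lborel (B \<union> (U - B))" using U B by (intro emeasure_mono) auto
    also have "\<dots> \<le> emeasure lborel B + emeasure lborel (U - B)" using U B by (intro emeasure_subadditive) auto
    also have "\<dots> \<le> emeasure lborel B + ennreal d'" using U by (intro add_left_mono) auto
    finally have lb: "emeasure lborel ?U \<le> emeasure lborel B + ennreal d'" .
    have "emeasure m B \<le> emeasure m ?U" using U B m by (intro emeasure_mono) auto
    also have "\<dots> \<le> ennreal K * emeasure lborel ?U" using U by (intro open_bound) auto
    also have "\<dots> \<le> ennreal K * (emeasure lborel B + ennreal d')" by (rule mult_left_mono[OF lb]) simp
    also have "\<dots> = ennreal K * emeasure lborel B + ennreal (K * d')"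
      using K d' by (simp add: distrib_left ennreal_mult)
    also have "\<dots> \<le> ennreal K * emeasure lborel B + ennreal d"
      using K d by (intro add_left_mono ennreal_leI) (simp add: d'_def field_simps)
    finally show "emeasure m B \<le> ennreal K * emeasure lborel B + ennreal d" .
  qed
  have "(\<integral>\<^sup>+ x. f x * indicator ?E x \<partial>m) = (\<integral>\<^sup>+ x. f x \<partial>density m (indicator ?E))"
    by (subst nn_integral_density) (auto simp: mult.commute)
  also have "\<dots> \<le> (\<integral>\<^sup>+ x. f x \<partial>density lborel (\<lambda>x. ennreal K * indicator ?E x))"
  proof (rule nn_integral_mono_measure)
    show s: "sets (density m (indicator ?E)) = sets (density lborel (\<lambda>x. ennreal K * indicator ?E x))" using m by simp
    show "density m (indicator ?E) \<le> density lborel (\<lambda>x. ennreal K * indicator ?E x)"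
      unfolding le_measure[OF s]
    proof
      fix A assume "A \<in> sets (density m (indicator ?E))"
      then have A [measurable]: "A \<in> sets borel" "A \<in> sets m" using m by auto
      have "emeasure (density m (indicator ?E)) A = emeasure m (A \<inter> ?E)"
        using A by (subst emeasure_density) (auto simp: indicator_inter_arith[symmetric] Int_commute m)
      also have "\<dots> \<le> ennreal K * emeasure lborel (A \<inter> ?E)" using A by (intro set_bound) auto
      also have "\<dots> = (\<integral>\<^sup>+ x. ennreal K * indicator (A \<inter> ?E) x \<partial>lborel)" by (simp add: nn_integral_cmult)
      also have "\<dots> = (\<integral>\<^sup>+ x. ennreal K * indicator ?E x * indicator A x \<partial>lborel)"
        by (intro nn_integral_cong) (auto split: split_indicator)
      also have "\<dots> = emeasure (density lborel (\<lambda>x. ennreal K * indicator ?E x)) A"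
        by (rule emeasure_density[symmetric]) (use A in auto)
      finally show "emeasure (density m (indicator ?E)) A \<le> emeasure (density lborel (\<lambda>x. ennreal K * indicator ?E x)) A" .
    qed
  qed
  also have "\<dots> = (\<integral>\<^sup>+ x. ennreal K * indicator ?E x * f x \<partial>lborel)" by (rule nn_integral_density) auto
  also have "\<dots> = (\<integral>\<^sup>+ x. ennreal K * (f x * indicator ?E x) \<partial>lborel)" by (intro nn_integral_cong) (simp add: mult_ac)
  also have "\<dots> = ennreal K * (\<integral>\<^sup>+ x. f x * indicator ?E x \<partial>lborel)" by (rule nn_integral_cmult) measurable
  finally show ?thesis .
qed

section \<open>Expected occupation measures\<close>

context jump_diffusion begin

text \<open>A bound of type \<open>enat\<close> covers the truncated weights and, for \<infinity>,
  the full one; monotone convergence links them.\<close>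

definition occ_weight :: "enat \<Rightarrow> real \<Rightarrow> real \<times> 'a \<Rightarrow> real" where
  "occ_weight n T z = indicator {0<..T} (fst z) * (if enat (count (max 0 (fst z)) (snd z)) < n then 1 else 0)"

text \<open>The expected occupation measure of X up to time \<open>T\<close>, counted only while
  fewer than \<open>n\<close> jumps have occurred.\<close>

definition occm :: "enat \<Rightarrow> real \<Rightarrow> real measure" where
  "occm n T = distr (density (lborel \<Otimes>\<^sub>M M) (\<lambda>z. ennreal (occ_weight n T z))) borel (\<lambda>z. X (max 0 (fst z)) (snd z))"

lemma measurable_occ_weight [measurable]: "occ_weight n T \<in> borel_measurable (lborel \<Otimes>\<^sub>M M)"
proof -
  have "(\<lambda>z. (if enat (count (max 0 (fst z)) (snd z)) < n then 1 else 0 :: real)) =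
    (\<lambda>z. (\<lambda>k. if enat k < n then 1 else 0 :: real) (count (max 0 (fst z)) (snd z)))" by simp
  moreover have "(\<lambda>z. (\<lambda>k. if enat k < n then 1 else 0 :: real) (count (max 0 (fst z)) (snd z))) \<in> borel_measurable (lborel \<Otimes>\<^sub>M M)"
    by (rule measurable_compose[of _ _ "count_space UNIV"]) measurable
  ultimately show ?thesis unfolding occ_weight_def by measurable
qed

lemma occ_weight_nonneg: "0 \<le> occ_weight n T z"
  by (simp add: occ_weight_def)

lemma sets_occm [measurable_cong, simp]: "sets (occm n T) = sets borel"
  by (simp add: occm_def)

lemma space_occm [simp]: "space (occm n T) = UNIV"
  by (simp add: occm_def)

lemma measurable_occm_iff [simp]: "f \<in> measurable (occm n T) S \<longleftrightarrow> f \<in> measurable borel S"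
  using measurable_cong_sets[OF sets_occm refl, of n T S] by simp

lemma nn_integral_occm_pair:
  assumes [measurable]: "f \<in> borel_measurable borel"
  shows "(\<integral>\<^sup>+ x. f x \<partial>occm n T) = (\<integral>\<^sup>+ z. ennreal (occ_weight n T z) * f (X (max 0 (fst z)) (snd z)) \<partial>(lborel \<Otimes>\<^sub>M M))"
proof -
  have "(\<integral>\<^sup>+ x. f x \<partial>occm n T) = (\<integral>\<^sup>+ z. f (X (max 0 (fst z)) (snd z)) \<partial>density (lborel \<Otimes>\<^sub>M M) (\<lambda>z. ennreal (occ_weight n T z)))"
    unfolding occm_def by (rule nn_integral_distr) measurable
  also have "\<dots> = (\<integral>\<^sup>+ z. ennreal (occ_weight n T z) * f (X (max 0 (fst z)) (snd z)) \<partial>(lborel \<Otimes>\<^sub>M M))"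
    by (rule nn_integral_density) measurable
  finally show ?thesis .
qed

lemma nn_integral_occm:
  assumes [measurable]: "f \<in> borel_measurable borel"
  shows "(\<integral>\<^sup>+ x. f x \<partial>occm n T) = (\<integral>\<^sup>+ w. (\<integral>\<^sup>+ s\<in>{0<..T}. (if enat (count s w) < n then f (X s w) else 0) \<partial>lborel) \<partial>M)"
proof -
  have "(\<integral>\<^sup>+ x. f x \<partial>occm n T) = (\<integral>\<^sup>+ w. (\<integral>\<^sup>+ s. (\<lambda>z. ennreal (occ_weight n T z) * f (X (max 0 (fst z)) (snd z))) (s, w) \<partial>lborel) \<partial>M)"
    unfolding nn_integral_occm_pair[OF assms] by (rule nn_integral_iterated[symmetric]) measurable
  also have "\<dots> = (\<integral>\<^sup>+ w. (\<integral>\<^sup>+ s\<in>{0<..T}. (if enat (count s w) < n then f (X s w) else 0) \<partial>lborel) \<partial>M)"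
    by (intro nn_integral_cong) (auto simp: occ_weight_def split: split_indicator)
  finally show ?thesis .
qed

lemma finite_occm: "0 < T \<Longrightarrow> emeasure (occm n T) UNIV \<le> ennreal T"
proof -
  assume T: "0 < T"
  have "emeasure (occm n T) UNIV = (\<integral>\<^sup>+ x. 1 \<partial>occm n T)" by simp
  also have "\<dots> \<le> (\<integral>\<^sup>+ w. ennreal T \<partial>M)"
    unfolding nn_integral_occm[OF borel_measurable_const]
  proof (rule nn_integral_mono)
    fix w
    have "(\<integral>\<^sup>+ s\<in>{0<..T}. (if enat (count s w) < n then 1 else 0) \<partial>lborel) \<le> (\<integral>\<^sup>+ s. indicator {0<..T} s \<partial>lborel)"
      by (intro nn_integral_mono) (auto split: split_indicator)
    then show "(\<integral>\<^sup>+ s\<in>{0<..T}. (if enat (count s w) < n then 1 else 0) \<partial>lborel) \<le> ennreal T" using T by simp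
  qed
  finally show ?thesis by (simp add: emeasure_space_1)
qed

lemma finite_measure_occm: "0 < T \<Longrightarrow> finite_measure (occm n T)"
proof (rule finite_measureI)
  assume "0 < T"
  from finite_occm[OF this, of n] show "emeasure (occm n T) (space (occm n T)) \<noteq> \<infinity>" by (auto simp: top_unique)
qed

lemma integral_occm:
  fixes f :: "real \<Rightarrow> real"
  assumes T: "0 < T" and f [measurable]: "f \<in> borel_measurable borel" and b: "\<And>x. \<bar>f x\<bar> \<le> C"
  shows "(\<integral>x. f x \<partial>occm (enat n) T) =
    (\<integral>w. (\<integral>s. indicator {0<..T} s * (if count (max 0 s) w < n then f (X (max 0 s) w) else 0) \<partial>lborel) \<partial>M)"
proof -
  interpret P: pair_sigma_finite lborel M ..
  let ?g = "\<lambda>z. occ_weight (enat n) T z * f (X (max 0 (fst z)) (snd z))"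
  have "integrable (occm (enat n) T) f"
    by (rule finite_measure.integrable_const_bound[OF finite_measure_occm[OF T], where B = C]) (use b in auto)
  then have "integrable (density (lborel \<Otimes>\<^sub>M M) (\<lambda>z. ennreal (occ_weight (enat n) T z))) (\<lambda>z. f (X (max 0 (fst z)) (snd z)))"
    unfolding occm_def by (subst (asm) integrable_distr_eq) auto
  then have i: "integrable (lborel \<Otimes>\<^sub>M M) ?g"
    by (subst (asm) integrable_density) (auto simp: occ_weight_nonneg)
  have "(\<integral>x. f x \<partial>occm (enat n) T) = (\<integral>z. f (X (max 0 (fst z)) (snd z)) \<partial>density (lborel \<Otimes>\<^sub>M M) (\<lambda>z. ennreal (occ_weight (enat n) T z)))"
    unfolding occm_def by (rule integral_distr) measurable
  also have "\<dots> = (\<integral>z. ?g z \<partial>(lborel \<Otimes>\<^sub>M M))"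
    by (subst integral_density) (auto simp: occ_weight_nonneg)
  also have "\<dots> = (\<integral>w. (\<integral>s. ?g (s, w) \<partial>lborel) \<partial>M)"
    using P.integral_snd[of "\<lambda>s w. ?g (s, w)"] i by (simp add: case_prod_beta')
  also have "\<dots> = (\<integral>w. (\<integral>s. indicator {0<..T} s * (if count (max 0 s) w < n then f (X (max 0 s) w) else 0) \<partial>lborel) \<partial>M)"
    by (intro Bochner_Integration.integral_cong) (auto simp: occ_weight_def)
  finally show ?thesis .
qed

lemma occm_SUP:
  assumes [measurable]: "f \<in> borel_measurable borel"
  shows "(\<integral>\<^sup>+ x. f x \<partial>occm \<infinity> T) = (SUP n. \<integral>\<^sup>+ x. f x \<partial>occm (enat n) T)"
proof -
  have "(\<integral>\<^sup>+ x. f x \<partial>occm \<infinity> T) = (\<integral>\<^sup>+ z. (SUP n. ennreal (occ_weight (enat n) T z) * f (X (max 0 (fst z)) (snd z))) \<partial>(lborel \<Otimes>\<^sub>M M))"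
    unfolding nn_integral_occm_pair[OF assms]
  proof (rule nn_integral_cong)
    fix z
    have "(SUP n. ennreal (occ_weight (enat n) T z)) = ennreal (occ_weight \<infinity> T z)"
    proof (rule antisym)
      show "(SUP n. ennreal (occ_weight (enat n) T z)) \<le> ennreal (occ_weight \<infinity> T z)"
        by (intro SUP_least ennreal_leI) (auto simp: occ_weight_def)
      show "ennreal (occ_weight \<infinity> T z) \<le> (SUP n. ennreal (occ_weight (enat n) T z))"
        by (rule SUP_upper2[of "Suc (count (max 0 (fst z)) (snd z))"]) (auto simp: occ_weight_def)
    qed
    then show "ennreal (occ_weight \<infinity> T z) * f (X (max 0 (fst z)) (snd z)) = (SUP n. ennreal (occ_weight (enat n) T z) * f (X (max 0 (fst z)) (snd z)))"
      by (simp add: SUP_mult_right_ennreal[symmetric])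
  qed
  also have "\<dots> = (SUP n. \<integral>\<^sup>+ x. f x \<partial>occm (enat n) T)"
    unfolding nn_integral_occm_pair[OF assms]
    by (rule nn_integral_monotone_convergence_SUP)
      (auto intro!: incseq_SucI le_funI mult_right_mono ennreal_leI simp: occ_weight_def)
  finally show ?thesis .
qed

lemma occm_mono: "m \<le> n \<Longrightarrow> f \<in> borel_measurable borel \<Longrightarrow> (\<integral>\<^sup>+ x. f x \<partial>occm m T) \<le> (\<integral>\<^sup>+ x. f x \<partial>occm n T)"
  unfolding nn_integral_occm_pair
  by (intro nn_integral_mono mult_right_mono ennreal_leI) (auto simp: occ_weight_def)

text \<open>The first \<open>n\<close> jumps contribute at most n C, so the rate integrated against
  the truncated occupation measure is finite before anything is known about the full one.\<close>

lemma expected_jump_sum: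
  fixes \<psi> :: "real \<Rightarrow> real"
  assumes T: "0 < T" and c: "continuous_on UNIV \<psi>" and nn: "\<And>x. 0 \<le> \<psi> x" and b: "\<And>x. \<psi> x \<le> C"
  shows "integrable M (\<lambda>w. \<Sum>s\<in>N w \<inter> {0<..T}. if countL s w < n then \<psi> (XL s w) else 0)"
    and "ennreal (\<integral>w. (\<Sum>s\<in>N w \<inter> {0<..T}. if countL s w < n then \<psi> (XL s w) else 0) \<partial>M) =
      (\<integral>\<^sup>+ x. ennreal (\<psi> x) * \<Lambda> x \<partial>occm (enat n) T)"
proof -
  let ?J = "\<lambda>w. \<Sum>s\<in>N w \<inter> {0<..T}. if countL s w < n then \<psi> (XL s w) else 0"
  have [measurable]: "\<psi> \<in> borel_measurable borel" by (rule borel_measurable_continuous_onI[OF c])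
  have J [measurable]: "?J \<in> borel_measurable M"
    by (rule measurable_jump_sum[OF _ T, of "\<lambda>_. \<psi>"])
      (rule continuous_on_compose2[OF c], auto intro: continuous_on_snd)
  have C: "0 \<le> C" using nn[of 0] b[of 0] by simp
  have J0: "0 \<le> ?J w" for w using nn by (intro sum_nonneg) auto
  show i: "integrable M ?J"
  proof (rule integrable_const_bound[where B = "real n * C"])
    show "AE w in M. norm (?J w) \<le> real n * C"
      using sum_jumps_le[of _ n "\<lambda>s. \<psi> (XL s _)" C T] J0 b C by (intro AE_I2) auto
  qed (rule J)
  have "ennreal (\<integral>w. ?J w \<partial>M) = (\<integral>\<^sup>+ w. ennreal (?J w) \<partial>M)"
    by (rule nn_integral_eq_integral[OF i, symmetric]) (use J0 in auto)
  also have "\<dots> = (\<integral>\<^sup>+ w. (\<Sum>s\<in>N w \<inter> {0<..T}. (\<lambda>(s :: real, x, k). ennreal (if k < n then \<psi> x else 0)) (s, XL s w, countL s w)) \<partial>M)"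
    by (intro nn_integral_cong, subst sum_ennreal[symmetric]) (auto simp: nn)
  also have "\<dots> = (\<integral>\<^sup>+ w. (\<integral>\<^sup>+ s\<in>{0<..T}. (\<lambda>(s :: real, x, k). ennreal (if k < n then \<psi> x else 0)) (s, X s w, count s w) * \<Lambda> (X s w) \<partial>lborel) \<partial>M)"
    by (rule compensation) measurable
  also have "\<dots> = (\<integral>\<^sup>+ x. ennreal (\<psi> x) * \<Lambda> x \<partial>occm (enat n) T)"
    by (subst nn_integral_occm) (auto intro!: nn_integral_cong split: split_indicator)
  finally show "ennreal (\<integral>w. ?J w \<partial>M) = (\<integral>\<^sup>+ x. ennreal (\<psi> x) * \<Lambda> x \<partial>occm (enat n) T)" .
qed

lemma prob_count_large_tendsto_0: "0 \<le> T \<Longrightarrow> (\<lambda>n. prob {w \<in> space M. n \<le> count T w}) \<longlonglongrightarrow> 0"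
proof -
  assume T: "0 \<le> T"
  note [measurable] = measurable_count[OF T]
  have "(\<lambda>n. prob {w \<in> space M. n \<le> count T w}) \<longlonglongrightarrow> prob (\<Inter>n. {w \<in> space M. n \<le> count T w})"
    by (rule finite_Lim_measure_decseq) (auto simp: decseq_def)
  also have "(\<Inter>n. {w \<in> space M. n \<le> count T w}) = {}"
    by (auto intro: exI[of _ "Suc (count T _)"]) (metis not_less_eq_eq order_refl)
  finally show ?thesis by simp
qed

lemma dynkin_space:
  assumes v: "test_function (\<lambda>_. v) (\<lambda>_ _. 0) (\<lambda>_. v1) (\<lambda>_. v2) B0 B" and T: "0 < T"
  shows "\<bar>(\<integral>w. (\<Sum>s\<in>N w \<inter> {0<..T}. if countL s w < n then v (XL s w / \<theta>) - v (XL s w) else 0) \<partial>M) +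
    (\<integral>x. \<mu> * v1 x + \<sigma>\<^sup>2 / 2 * v2 x \<partial>occm (enat n) T) - ((\<integral>w. v (X T w) \<partial>M) - v x0)\<bar>
    \<le> 2 * B0 * prob {w \<in> space M. n \<le> count T w}"
proof -
  have eq: "(\<integral>x. \<mu> * v1 x + \<sigma>\<^sup>2 / 2 * v2 x \<partial>occm (enat n) T) =
    (\<integral>w. (\<integral>s. indicator {0<..T} s * (if count (max 0 s) w < n then \<mu> * v1 (X (max 0 s) w) + \<sigma>\<^sup>2 / 2 * v2 (X (max 0 s) w) else 0) \<partial>lborel) \<partial>M)"
  proof (rule integral_occm[OF T])
    have "continuous_on UNIV (\<lambda>z. generator (\<lambda>_ _. 0) (\<lambda>_. v1) (\<lambda>_. v2) (fst z) (snd z))"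
      by (rule continuous_generator[OF v T])
    from continuous_on_compose2[OF this, of UNIV "\<lambda>x. (0, x)"]
    have "continuous_on UNIV (\<lambda>x. \<mu> * v1 x + \<sigma>\<^sup>2 / 2 * v2 x)" by (simp add: generator_def continuous_on_Pair)
    then show "(\<lambda>x. \<mu> * v1 x + \<sigma>\<^sup>2 / 2 * v2 x) \<in> borel_measurable borel" by (rule borel_measurable_continuous_onI)
    show "\<bar>\<mu> * v1 x + \<sigma>\<^sup>2 / 2 * v2 x\<bar> \<le> B + \<bar>\<mu>\<bar> * B + \<sigma>\<^sup>2 / 2 * B" for x
      using generator_bound[OF v T, of 0 x] by (simp add: generator_def)
  qed
  have g: "generator (\<lambda>_ _. 0) (\<lambda>_. v1) (\<lambda>_. v2) s x = \<mu> * v1 x + \<sigma>\<^sup>2 / 2 * v2 x" for s x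
    by (simp add: generator_def)
  show ?thesis unfolding eq using dynkin_localized[OF v T, of n] unfolding g .
qed

lemma integral_occm_bound:
  fixes f :: "real \<Rightarrow> real"
  assumes T: "0 < T" and [measurable]: "f \<in> borel_measurable borel" and b: "\<And>x. \<bar>f x\<bar> \<le> C"
  shows "integrable (occm n T) f" "\<bar>\<integral>x. f x \<partial>occm n T\<bar> \<le> C * T"
proof -
  interpret O: finite_measure "occm n T" by (rule finite_measure_occm[OF T])
  show i: "integrable (occm n T) f" by (rule O.integrable_const_bound[where B = C]) (use b in auto)
  have C: "0 \<le> C" using b[of 0] by linarith
  have m: "measure (occm n T) UNIV \<le> T"
    using finite_occm[OF T, of n] T by (simp add: O.emeasure_eq_measure)
  have "\<bar>\<integral>x. f x \<partial>occm n T\<bar> \<le> (\<integral>x. \<bar>f x\<bar> \<partial>occm n T)" by (rule integral_abs_bound)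
  also have "\<dots> \<le> (\<integral>x. C \<partial>occm n T)" using i b by (intro integral_mono) auto
  also have "\<dots> \<le> C * T" using m C by (simp add: mult.commute mult_left_mono)
  finally show "\<bar>\<integral>x. f x \<partial>occm n T\<bar> \<le> C * T" .
qed

lemma test_function_continuous:
  assumes "test_function (\<lambda>_. v) (\<lambda>_ _. 0) (\<lambda>_. v1) (\<lambda>_. v2) B0 B"
  shows "continuous_on UNIV v" "continuous_on UNIV v1" "continuous_on UNIV v2"
proof -
  have "(v has_real_derivative v1 x) (at x)" "(v1 has_real_derivative v2 x) (at x)" for x
    using assms by (auto simp: test_function_def)
  then show "continuous_on UNIV v" "continuous_on UNIV v1"
    by (auto intro!: continuous_at_imp_continuous_on DERIV_isCont)
  have "continuous_on UNIV (\<lambda>z :: real \<times> real. v2 (snd z))"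
    using assms by (auto simp: test_function_def intro: uniformly_continuous_imp_continuous)
  from continuous_on_compose2[OF this, of UNIV "\<lambda>x. (0, x)"]
  show "continuous_on UNIV v2" by (simp add: continuous_on_Pair)
qed

text \<open>No jump raises the bounded barrier \<open>v\<close>, and one that starts in a \<le> |x|
  \<le> R sqrt c lowers it by at least c/2, while the diffusion changes its expectation by at most
  \<open>C\<close>. Letting n \<rightarrow> \<infinity> with \<open>R\<close> fixed removes the
  localization error, which carries ln (R/a); then \<open>R\<close> may tend to \<infinity>, since
  the bound \<open>b\<close> does not involve it.\<close>

lemma rate_from_far:
  assumes a: "0 < a" and T: "0 < T"
  shows "(\<integral>\<^sup>+ x. indicator {x. a \<le> \<bar>x\<bar>} x * \<Lambda> x \<partial>occm \<infinity> T) < \<infinity>"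
proof -
  define s where "s = 1 / \<theta>"
  have s: "0 \<le> s" "s < 1" using \<theta>_gt_1 by (auto simp: s_def)
  define c where "c = ln (2 / (1 + s\<^sup>2)) / 2"
  have c: "0 < c" using log_barrier_drop(2)[OF a _ s, of "a + 1"] by (simp add: c_def)
  define C where "C = (\<bar>\<mu>\<bar> * (2 / a) + \<sigma>\<^sup>2 / 2 * (2 / a\<^sup>2)) * T"
  define b where "b = log_barrier a x0 + C"
  have main: "(\<integral>\<^sup>+ x. indicator {x. a \<le> \<bar>x\<bar> \<and> \<bar>x\<bar> \<le> R * sqrt c} x * \<Lambda> x \<partial>occm \<infinity> T) \<le> ennreal (2 / c * b)" if R: "a < R" for R
  proof -
    have R0: "0 < R" using a R by simp
    define v where "v x = log_barrier a x - log_barrier R x" for x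
    define v1 where "v1 x = x / (a\<^sup>2 + x\<^sup>2) - x / (R\<^sup>2 + x\<^sup>2)" for x
    define v2 where "v2 x = (a\<^sup>2 - x\<^sup>2) / (a\<^sup>2 + x\<^sup>2)\<^sup>2 - (R\<^sup>2 - x\<^sup>2) / (R\<^sup>2 + x\<^sup>2)\<^sup>2" for x
    note lb = log_barrier_diff_test_function[OF a R, folded v_def v1_def v2_def]
    have tf: "test_function (\<lambda>_. v) (\<lambda>_ _. 0) (\<lambda>_. v1) (\<lambda>_. v2) (ln (R / a)) (2 / a + 2 / a\<^sup>2)"
      using lb(5) unfolding v_def[abs_def] v1_def[abs_def] v2_def[abs_def] .
    have v1b: "\<bar>v1 x\<bar> \<le> 2 / a" and v2b: "\<bar>v2 x\<bar> \<le> 2 / a\<^sup>2" and v0: "0 \<le> v x" and vle: "v x \<le> ln (R / a)" for x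
      using lb(1-4) by auto
    note drop = log_barrier_drop[OF a R s, folded v_def c_def]
    define D where "D x = v x - v (s * x)" for x
    have vc: "continuous_on UNIV v" "continuous_on UNIV v1" "continuous_on UNIV v2" by (rule test_function_continuous[OF tf])+
    have [measurable]: "v \<in> borel_measurable borel" "v1 \<in> borel_measurable borel" "v2 \<in> borel_measurable borel"
      using vc by (auto intro: borel_measurable_continuous_onI)
    have Dc: "continuous_on UNIV D" unfolding D_def
      by (intro continuous_on_diff vc continuous_on_compose2[OF vc(1)] continuous_intros) auto
    have D0: "0 \<le> D x" and DB: "D x \<le> ln (R / a)" for x
      using drop(1)[of x] vle[of x] v0[of "s * x"] by (auto simp: D_def)
    have step: "(\<integral>\<^sup>+ x. ennreal (D x) * \<Lambda> x \<partial>occm (enat n) T) \<le> ennreal (v x0 + C + 2 * ln (R / a) * prob {w \<in> space M. n \<le> count T w})" for n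
    proof -
      let ?J = "\<lambda>w. \<Sum>s\<in>N w \<inter> {0<..T}. if countL s w < n then D (XL s w) else 0"
      have J: "(\<Sum>s\<in>N w \<inter> {0<..T}. if countL s w < n then v (XL s w / \<theta>) - v (XL s w) else 0) = - ?J w" for w
        unfolding sum_negf[symmetric] by (rule sum.cong) (auto simp: D_def s_def)
      have "\<bar>- (\<integral>w. ?J w \<partial>M) + (\<integral>x. \<mu> * v1 x + \<sigma>\<^sup>2 / 2 * v2 x \<partial>occm (enat n) T) - ((\<integral>w. v (X T w) \<partial>M) - v x0)\<bar>
        \<le> 2 * ln (R / a) * prob {w \<in> space M. n \<le> count T w}"
        using dynkin_space[OF tf T, of n] unfolding J by simp
      moreover have "0 \<le> (\<integral>w. v (X T w) \<partial>M)" using v0 by (intro integral_nonneg_AE) auto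
      moreover have "\<bar>\<integral>x. \<mu> * v1 x + \<sigma>\<^sup>2 / 2 * v2 x \<partial>occm (enat n) T\<bar> \<le> C"
        unfolding C_def
      proof (rule integral_occm_bound[OF T])
        fix x
        have "\<bar>\<mu> * v1 x + \<sigma>\<^sup>2 / 2 * v2 x\<bar> \<le> \<bar>\<mu>\<bar> * \<bar>v1 x\<bar> + \<sigma>\<^sup>2 / 2 * \<bar>v2 x\<bar>"
          using abs_triangle_ineq[of "\<mu> * v1 x" "\<sigma>\<^sup>2 / 2 * v2 x"] by (simp add: abs_mult)
        also have "\<dots> \<le> \<bar>\<mu>\<bar> * (2 / a) + \<sigma>\<^sup>2 / 2 * (2 / a\<^sup>2)" by (intro add_mono mult_left_mono v1b v2b) auto
        finally show "\<bar>\<mu> * v1 x + \<sigma>\<^sup>2 / 2 * v2 x\<bar> \<le> \<bar>\<mu>\<bar> * (2 / a) + \<sigma>\<^sup>2 / 2 * (2 / a\<^sup>2)" .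
      qed measurable
      ultimately have "(\<integral>w. ?J w \<partial>M) \<le> v x0 + C + 2 * ln (R / a) * prob {w \<in> space M. n \<le> count T w}" by linarith
      then show ?thesis unfolding expected_jump_sum(2)[OF T Dc D0 DB, symmetric] by (rule ennreal_leI)
    qed
    have "(\<integral>\<^sup>+ x. ennreal (D x) * \<Lambda> x \<partial>occm (enat m) T) \<le> ennreal (v x0 + C)" for m
    proof (rule LIMSEQ_le_const)
      have "(\<lambda>n. v x0 + C + 2 * ln (R / a) * prob {w \<in> space M. n \<le> count T w}) \<longlonglongrightarrow> v x0 + C + 2 * ln (R / a) * 0"
        using T by (intro tendsto_intros prob_count_large_tendsto_0) simp
      then show "(\<lambda>n. ennreal (v x0 + C + 2 * ln (R / a) * prob {w \<in> space M. n \<le> count T w})) \<longlonglongrightarrow> ennreal (v x0 + C)"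
        by (intro tendsto_ennrealI) simp
      have [measurable]: "D \<in> borel_measurable borel" by (rule borel_measurable_continuous_onI[OF Dc])
      show "\<exists>N. \<forall>n\<ge>N. (\<integral>\<^sup>+ x. ennreal (D x) * \<Lambda> x \<partial>occm (enat m) T) \<le> ennreal (v x0 + C + 2 * ln (R / a) * prob {w \<in> space M. n \<le> count T w})"
      proof (intro exI[of _ m] allI impI)
        fix n assume "m \<le> n"
        then have "(\<integral>\<^sup>+ x. ennreal (D x) * \<Lambda> x \<partial>occm (enat m) T) \<le> (\<integral>\<^sup>+ x. ennreal (D x) * \<Lambda> x \<partial>occm (enat n) T)"
          by (intro occm_mono) auto
        then show "(\<integral>\<^sup>+ x. ennreal (D x) * \<Lambda> x \<partial>occm (enat m) T) \<le> ennreal (v x0 + C + 2 * ln (R / a) * prob {w \<in> space M. n \<le> count T w})"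
          using step[of n] by (rule order_trans)
      qed
    qed
    then have all: "(\<integral>\<^sup>+ x. ennreal (D x) * \<Lambda> x \<partial>occm \<infinity> T) \<le> ennreal (v x0 + C)"
      using borel_measurable_continuous_onI[OF Dc] by (subst occm_SUP) (auto intro!: SUP_least)
    have [measurable]: "D \<in> borel_measurable borel" by (rule borel_measurable_continuous_onI[OF Dc])
    have "(\<integral>\<^sup>+ x. indicator {x. a \<le> \<bar>x\<bar> \<and> \<bar>x\<bar> \<le> R * sqrt c} x * \<Lambda> x \<partial>occm \<infinity> T) \<le>
      (\<integral>\<^sup>+ x. ennreal (2 / c) * (ennreal (D x) * \<Lambda> x) \<partial>occm \<infinity> T)"
    proof (rule nn_integral_mono)
      fix x
      show "indicator {x. a \<le> \<bar>x\<bar> \<and> \<bar>x\<bar> \<le> R * sqrt c} x * \<Lambda> x \<le> ennreal (2 / c) * (ennreal (D x) * \<Lambda> x)"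
      proof (cases "a \<le> \<bar>x\<bar> \<and> \<bar>x\<bar> \<le> R * sqrt c")
        case True
        then have "c / 2 \<le> D x" using drop(3)[of x] by (simp add: D_def)
        then have "1 \<le> 2 / c * D x" using c by (simp add: field_simps)
        then have "1 \<le> ennreal (2 / c * D x)" by (metis ennreal_1 ennreal_leI)
        then have "1 * \<Lambda> x \<le> ennreal (2 / c * D x) * \<Lambda> x" by (rule mult_right_mono) simp
        also have "\<dots> = ennreal (2 / c) * (ennreal (D x) * \<Lambda> x)" using c D0[of x] by (subst ennreal_mult) (auto simp: mult.assoc)
        finally show ?thesis using True by simp
      qed simp
    qed
    also have "\<dots> = ennreal (2 / c) * (\<integral>\<^sup>+ x. ennreal (D x) * \<Lambda> x \<partial>occm \<infinity> T)" by (rule nn_integral_cmult) simp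
    also have "\<dots> \<le> ennreal (2 / c) * ennreal b"
    proof (rule mult_left_mono)
      have "0 \<le> log_barrier R x0" by (simp add: log_barrier_def)
      then have "v x0 + C \<le> b" by (simp add: v_def b_def)
      then show "(\<integral>\<^sup>+ x. ennreal (D x) * \<Lambda> x \<partial>occm \<infinity> T) \<le> ennreal b" using all by (meson ennreal_leI order_trans)
    qed simp
    also have "\<dots> = ennreal (2 / c * b)" using c by (intro ennreal_mult'[symmetric]) simp
    finally show ?thesis .
  qed
  \<comment> \<open>The regions for R = a + 1 + k; they exhaust |x| \<ge> a.\<close>
  define S where "S k = {x. a \<le> \<bar>x\<bar> \<and> \<bar>x\<bar> \<le> (a + 1 + real k) * sqrt c}" for k
  have "(\<integral>\<^sup>+ x. indicator {x. a \<le> \<bar>x\<bar>} x * \<Lambda> x \<partial>occm \<infinity> T) = (\<integral>\<^sup>+ x. (SUP k. indicator (S k) x * \<Lambda> x) \<partial>occm \<infinity> T)"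
  proof (rule nn_integral_cong)
    fix x
    show "indicator {x. a \<le> \<bar>x\<bar>} x * \<Lambda> x = (SUP k. indicator (S k) x * \<Lambda> x)"
    proof (rule antisym)
      show "(SUP k. indicator (S k) x * \<Lambda> x) \<le> indicator {x. a \<le> \<bar>x\<bar>} x * \<Lambda> x"
        by (intro SUP_least) (auto simp: S_def split: split_indicator)
      show "indicator {x. a \<le> \<bar>x\<bar>} x * \<Lambda> x \<le> (SUP k. indicator (S k) x * \<Lambda> x)"
      proof (cases "a \<le> \<bar>x\<bar>")
        case True
        obtain k :: nat where "\<bar>x\<bar> / sqrt c \<le> real k" using real_arch_simple by blast
        then have "\<bar>x\<bar> \<le> real k * sqrt c" using c by (simp add: pos_divide_le_eq)
        also have "\<dots> \<le> (a + 1 + real k) * sqrt c" using a c by (intro mult_right_mono) auto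
        finally have "x \<in> S k" using True by (simp add: S_def)
        then show ?thesis by (intro SUP_upper2[of k]) (auto split: split_indicator)
      qed simp
    qed
  qed
  also have "\<dots> = (SUP k. \<integral>\<^sup>+ x. indicator (S k) x * \<Lambda> x \<partial>occm \<infinity> T)"
  proof (rule nn_integral_monotone_convergence_SUP)
    have "S k \<subseteq> S (Suc k)" for k
    proof -
      have "(a + 1 + real k) * sqrt c \<le> (a + 1 + real (Suc k)) * sqrt c" using c by (intro mult_right_mono) auto
      then show ?thesis by (auto simp: S_def)
    qed
    then show "incseq (\<lambda>k x. indicator (S k) x * \<Lambda> x)"
      by (intro incseq_SucI le_funI mult_right_mono) (auto split: split_indicator)
    have [measurable]: "S k \<in> sets borel" for k unfolding S_def by measurable
    show "(\<lambda>x. indicator (S k) x * \<Lambda> x) \<in> borel_measurable (occm \<infinity> T)" for k by simp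
  qed
  also have "\<dots> \<le> ennreal (2 / c * b)"
    unfolding S_def using a by (intro SUP_least main) auto
  also have "\<dots> < \<infinity>" by simp
  finally show ?thesis .
qed

text \<open>Dynkin's formula for the potential \<open>v\<close> of \<open>h\<close> isolates
  \<sigma>^2/2 times the occupation integral of \<open>h\<close>, and every other term is at most a
  multiple of I, the integral of \<open>h\<close>. The values of \<open>v\<close> at both ends and
  the localization error give 8 e I. A jump from |x| < e changes \<open>v\<close> by at most I e,
  since \<open>v\<close> is I-Lipschitz and the jump is no longer than |x|; from farther out the
  bound 4 e I from the supremum of |v| is used.\<close>

lemma occm_bound_near_0:
  fixes h :: "real \<Rightarrow> real" and e T :: real and n :: nat
  assumes e: "0 < e" and T: "0 < T" and uc: "uniformly_continuous_on UNIV h"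
    and h: "\<And>x. 0 \<le> h x" "\<And>x. h x \<le> 1" and supp: "\<And>x. e \<le> \<bar>x\<bar> \<Longrightarrow> h x = 0"
    and A: "(\<integral>\<^sup>+ x. indicator {- e<..<e} x * \<Lambda> x \<partial>occm (enat n) T) = ennreal A" "0 \<le> A"
    and Kf: "(\<integral>\<^sup>+ x. indicator {x. e \<le> \<bar>x\<bar>} x * \<Lambda> x \<partial>occm (enat n) T) \<le> ennreal Kf" "0 \<le> Kf"
  shows "(\<integral>\<^sup>+ x. ennreal (h x) \<partial>occm (enat n) T) \<le>
    ennreal (2 / \<sigma>\<^sup>2 * (8 * e + \<bar>\<mu>\<bar> * T + \<sigma>\<^sup>2 * T / e + 4 * e * Kf + e * A) * (\<integral>x. h x \<partial>lborel))"
proof -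
  define I where "I = (\<integral>x. h x \<partial>lborel)"
  define k where "k x = tent e x / (\<integral>x. tent e x \<partial>lborel)" for x
  note np = neutral_potential[OF e uc h supp, folded I_def k_def]
  obtain v v1 B where v: "test_function (\<lambda>_. v) (\<lambda>_ _. 0) (\<lambda>_. v1) (\<lambda>_ x. h x - I * k x) (2 * e * I) B"
    and v1: "\<And>x. \<bar>v1 x\<bar> \<le> I" and lip: "\<And>x y. \<bar>v x - v y\<bar> \<le> I * \<bar>x - y\<bar>"
    using np(1) by blast
  have k: "0 \<le> k x" "k x \<le> 2 / e" for x using np(2,3) by auto
  have I: "0 \<le> I" by (rule np(4))
  have vb: "\<bar>v x\<bar> \<le> 2 * e * I" for x using v by (simp add: test_function_def)
  note cont = test_function_continuous[OF v]
  note [measurable] = cont[THEN borel_measurable_continuous_onI]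
  have hm [measurable]: "h \<in> borel_measurable borel"
    by (rule borel_measurable_continuous_onI[OF uniformly_continuous_imp_continuous[OF uc]])
  have km [measurable]: "k \<in> borel_measurable borel" unfolding k_def by measurable
  define \<psi> where "\<psi> x = \<bar>v (x / \<theta>) - v x\<bar>" for x
  have \<psi>c: "continuous_on UNIV \<psi>"
    unfolding \<psi>_def using \<theta>_gt_1
    by (intro continuous_intros continuous_on_compose2[OF cont(1)]) auto
  have \<psi>_le: "\<psi> x \<le> 4 * e * I" for x using vb[of "x / \<theta>"] vb[of x] unfolding \<psi>_def by linarith
  have \<psi>_near: "\<psi> x \<le> I * e" if "\<bar>x\<bar> < e" for x
  proof -
    have "\<bar>x / \<theta> - x\<bar> = \<bar>x\<bar> * (1 - 1 / \<theta>)"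
    proof -
      have "x / \<theta> - x = - (x * (1 - 1 / \<theta>))" by (simp add: algebra_simps)
      moreover have "0 \<le> 1 - 1 / \<theta>" using \<theta>_gt_1 by simp
      ultimately show ?thesis by (simp only: abs_minus abs_mult abs_of_nonneg)
    qed
    also have "\<dots> \<le> \<bar>x\<bar>" using \<theta>_gt_1 by (intro mult_right_le_one_le) auto
    finally have le: "\<bar>x / \<theta> - x\<bar> \<le> e" using that by linarith
    have "\<psi> x \<le> I * \<bar>x / \<theta> - x\<bar>" unfolding \<psi>_def by (rule lip)
    then show ?thesis using mult_left_mono[OF le I] by linarith
  qed
  let ?J = "\<lambda>w. \<Sum>s\<in>N w \<inter> {0<..T}. if countL s w < n then v (XL s w / \<theta>) - v (XL s w) else 0"
  let ?P = "\<lambda>w. \<Sum>s\<in>N w \<inter> {0<..T}. if countL s w < n then \<psi> (XL s w) else 0"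
  note P = expected_jump_sum[OF T \<psi>c _ \<psi>_le, of n]
  have P1: "integrable M ?P" by (rule P(1)) (simp add: \<psi>_def)
  have P2: "ennreal (\<integral>w. ?P w \<partial>M) = (\<integral>\<^sup>+ x. ennreal (\<psi> x) * \<Lambda> x \<partial>occm (enat n) T)" by (rule P(2)) (simp add: \<psi>_def)
  have "(\<integral>\<^sup>+ x. ennreal (\<psi> x) * \<Lambda> x \<partial>occm (enat n) T) \<le>
    (\<integral>\<^sup>+ x. ennreal (I * e) * (indicator {- e<..<e} x * \<Lambda> x) + ennreal (4 * e * I) * (indicator {x. e \<le> \<bar>x\<bar>} x * \<Lambda> x) \<partial>occm (enat n) T)"
  proof (rule nn_integral_mono)
    fix x
    show "ennreal (\<psi> x) * \<Lambda> x \<le> ennreal (I * e) * (indicator {- e<..<e} x * \<Lambda> x) + ennreal (4 * e * I) * (indicator {x. e \<le> \<bar>x\<bar>} x * \<Lambda> x)"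
    proof (cases "\<bar>x\<bar> < e")
      case True
      then have "x \<in> {- e<..<e}" "\<not> e \<le> \<bar>x\<bar>" by auto
      then show ?thesis using \<psi>_near[OF True] by (auto intro!: mult_right_mono ennreal_leI)
    next
      case False
      then have "x \<notin> {- e<..<e}" "e \<le> \<bar>x\<bar>" by auto
      then show ?thesis using \<psi>_le[of x] by (auto intro!: mult_right_mono ennreal_leI)
    qed
  qed
  also have "\<dots> = ennreal (I * e) * (\<integral>\<^sup>+ x. indicator {- e<..<e} x * \<Lambda> x \<partial>occm (enat n) T)
      + ennreal (4 * e * I) * (\<integral>\<^sup>+ x. indicator {x. e \<le> \<bar>x\<bar>} x * \<Lambda> x \<partial>occm (enat n) T)"
    by (simp add: nn_integral_add nn_integral_cmult)
  also have "\<dots> \<le> ennreal (I * e) * ennreal A + ennreal (4 * e * I) * ennreal Kf"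
    unfolding A(1) by (intro add_left_mono mult_left_mono Kf) auto
  also have "\<dots> = ennreal (I * e * A + 4 * e * I * Kf)"
    using I e A Kf by (simp add: ennreal_mult[symmetric])
  finally have "ennreal (\<integral>w. ?P w \<partial>M) \<le> ennreal (I * e * A + 4 * e * I * Kf)" unfolding P2 .
  moreover have "0 \<le> I * e * A + 4 * e * I * Kf" using I e A Kf by simp
  ultimately have EP: "(\<integral>w. ?P w \<partial>M) \<le> I * e * A + 4 * e * I * Kf" by simp
  have J: "\<bar>\<integral>w. ?J w \<partial>M\<bar> \<le> (\<integral>w. ?P w \<partial>M)"
  proof -
    have "\<bar>\<integral>w. ?J w \<partial>M\<bar> \<le> (\<integral>w. \<bar>?J w\<bar> \<partial>M)" by (rule integral_abs_bound)
    moreover have "(\<integral>w. \<bar>?J w\<bar> \<partial>M) \<le> (\<integral>w. ?P w \<partial>M)"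
    proof (rule integral_mono')
      show "integrable M ?P" by (rule P1)
      show "\<bar>?J w\<bar> \<le> ?P w" for w
        by (rule order_trans[OF sum_abs]) (auto intro!: sum_mono simp: \<psi>_def)
    qed (auto intro!: sum_nonneg simp: \<psi>_def)
    ultimately show ?thesis by linarith
  qed
  have Bc: "integrable (occm (enat n) T) h" using integral_occm_bound(1)[OF T hm, where C = 1 and n = "enat n"] h by auto
  have i1: "integrable (occm (enat n) T) v1" "\<bar>\<integral>x. v1 x \<partial>occm (enat n) T\<bar> \<le> I * T"
    by (rule integral_occm_bound[OF T borel_measurable_continuous_onI[OF cont(2)] v1])+
  have kb: "\<bar>k x\<bar> \<le> 2 / e" for x using k by simp
  have i2: "integrable (occm (enat n) T) k" "\<bar>\<integral>x. k x \<partial>occm (enat n) T\<bar> \<le> 2 / e * T"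
    by (rule integral_occm_bound[OF T km kb])+
  let ?E = "\<integral>x. h x \<partial>occm (enat n) T"
  let ?p = "prob {w \<in> space M. n \<le> count T w}"
  have eq: "(\<integral>x. \<mu> * v1 x + \<sigma>\<^sup>2 / 2 * (h x - I * k x) \<partial>occm (enat n) T) =
      \<mu> * (\<integral>x. v1 x \<partial>occm (enat n) T) + \<sigma>\<^sup>2 / 2 * (?E - I * (\<integral>x. k x \<partial>occm (enat n) T))"
    using i1(1) i2(1) Bc by simp
  have dyn: "\<bar>(\<integral>w. ?J w \<partial>M) + (\<mu> * (\<integral>x. v1 x \<partial>occm (enat n) T) + \<sigma>\<^sup>2 / 2 * (?E - I * (\<integral>x. k x \<partial>occm (enat n) T)))
     - ((\<integral>w. v (X T w) \<partial>M) - v x0)\<bar> \<le> 2 * (2 * e * I) * ?p"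
    using dynkin_space[OF v T, of n] unfolding eq .
  have p: "2 * (2 * e * I) * ?p \<le> 2 * (2 * e * I)"
    using I e by (intro mult_left_le) auto
  have vT: "\<bar>\<integral>w. v (X T w) \<partial>M\<bar> \<le> 2 * e * I"
  proof -
    have [measurable]: "X T \<in> borel_measurable M" by (rule X_measurable) (use T in simp)
    have "integrable M (\<lambda>w. v (X T w))"
      by (rule integrable_const_bound[where B = "2 * e * I"]) (use vb in auto)
    then have "(\<integral>w. \<bar>v (X T w)\<bar> \<partial>M) \<le> (\<integral>w. 2 * e * I \<partial>M)"
      by (intro integral_mono) (use vb in auto)
    then have "(\<integral>w. \<bar>v (X T w)\<bar> \<partial>M) \<le> 2 * e * I" by (simp add: prob_space)
    then show ?thesis by (rule order_trans[OF integral_abs_bound])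
  qed
  have mu: "\<bar>\<mu> * (\<integral>x. v1 x \<partial>occm (enat n) T)\<bar> \<le> \<bar>\<mu>\<bar> * (I * T)"
    unfolding abs_mult by (intro mult_left_mono i1) simp
  have kk: "I * (\<integral>x. k x \<partial>occm (enat n) T) \<le> I * (2 / e * T)"
    using i2(2) by (intro mult_left_mono I) simp
  have s2: "0 \<le> \<sigma>\<^sup>2 / 2" by simp
  have "\<sigma>\<^sup>2 / 2 * (I * (\<integral>x. k x \<partial>occm (enat n) T)) \<le> \<sigma>\<^sup>2 / 2 * (I * (2 / e * T))"
    by (rule mult_left_mono[OF kk s2])
  then have "\<sigma>\<^sup>2 / 2 * ?E \<le> 8 * e * I + \<bar>\<mu>\<bar> * (I * T) + \<sigma>\<^sup>2 / 2 * (I * (2 / e * T)) + (I * e * A + 4 * e * I * Kf)"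
    using dyn p vT mu J EP vb[of x0] by (simp only: right_diff_distrib)
  also have "\<dots> = (8 * e + \<bar>\<mu>\<bar> * T + \<sigma>\<^sup>2 * T / e + 4 * e * Kf + e * A) * I"
    by (simp add: algebra_simps)
  finally have "?E \<le> 2 / \<sigma>\<^sup>2 * (8 * e + \<bar>\<mu>\<bar> * T + \<sigma>\<^sup>2 * T / e + 4 * e * Kf + e * A) * I"
    using \<sigma>_pos by (simp add: field_simps)
  moreover have "(\<integral>\<^sup>+ x. ennreal (h x) \<partial>occm (enat n) T) = ennreal ?E"
    by (rule nn_integral_eq_integral[OF Bc]) (use h in auto)
  ultimately show ?thesis unfolding I_def by (simp add: ennreal_leI)
qed

text \<open>Let A be the expected number of jumps from (-e, e) among the first n. The occupation
  bound gives A \<le> (C0 + 2 e A/\<sigma>^2) I0 with I0 a local integral of \<Lambda>; for 4 e I0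
  \<le> \<sigma>^2 the term with A on the right is at most A/2, so A \<le> 2 C0 I0 uniformly in
  n.\<close>

theorem expected_rate_finite:
  assumes T: "0 < T"
  shows "(\<integral>\<^sup>+ x. \<Lambda> x \<partial>occm \<infinity> T) < \<infinity>"
proof -
  obtain r where r: "0 < r" "(\<integral>\<^sup>+ x. \<Lambda> x * indicator {-r..r} x \<partial>lborel) < \<infinity>"
    using \<Lambda>_integrable_near_0 by blast
  define I0 where "I0 = enn2real (\<integral>\<^sup>+ x. \<Lambda> x * indicator {-r..r} x \<partial>lborel)"
  have I0: "(\<integral>\<^sup>+ x. \<Lambda> x * indicator {-r..r} x \<partial>lborel) = ennreal I0" "0 \<le> I0" using r by (auto simp: I0_def)
  define e where "e = min r (\<sigma>\<^sup>2 / (4 * (I0 + 1)))"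
  have e: "0 < e" "e \<le> r" using r \<sigma>_pos I0 by (auto simp: e_def)
  have "e * (4 * (I0 + 1)) \<le> \<sigma>\<^sup>2" using I0 by (simp add: e_def min_def pos_le_divide_eq split: if_splits)
  moreover have "e * I0 \<le> e * (I0 + 1)" using e by simp
  ultimately have eI: "4 * (e * I0) \<le> \<sigma>\<^sup>2" by linarith
  have le: "(\<integral>\<^sup>+ x. \<Lambda> x * indicator {-e<..<e} x \<partial>lborel) \<le> ennreal I0"
    unfolding I0(1)[symmetric] using e by (intro nn_integral_mono mult_left_mono) (auto split: split_indicator)
  define Kf where "Kf = enn2real (\<integral>\<^sup>+ x. indicator {x. e \<le> \<bar>x\<bar>} x * \<Lambda> x \<partial>occm \<infinity> T)"
  have Kf: "(\<integral>\<^sup>+ x. indicator {x. e \<le> \<bar>x\<bar>} x * \<Lambda> x \<partial>occm \<infinity> T) = ennreal Kf" "0 \<le> Kf"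
    using rate_from_far[OF e(1) T] by (auto simp: Kf_def)
  have Kfn: "(\<integral>\<^sup>+ x. indicator {x. e \<le> \<bar>x\<bar>} x * \<Lambda> x \<partial>occm (enat n) T) \<le> ennreal Kf" for n
    unfolding Kf(1)[symmetric] by (rule occm_mono) auto
  define C0 where "C0 = 2 / \<sigma>\<^sup>2 * (8 * e + \<bar>\<mu>\<bar> * T + \<sigma>\<^sup>2 * T / e + 4 * e * Kf)"
  have C0: "0 \<le> C0" using e T Kf by (simp add: C0_def)
  have near: "(\<integral>\<^sup>+ x. indicator {- e<..<e} x * \<Lambda> x \<partial>occm (enat n) T) \<le> ennreal (2 * C0 * I0)" for n
  proof -
    have "(\<integral>\<^sup>+ x. indicator {- e<..<e} x * \<Lambda> x \<partial>occm (enat n) T) \<le> (\<integral>\<^sup>+ x. ennreal 1 * \<Lambda> x \<partial>occm (enat n) T)"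
      by (intro nn_integral_mono mult_right_mono) (auto split: split_indicator)
    also have "\<dots> = ennreal (\<integral>w. (\<Sum>s\<in>N w \<inter> {0<..T}. if countL s w < n then 1 else 0) \<partial>M)"
      by (rule expected_jump_sum(2)[OF T, of "\<lambda>_. 1" 1, symmetric]) auto
    \<comment> \<open>Absorbing A/2 requires A to be finite; the expected number of the first
      \<open>n\<close> jumps, an integral of a bounded function, provides this.\<close>
    finally have fin: "(\<integral>\<^sup>+ x. indicator {- e<..<e} x * \<Lambda> x \<partial>occm (enat n) T) < \<infinity>" by (rule le_less_trans) simp
    define A where "A = enn2real (\<integral>\<^sup>+ x. indicator {- e<..<e} x * \<Lambda> x \<partial>occm (enat n) T)"
    have A: "(\<integral>\<^sup>+ x. indicator {- e<..<e} x * \<Lambda> x \<partial>occm (enat n) T) = ennreal A" "0 \<le> A"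
      using fin by (auto simp: A_def)
    have K: "2 / \<sigma>\<^sup>2 * (8 * e + \<bar>\<mu>\<bar> * T + \<sigma>\<^sup>2 * T / e + 4 * e * Kf + e * A) = C0 + 2 / \<sigma>\<^sup>2 * (e * A)"
      unfolding C0_def by (simp add: distrib_left)
    have Kp: "0 \<le> C0 + 2 / \<sigma>\<^sup>2 * (e * A)" using C0 A e by simp
    have "(\<integral>\<^sup>+ x. \<Lambda> x * indicator {- e<..<e} x \<partial>occm (enat n) T)
      \<le> ennreal (C0 + 2 / \<sigma>\<^sup>2 * (e * A)) * (\<integral>\<^sup>+ x. \<Lambda> x * indicator {- e<..<e} x \<partial>lborel)"
    proof (rule nn_integral_le_of_test_functions[OF sets_occm e(1) Kp])
      show "(\<integral>\<^sup>+ x. ennreal (h x) \<partial>occm (enat n) T) \<le> ennreal ((C0 + 2 / \<sigma>\<^sup>2 * (e * A)) * (\<integral>x. h x \<partial>lborel))"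
        if "uniformly_continuous_on UNIV h" "\<And>x. 0 \<le> h x" "\<And>x. h x \<le> 1" "\<And>x. e \<le> \<bar>x\<bar> \<Longrightarrow> h x = 0" for h
        using occm_bound_near_0[OF e(1) T that A Kfn Kf(2)] unfolding K .
    qed (rule \<Lambda>_measurable)
    then have "ennreal A \<le> ennreal (C0 + 2 / \<sigma>\<^sup>2 * (e * A)) * (\<integral>\<^sup>+ x. \<Lambda> x * indicator {- e<..<e} x \<partial>lborel)"
      unfolding A(1)[symmetric] by (simp add: mult.commute)
    also have "\<dots> \<le> ennreal (C0 + 2 / \<sigma>\<^sup>2 * (e * A)) * ennreal I0" by (rule mult_left_mono[OF le]) simp
    also have "\<dots> = ennreal ((C0 + 2 / \<sigma>\<^sup>2 * (e * A)) * I0)" by (rule ennreal_mult[OF Kp I0(2), symmetric])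
    finally have "A \<le> (C0 + 2 / \<sigma>\<^sup>2 * (e * A)) * I0" using Kp I0 by simp
    moreover have "2 / \<sigma>\<^sup>2 * (e * A) * I0 \<le> A / 2"
    proof -
      have "A * (4 * (e * I0)) \<le> A * \<sigma>\<^sup>2" by (rule mult_left_mono[OF eI A(2)])
      then show ?thesis using \<sigma>_pos by (simp add: field_simps)
    qed
    ultimately have "A \<le> 2 * C0 * I0" by (simp add: distrib_right) 
    then show ?thesis unfolding A(1) by (rule ennreal_leI)
  qed
  have "(\<integral>\<^sup>+ x. \<Lambda> x \<partial>occm \<infinity> T) = (SUP n. \<integral>\<^sup>+ x. \<Lambda> x \<partial>occm (enat n) T)" by (rule occm_SUP) simp
  also have "\<dots> \<le> ennreal (2 * C0 * I0) + ennreal Kf"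
  proof (rule SUP_least)
    fix n
    have "(\<integral>\<^sup>+ x. \<Lambda> x \<partial>occm (enat n) T) =
      (\<integral>\<^sup>+ x. indicator {- e<..<e} x * \<Lambda> x + indicator {x. e \<le> \<bar>x\<bar>} x * \<Lambda> x \<partial>occm (enat n) T)"
      by (intro nn_integral_cong) (auto split: split_indicator)
    also have "\<dots> = (\<integral>\<^sup>+ x. indicator {- e<..<e} x * \<Lambda> x \<partial>occm (enat n) T) + (\<integral>\<^sup>+ x. indicator {x. e \<le> \<bar>x\<bar>} x * \<Lambda> x \<partial>occm (enat n) T)"
      by (intro nn_integral_add) auto
    also have "\<dots> \<le> ennreal (2 * C0 * I0) + ennreal Kf" by (intro add_mono near Kfn)
    finally show "(\<integral>\<^sup>+ x. \<Lambda> x \<partial>occm (enat n) T) \<le> ennreal (2 * C0 * I0) + ennreal Kf" .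
  qed
  also have "\<dots> < \<infinity>" by simp
  finally show ?thesis .
qed

end

section \<open>The equation in the sense of distributions\<close>

text \<open>Uniform continuity on a compact unit neighbourhood of \<open>K\<close> suffices: two
  points at distance below 1 both lie in it unless both are outside \<open>K\<close>, where
  \<open>f\<close> is 0.\<close>

lemma continuous_compact_support:
  fixes f :: "'a::{heine_borel, real_normed_vector} \<Rightarrow> real"
  assumes c: "continuous_on UNIV f" and K: "compact K" and supp: "\<And>x. x \<notin> K \<Longrightarrow> f x = 0"
  shows "uniformly_continuous_on UNIV f" "\<exists>B. \<forall>x. \<bar>f x\<bar> \<le> B"
proof -
  define K1 where "K1 = {x + y |x y. x \<in> K \<and> y \<in> cball 0 1}"
  have "compact K1" unfolding K1_def by (intro compact_sums K compact_cball)
  then have uc: "uniformly_continuous_on K1 f"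
    by (intro compact_uniformly_continuous continuous_on_subset[OF c]) auto
  have near: "y \<in> K1" if "x \<in> K" "dist x y \<le> 1" for x y
    unfolding K1_def using that by (intro CollectI exI[of _ x] exI[of _ "y - x"]) (auto simp: dist_norm norm_minus_commute)
  show "uniformly_continuous_on UNIV f"
  unfolding uniformly_continuous_on_def
  proof (intro allI impI)
    fix e :: real assume e: "0 < e"
    obtain d where d: "0 < d" "\<And>x y. x \<in> K1 \<Longrightarrow> y \<in> K1 \<Longrightarrow> dist y x < d \<Longrightarrow> dist (f y) (f x) < e"
      using uniformly_continuous_onE[OF uc e] by metis
    show "\<exists>d>0. \<forall>x\<in>UNIV. \<forall>x'\<in>UNIV. dist x' x < d \<longrightarrow> dist (f x') (f x) < e"
    proof (intro exI[of _ "min d 1"] conjI ballI impI)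
      fix x y :: 'a assume a: "dist y x < min d 1"
      show "dist (f y) (f x) < e"
      proof (cases "x \<in> K \<or> y \<in> K")
        case True
        then have "x \<in> K1" "y \<in> K1" using near[of x x] near[of x y] near[of y x] near[of y y] a by (auto simp: dist_commute)
        then show ?thesis using d a by auto
      next
        case False
        then show ?thesis using supp e by simp
      qed
    qed (use d in auto)
  qed
  have "bounded (f ` K)" by (intro compact_imp_bounded compact_continuous_image continuous_on_subset[OF c] K) auto
  then obtain B where B: "\<And>x. x \<in> K \<Longrightarrow> \<bar>f x\<bar> \<le> B" by (auto simp: bounded_iff)
  have "\<bar>f x\<bar> \<le> max B 0" for x using B[of x] supp[of x] by (cases "x \<in> K") auto
  then show "\<exists>B. \<forall>x. \<bar>f x\<bar> \<le> B" by blast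
qed

lemma derivatives_vanish_off_support:
  assumes K: "compact K" and supp: "\<And>t x. (t, x) \<notin> K \<Longrightarrow> \<phi> t x = 0" and z: "(t, x) \<notin> K"
  shows "dt \<phi> t x = 0" "dx \<phi> t x = 0"
proof -
  have op: "open (- K)" using compact_imp_closed[OF K] by (simp add: open_Compl)
  have "open ((\<lambda>s. (s, x)) -` (- K))" "open ((\<lambda>y. (t, y)) -` (- K))"
    by (intro continuous_open_vimage op continuous_intros)+
  then have "eventually (\<lambda>s. (s, x) \<in> - K) (nhds t)" "eventually (\<lambda>y. (t, y) \<in> - K) (nhds x)"
    using z eventually_nhds_in_open[of "(\<lambda>s. (s, x)) -` (- K)" t] eventually_nhds_in_open[of "(\<lambda>y. (t, y)) -` (- K)" x] by auto
  then have "eventually (\<lambda>s. \<phi> s x = 0) (nhds t)" "eventually (\<lambda>y. \<phi> t y = 0) (nhds x)"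
    by (auto elim!: eventually_mono simp: supp)
  from this[THEN deriv_cong_ev[OF _ refl]]
  show "dt \<phi> t x = 0" "dx \<phi> t x = 0" unfolding dt_def dx_def by simp_all
qed

text \<open>Compactness of the support supplies the bounds and the uniform continuity; the
  derivatives vanish off \<open>K\<close> because its complement is open.\<close>

lemma test_function_of_C12:
  assumes \<phi>: "C12_on UNIV \<phi>" and K: "compact K" and supp: "\<And>t x. (t, x) \<notin> K \<Longrightarrow> \<phi> t x = 0"
  shows "\<exists>B. test_function \<phi> (dt \<phi>) (dx \<phi>) (dx (dx \<phi>)) B B"
proof -
  have d1: "dt \<phi> t x = 0" "dx \<phi> t x = 0" if "(t, x) \<notin> K" for t x
    by (rule derivatives_vanish_off_support(1)[where \<phi> = \<phi>, OF K supp that], assumption,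
      rule derivatives_vanish_off_support(2)[where \<phi> = \<phi>, OF K supp that])
  have d2: "dx (dx \<phi>) t x = 0" if "(t, x) \<notin> K" for t x
    by (rule derivatives_vanish_off_support(2)[where \<phi> = "dx \<phi>", OF K d1(2) that])
  have c: "continuous_on UNIV (\<lambda>z. \<phi> (fst z) (snd z))" "continuous_on UNIV (\<lambda>z. dt \<phi> (fst z) (snd z))"
    "continuous_on UNIV (\<lambda>z. dx \<phi> (fst z) (snd z))" "continuous_on UNIV (\<lambda>z. dx (dx \<phi>) (fst z) (snd z))"
    using \<phi> by (auto simp: C12_on_def split_beta)
  have "\<exists>B. \<forall>z. \<bar>\<phi> (fst z) (snd z)\<bar> \<le> B" "\<exists>B. \<forall>z. \<bar>dt \<phi> (fst z) (snd z)\<bar> \<le> B"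
    "\<exists>B. \<forall>z. \<bar>dx \<phi> (fst z) (snd z)\<bar> \<le> B" "\<exists>B. \<forall>z. \<bar>dx (dx \<phi>) (fst z) (snd z)\<bar> \<le> B"
    by (rule continuous_compact_support(2)[OF c(1) K], use supp in simp,
      rule continuous_compact_support(2)[OF c(2) K], use d1 in simp,
      rule continuous_compact_support(2)[OF c(3) K], use d1 in simp,
      rule continuous_compact_support(2)[OF c(4) K], use d2 in simp)
  then obtain B1 B2 B3 B4 where B: "\<And>z. \<bar>\<phi> (fst z) (snd z)\<bar> \<le> B1" "\<And>z. \<bar>dt \<phi> (fst z) (snd z)\<bar> \<le> B2"
    "\<And>z. \<bar>dx \<phi> (fst z) (snd z)\<bar> \<le> B3" "\<And>z. \<bar>dx (dx \<phi>) (fst z) (snd z)\<bar> \<le> B4" by blast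
  have B': "\<bar>\<phi> t x\<bar> \<le> B1" "\<bar>dt \<phi> t x\<bar> \<le> B2" "\<bar>dx \<phi> t x\<bar> \<le> B3" "\<bar>dx (dx \<phi>) t x\<bar> \<le> B4" for t x
    using B[of "(t, x)"] by simp_all
  have "0 \<le> B1" "0 \<le> B2" "0 \<le> B3" "0 \<le> B4" using B'[of 0 0] by linarith+
  then have "\<bar>\<phi> t x\<bar> \<le> B1 + B2 + B3 + B4" "\<bar>dt \<phi> t x\<bar> \<le> B1 + B2 + B3 + B4"
    "\<bar>dx \<phi> t x\<bar> \<le> B1 + B2 + B3 + B4" "\<bar>dx (dx \<phi>) t x\<bar> \<le> B1 + B2 + B3 + B4" for t x
    using B'[of t x] by linarith+
  moreover have "((\<lambda>s. \<phi> s x) has_real_derivative dt \<phi> t x) (at t)" "(\<phi> t has_real_derivative dx \<phi> t x) (at x)"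
    "(dx \<phi> t has_real_derivative dx (dx \<phi>) t x) (at x)" for t x
  proof -
    have f: "(\<lambda>s. \<phi> s x) field_differentiable at t" "(\<lambda>y. \<phi> t y) field_differentiable at x" "(\<lambda>y. dx \<phi> t y) field_differentiable at x"
      using \<phi> by (auto simp: C12_on_def)
    show "((\<lambda>s. \<phi> s x) has_real_derivative dt \<phi> t x) (at t)" "(\<phi> t has_real_derivative dx \<phi> t x) (at x)"
      "(dx \<phi> t has_real_derivative dx (dx \<phi>) t x) (at x)"
      using f[unfolded DERIV_deriv_iff_field_differentiable[symmetric]]
      by (simp_all add: dt_def dx_def[abs_def])
  qed
  moreover have "uniformly_continuous_on UNIV (\<lambda>z. dt \<phi> (fst z) (snd z))"
    by (rule continuous_compact_support(1)[OF c(2) K]) (use d1 in simp)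
  moreover have "uniformly_continuous_on UNIV (\<lambda>z. dx (dx \<phi>) (fst z) (snd z))"
    by (rule continuous_compact_support(1)[OF c(4) K]) (use d2 in simp)
  ultimately have "test_function \<phi> (dt \<phi>) (dx \<phi>) (dx (dx \<phi>)) (B1 + B2 + B3 + B4) (B1 + B2 + B3 + B4)"
    unfolding test_function_def using c by blast
  then show ?thesis by blast
qed

text \<open>Dilating the second coordinate has determinant \<open>c\<close>; this is the source of
  the factor \<theta> in the non-local term.\<close>

lemma lborel_scale_snd:
  fixes c :: real assumes c: "0 < c"
  shows "(lborel :: (real \<times> real) measure) = density (distr lborel borel (\<lambda>z. (fst z, c * snd z))) (\<lambda>_. ennreal c)"
proof (rule measure_eqI)
  fix A :: "(real \<times> real) set" assume "A \<in> sets lborel"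
  then have A' [measurable]: "A \<in> sets borel" by simp
  then have A [measurable]: "A \<in> sets (borel \<Otimes>\<^sub>M borel)" unfolding borel_prod .
  have g [measurable]: "(\<lambda>z. (fst z, c * snd z)) \<in> (borel \<Otimes>\<^sub>M borel) \<rightarrow>\<^sub>M (borel :: (real \<times> real) measure)"
    unfolding borel_prod[symmetric] by measurable
  then have g': "(\<lambda>z :: real \<times> real. (fst z, c * snd z)) \<in> borel \<rightarrow>\<^sub>M borel" by (simp add: borel_prod)
  have "emeasure (density (distr lborel borel (\<lambda>z. (fst z, c * snd z))) (\<lambda>_. ennreal c)) A =
      (\<integral>\<^sup>+ z. ennreal c * indicator A z \<partial>distr lborel borel (\<lambda>z. (fst z, c * snd z)))"
    by (subst emeasure_density) auto
  also have "\<dots> = (\<integral>\<^sup>+ z. ennreal c * indicator A (fst z, c * snd z) \<partial>(lborel :: (real \<times> real) measure))"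
    by (rule nn_integral_distr) (use g' in auto)
  also have "\<dots> = (\<integral>\<^sup>+ z. ennreal c * indicator A (fst z, c * snd z) \<partial>(lborel \<Otimes>\<^sub>M lborel))"
    by (simp add: lborel_prod)
  also have "\<dots> = (\<integral>\<^sup>+ t. (\<integral>\<^sup>+ x. ennreal c * indicator A (t, c * x) \<partial>lborel) \<partial>lborel)"
    by (subst lborel.nn_integral_fst[symmetric]) (auto simp: split_beta')
  also have "\<dots> = (\<integral>\<^sup>+ t. (\<integral>\<^sup>+ x. indicator A (t, x) \<partial>lborel) \<partial>lborel)"
  proof (rule nn_integral_cong)
    fix t
    have "(\<integral>\<^sup>+ x. indicator A (t, x) \<partial>lborel) = ennreal \<bar>c\<bar> * (\<integral>\<^sup>+ x. indicator A (t, 0 + c * x) \<partial>lborel)"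
      by (rule nn_integral_real_affine) (use c in auto)
    then show "(\<integral>\<^sup>+ x. ennreal c * indicator A (t, c * x) \<partial>lborel) = (\<integral>\<^sup>+ x. indicator A (t, x) \<partial>lborel)"
      using c by (simp add: nn_integral_cmult)
  qed
  also have "\<dots> = (\<integral>\<^sup>+ z. indicator A z \<partial>(lborel \<Otimes>\<^sub>M lborel))"
    by (subst lborel.nn_integral_fst) auto
  also have "\<dots> = emeasure lborel A" by (simp add: lborel_prod)
  finally show "emeasure lborel A = emeasure (density (distr lborel borel (\<lambda>z. (fst z, c * snd z))) (\<lambda>_. ennreal c)) A" ..
qed simp

lemma integral_scale_snd:
  fixes c :: real and f :: "real \<times> real \<Rightarrow> real"
  assumes c: "0 < c" and f: "integrable lborel f"
  shows "integrable lborel (\<lambda>z. f (fst z, c * snd z))"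
    and "(\<integral>z. f z \<partial>lborel) = c * (\<integral>z. f (fst z, c * snd z) \<partial>lborel)"
proof -
  have fm: "f \<in> borel_measurable borel" using borel_measurable_integrable[OF f] by simp
  have "(\<lambda>z. (fst z, c * snd z)) \<in> (borel \<Otimes>\<^sub>M borel) \<rightarrow>\<^sub>M (borel :: (real \<times> real) measure)"
    unfolding borel_prod[symmetric] by measurable
  then have g': "(\<lambda>z :: real \<times> real. (fst z, c * snd z)) \<in> borel \<rightarrow>\<^sub>M borel" by (simp add: borel_prod)
  have "integrable (density (distr lborel borel (\<lambda>z. (fst z, c * snd z))) (\<lambda>_. ennreal c)) f"
    using f by (subst lborel_scale_snd[OF c, symmetric])
  then have "integrable (distr lborel borel (\<lambda>z. (fst z, c * snd z))) (\<lambda>z. c * f z)"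
    by (subst (asm) integrable_density) (use c fm in auto)
  then have "integrable (distr lborel borel (\<lambda>z. (fst z, c * snd z))) f" using c by simp
  then show "integrable lborel (\<lambda>z. f (fst z, c * snd z))"
    by (subst (asm) integrable_distr_eq) (use g' fm in auto)
  have "(\<integral>z. f z \<partial>lborel) = (\<integral>z. f z \<partial>density (distr lborel borel (\<lambda>z. (fst z, c * snd z))) (\<lambda>_. ennreal c))"
    by (subst lborel_scale_snd[OF c]) simp
  also have "\<dots> = (\<integral>z. c * f z \<partial>distr lborel borel (\<lambda>z. (fst z, c * snd z)))"
    by (subst integral_density) (use c fm in auto)
  also have "\<dots> = (\<integral>z. c * f (fst z, c * snd z) \<partial>lborel)"
    by (rule integral_distr) (use g' fm in auto)
  finally show "(\<integral>z. f z \<partial>lborel) = c * (\<integral>z. f (fst z, c * snd z) \<partial>lborel)" by simp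
qed

context jump_diffusion begin

definition rate :: "real \<Rightarrow> real" where "rate x = enn2real (\<Lambda> x)"

lemma measurable_rate [measurable]: "rate \<in> borel_measurable borel"
  unfolding rate_def by measurable

lemma measurable_time_space: "(\<lambda>z. (fst z, X (max 0 (fst z)) (snd z))) \<in> (lborel \<Otimes>\<^sub>M M) \<rightarrow>\<^sub>M borel"
  unfolding borel_prod[symmetric] by measurable

lemma integrable_occ_weight:
  assumes T: "0 < T"
  shows "integrable (lborel \<Otimes>\<^sub>M M) (occ_weight \<infinity> T)"
proof (rule integrableI_bounded)
  have "(\<integral>\<^sup>+ z. ennreal (norm (occ_weight \<infinity> T z)) \<partial>(lborel \<Otimes>\<^sub>M M)) = (\<integral>\<^sup>+ z. ennreal (occ_weight \<infinity> T z) * (\<lambda>_. 1) (X (max 0 (fst z)) (snd z)) \<partial>(lborel \<Otimes>\<^sub>M M))"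
    by (simp add: occ_weight_nonneg)
  also have "\<dots> = (\<integral>\<^sup>+ x. 1 \<partial>occm \<infinity> T)" by (rule nn_integral_occm_pair[symmetric]) simp
  also have "\<dots> < \<infinity>" using finite_occm[OF T, of \<infinity>] by (auto simp: less_top[symmetric] top_unique)
  finally show "(\<integral>\<^sup>+ z. ennreal (norm (occ_weight \<infinity> T z)) \<partial>(lborel \<Otimes>\<^sub>M M)) < \<infinity>" .
qed measurable

text \<open>Compensation for bounded signed integrands. The finite expected rate supplies the
  integrability, also without a bound on the number of jumps, that is needed to subtract the
  positive and negative parts.\<close>

lemma expected_jump_sum_time_space:
  fixes \<eta> :: "real \<times> real \<Rightarrow> real"
  assumes T: "0 < T" and c: "continuous_on UNIV \<eta>" and b: "\<And>z. \<bar>\<eta> z\<bar> \<le> C"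
  shows "integrable (lborel \<Otimes>\<^sub>M M) (\<lambda>z. occ_weight n T z * (\<eta> (fst z, X (max 0 (fst z)) (snd z)) * rate (X (max 0 (fst z)) (snd z))))"
    and "(\<integral>w. (\<Sum>s\<in>N w \<inter> {0<..T}. if countL s w < k then \<eta> (s, XL s w) else 0) \<partial>M) =
      (\<integral>z. occ_weight (enat k) T z * (\<eta> (fst z, X (max 0 (fst z)) (snd z)) * rate (X (max 0 (fst z)) (snd z))) \<partial>(lborel \<Otimes>\<^sub>M M))"
proof -
  let ?J = "\<lambda>\<eta> w. \<Sum>s\<in>N w \<inter> {0<..T}. if countL s w < k then \<eta> (s, XL s w) else 0 :: real"
  let ?G = "\<lambda>\<eta> n z. occ_weight n T z * (\<eta> (fst z, X (max 0 (fst z)) (snd z)) * rate (X (max 0 (fst z)) (snd z)))"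
  let ?L = "\<lambda>z. occ_weight \<infinity> T z * rate (X (max 0 (fst z)) (snd z))"
  have L: "integrable (lborel \<Otimes>\<^sub>M M) ?L"
  proof (rule integrableI_bounded)
    have "(\<integral>\<^sup>+ z. ennreal (norm (?L z)) \<partial>(lborel \<Otimes>\<^sub>M M)) \<le> (\<integral>\<^sup>+ z. ennreal (occ_weight \<infinity> T z) * \<Lambda> (X (max 0 (fst z)) (snd z)) \<partial>(lborel \<Otimes>\<^sub>M M))"
      by (intro nn_integral_mono) (auto simp: occ_weight_nonneg ennreal_mult rate_def abs_mult ennreal_enn2real_if intro!: mult_left_mono)
    also have "\<dots> < \<infinity>"
      using expected_rate_finite[OF T] by (simp add: nn_integral_occm_pair)
    finally show "(\<integral>\<^sup>+ z. ennreal (norm (?L z)) \<partial>(lborel \<Otimes>\<^sub>M M)) < \<infinity>" .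
  qed measurable
  have G: "integrable (lborel \<Otimes>\<^sub>M M) (?G \<eta> n)" if c: "continuous_on UNIV \<eta>" and b: "\<And>z. \<bar>\<eta> z\<bar> \<le> C" for \<eta> n
  proof (rule Bochner_Integration.integrable_bound)
    show "integrable (lborel \<Otimes>\<^sub>M M) (\<lambda>z. C * ?L z)" using L by simp
    have "(\<lambda>z. \<eta> (fst z, X (max 0 (fst z)) (snd z))) \<in> borel_measurable (lborel \<Otimes>\<^sub>M M)"
      by (rule measurable_compose[OF measurable_time_space borel_measurable_continuous_onI[OF c]])
    then show "?G \<eta> n \<in> borel_measurable (lborel \<Otimes>\<^sub>M M)" by measurable
    show "AE z in lborel \<Otimes>\<^sub>M M. norm (?G \<eta> n z) \<le> norm (C * ?L z)"
    proof (rule AE_I2)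
      fix z
      have C: "0 \<le> C" using b[of z] by linarith
      have "\<bar>?G \<eta> n z\<bar> = occ_weight n T z * (\<bar>\<eta> (fst z, X (max 0 (fst z)) (snd z))\<bar> * rate (X (max 0 (fst z)) (snd z)))"
        by (simp add: abs_mult occ_weight_nonneg rate_def)
      moreover have "\<dots> \<le> occ_weight \<infinity> T z * (C * rate (X (max 0 (fst z)) (snd z)))"
        using b C by (intro mult_mono mult_right_mono) (auto simp: occ_weight_def rate_def)
      ultimately have "\<bar>?G \<eta> n z\<bar> \<le> C * ?L z" by (simp add: mult.left_commute)
      then show "norm (?G \<eta> n z) \<le> norm (C * ?L z)" by simp
    qed
  qed
  show "integrable (lborel \<Otimes>\<^sub>M M) (?G \<eta> n)" by (rule G[OF c b])
  \<comment> \<open>The finite expected rate makes \<Lambda>(X) finite almost everywhere where the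
    weight is not 0, so replacing \<infinity> by 0 through \<open>enn2real\<close> changes no
    integral.\<close>
  have Lfin: "AE z in lborel \<Otimes>\<^sub>M M. occ_weight \<infinity> T z = 0 \<or> \<Lambda> (X (max 0 (fst z)) (snd z)) \<noteq> \<infinity>"
  proof -
    have "AE z in lborel \<Otimes>\<^sub>M M. ennreal (occ_weight \<infinity> T z) * \<Lambda> (X (max 0 (fst z)) (snd z)) \<noteq> \<infinity>"
      using expected_rate_finite[OF T] by (intro nn_integral_PInf_AE) (auto simp: nn_integral_occm_pair)
    then show ?thesis by eventually_elim (auto simp: occ_weight_def ennreal_mult_eq_top_iff split: split_indicator_asm)
  qed
  have J: "?J \<eta> \<in> borel_measurable M" if "continuous_on UNIV \<eta>" for \<eta>
    using measurable_jump_sum[of "\<lambda>s x. \<eta> (s, x)" T k] that T by simp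
  have Ji: "integrable M (?J \<eta>)" if c: "continuous_on UNIV \<eta>" and b: "\<And>z. \<bar>\<eta> z\<bar> \<le> C" for \<eta>
  proof (rule integrable_const_bound[where B = "real k * C"])
    have "norm (?J \<eta> w) \<le> real k * C" if w: "w \<in> space M" for w
    proof -
      have "\<bar>?J \<eta> w\<bar> \<le> (\<Sum>s\<in>N w \<inter> {0<..T}. if countL s w < k then \<bar>\<eta> (s, XL s w)\<bar> else 0)"
        by (rule order_trans[OF sum_abs]) (auto intro!: sum_mono)
      moreover have "\<dots> \<le> real k * C"
        using sum_jumps_le[OF w, of k "\<lambda>s. \<bar>\<eta> (s, XL s w)\<bar>" C T] b order_trans[OF abs_ge_zero b] by simp
      ultimately show ?thesis by simp
    qed
    then show "AE w in M. norm (?J \<eta> w) \<le> real k * C" by (rule AE_I2)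
  qed (rule J[OF c])
  have main: "(\<integral>w. ?J \<eta> w \<partial>M) = (\<integral>z. ?G \<eta> (enat k) z \<partial>(lborel \<Otimes>\<^sub>M M))"
    if c: "continuous_on UNIV \<eta>" and b: "\<And>z. \<bar>\<eta> z\<bar> \<le> C" and nn: "\<And>z. 0 \<le> \<eta> z" for \<eta>
  proof -
    have m: "\<eta> \<in> borel_measurable (borel \<Otimes>\<^sub>M borel)" using borel_measurable_continuous_onI[OF c] by (simp add: borel_prod)
    define f :: "real \<times> real \<times> nat \<Rightarrow> ennreal" where "f = (\<lambda>y. if snd (snd y) < k then ennreal (\<eta> (fst y, fst (snd y))) else 0)"
    have fm [measurable]: "f \<in> borel_measurable (borel \<Otimes>\<^sub>M borel \<Otimes>\<^sub>M count_space UNIV)"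
      using m unfolding f_def by measurable
    have "(\<integral>\<^sup>+ w. ennreal (?J \<eta> w) \<partial>M) = (\<integral>\<^sup>+ w. (\<Sum>s\<in>N w \<inter> {0<..T}. f (s, XL s w, countL s w)) \<partial>M)"
    proof (rule nn_integral_cong)
      fix w
      have "ennreal (?J \<eta> w) = (\<Sum>s\<in>N w \<inter> {0<..T}. ennreal (if countL s w < k then \<eta> (s, XL s w) else 0))"
        by (rule sum_ennreal[symmetric]) (simp add: nn)
      then show "ennreal (?J \<eta> w) = (\<Sum>s\<in>N w \<inter> {0<..T}. f (s, XL s w, countL s w))"
        by (auto simp: f_def intro!: sum.cong)
    qed
    also have "\<dots> = (\<integral>\<^sup>+ w. (\<integral>\<^sup>+ s\<in>{0<..T}. f (s, X s w, count s w) * \<Lambda> (X s w) \<partial>lborel) \<partial>M)"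
      by (rule compensation[OF fm])
    also have "\<dots> = (\<integral>\<^sup>+ w. (\<integral>\<^sup>+ s\<in>{0<..T}. (\<lambda>y. f y * \<Lambda> (fst (snd y))) (s, X s w, count s w) \<partial>lborel) \<partial>M)"
      by simp
    also have "\<dots> = (\<integral>\<^sup>+ z. (\<lambda>y. f y * \<Lambda> (fst (snd y))) (fst z, X (max 0 (fst z)) (snd z), count (max 0 (fst z)) (snd z)) * indicator {0<..T} (fst z) \<partial>(lborel \<Otimes>\<^sub>M M))"
      by (rule nn_integral_time_space) measurable
    also have "\<dots> = (\<integral>\<^sup>+ z. ennreal (?G \<eta> (enat k) z) \<partial>(lborel \<Otimes>\<^sub>M M))"
    proof (rule nn_integral_cong_AE, use Lfin in eventually_elim)
      fix z assume "occ_weight \<infinity> T z = 0 \<or> \<Lambda> (X (max 0 (fst z)) (snd z)) \<noteq> \<infinity>"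
      then show "(\<lambda>y. f y * \<Lambda> (fst (snd y))) (fst z, X (max 0 (fst z)) (snd z), count (max 0 (fst z)) (snd z)) * indicator {0<..T} (fst z)
        = ennreal (?G \<eta> (enat k) z)"
        by (auto simp: f_def occ_weight_def rate_def nn ennreal_mult ennreal_enn2real_if split: split_indicator split_indicator_asm)
    qed
    finally have eq: "(\<integral>\<^sup>+ w. ennreal (?J \<eta> w) \<partial>M) = (\<integral>\<^sup>+ z. ennreal (?G \<eta> (enat k) z) \<partial>(lborel \<Otimes>\<^sub>M M))" .
    have "(\<integral>w. ?J \<eta> w \<partial>M) = enn2real (\<integral>\<^sup>+ w. ennreal (?J \<eta> w) \<partial>M)"
      by (rule integral_eq_nn_integral[OF J[OF c]]) (auto intro!: sum_nonneg AE_I2 simp: nn)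
    moreover have "(\<integral>z. ?G \<eta> (enat k) z \<partial>(lborel \<Otimes>\<^sub>M M)) = enn2real (\<integral>\<^sup>+ z. ennreal (?G \<eta> (enat k) z) \<partial>(lborel \<Otimes>\<^sub>M M))"
      by (rule integral_eq_nn_integral[OF borel_measurable_integrable[OF G[OF c b]]])
        (auto intro!: AE_I2 mult_nonneg_nonneg simp: nn occ_weight_nonneg rate_def)
    ultimately show ?thesis by (simp only: eq)
  qed
  define \<eta>1 \<eta>2 where "\<eta>1 z = max 0 (\<eta> z)" and "\<eta>2 z = max 0 (- \<eta> z)" for z
  have c12: "continuous_on UNIV \<eta>1" "continuous_on UNIV \<eta>2" unfolding \<eta>1_def \<eta>2_def by (intro continuous_intros c)+
  have C: "0 \<le> C" using b[of undefined] by linarith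
  have b1: "\<bar>\<eta>1 z\<bar> \<le> C" and b2: "\<bar>\<eta>2 z\<bar> \<le> C" for z using b[of z] C by (auto simp: \<eta>1_def \<eta>2_def)
  have p: "\<eta> z = \<eta>1 z - \<eta>2 z" for z by (simp add: \<eta>1_def \<eta>2_def)
  have "(\<integral>w. ?J \<eta> w \<partial>M) = (\<integral>w. ?J \<eta>1 w - ?J \<eta>2 w \<partial>M)"
    by (intro Bochner_Integration.integral_cong refl, subst sum_subtractf[symmetric]) (auto simp: p intro!: sum.cong)
  also have "\<dots> = (\<integral>z. ?G \<eta>1 (enat k) z \<partial>(lborel \<Otimes>\<^sub>M M)) - (\<integral>z. ?G \<eta>2 (enat k) z \<partial>(lborel \<Otimes>\<^sub>M M))"
    using main[OF c12(1) b1] main[OF c12(2) b2] Bochner_Integration.integral_diff[OF Ji[OF c12(1) b1] Ji[OF c12(2) b2]]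
    by (simp add: \<eta>1_def \<eta>2_def)
  also have "\<dots> = (\<integral>z. ?G \<eta>1 (enat k) z - ?G \<eta>2 (enat k) z \<partial>(lborel \<Otimes>\<^sub>M M))"
    by (rule Bochner_Integration.integral_diff[OF G[OF c12(1) b1] G[OF c12(2) b2], symmetric])
  also have "\<dots> = (\<integral>z. ?G \<eta> (enat k) z \<partial>(lborel \<Otimes>\<^sub>M M))"
    by (intro Bochner_Integration.integral_cong refl) (simp add: p algebra_simps)
  finally show "(\<integral>w. ?J \<eta> w \<partial>M) = (\<integral>z. ?G \<eta> (enat k) z \<partial>(lborel \<Otimes>\<^sub>M M))" .
qed

text \<open>Letting the number of admitted jumps tend to infinity in the localized Dynkin formula.\<close>

lemma dynkin_time_space:
  assumes \<phi>: "test_function \<phi> \<phi>t \<phi>x \<phi>xx B0 B" and T: "0 < T" and z: "\<And>x. \<phi> 0 x = 0" "\<And>x. \<phi> T x = 0"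
  shows "(\<integral>z. occ_weight \<infinity> T z * (generator \<phi>t \<phi>x \<phi>xx (fst z) (X (max 0 (fst z)) (snd z)) +
    (\<phi> (fst z) (X (max 0 (fst z)) (snd z) / \<theta>) - \<phi> (fst z) (X (max 0 (fst z)) (snd z))) * rate (X (max 0 (fst z)) (snd z))) \<partial>(lborel \<Otimes>\<^sub>M M)) = 0"
proof -
  interpret P: pair_sigma_finite lborel M ..
  define \<eta> where "\<eta> z = \<phi> (fst z) (snd z / \<theta>) - \<phi> (fst z) (snd z)" for z
  define g where "g z = generator \<phi>t \<phi>x \<phi>xx (fst z) (snd z)" for z
  define Y where "Y z = (fst z, X (max 0 (fst z)) (snd z))" for z
  have c\<phi>: "continuous_on UNIV (\<lambda>z. \<phi> (fst z) (snd z))" using \<phi> by (simp add: test_function_def)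
  have "continuous_on UNIV (\<lambda>z. (\<lambda>z. \<phi> (fst z) (snd z)) (fst z, snd z / \<theta>))"
    by (rule continuous_on_compose2[OF c\<phi>]) (use \<theta>_gt_1 in \<open>auto intro!: continuous_intros\<close>)
  then have \<eta>c: "continuous_on UNIV \<eta>" unfolding \<eta>_def by (intro continuous_intros c\<phi>) simp
  have \<phi>b: "\<bar>\<phi> t x\<bar> \<le> B0" for t x using \<phi> by (simp add: test_function_def)
  have \<eta>b: "\<bar>\<eta> z\<bar> \<le> 2 * B0" for z using \<phi>b[of "fst z" "snd z / \<theta>"] \<phi>b[of "fst z" "snd z"] unfolding \<eta>_def by linarith
  have gc: "continuous_on UNIV g" unfolding g_def by (rule continuous_generator[OF \<phi> T])
  define C where "C = B + \<bar>\<mu>\<bar> * B + \<sigma>\<^sup>2 / 2 * B"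
  have gb: "\<bar>g z\<bar> \<le> C" for z unfolding g_def C_def by (rule generator_bound[OF \<phi> T])
  have Ym: "Y \<in> (lborel \<Otimes>\<^sub>M M) \<rightarrow>\<^sub>M borel" unfolding Y_def by (rule measurable_time_space)
  have gm [measurable]: "(\<lambda>z. g (Y z)) \<in> borel_measurable (lborel \<Otimes>\<^sub>M M)"
    by (rule measurable_compose[OF Ym borel_measurable_continuous_onI[OF gc]])
  have \<eta>m [measurable]: "(\<lambda>z. \<eta> (Y z)) \<in> borel_measurable (lborel \<Otimes>\<^sub>M M)"
    by (rule measurable_compose[OF Ym borel_measurable_continuous_onI[OF \<eta>c]])
  have rate_m [measurable]: "(\<lambda>z. rate (snd (Y z))) \<in> borel_measurable (lborel \<Otimes>\<^sub>M M)" unfolding Y_def by simp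
  have gi: "integrable (lborel \<Otimes>\<^sub>M M) (\<lambda>z. occ_weight n T z * g (Y z))" for n
  proof (rule Bochner_Integration.integrable_bound)
    show "integrable (lborel \<Otimes>\<^sub>M M) (\<lambda>z. C * occ_weight \<infinity> T z)" using integrable_occ_weight[OF T] by simp
    show "AE z in lborel \<Otimes>\<^sub>M M. norm (occ_weight n T z * g (Y z)) \<le> norm (C * occ_weight \<infinity> T z)"
      using gb order_trans[OF abs_ge_zero gb] by (intro AE_I2) (auto simp: occ_weight_def split: split_indicator)
  qed measurable
  have \<eta>i: "integrable (lborel \<Otimes>\<^sub>M M) (\<lambda>z. occ_weight n T z * (\<eta> (Y z) * rate (snd (Y z))))" for n
    using expected_jump_sum_time_space(1)[OF T \<eta>c \<eta>b, of n] by (simp add: Y_def)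
  let ?f = "\<lambda>n z. occ_weight n T z * (g (Y z) + \<eta> (Y z) * rate (snd (Y z)))"
  have fi: "integrable (lborel \<Otimes>\<^sub>M M) (?f n)" for n
    using Bochner_Integration.integrable_add[OF gi \<eta>i, of n n] by (simp add: distrib_left)
  have bound: "\<bar>\<integral>z. ?f (enat n) z \<partial>(lborel \<Otimes>\<^sub>M M)\<bar> \<le> 2 * B0 * prob {w \<in> space M. n \<le> count T w}" for n
  proof -
    have "(\<integral>w. (\<integral>s. indicator {0<..T} s * (if count (max 0 s) w < n then generator \<phi>t \<phi>x \<phi>xx s (X (max 0 s) w) else 0) \<partial>lborel) \<partial>M)
      = (\<integral>w. (\<integral>s. (\<lambda>z. occ_weight (enat n) T z * g (Y z)) (s, w) \<partial>lborel) \<partial>M)"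
      by (intro Bochner_Integration.integral_cong refl) (auto simp: occ_weight_def g_def Y_def)
    also have "\<dots> = (\<integral>z. occ_weight (enat n) T z * g (Y z) \<partial>(lborel \<Otimes>\<^sub>M M))"
      using P.integral_snd[of "\<lambda>s w. (\<lambda>z. occ_weight (enat n) T z * g (Y z)) (s, w)"] gi by (simp add: case_prod_beta')
    finally have D: "(\<integral>w. (\<integral>s. indicator {0<..T} s * (if count (max 0 s) w < n then generator \<phi>t \<phi>x \<phi>xx s (X (max 0 s) w) else 0) \<partial>lborel) \<partial>M)
      = (\<integral>z. occ_weight (enat n) T z * g (Y z) \<partial>(lborel \<Otimes>\<^sub>M M))" .
    have J: "(\<integral>w. (\<Sum>s\<in>N w \<inter> {0<..T}. if countL s w < n then \<phi> s (XL s w / \<theta>) - \<phi> s (XL s w) else 0) \<partial>M) =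
      (\<integral>z. occ_weight (enat n) T z * (\<eta> (Y z) * rate (snd (Y z))) \<partial>(lborel \<Otimes>\<^sub>M M))"
      using expected_jump_sum_time_space(2)[OF T \<eta>c \<eta>b, of n] by (simp add: Y_def \<eta>_def cong: if_cong)
    have S: "(\<integral>z. ?f (enat n) z \<partial>(lborel \<Otimes>\<^sub>M M)) = (\<integral>z. occ_weight (enat n) T z * g (Y z) \<partial>(lborel \<Otimes>\<^sub>M M)) +
      (\<integral>z. occ_weight (enat n) T z * (\<eta> (Y z) * rate (snd (Y z))) \<partial>(lborel \<Otimes>\<^sub>M M))"
      using Bochner_Integration.integral_add[OF gi \<eta>i, of "enat n" "enat n"] by (simp add: distrib_left)
    show ?thesis using dynkin_localized[OF \<phi> T, of n] unfolding D J S by (simp add: z add.commute)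
  qed
  have "(\<lambda>n. 2 * B0 * prob {w \<in> space M. n \<le> count T w}) \<longlonglongrightarrow> 2 * B0 * 0"
    by (intro tendsto_mult tendsto_const prob_count_large_tendsto_0) (use T in simp)
  then have "(\<lambda>n. 2 * B0 * prob {w \<in> space M. n \<le> count T w}) \<longlonglongrightarrow> 0" by simp
  then have lim0: "(\<lambda>n. \<integral>z. ?f (enat n) z \<partial>(lborel \<Otimes>\<^sub>M M)) \<longlonglongrightarrow> 0"
    by (rule Lim_null_comparison[rotated]) (use bound in \<open>auto intro!: always_eventually\<close>)
  \<comment> \<open>The truncated integrand equals the full one as soon as n exceeds the count, and
    its absolute value is dominated by that of the full one.\<close>
  have "(\<lambda>n. \<integral>z. ?f (enat n) z \<partial>(lborel \<Otimes>\<^sub>M M)) \<longlonglongrightarrow> (\<integral>z. ?f \<infinity> z \<partial>(lborel \<Otimes>\<^sub>M M))"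
  proof (rule integral_dominated_convergence[where w = "\<lambda>z. \<bar>?f \<infinity> z\<bar>"])
    show "?f \<infinity> \<in> borel_measurable (lborel \<Otimes>\<^sub>M M)" "\<And>n. ?f (enat n) \<in> borel_measurable (lborel \<Otimes>\<^sub>M M)"
      using fi by auto
    show "integrable (lborel \<Otimes>\<^sub>M M) (\<lambda>z. \<bar>?f \<infinity> z\<bar>)" by (rule integrable_abs[OF fi])
    show "AE z in lborel \<Otimes>\<^sub>M M. (\<lambda>n. ?f (enat n) z) \<longlonglongrightarrow> ?f \<infinity> z"
    proof (intro AE_I2 tendsto_eventually)
      fix z
      show "\<forall>\<^sub>F n in sequentially. ?f (enat n) z = ?f \<infinity> z"
        using eventually_gt_at_top[of "count (max 0 (fst z)) (snd z)"] by eventually_elim (simp add: occ_weight_def)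
    qed
    show "AE z in lborel \<Otimes>\<^sub>M M. norm (?f (enat n) z) \<le> \<bar>?f \<infinity> z\<bar>" for n
      by (intro AE_I2) (auto simp: occ_weight_def abs_mult)
  qed
  from LIMSEQ_unique[OF this lim0] show ?thesis by (simp add: Y_def g_def \<eta>_def)
qed

section \<open>The occupation measure expressed by the density\<close>

context
  fixes p :: "real \<Rightarrow> real \<Rightarrow> real"
  assumes p: "density_of_process M X p"
begin

text \<open>Extended by 0 to t \<le> 0, the density becomes a Borel function on the whole
  plane.\<close>

definition pp :: "real \<times> real \<Rightarrow> real" where "pp z = (if 0 < fst z then p (fst z) (snd z) else 0)"

lemma measurable_pp: "pp \<in> borel_measurable borel"
proof -
  have "(\<lambda>z. indicator ({0<..} \<times> UNIV) z *\<^sub>R (\<lambda>(t, x). p t x) z) \<in> borel_measurable borel"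
    using p unfolding density_of_process_def
    by (subst borel_measurable_restrict_space_iff[symmetric]) (auto simp: borel_open open_Times)
  moreover have "(\<lambda>z. indicator ({0<..} \<times> UNIV) z *\<^sub>R (\<lambda>(t, x). p t x) z) = pp"
    by (auto simp: pp_def fun_eq_iff split: split_indicator)
  ultimately show ?thesis by simp
qed

lemma measurable_pp_pair: "pp \<in> borel_measurable (borel \<Otimes>\<^sub>M borel)"
  using measurable_pp by (simp only: borel_prod)

definition occ_density :: "real \<Rightarrow> real \<times> real \<Rightarrow> real" where
  "occ_density T z = indicator {0<..T} (fst z) * pp z"

lemma occ_density_nonneg: "0 \<le> occ_density T z"
  using p by (simp add: occ_density_def pp_def density_of_process_def)

lemma measurable_occ_density: "occ_density T \<in> borel_measurable borel" "occ_density T \<in> borel_measurable (borel \<Otimes>\<^sub>M borel)"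
proof -
  note [measurable] = measurable_pp_pair
  show "occ_density T \<in> borel_measurable (borel \<Otimes>\<^sub>M borel)" unfolding occ_density_def by measurable
  then show "occ_density T \<in> borel_measurable borel" by (simp only: borel_prod)
qed

text \<open>At each fixed t the expectation of f(t, X(t)) is an integral against p(t, .); of the
  process only the one-dimensional laws enter.\<close>

lemma nn_integral_occ_density:
  assumes f: "f \<in> borel_measurable borel"
  shows "(\<integral>\<^sup>+ z. ennreal (occ_weight \<infinity> T z) * f (fst z, X (max 0 (fst z)) (snd z)) \<partial>(lborel \<Otimes>\<^sub>M M)) =
    (\<integral>\<^sup>+ z. ennreal (occ_density T z) * f z \<partial>lborel)"
proof -
  have fm [measurable]: "f \<in> borel_measurable (borel \<Otimes>\<^sub>M borel)" using f by (simp only: borel_prod)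
  note [measurable] = measurable_occ_density(2)[of T]
  have "(\<integral>\<^sup>+ z. ennreal (occ_weight \<infinity> T z) * f (fst z, X (max 0 (fst z)) (snd z)) \<partial>(lborel \<Otimes>\<^sub>M M)) =
    (\<integral>\<^sup>+ t. (\<integral>\<^sup>+ w. (\<lambda>z. ennreal (occ_weight \<infinity> T z) * f (fst z, X (max 0 (fst z)) (snd z))) (t, w) \<partial>M) \<partial>lborel)"
    by (rule nn_integral_fst[symmetric]) measurable
  also have "\<dots> = (\<integral>\<^sup>+ t. (\<integral>\<^sup>+ x. (\<lambda>z. ennreal (occ_density T z) * f z) (t, x) \<partial>lborel) \<partial>lborel)"
  proof (rule nn_integral_cong)
    fix t
    show "(\<integral>\<^sup>+ w. (\<lambda>z. ennreal (occ_weight \<infinity> T z) * f (fst z, X (max 0 (fst z)) (snd z))) (t, w) \<partial>M) =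
      (\<integral>\<^sup>+ x. (\<lambda>z. ennreal (occ_density T z) * f z) (t, x) \<partial>lborel)"
    proof (cases "0 < t \<and> t \<le> T")
      case True
      then have "distributed M lborel (X t) (\<lambda>x. ennreal (p t x))" using p by (simp add: density_of_process_def)
      from distributed_nn_integral[OF this, of "\<lambda>x. f (t, x)"] True
      show ?thesis by (simp add: occ_weight_def occ_density_def pp_def)
    qed (auto simp: occ_weight_def occ_density_def)
  qed
  also have "\<dots> = (\<integral>\<^sup>+ z. ennreal (occ_density T z) * f z \<partial>(lborel \<Otimes>\<^sub>M lborel))"
    by (rule lborel.nn_integral_fst) measurable
  finally show ?thesis by (simp only: lborel_prod)
qed

lemma distr_occ_density:
  "distr (density (lborel \<Otimes>\<^sub>M M) (\<lambda>z. ennreal (occ_weight \<infinity> T z))) borel (\<lambda>z. (fst z, X (max 0 (fst z)) (snd z))) =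
    density lborel (\<lambda>z. ennreal (occ_density T z))" (is "?L = ?R")
proof (rule measure_eqI)
  fix A assume "A \<in> sets ?L"
  then have A: "A \<in> sets borel" by simp
  have Y: "(\<lambda>z. (fst z, X (max 0 (fst z)) (snd z))) \<in> density (lborel \<Otimes>\<^sub>M M) (\<lambda>z. ennreal (occ_weight \<infinity> T z)) \<rightarrow>\<^sub>M borel"
    using measurable_time_space by simp
  have i: "(indicator A :: real \<times> real \<Rightarrow> ennreal) \<in> borel_measurable borel" using A by simp
  have "emeasure ?L A = (\<integral>\<^sup>+ z. indicator A z \<partial>?L)" using A by simp
  also have "\<dots> = (\<integral>\<^sup>+ z. indicator A (fst z, X (max 0 (fst z)) (snd z)) \<partial>density (lborel \<Otimes>\<^sub>M M) (\<lambda>z. ennreal (occ_weight \<infinity> T z)))"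
    by (rule nn_integral_distr[OF Y]) (use A in simp)
  also have "\<dots> = (\<integral>\<^sup>+ z. ennreal (occ_weight \<infinity> T z) * indicator A (fst z, X (max 0 (fst z)) (snd z)) \<partial>(lborel \<Otimes>\<^sub>M M))"
    by (rule nn_integral_density) (use measurable_compose[OF measurable_time_space i] in auto)
  also have "\<dots> = (\<integral>\<^sup>+ z. ennreal (occ_density T z) * indicator A z \<partial>lborel)" by (rule nn_integral_occ_density[OF i])
  also have "\<dots> = emeasure ?R A"
    using A measurable_occ_density(1)[of T] by (subst emeasure_density) auto
  finally show "emeasure ?L A = emeasure ?R A" .
qed simp

lemma integral_occ_density:
  fixes f :: "real \<times> real \<Rightarrow> real"
  assumes f: "f \<in> borel_measurable borel"
  shows "integrable (lborel \<Otimes>\<^sub>M M) (\<lambda>z. occ_weight \<infinity> T z * f (fst z, X (max 0 (fst z)) (snd z))) \<longleftrightarrow>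
      integrable lborel (\<lambda>z. occ_density T z * f z)"
    and "(\<integral>z. occ_weight \<infinity> T z * f (fst z, X (max 0 (fst z)) (snd z)) \<partial>(lborel \<Otimes>\<^sub>M M)) = (\<integral>z. occ_density T z * f z \<partial>lborel)"
proof -
  let ?Y = "\<lambda>z. (fst z, X (max 0 (fst z)) (snd z))"
  let ?D = "density (lborel \<Otimes>\<^sub>M M) (\<lambda>z. ennreal (occ_weight \<infinity> T z))"
  have Y: "?Y \<in> ?D \<rightarrow>\<^sub>M borel" using measurable_time_space by simp
  have fY: "(\<lambda>z. f (?Y z)) \<in> borel_measurable (lborel \<Otimes>\<^sub>M M)" by (rule measurable_compose[OF measurable_time_space f])
  have fl: "f \<in> borel_measurable lborel" using f by simp
  have dl: "occ_density T \<in> borel_measurable lborel" using measurable_occ_density(1) by simp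
  have "integrable (lborel \<Otimes>\<^sub>M M) (\<lambda>z. occ_weight \<infinity> T z * f (?Y z)) \<longleftrightarrow> integrable ?D (\<lambda>z. f (?Y z))"
    using integrable_density[OF fY measurable_occ_weight, of \<infinity> T] by (simp add: occ_weight_nonneg)
  also have "\<dots> \<longleftrightarrow> integrable (distr ?D borel ?Y) f" by (rule integrable_distr_eq[OF Y f, symmetric])
  also have "\<dots> \<longleftrightarrow> integrable lborel (\<lambda>z. occ_density T z * f z)"
    unfolding distr_occ_density using integrable_density[OF fl dl] by (simp add: occ_density_nonneg)
  finally show "integrable (lborel \<Otimes>\<^sub>M M) (\<lambda>z. occ_weight \<infinity> T z * f (?Y z)) \<longleftrightarrow> integrable lborel (\<lambda>z. occ_density T z * f z)" .
  have "(\<integral>z. occ_weight \<infinity> T z * f (?Y z) \<partial>(lborel \<Otimes>\<^sub>M M)) = (\<integral>z. f (?Y z) \<partial>?D)"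
    using integral_density[OF fY measurable_occ_weight, of \<infinity> T] by (simp add: occ_weight_nonneg)
  also have "\<dots> = (\<integral>z. f z \<partial>distr ?D borel ?Y)" by (rule integral_distr[OF Y f, symmetric])
  also have "\<dots> = (\<integral>z. occ_density T z * f z \<partial>lborel)"
    unfolding distr_occ_density using integral_density[OF fl dl] by (simp add: occ_density_nonneg)
  finally show "(\<integral>z. occ_weight \<infinity> T z * f (?Y z) \<partial>(lborel \<Otimes>\<^sub>M M)) = (\<integral>z. occ_density T z * f z \<partial>lborel)" .
qed

lemma integrable_occ_density:
  fixes g :: "real \<times> real \<Rightarrow> real"
  assumes T: "0 < T" and g: "g \<in> borel_measurable borel" and b: "\<And>z. \<bar>g z\<bar> \<le> C"
  shows "integrable lborel (\<lambda>z. occ_density T z * g z)"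
    and "integrable lborel (\<lambda>z. occ_density T z * (g z * rate (snd z)))"
proof -
  have r: "(\<lambda>z :: real \<times> real. rate (snd z)) \<in> borel_measurable borel"
    by (rule measurable_compose[OF _ measurable_rate]) (simp add: borel_prod[symmetric])
  have "integrable lborel (\<lambda>z. occ_density T z * (\<lambda>_. 1) z)"
    using integral_occ_density(1)[of "\<lambda>_. 1" T] integrable_occ_weight[OF T] by simp
  then have "integrable lborel (\<lambda>z. C * occ_density T z)" by simp
  then show "integrable lborel (\<lambda>z. occ_density T z * g z)"
    by (rule Bochner_Integration.integrable_bound)
      (use g measurable_occ_density(1) b order_trans[OF abs_ge_zero b] in
        \<open>auto simp: abs_mult occ_density_nonneg mult.commute intro!: mult_right_mono\<close>)
  have "integrable lborel (\<lambda>z. occ_density T z * (\<lambda>z. 1 * rate (snd z)) z)"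
    using integral_occ_density(1)[of "\<lambda>z. 1 * rate (snd z)" T] r expected_jump_sum_time_space(1)[OF T, of "\<lambda>_. 1" 1 \<infinity>] by simp
  then have "integrable lborel (\<lambda>z. C * (occ_density T z * rate (snd z)))" by simp
  then show "integrable lborel (\<lambda>z. occ_density T z * (g z * rate (snd z)))"
  proof (rule Bochner_Integration.integrable_bound)
    show "(\<lambda>z. occ_density T z * (g z * rate (snd z))) \<in> borel_measurable lborel"
      using g r measurable_occ_density(1)[of T] by simp
    have "\<bar>occ_density T z * (g z * rate (snd z))\<bar> \<le> \<bar>C * (occ_density T z * rate (snd z))\<bar>" for z
    proof -
      have "\<bar>g z\<bar> * (occ_density T z * rate (snd z)) \<le> C * (occ_density T z * rate (snd z))"
        using b by (intro mult_right_mono) (auto simp: occ_density_nonneg rate_def)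
      moreover have "\<bar>occ_density T z * (g z * rate (snd z))\<bar> = \<bar>g z\<bar> * (occ_density T z * rate (snd z))"
        using occ_density_nonneg[of T z] by (simp add: abs_mult rate_def mult.left_commute)
      ultimately show ?thesis by linarith
    qed
    then show "AE z in lborel. norm (occ_density T z * (g z * rate (snd z))) \<le> norm (C * (occ_density T z * rate (snd z)))"
      by (intro AE_I2) simp
  qed
qed

text \<open>The strict bound matters: a function supported in \<open>K\<close> vanishes at the times
  0 and T, so Dynkin's formula has no boundary terms.\<close>

lemma compact_time_bound:
  fixes K :: "(real \<times> real) set"
  assumes K: "compact K" "K \<subseteq> {0<..} \<times> UNIV"
  shows "\<exists>T>0. K \<subseteq> {0<..<T} \<times> UNIV"
proof -
  obtain B where B: "\<And>z. z \<in> K \<Longrightarrow> norm z \<le> B" using compact_imp_bounded[OF K(1)] by (auto simp: bounded_iff)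
  have "fst z < max 0 B + 1" if "z \<in> K" for z
    using norm_fst_le[of "fst z" "snd z"] B[OF that] by auto
  then have "K \<subseteq> {0<..<max 0 B + 1} \<times> UNIV" using K(2) by (auto simp: subset_eq)
  then show ?thesis by (intro exI[of _ "max 0 B + 1"]) simp
qed

theorem forward_equation: "forward_equation_distributional \<Lambda> \<theta> \<mu> \<sigma> p"
proof -
  have th: "0 < \<theta>" using \<theta>_gt_1 by simp
  have one: "integrable lborel (occ_density T)" "integrable lborel (\<lambda>z. occ_density T z * rate (snd z))"
    "integrable lborel (\<lambda>z. occ_density T (fst z, \<theta> * snd z) * rate (\<theta> * snd z))" if T: "0 < T" for T
  proof -
    show "integrable lborel (occ_density T)" "integrable lborel (\<lambda>z. occ_density T z * rate (snd z))"
      using integrable_occ_density[OF T, of "\<lambda>_. 1" 1] by simp_all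
    from integral_scale_snd(1)[OF th this(2)]
    show "integrable lborel (\<lambda>z. occ_density T (fst z, \<theta> * snd z) * rate (\<theta> * snd z))" by simp
  qed
  \<comment> \<open>A compact set lies in some strip 0 < t < T, so agreement with an integrable
    function on each strip suffices; these functions are built from
    \<open>occ_density T\<close>.\<close>
  have loc: "locally_integrable_on ({0<..} \<times> UNIV) f"
    if f: "\<And>T. 0 < T \<Longrightarrow> \<exists>g. integrable lborel g \<and> (\<forall>t x. 0 < t \<longrightarrow> t < T \<longrightarrow> f (t, x) = g (t, x))" for f :: "real \<times> real \<Rightarrow> real"
    unfolding locally_integrable_on_def set_integrable_def
  proof (intro allI impI)
    fix K :: "(real \<times> real) set" assume K: "compact K \<and> K \<subseteq> {0<..} \<times> UNIV"
    obtain T where T: "0 < T" "K \<subseteq> {0<..<T} \<times> UNIV" using compact_time_bound[of K] K by (elim conjE) (metis)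
    obtain g where g: "integrable lborel g" "\<And>t x. 0 < t \<Longrightarrow> t < T \<Longrightarrow> f (t, x) = g (t, x)" using f[OF T(1)] by blast
    have "K \<in> sets lborel" using K by (simp add: borel_compact)
    from integrable_mult_indicator[OF this g(1)]
    have "integrable lborel (\<lambda>z. indicator K z *\<^sub>R g z)" .
    moreover have "(\<lambda>z. indicator K z *\<^sub>R g z) = (\<lambda>z. indicator K z *\<^sub>R f z)"
    proof (rule ext)
      fix z
      show "indicator K z *\<^sub>R g z = indicator K z *\<^sub>R f z"
      proof (cases "z \<in> K")
        case True
        then have "z \<in> {0<..<T} \<times> UNIV" using T(2) by blast
        then show ?thesis using g(2)[of "fst z" "snd z"] by (cases z) simp
      qed simp
    qed
    ultimately show "integrable lborel (\<lambda>z. indicator K z *\<^sub>R f z)" by simp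
  qed
  show ?thesis unfolding forward_equation_distributional_def
  proof (intro conjI allI impI)
    show "locally_integrable_on ({0<..} \<times> UNIV) (\<lambda>(t, x). p t x)"
      by (rule loc, rule exI, rule conjI, erule one(1)) (simp add: occ_density_def pp_def)
    show "locally_integrable_on ({0<..} \<times> UNIV) (\<lambda>(t, x). enn2real (\<Lambda> x) * p t x)"
      by (rule loc, rule exI, rule conjI, erule one(2)) (simp add: occ_density_def pp_def rate_def)
    show "locally_integrable_on ({0<..} \<times> UNIV) (\<lambda>(t, x). enn2real (\<Lambda> (\<theta> * x)) * p t (\<theta> * x))"
      by (rule loc, rule exI, rule conjI, erule one(3)) (simp add: occ_density_def pp_def rate_def)
    fix \<phi> :: "real \<Rightarrow> real \<Rightarrow> real" and K :: "(real \<times> real) set"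
    assume A: "compact K \<and> K \<subseteq> {0<..} \<times> UNIV \<and> C12_on UNIV \<phi> \<and> (\<forall>t x. (t, x) \<notin> K \<longrightarrow> \<phi> t x = 0)"
    then have K: "compact K" and KS: "K \<subseteq> {0<..} \<times> UNIV" and \<phi>: "C12_on UNIV \<phi>" by simp_all
    have supp: "\<And>t x. (t, x) \<notin> K \<Longrightarrow> \<phi> t x = 0" using A by blast
    obtain T where T: "0 < T" and KT: "K \<subseteq> {0<..<T} \<times> UNIV" using compact_time_bound[OF K KS] by (elim exE conjE)
    have "\<exists>B. test_function \<phi> (dt \<phi>) (dx \<phi>) (dx (dx \<phi>)) B B"
      by (rule test_function_of_C12[OF \<phi> K]) (rule supp)
    then obtain B where tf: "test_function \<phi> (dt \<phi>) (dx \<phi>) (dx (dx \<phi>)) B B" by (elim exE)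
    have d1: "dt \<phi> t x = 0" if "(t, x) \<notin> K" for t x by (rule derivatives_vanish_off_support(1)[where \<phi> = \<phi>, OF K supp that])
    have d2: "dx \<phi> t x = 0" if "(t, x) \<notin> K" for t x by (rule derivatives_vanish_off_support(2)[where \<phi> = \<phi>, OF K supp that])
    have d3: "dx (dx \<phi>) t x = 0" if "(t, x) \<notin> K" for t x
      by (rule derivatives_vanish_off_support(2)[where \<phi> = "dx \<phi>", OF K d2 that])
    have b: "\<bar>\<phi> t x\<bar> \<le> B" "\<bar>dt \<phi> t x\<bar> \<le> B" "\<bar>dx \<phi> t x\<bar> \<le> B" "\<bar>dx (dx \<phi>) t x\<bar> \<le> B" for t x
      using tf by (auto simp: test_function_def)
    have c: "continuous_on UNIV (\<lambda>z. \<phi> (fst z) (snd z))" "continuous_on UNIV (\<lambda>z. dt \<phi> (fst z) (snd z))"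
      "continuous_on UNIV (\<lambda>z. dx \<phi> (fst z) (snd z))" "continuous_on UNIV (\<lambda>z. dx (dx \<phi>) (fst z) (snd z))"
      using \<phi> by (auto simp: C12_on_def split_beta)
    note m = c[THEN borel_measurable_continuous_onI]
    have "continuous_on UNIV (\<lambda>z. (\<lambda>z. \<phi> (fst z) (snd z)) (fst z, snd z / \<theta>))"
      by (rule continuous_on_compose2[OF c(1)]) (use th in \<open>auto intro!: continuous_intros\<close>)
    then have m': "(\<lambda>z. \<phi> (fst z) (snd z / \<theta>)) \<in> borel_measurable borel" by (intro borel_measurable_continuous_onI) simp
    have r: "(\<lambda>z :: real \<times> real. rate (snd z)) \<in> borel_measurable borel"
      by (rule measurable_compose[OF _ measurable_rate]) (simp add: borel_prod[symmetric])
    let ?q = "occ_density T"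
    let ?g = "\<lambda>z. generator (dt \<phi>) (dx \<phi>) (dx (dx \<phi>)) (fst z) (snd z)"
    have \<phi>0: "\<phi> 0 x = 0" "\<phi> T x = 0" for x using KT by (auto intro!: supp)
    have hm: "(\<lambda>z. ?g z + (\<phi> (fst z) (snd z / \<theta>) - \<phi> (fst z) (snd z)) * rate (snd z)) \<in> borel_measurable borel"
      unfolding generator_def by (intro borel_measurable_add borel_measurable_times borel_measurable_diff borel_measurable_const m m' r)
    \<comment> \<open>Dynkin's formula written with the density: all derivatives already fall on
      \<phi>, and only the jump term still contains \<phi> at x/\<theta>.\<close>
    have "(\<integral>z. ?q z * (?g z + (\<phi> (fst z) (snd z / \<theta>) - \<phi> (fst z) (snd z)) * rate (snd z)) \<partial>lborel) = 0"
      using integral_occ_density(2)[OF hm, of T] dynkin_time_space[OF tf T \<phi>0] by simp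
    moreover have "(\<integral>z. ?q z * (?g z + (\<phi> (fst z) (snd z / \<theta>) - \<phi> (fst z) (snd z)) * rate (snd z)) \<partial>lborel) =
      (\<integral>z. ?q z * dt \<phi> (fst z) (snd z) \<partial>lborel) + \<mu> * (\<integral>z. ?q z * dx \<phi> (fst z) (snd z) \<partial>lborel)
      + \<sigma>\<^sup>2 / 2 * (\<integral>z. ?q z * dx (dx \<phi>) (fst z) (snd z) \<partial>lborel)
      + ((\<integral>z. ?q z * (\<phi> (fst z) (snd z / \<theta>) * rate (snd z)) \<partial>lborel) - (\<integral>z. ?q z * (\<phi> (fst z) (snd z) * rate (snd z)) \<partial>lborel))"
    proof -
      note i = integrable_occ_density(1)[OF T m(2) b(2)] integrable_occ_density(1)[OF T m(3) b(3)] integrable_occ_density(1)[OF T m(4) b(4)]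
        integrable_occ_density(2)[OF T m' b(1)] integrable_occ_density(2)[OF T m(1) b(1)]
      have "(\<integral>z. ?q z * (?g z + (\<phi> (fst z) (snd z / \<theta>) - \<phi> (fst z) (snd z)) * rate (snd z)) \<partial>lborel) =
        (\<integral>z. ?q z * dt \<phi> (fst z) (snd z) + \<mu> * (?q z * dx \<phi> (fst z) (snd z)) + \<sigma>\<^sup>2 / 2 * (?q z * dx (dx \<phi>) (fst z) (snd z))
          + (?q z * (\<phi> (fst z) (snd z / \<theta>) * rate (snd z)) - ?q z * (\<phi> (fst z) (snd z) * rate (snd z))) \<partial>lborel)"
        by (intro Bochner_Integration.integral_cong refl) (simp add: generator_def algebra_simps)
      then show ?thesis using i by simp
    qed
    \<comment> \<open>Replacing x by \<theta> x frees the test function of the division and moves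
      the scaling onto the density and the rate.\<close>
    moreover have "(\<integral>z. ?q z * (\<phi> (fst z) (snd z / \<theta>) * rate (snd z)) \<partial>lborel) =
      \<theta> * (\<integral>z. ?q (fst z, \<theta> * snd z) * (\<phi> (fst z) (snd z) * rate (\<theta> * snd z)) \<partial>lborel)"
      using integral_scale_snd(2)[OF th integrable_occ_density(2)[OF T m' b(1)]] th by simp
    moreover have S: "(\<integral>(t, x)\<in>K. f t x \<partial>lborel) = (\<integral>z. h z \<partial>lborel)"
      if "\<And>t x. (t, x) \<in> K \<Longrightarrow> f t x = h (t, x)" "\<And>t x. (t, x) \<notin> K \<Longrightarrow> h (t, x) = 0" for f :: "real \<Rightarrow> real \<Rightarrow> real" and h :: "real \<times> real \<Rightarrow> real"
      unfolding set_lebesgue_integral_def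
      by (intro Bochner_Integration.integral_cong refl) (use that in \<open>auto split: split_indicator\<close>)
    have q: "?q (t, x) = p t x" "?q (t, y) = p t y" if "(t, x) \<in> K" for t x y
      using that KT by (auto simp: occ_density_def pp_def)
    have "(\<integral>(t, x)\<in>K. p t x * dt \<phi> t x \<partial>lborel) = (\<integral>z. ?q z * dt \<phi> (fst z) (snd z) \<partial>lborel)"
      by (rule S) (auto simp: q d1)
    moreover have "(\<integral>(t, x)\<in>K. p t x * dx \<phi> t x \<partial>lborel) = (\<integral>z. ?q z * dx \<phi> (fst z) (snd z) \<partial>lborel)"
      by (rule S) (auto simp: q d2)
    moreover have "(\<integral>(t, x)\<in>K. p t x * dx (dx \<phi>) t x \<partial>lborel) = (\<integral>z. ?q z * dx (dx \<phi>) (fst z) (snd z) \<partial>lborel)"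
      by (rule S) (auto simp: q d3)
    moreover have "(\<integral>(t, x)\<in>K. enn2real (\<Lambda> x) * p t x * \<phi> t x \<partial>lborel) = (\<integral>z. ?q z * (\<phi> (fst z) (snd z) * rate (snd z)) \<partial>lborel)"
      by (rule S) (auto simp: q supp rate_def)
    moreover have "(\<integral>(t, x)\<in>K. enn2real (\<Lambda> (\<theta> * x)) * p t (\<theta> * x) * \<phi> t x \<partial>lborel) =
        (\<integral>z. ?q (fst z, \<theta> * snd z) * (\<phi> (fst z) (snd z) * rate (\<theta> * snd z)) \<partial>lborel)"
      by (rule S) (auto simp: q supp rate_def)
    ultimately show "- (\<integral>(t, x)\<in>K. p t x * dt \<phi> t x \<partial>lborel) =
          \<sigma>\<^sup>2 / 2 * (\<integral>(t, x)\<in>K. p t x * dx (dx \<phi>) t x \<partial>lborel)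
          + \<mu> * (\<integral>(t, x)\<in>K. p t x * dx \<phi> t x \<partial>lborel)
          - (\<integral>(t, x)\<in>K. enn2real (\<Lambda> x) * p t x * \<phi> t x \<partial>lborel)
          + \<theta> * (\<integral>(t, x)\<in>K. enn2real (\<Lambda> (\<theta> * x)) * p t (\<theta> * x) * \<phi> t x \<partial>lborel)"
      by simp
  qed
qed

end

end

section \<open>The equation for smooth densities\<close>

text \<open>The first-order remainder is at most (y - x)^2 for all signs of x and y, which covers
  the point 0, where \<open>max 0\<close> itself has no derivative.\<close>

lemma DERIV_max_0_square: "((\<lambda>x. (max 0 x)\<^sup>2) has_real_derivative 2 * max 0 x) (at (x :: real))"
proof -
  have q: "\<bar>(max 0 y)\<^sup>2 - (max 0 x)\<^sup>2 - 2 * max 0 x * (y - x)\<bar> \<le> (y - x)\<^sup>2" for y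
  proof (cases "0 \<le> x")
    case True
    show ?thesis
    proof (cases "0 \<le> y")
      case y: True
      have "y\<^sup>2 - x\<^sup>2 - 2 * x * (y - x) = (y - x)\<^sup>2" by algebra
      then show ?thesis using True y by simp
    next
      case False
      have "- x\<^sup>2 - 2 * x * (y - x) = x * (x - 2 * y)" "(y - x)\<^sup>2 = x * (x - 2 * y) + y\<^sup>2" by algebra+
      moreover have "0 \<le> x * (x - 2 * y)" using True False by (intro mult_nonneg_nonneg) auto
      ultimately show ?thesis using True False by simp
    qed
  next
    case False
    then have "0 \<le> y \<Longrightarrow> y\<^sup>2 \<le> (y - x)\<^sup>2" by (intro power_mono) auto
    then show ?thesis using False by (cases "0 \<le> y") (auto simp: max_def)
  qed
  have "norm (((max 0 (x + h))\<^sup>2 - (max 0 x)\<^sup>2) / h - 2 * max 0 x) \<le> \<bar>h\<bar>" if "h \<noteq> 0" for h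
  proof -
    have "((max 0 (x + h))\<^sup>2 - (max 0 x)\<^sup>2) / h - 2 * max 0 x = ((max 0 (x + h))\<^sup>2 - (max 0 x)\<^sup>2 - 2 * max 0 x * h) / h"
      using that by (simp add: diff_divide_distrib)
    moreover have "\<bar>(max 0 (x + h))\<^sup>2 - (max 0 x)\<^sup>2 - 2 * max 0 x * h\<bar> / \<bar>h\<bar> \<le> h\<^sup>2 / \<bar>h\<bar>"
      using q[of "x + h"] by (intro divide_right_mono) auto
    moreover have "h\<^sup>2 / \<bar>h\<bar> = \<bar>h\<bar>" using that by (simp add: power2_eq_square abs_if)
    ultimately show ?thesis by (simp add: abs_divide)
  qed
  then have "((\<lambda>h. ((max 0 (x + h))\<^sup>2 - (max 0 x)\<^sup>2) / h - 2 * max 0 x) \<longlongrightarrow> 0) (at 0)"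
    by (intro Lim_null_comparison[OF _ tendsto_rabs_zero[OF tendsto_ident_at]]) (simp add: eventually_at_filter)
  then show ?thesis unfolding DERIV_def by (rule LIM_zero_cancel)
qed

lemma DERIV_max_0_cube: "((\<lambda>x. (max 0 x) ^ 3) has_real_derivative 3 * (max 0 x)\<^sup>2) (at (x :: real))"
proof -
  have "(\<lambda>x :: real. (max 0 x) ^ 3) = (\<lambda>x. x * (max 0 x)\<^sup>2)"
    by (auto simp: max_def power2_eq_square power3_eq_cube fun_eq_iff)
  moreover have "((\<lambda>x. x * (max 0 x)\<^sup>2) has_real_derivative 1 * (max 0 x)\<^sup>2 + 2 * max 0 x * x) (at x)"
    by (intro DERIV_mult DERIV_ident DERIV_max_0_square)
  moreover have "1 * (max 0 x)\<^sup>2 + 2 * max 0 x * x = 3 * (max 0 x)\<^sup>2"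
    by (auto simp: max_def power2_eq_square)
  ultimately show ?thesis by (simp only:)
qed

text \<open>The function \<open>e\<close> is the cube of the positive part of (x - c)(d - x); the
  cube makes it twice continuously differentiable across the endpoints. Then 1 - exp (-k e) is 0
  outside (c, d) and tends to 1 inside.\<close>

lemma bumps_exist:
  fixes c d :: real
  shows "\<exists>b b1 b2 :: nat \<Rightarrow> real \<Rightarrow> real. (\<forall>k x. (b k has_real_derivative b1 k x) (at x) \<and> (b1 k has_real_derivative b2 k x) (at x) \<and>
      0 \<le> b k x \<and> b k x \<le> 1 \<and> (x \<notin> {c<..<d} \<longrightarrow> b k x = 0 \<and> b1 k x = 0)) \<and> (\<forall>k. continuous_on UNIV (b2 k)) \<and>
      (\<forall>x\<in>{c<..<d}. (\<lambda>k. b k x) \<longlonglongrightarrow> 1)"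
proof (cases "c < d")
  case False
  then show ?thesis by (intro exI[of _ "\<lambda>_ _. 0"]) auto
next
  case cd: True
  define q where "q x = (x - c) * (d - x)" for x
  define m where "m x = max 0 (q x)" for x
  define e where "e x = m x ^ 3" for x
  define e1 where "e1 x = 3 * (m x)\<^sup>2 * (c + d - 2 * x)" for x
  define e2 where "e2 x = 6 * m x * (c + d - 2 * x) * (c + d - 2 * x) - 6 * (m x)\<^sup>2" for x
  have dq: "(q has_real_derivative c + d - 2 * x) (at x)" for x
    unfolding q_def by (auto intro!: derivative_eq_intros)
  have de: "(e has_real_derivative e1 x) (at x)" for x
    unfolding e_def e1_def m_def using DERIV_chain2[OF DERIV_max_0_cube dq] by simp
  have dm2: "((\<lambda>x. (m x)\<^sup>2) has_real_derivative 2 * m x * (c + d - 2 * x)) (at x)" for x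
    unfolding m_def using DERIV_chain2[OF DERIV_max_0_square dq] by simp
  have de1: "(e1 has_real_derivative e2 x) (at x)" for x
  proof -
    have "((\<lambda>x. (m x)\<^sup>2 * (3 * (c + d - 2 * x))) has_real_derivative 2 * m x * (c + d - 2 * x) * (3 * (c + d - 2 * x)) + (- 6) * (m x)\<^sup>2) (at x)"
      by (rule DERIV_mult[OF dm2]) (auto intro!: derivative_eq_intros)
    moreover have "(\<lambda>x. (m x)\<^sup>2 * (3 * (c + d - 2 * x))) = e1" by (simp add: e1_def fun_eq_iff)
    moreover have "2 * m x * (c + d - 2 * x) * (3 * (c + d - 2 * x)) + (- 6) * (m x)\<^sup>2 = e2 x" by (simp add: e2_def)
    ultimately show ?thesis by simp
  qed
  have e0: "0 \<le> e x" for x by (simp add: e_def m_def)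
  have mc: "continuous_on UNIV m" unfolding m_def q_def by (intro continuous_intros)
  have ec: "continuous_on UNIV e" "continuous_on UNIV e1" "continuous_on UNIV e2"
    unfolding e_def e1_def e2_def by (intro continuous_intros mc)+
  define b where "b k x = 1 - exp (- (real k * e x))" for k x
  define b1 where "b1 k x = real k * e1 x * exp (- (real k * e x))" for k x
  define b2 where "b2 k x = (real k * e2 x - (real k * e1 x) * (real k * e1 x)) * exp (- (real k * e x))" for k x
  have dE: "((\<lambda>x. exp (- (real k * e x))) has_real_derivative - (real k * e1 x) * exp (- (real k * e x))) (at x)" for k x
    by (auto intro!: derivative_eq_intros de)
  have "(b k has_real_derivative b1 k x) (at x)" for k x
    unfolding b_def b1_def by (rule DERIV_cong[OF DERIV_diff[OF DERIV_const dE]]) simp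
  moreover have "(b1 k has_real_derivative b2 k x) (at x)" for k x
    unfolding b1_def b2_def by (rule DERIV_cong[OF DERIV_mult[OF DERIV_cmult[OF de1] dE]]) (simp add: algebra_simps)
  moreover have "0 \<le> b k x" "b k x \<le> 1" for k x using e0[of x] by (auto simp: b_def)
  moreover have "b k x = 0 \<and> b1 k x = 0" if "x \<notin> {c<..<d}" for k x
  proof -
    have "q x \<le> 0" using that cd by (cases "x \<le> c") (auto simp: q_def mult_nonpos_nonneg mult_nonneg_nonpos)
    then show ?thesis by (simp add: b_def b1_def e_def e1_def m_def)
  qed
  moreover have "continuous_on UNIV (b2 k)" for k unfolding b2_def by (intro continuous_intros ec)
  moreover have "(\<lambda>k. b k x) \<longlonglongrightarrow> 1" if x: "x \<in> {c<..<d}" for x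
  proof -
    have "0 < e x" using x by (simp add: e_def m_def q_def)
    then have "(\<lambda>k. 1 - exp (- e x) ^ k) \<longlonglongrightarrow> 1 - 0" by (intro tendsto_diff tendsto_const LIMSEQ_power_zero) simp
    moreover have "b k x = 1 - exp (- e x) ^ k" for k unfolding b_def exp_of_nat_mult[symmetric] by simp
    ultimately show ?thesis by simp
  qed
  ultimately show ?thesis by blast
qed

section \<open>Integration by parts and localization on rectangles\<close>

lemma set_integrable_continuous_rectangle:
  fixes g :: "real \<times> real \<Rightarrow> real"
  assumes "continuous_on ({a..b} \<times> {c..d}) g"
  shows "integrable lborel (\<lambda>z. indicator ({a..b} \<times> {c..d}) z * g z)"
  using borel_integrable_compact[OF compact_Times[OF compact_Icc compact_Icc] assms] by simp

lemma integral_derivative_fst: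
  fixes f g :: "real \<Rightarrow> real \<Rightarrow> real"
  assumes ab: "a \<le> b" and g: "continuous_on ({a..b} \<times> {c..d}) (\<lambda>z. g (fst z) (snd z))"
    and f: "\<And>t x. t \<in> {a..b} \<Longrightarrow> x \<in> {c..d} \<Longrightarrow> ((\<lambda>s. f s x) has_real_derivative g t x) (at t)"
    and bd: "\<And>x. f a x = 0" "\<And>x. f b x = 0"
  shows "(\<integral>z. indicator ({a..b} \<times> {c..d}) z * g (fst z) (snd z) \<partial>lborel) = 0"
proof -
  let ?h = "\<lambda>z. indicator ({a..b} \<times> {c..d}) z * g (fst z) (snd z)"
  have i: "integrable (lborel \<Otimes>\<^sub>M lborel) ?h" using set_integrable_continuous_rectangle[OF g] by (simp only: lborel_prod)
  have inner: "(\<integral>t. ?h (t, x) \<partial>lborel) = 0" for x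
  proof (cases "x \<in> {c..d}")
    case True
    have "(\<integral>t. indicator {a..b} t *\<^sub>R g t x \<partial>lborel) = f b x - f a x"
    proof (rule integral_FTC_Icc[OF ab])
      show "((\<lambda>s. f s x) has_vector_derivative g t x) (at t within {a..b})" if "a \<le> t" "t \<le> b" for t
        using f[of t x] that True by (simp add: has_real_derivative_iff_has_vector_derivative[symmetric] has_field_derivative_at_within)
      show "continuous_on {a..b} (\<lambda>t. g t x)"
        by (rule continuous_on_compose2[OF g, where f = "\<lambda>t. (t, x)", simplified]) (use True in \<open>auto intro!: continuous_intros\<close>)
    qed
    then show ?thesis using True bd by (simp add: indicator_times)
  qed (simp add: indicator_times)
  have "(\<integral>z. ?h z \<partial>(lborel \<Otimes>\<^sub>M lborel)) = (\<integral>x. (\<integral>t. ?h (t, x) \<partial>lborel) \<partial>lborel)"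
    using lborel_pair.integral_snd[of "\<lambda>t x. ?h (t, x)"] i by (simp add: case_prod_beta')
  then show ?thesis unfolding inner by (simp add: lborel_prod)
qed

lemma integral_derivative_snd:
  fixes f g :: "real \<Rightarrow> real \<Rightarrow> real"
  assumes cd: "c \<le> d" and g: "continuous_on ({a..b} \<times> {c..d}) (\<lambda>z. g (fst z) (snd z))"
    and f: "\<And>t x. t \<in> {a..b} \<Longrightarrow> x \<in> {c..d} \<Longrightarrow> (f t has_real_derivative g t x) (at x)"
    and bd: "\<And>t. f t c = 0" "\<And>t. f t d = 0"
  shows "(\<integral>z. indicator ({a..b} \<times> {c..d}) z * g (fst z) (snd z) \<partial>lborel) = 0"
proof -
  let ?h = "\<lambda>z. indicator ({a..b} \<times> {c..d}) z * g (fst z) (snd z)"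
  have i: "integrable (lborel \<Otimes>\<^sub>M lborel) ?h" using set_integrable_continuous_rectangle[OF g] by (simp only: lborel_prod)
  have inner: "(\<integral>x. ?h (t, x) \<partial>lborel) = 0" for t
  proof (cases "t \<in> {a..b}")
    case True
    have "(\<integral>x. indicator {c..d} x *\<^sub>R g t x \<partial>lborel) = f t d - f t c"
    proof (rule integral_FTC_Icc[OF cd])
      show "(f t has_vector_derivative g t x) (at x within {c..d})" if "c \<le> x" "x \<le> d" for x
        using f[of t x] that True by (simp add: has_real_derivative_iff_has_vector_derivative[symmetric] has_field_derivative_at_within)
      show "continuous_on {c..d} (\<lambda>x. g t x)"
        by (rule continuous_on_compose2[OF g, where f = "\<lambda>x. (t, x)", simplified]) (use True in \<open>auto intro!: continuous_intros\<close>)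
    qed
    then show ?thesis using True bd by (simp add: indicator_times)
  qed (simp add: indicator_times)
  have "(\<integral>z. ?h z \<partial>(lborel \<Otimes>\<^sub>M lborel)) = (\<integral>t. (\<integral>x. ?h (t, x) \<partial>lborel) \<partial>lborel)"
    by (rule lborel_pair.integral_fst'[OF i, symmetric])
  then show ?thesis unfolding inner by (simp add: lborel_prod)
qed

text \<open>The positive and the negative part of \<open>f\<close> are densities of two measures
  that agree on boxes, an intersection-stable generator of the Borel sets. So they coincide, and
  \<open>ennreal (f x) = ennreal (- f x)\<close> leaves only the value 0.\<close>

lemma AE_eq_0_of_box_integrals:
  fixes f :: "'a::euclidean_space \<Rightarrow> real"
  assumes f: "integrable lborel f" and z: "\<And>u v. (\<integral>x. indicator (box u v) x * f x \<partial>lborel) = 0"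
  shows "AE x in lborel. f x = 0"
proof -
  have fm [measurable]: "f \<in> borel_measurable borel" using borel_measurable_integrable[OF f] by simp
  let ?P = "density lborel (\<lambda>x. ennreal (f x))" and ?N = "density lborel (\<lambda>x. ennreal (- f x))"
  have emP: "emeasure (density lborel (\<lambda>x. ennreal (g x))) A = ennreal (\<integral>x. indicator A x * max 0 (g x) \<partial>lborel)"
    if g: "integrable lborel g" and A: "A \<in> sets borel" for g :: "'a \<Rightarrow> real" and A
  proof -
    have gm: "g \<in> borel_measurable lborel" using g by auto
    have i: "integrable lborel (\<lambda>x. indicator A x * max 0 (g x))"
      using integrable_mult_indicator[of A lborel "\<lambda>x. max 0 (g x)"] A g by simp
    have "emeasure (density lborel (\<lambda>x. ennreal (g x))) A = (\<integral>\<^sup>+ x. ennreal (g x) * indicator A x \<partial>lborel)"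
      using A gm by (subst emeasure_density) auto
    also have "\<dots> = (\<integral>\<^sup>+ x. ennreal (indicator A x * max 0 (g x)) \<partial>lborel)"
      by (intro nn_integral_cong) (auto split: split_indicator simp: max_def ennreal_neg)
    also have "\<dots> = ennreal (\<integral>x. indicator A x * max 0 (g x) \<partial>lborel)"
      by (rule nn_integral_eq_integral[OF i]) simp
    finally show ?thesis .
  qed
  have nf: "integrable lborel (\<lambda>x. - f x)" using f by simp
  have "?P = ?N"
  proof (rule measure_eqI_generator_eq[where E = "range (\<lambda>(a, b). box a b)" and \<Omega> = UNIV and A = "\<lambda>i :: nat. box (- (real i *\<^sub>R One)) (real i *\<^sub>R One)"])
    show "Int_stable (range (\<lambda>(a, b). box a b :: 'a set))"
      by (auto simp: Int_stable_def box_Int_box)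
    show "sets ?P = sigma_sets UNIV (range (\<lambda>(a, b). box a b))" "sets ?N = sigma_sets UNIV (range (\<lambda>(a, b). box a b))"
      by (simp_all add: borel_eq_box)
    show "emeasure ?P (box (- (real i *\<^sub>R One)) (real i *\<^sub>R One)) \<noteq> \<infinity>" for i :: nat
      by (subst emP[OF f]) auto
    show "emeasure ?P A = emeasure ?N A" if "A \<in> range (\<lambda>(a, b). box a b)" for A
    proof -
      obtain u v where A: "A = box u v" using \<open>A \<in> _\<close> by auto
      then have Am: "A \<in> sets borel" by simp
      have i: "integrable lborel (\<lambda>x. indicator A x * max 0 (g x))" if "integrable lborel g" for g :: "'a \<Rightarrow> real"
        using integrable_mult_indicator[of A lborel "\<lambda>x. max 0 (g x)"] Am that by simp
      have "(\<integral>x. indicator A x * f x \<partial>lborel) = (\<integral>x. indicator A x * max 0 (f x) - indicator A x * max 0 (- f x) \<partial>lborel)"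
        by (intro Bochner_Integration.integral_cong refl) (auto split: split_indicator)
      also have "\<dots> = (\<integral>x. indicator A x * max 0 (f x) \<partial>lborel) - (\<integral>x. indicator A x * max 0 (- f x) \<partial>lborel)"
        by (rule Bochner_Integration.integral_diff[OF i[OF f] i[OF nf]])
      finally show ?thesis using z[of u v] unfolding emP[OF f Am] emP[OF nf Am] unfolding A by simp
    qed
  qed (auto simp: UN_box_eq_UNIV)
  then have "AE x in lborel. ennreal (f x) = ennreal (- f x)"
    by (subst (asm) sigma_finite_measure.density_unique_iff[OF sigma_finite_lborel]) auto
  then show ?thesis
  proof eventually_elim
    fix x assume eq: "ennreal (f x) = ennreal (- f x)"
    show "f x = 0"
    proof (cases "0 \<le> f x")
      case True
      then have "ennreal (f x) = 0" unfolding eq by (simp add: ennreal_neg)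
      then show ?thesis using True by (simp add: ennreal_eq_0_iff)
    next
      case False
      then have "ennreal (- f x) = 0" unfolding eq[symmetric] by (simp add: ennreal_neg)
      then show ?thesis using False by (simp add: ennreal_eq_0_iff)
    qed
  qed
qed

text \<open>The products \<alpha>(t) \<beta>(x) vanish off a rectangle inside \<open>U\<close>,
  where \<open>p\<close> may be differentiated, so all derivatives move back to \<open>p\<close>
  without boundary terms. The terms with \<Lambda> are only known to be locally integrable and are
  left as they are. Dominated convergence turns the products into the indicator of the open
  rectangle.\<close>

lemma forward_equation_tested_on_rectangle:
  fixes p :: "real \<Rightarrow> real \<Rightarrow> real" and a b c d :: real
  assumes fe: "forward_equation_distributional \<Lambda> \<theta> \<mu> \<sigma> p" and U: "U \<subseteq> {0<..} \<times> UNIV" and p: "C12_on U p"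
    and R: "{a..b} \<times> {c..d} \<subseteq> U"
  defines "G \<equiv> \<lambda>z. dt p (fst z) (snd z) - \<sigma>\<^sup>2 / 2 * dx (dx p) (fst z) (snd z) + \<mu> * dx p (fst z) (snd z)
    + enn2real (\<Lambda> (snd z)) * p (fst z) (snd z) - \<theta> * (enn2real (\<Lambda> (\<theta> * snd z)) * p (fst z) (\<theta> * snd z))"
  shows "integrable lborel (\<lambda>z. indicator ({a..b} \<times> {c..d}) z * G z)"
    and "(\<integral>z. indicator ({a<..<b} \<times> {c<..<d}) z * G z \<partial>lborel) = 0"
proof -
  let ?R = "{a..b} \<times> {c..d}" and ?Q = "{a<..<b} \<times> {c<..<d}"
  have cp: "continuous_on ?R (\<lambda>z. p (fst z) (snd z))" "continuous_on ?R (\<lambda>z. dt p (fst z) (snd z))"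
    "continuous_on ?R (\<lambda>z. dx p (fst z) (snd z))" "continuous_on ?R (\<lambda>z. dx (dx p) (fst z) (snd z))"
    using p by (auto simp: C12_on_def split_beta' intro: continuous_on_subset[OF _ R])
  have dp: "((\<lambda>s. p s x) has_real_derivative dt p t x) (at t)" "(p t has_real_derivative dx p t x) (at x)"
    "(dx p t has_real_derivative dx (dx p) t x) (at x)" if "t \<in> {a..b}" "x \<in> {c..d}" for t x
  proof -
    have "(t, x) \<in> U" using that R by auto
    then have f: "(\<lambda>s. p s x) field_differentiable at t" "(\<lambda>y. p t y) field_differentiable at x" "(\<lambda>y. dx p t y) field_differentiable at x"
      using p by (auto simp: C12_on_def)
    show "((\<lambda>s. p s x) has_real_derivative dt p t x) (at t)" "(p t has_real_derivative dx p t x) (at x)"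
      "(dx p t has_real_derivative dx (dx p) t x) (at x)"
      using f[unfolded DERIV_deriv_iff_field_differentiable[symmetric]] by (simp_all add: dt_def dx_def[abs_def])
  qed
  have cR: "compact ?R" by (intro compact_Times compact_Icc)
  have RU: "?R \<subseteq> {0<..} \<times> UNIV" using R U by blast
  have lam: "integrable lborel (\<lambda>z. indicator ?R z * (enn2real (\<Lambda> (snd z)) * p (fst z) (snd z)))"
    "integrable lborel (\<lambda>z. indicator ?R z * (enn2real (\<Lambda> (\<theta> * snd z)) * p (fst z) (\<theta> * snd z)))"
    using fe cR RU unfolding forward_equation_distributional_def locally_integrable_on_def set_integrable_def
    by (auto simp: split_beta')
  note ci = set_integrable_continuous_rectangle[of a b c d]
  let ?h = "\<lambda>w z. indicator ?R z * dt p (fst z) (snd z) * w z - \<sigma>\<^sup>2 / 2 * (indicator ?R z * dx (dx p) (fst z) (snd z) * w z)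
    + \<mu> * (indicator ?R z * dx p (fst z) (snd z) * w z)
    + indicator ?R z * (enn2real (\<Lambda> (snd z)) * p (fst z) (snd z)) * w z
    - \<theta> * (indicator ?R z * (enn2real (\<Lambda> (\<theta> * snd z)) * p (fst z) (\<theta> * snd z)) * w z)"
  have "integrable lborel (?h (\<lambda>_. 1))" using ci[OF cp(2)] ci[OF cp(3)] ci[OF cp(4)] lam by simp
  moreover have "?h (\<lambda>_. 1) = (\<lambda>z. indicator ?R z * G z)" by (simp add: G_def fun_eq_iff algebra_simps)
  ultimately show Gi: "integrable lborel (\<lambda>z. indicator ?R z * G z)" by simp
  show "(\<integral>z. indicator ?Q z * G z \<partial>lborel) = 0"
  proof (cases "a \<le> b \<and> c \<le> d")
    case False
    then have e: "?Q = {}" by auto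
    show ?thesis unfolding e by simp
  next
    case True
    then have ab: "a \<le> b" and cd: "c \<le> d" by auto
    obtain \<alpha> \<alpha>1 \<alpha>2 where \<alpha>: "\<And>k x. (\<alpha> k has_real_derivative \<alpha>1 k x) (at x)" "\<And>k x. (\<alpha>1 k has_real_derivative \<alpha>2 k x) (at x)"
      "\<And>k x. 0 \<le> \<alpha> k x" "\<And>k x. \<alpha> k x \<le> 1" "\<And>k x. x \<notin> {a<..<b} \<Longrightarrow> \<alpha> k x = 0" "\<And>k. continuous_on UNIV (\<alpha>2 k)"
      "\<And>x. x \<in> {a<..<b} \<Longrightarrow> (\<lambda>k. \<alpha> k x) \<longlonglongrightarrow> 1"
      using bumps_exist[of a b] by blast
    obtain \<beta> \<beta>1 \<beta>2 where \<beta>: "\<And>k x. (\<beta> k has_real_derivative \<beta>1 k x) (at x)" "\<And>k x. (\<beta>1 k has_real_derivative \<beta>2 k x) (at x)"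
      "\<And>k x. 0 \<le> \<beta> k x" "\<And>k x. \<beta> k x \<le> 1" "\<And>k x. x \<notin> {c<..<d} \<Longrightarrow> \<beta> k x = 0" "\<And>k. continuous_on UNIV (\<beta>2 k)"
      "\<And>x. x \<in> {c<..<d} \<Longrightarrow> (\<lambda>k. \<beta> k x) \<longlonglongrightarrow> 1" "\<And>k x. x \<notin> {c<..<d} \<Longrightarrow> \<beta>1 k x = 0"
      using bumps_exist[of c d] by blast
    have cont1: "continuous_on S (\<alpha> k)" "continuous_on S (\<alpha>1 k)" "continuous_on S (\<beta> k)" "continuous_on S (\<beta>1 k)" "continuous_on S (\<beta>2 k)" for S k
      by (auto intro!: continuous_on_subset[OF \<beta>(6) subset_UNIV] continuous_at_imp_continuous_on DERIV_isCont[OF \<alpha>(1)] DERIV_isCont[OF \<alpha>(2)] DERIV_isCont[OF \<beta>(1)] DERIV_isCont[OF \<beta>(2)])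
    have c: "continuous_on S (\<lambda>z :: real \<times> real. \<alpha> k (fst z))" "continuous_on S (\<lambda>z :: real \<times> real. \<alpha>1 k (fst z))"
      "continuous_on S (\<lambda>z :: real \<times> real. \<beta> k (snd z))" "continuous_on S (\<lambda>z :: real \<times> real. \<beta>1 k (snd z))"
      "continuous_on S (\<lambda>z :: real \<times> real. \<beta>2 k (snd z))" for S k
      by (auto intro!: continuous_on_compose2[OF cont1(1)] continuous_on_compose2[OF cont1(2)] continuous_on_compose2[OF cont1(3)]
          continuous_on_compose2[OF cont1(4)] continuous_on_compose2[OF cont1(5)] continuous_intros)
    define w where "w k z = \<alpha> k (fst z) * \<beta> k (snd z)" for k z
    have w: "0 \<le> w k z" "w k z \<le> 1" for k z
      unfolding w_def using \<alpha>(3,4)[of k "fst z"] \<beta>(3,4)[of k "snd z"] by (auto intro: mult_le_one)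
    have wm: "w k \<in> borel_measurable borel" for k
      unfolding w_def by (intro borel_measurable_continuous_onI continuous_intros c)
    have wi: "integrable lborel (\<lambda>z. f z * w k z)" if "integrable lborel f" for f k
      by (rule Bochner_Integration.integrable_bound[OF that])
        (use that wm w in \<open>auto simp: abs_mult intro!: mult_left_le\<close>)
    define J where "J f = (\<integral>z. indicator ?R z * f (fst z) (snd z) \<partial>lborel)" for f :: "real \<Rightarrow> real \<Rightarrow> real"
    have J_add: "J (\<lambda>t x. f t x + g t x) = J f + J g"
      if "continuous_on ?R (\<lambda>z. f (fst z) (snd z))" "continuous_on ?R (\<lambda>z. g (fst z) (snd z))" for f g
      unfolding J_def using Bochner_Integration.integral_add[OF ci[OF that(1)] ci[OF that(2)]] by (simp add: distrib_left)
    have zero: "(\<integral>z. indicator ?R z * G z * w k z \<partial>lborel) = 0" for k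
    proof -
      let ?\<phi> = "\<lambda>t x. \<alpha> k t * \<beta> k x"
      have e1: "dt ?\<phi> = (\<lambda>t x. \<alpha>1 k t * \<beta> k x)"
        unfolding dt_def by (intro ext DERIV_imp_deriv DERIV_cmult_right \<alpha>)
      have e2: "dx ?\<phi> = (\<lambda>t x. \<alpha> k t * \<beta>1 k x)"
        unfolding dx_def by (intro ext DERIV_imp_deriv DERIV_cmult \<beta>)
      have e3: "dx (\<lambda>t x. \<alpha> k t * \<beta>1 k x) = (\<lambda>t x. \<alpha> k t * \<beta>2 k x)"
        unfolding dx_def by (intro ext DERIV_imp_deriv DERIV_cmult \<beta>)
      have C: "C12_on UNIV ?\<phi>"
      proof -
        have "(\<lambda>s. \<alpha> k s * \<beta> k x) field_differentiable at t" "(\<lambda>y. \<alpha> k t * \<beta> k y) field_differentiable at x"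
          "(\<lambda>y. \<alpha> k t * \<beta>1 k y) field_differentiable at x" for t x
          unfolding field_differentiable_def
          by (rule exI, rule DERIV_cmult_right[OF \<alpha>(1)], rule exI, rule DERIV_cmult[OF \<beta>(1)], rule exI, rule DERIV_cmult[OF \<beta>(2)])
        moreover have "continuous_on UNIV (\<lambda>z. \<alpha> k (fst z) * \<beta> k (snd z))" "continuous_on UNIV (\<lambda>z. \<alpha>1 k (fst z) * \<beta> k (snd z))"
          "continuous_on UNIV (\<lambda>z. \<alpha> k (fst z) * \<beta>1 k (snd z))" "continuous_on UNIV (\<lambda>z. \<alpha> k (fst z) * \<beta>2 k (snd z))"
          by (intro continuous_intros c)+
        ultimately show ?thesis unfolding C12_on_def e1 e2 e3 by (simp add: split_beta')
      qed
      have s: "\<forall>t x. (t, x) \<notin> ?R \<longrightarrow> ?\<phi> t x = 0"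
        using \<alpha>(5)[of _ k] \<beta>(5)[of _ k] by (auto simp: greaterThanLessThan_def)
      have "- J (\<lambda>t x. p t x * (\<alpha>1 k t * \<beta> k x)) =
          \<sigma>\<^sup>2 / 2 * J (\<lambda>t x. p t x * (\<alpha> k t * \<beta>2 k x)) + \<mu> * J (\<lambda>t x. p t x * (\<alpha> k t * \<beta>1 k x))
          - J (\<lambda>t x. enn2real (\<Lambda> x) * p t x * ?\<phi> t x) + \<theta> * J (\<lambda>t x. enn2real (\<Lambda> (\<theta> * x)) * p t (\<theta> * x) * ?\<phi> t x)"
        using fe[unfolded forward_equation_distributional_def, THEN conjunct2, THEN conjunct2, THEN conjunct2, rule_format, of ?R ?\<phi>, OF conjI[OF cR conjI[OF RU conjI[OF C s]]]]
        unfolding e1 e2 e3 by (simp add: J_def set_lebesgue_integral_def split_beta')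
      moreover have "J (\<lambda>t x. dt p t x * ?\<phi> t x + p t x * (\<alpha>1 k t * \<beta> k x)) = 0"
        unfolding J_def
      proof (rule integral_derivative_fst[OF ab, where f = "\<lambda>t x. p t x * ?\<phi> t x"])
        show "((\<lambda>s. p s x * ?\<phi> s x) has_real_derivative dt p t x * ?\<phi> t x + p t x * (\<alpha>1 k t * \<beta> k x)) (at t)"
          if "t \<in> {a..b}" "x \<in> {c..d}" for t x
          by (rule DERIV_cong[OF DERIV_mult[OF dp(1)[OF that] DERIV_cmult_right[OF \<alpha>(1)]]]) simp
      qed (intro continuous_intros cp c, use \<alpha>(5)[of _ k] in auto)
      moreover have "J (\<lambda>t x. dx p t x * ?\<phi> t x + p t x * (\<alpha> k t * \<beta>1 k x)) = 0"
        unfolding J_def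
      proof (rule integral_derivative_snd[OF cd, where f = "\<lambda>t x. p t x * ?\<phi> t x"])
        show "((\<lambda>x. p t x * ?\<phi> t x) has_real_derivative dx p t x * ?\<phi> t x + p t x * (\<alpha> k t * \<beta>1 k x)) (at x)"
          if "t \<in> {a..b}" "x \<in> {c..d}" for t x
          by (rule DERIV_cong[OF DERIV_mult[OF dp(2)[OF that] DERIV_cmult[OF \<beta>(1)]]]) simp
      qed (intro continuous_intros cp c, use \<beta>(5)[of _ k] in auto)
      \<comment> \<open>The x-derivative of p_x \<phi> - p \<phi>_x is p_xx \<phi> - p \<phi>_xx, so
        one application of the fundamental theorem performs both integrations by parts.\<close>
      moreover have "J (\<lambda>t x. dx (dx p) t x * ?\<phi> t x + - (p t x * (\<alpha> k t * \<beta>2 k x))) = 0"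
        unfolding J_def
      proof (rule integral_derivative_snd[OF cd, where f = "\<lambda>t x. dx p t x * ?\<phi> t x - p t x * (\<alpha> k t * \<beta>1 k x)"])
        show "((\<lambda>x. dx p t x * ?\<phi> t x - p t x * (\<alpha> k t * \<beta>1 k x)) has_real_derivative
            dx (dx p) t x * ?\<phi> t x + - (p t x * (\<alpha> k t * \<beta>2 k x))) (at x)"
          if "t \<in> {a..b}" "x \<in> {c..d}" for t x
          by (rule DERIV_cong[OF DERIV_diff[OF DERIV_mult[OF dp(3)[OF that] DERIV_cmult[OF \<beta>(1)]] DERIV_mult[OF dp(2)[OF that] DERIV_cmult[OF \<beta>(2)]]]]) simp
      qed (intro continuous_intros cp c, use \<beta>(5,8)[of _ k] in auto)
      moreover have "J (\<lambda>t x. dt p t x * ?\<phi> t x + p t x * (\<alpha>1 k t * \<beta> k x)) = J (\<lambda>t x. dt p t x * ?\<phi> t x) + J (\<lambda>t x. p t x * (\<alpha>1 k t * \<beta> k x))"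
        "J (\<lambda>t x. dx p t x * ?\<phi> t x + p t x * (\<alpha> k t * \<beta>1 k x)) = J (\<lambda>t x. dx p t x * ?\<phi> t x) + J (\<lambda>t x. p t x * (\<alpha> k t * \<beta>1 k x))"
        "J (\<lambda>t x. dx (dx p) t x * ?\<phi> t x + - (p t x * (\<alpha> k t * \<beta>2 k x))) = J (\<lambda>t x. dx (dx p) t x * ?\<phi> t x) + J (\<lambda>t x. - (p t x * (\<alpha> k t * \<beta>2 k x)))"
        by (intro J_add continuous_intros cp c)+
      moreover have "J (\<lambda>t x. - (p t x * (\<alpha> k t * \<beta>2 k x))) = - J (\<lambda>t x. p t x * (\<alpha> k t * \<beta>2 k x))"
        unfolding J_def by simp
      ultimately have main: "J (\<lambda>t x. dt p t x * ?\<phi> t x) - \<sigma>\<^sup>2 / 2 * J (\<lambda>t x. dx (dx p) t x * ?\<phi> t x) + \<mu> * J (\<lambda>t x. dx p t x * ?\<phi> t x)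
         + J (\<lambda>t x. enn2real (\<Lambda> x) * p t x * ?\<phi> t x) - \<theta> * J (\<lambda>t x. enn2real (\<Lambda> (\<theta> * x)) * p t (\<theta> * x) * ?\<phi> t x) = 0"
        by (simp add: eq_neg_iff_add_eq_0[symmetric])
      have "(\<integral>z. indicator ?R z * G z * w k z \<partial>lborel) = (\<integral>z. ?h (w k) z \<partial>lborel)"
        by (intro Bochner_Integration.integral_cong refl) (simp add: G_def algebra_simps)
      also have "\<dots> = J (\<lambda>t x. dt p t x * ?\<phi> t x) - \<sigma>\<^sup>2 / 2 * J (\<lambda>t x. dx (dx p) t x * ?\<phi> t x) + \<mu> * J (\<lambda>t x. dx p t x * ?\<phi> t x)
         + J (\<lambda>t x. enn2real (\<Lambda> x) * p t x * ?\<phi> t x) - \<theta> * J (\<lambda>t x. enn2real (\<Lambda> (\<theta> * x)) * p t (\<theta> * x) * ?\<phi> t x)"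
        using wi[OF ci[OF cp(2)], of k] wi[OF ci[OF cp(3)], of k] wi[OF ci[OF cp(4)], of k] wi[OF lam(1), of k] wi[OF lam(2), of k]
        by (simp add: J_def w_def mult.assoc)
      finally show ?thesis unfolding main .
    qed
    have "(\<lambda>k. \<integral>z. indicator ?R z * G z * w k z \<partial>lborel) \<longlonglongrightarrow> (\<integral>z. indicator ?Q z * G z \<partial>lborel)"
    proof (rule integral_dominated_convergence[where w = "\<lambda>z. \<bar>indicator ?R z * G z\<bar>"])
      have "(\<lambda>z. indicator ?Q z *\<^sub>R (indicator ?R z * G z)) \<in> borel_measurable lborel"
        using Gi by (intro borel_measurable_scaleR borel_measurable_indicator) (auto simp: borel_open open_Times)
      moreover have "(\<lambda>z. indicator ?Q z *\<^sub>R (indicator ?R z * G z)) = (\<lambda>z. indicator ?Q z * G z)"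
        by (auto simp: fun_eq_iff split: split_indicator)
      ultimately show "(\<lambda>z. indicator ?Q z * G z) \<in> borel_measurable lborel" by simp
      show "(\<lambda>z. indicator ?R z * G z * w k z) \<in> borel_measurable lborel" for k using wi[OF Gi, of k] by auto
      show "integrable lborel (\<lambda>z. \<bar>indicator ?R z * G z\<bar>)" using Gi by (rule integrable_abs)
      show "AE z in lborel. norm (indicator ?R z * G z * w k z) \<le> \<bar>indicator ?R z * G z\<bar>" for k
      proof (rule AE_I2)
        fix z
        have "\<bar>indicator ?R z * G z\<bar> * w k z \<le> \<bar>indicator ?R z * G z\<bar>" using w by (intro mult_left_le) auto
        then show "norm (indicator ?R z * G z * w k z) \<le> \<bar>indicator ?R z * G z\<bar>" using w[of k z] by (simp add: abs_mult)
      qed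
      show "AE z in lborel. (\<lambda>k. indicator ?R z * G z * w k z) \<longlonglongrightarrow> indicator ?Q z * G z"
      proof (rule AE_I2)
        fix z :: "real \<times> real"
        show "(\<lambda>k. indicator ?R z * G z * w k z) \<longlonglongrightarrow> indicator ?Q z * G z"
        proof (cases "z \<in> ?Q")
          case True
          then have z: "fst z \<in> {a<..<b}" "snd z \<in> {c<..<d}" "z \<in> ?R" by auto
          have "(\<lambda>k. indicator ?R z * G z * w k z) \<longlonglongrightarrow> indicator ?R z * G z * (1 * 1)"
            unfolding w_def by (intro tendsto_mult tendsto_const \<alpha>(7) \<beta>(7) z)
          then show ?thesis using z True by simp
        next
          case False
          then have "fst z \<notin> {a<..<b} \<or> snd z \<notin> {c<..<d}" by (auto simp: mem_Times_iff)
          then have "w k z = 0" for k unfolding w_def using \<alpha>(5)[of "fst z" k] \<beta>(5)[of "snd z" k] by auto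
          then show ?thesis using False by simp
        qed
      qed
    qed
    then show ?thesis unfolding zero by (simp add: LIMSEQ_const_iff)
  qed
qed

lemma open_rectangle:
  fixes U :: "(real \<times> real) set"
  assumes "open U" "z \<in> U"
  obtains a b c d where "z \<in> {a<..<b} \<times> {c<..<d}" "{a..b} \<times> {c..d} \<subseteq> U"
proof -
  obtain A B where AB: "open A" "open B" "z \<in> A \<times> B" "A \<times> B \<subseteq> U" using open_prod_elim[OF assms] by metis
  obtain e where e: "0 < e" "cball (fst z) e \<subseteq> A" using AB open_contains_cball[of A] by (auto simp: mem_Times_iff)
  obtain e' where e': "0 < e'" "cball (snd z) e' \<subseteq> B" using AB open_contains_cball[of B] by (auto simp: mem_Times_iff)
  show thesis
  proof (rule that[of "fst z - e" "fst z + e" "snd z - e'" "snd z + e'"])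
    show "z \<in> {fst z - e<..<fst z + e} \<times> {snd z - e'<..<snd z + e'}" using e e' by (cases z) simp
    show "{fst z - e..fst z + e} \<times> {snd z - e'..snd z + e'} \<subseteq> U"
      using e(2) e'(2) AB(4) by (auto simp: cball_eq_atLeastAtMost)
  qed
qed

lemma box_Times: "box u v = {fst u<..<fst v} \<times> {snd u<..<snd (v :: real \<times> real)}"
  by (rule set_eqI, case_tac x, cases u, cases v) (auto simp: mem_box Basis_prod_def ball_Un)

text \<open>Countably many rectangles cover \<open>U\<close>, and on each the difference
  \<open>G\<close> of the two sides integrates to 0 over all subrectangles; this gives the statement
  almost everywhere. Under the continuity assumptions at a point, \<open>G\<close> is continuous
  there, so a nonzero value would persist on a nonempty open set, which is not a null set.\<close>

theorem classical_forward_equation: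
  fixes p :: "real \<Rightarrow> real \<Rightarrow> real"
  assumes fe: "forward_equation_distributional \<Lambda> \<theta> \<mu> \<sigma> p" and U: "open U" "U \<subseteq> {0<..} \<times> UNIV" and p: "C12_on U p"
  shows "AE (t, x) in lborel. (t, x) \<in> U \<longrightarrow> forward_equation_at \<Lambda> \<theta> \<mu> \<sigma> p t x"
    and "(t, x) \<in> U \<Longrightarrow> \<Lambda> x < \<infinity> \<Longrightarrow> \<Lambda> (\<theta> * x) < \<infinity> \<Longrightarrow> isCont \<Lambda> x \<Longrightarrow> isCont \<Lambda> (\<theta> * x) \<Longrightarrow>
      isCont (\<lambda>(s, y). p s y) (t, \<theta> * x) \<Longrightarrow> forward_equation_at \<Lambda> \<theta> \<mu> \<sigma> p t x"
proof -
  define G where "G z = dt p (fst z) (snd z) - \<sigma>\<^sup>2 / 2 * dx (dx p) (fst z) (snd z) + \<mu> * dx p (fst z) (snd z)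
    + enn2real (\<Lambda> (snd z)) * p (fst z) (snd z) - \<theta> * (enn2real (\<Lambda> (\<theta> * snd z)) * p (fst z) (\<theta> * snd z))" for z
  note T = forward_equation_tested_on_rectangle[OF fe U(2) p, folded G_def]
  have G_iff: "forward_equation_at \<Lambda> \<theta> \<mu> \<sigma> p t x \<longleftrightarrow> G (t, x) = 0" for t x
    by (auto simp: forward_equation_at_def G_def)
  define FF where "FF = {{a<..<b} \<times> {c<..<d} | a b c d :: real. {a..b} \<times> {c..d} \<subseteq> U}"
  have op: "open S" if "S \<in> FF" for S using that by (auto simp: FF_def open_Times)
  \<comment> \<open>By Lindelof's theorem a countable subfamily suffices, so that the exceptional
    null sets can be united.\<close>
  obtain F' where F': "F' \<subseteq> FF" "countable F'" "\<Union>F' = \<Union>FF" using Lindelof[of FF] op by blast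
  have cover: "U \<subseteq> \<Union>FF"
  proof
    fix z assume "z \<in> U"
    from open_rectangle[OF U(1) this] obtain a b c d where "z \<in> {a<..<b} \<times> {c<..<d}" "{a..b} \<times> {c..d} \<subseteq> U" by blast
    then show "z \<in> \<Union>FF" unfolding FF_def by blast
  qed
  have "AE z in lborel. z \<in> S \<longrightarrow> G z = 0" if "S \<in> F'" for S
  proof -
    have "S \<in> FF" using that F'(1) by blast
    then obtain a b c d where S: "S = {a<..<b} \<times> {c<..<d}" "{a..b} \<times> {c..d} \<subseteq> U" by (auto simp: FF_def)
    have "(\<lambda>z. indicator S z *\<^sub>R (indicator ({a..b} \<times> {c..d}) z * G z)) = (\<lambda>z. indicator S z * G z)"
      by (auto simp: fun_eq_iff S(1) split: split_indicator)
    moreover have "integrable lborel (\<lambda>z. indicator S z *\<^sub>R (indicator ({a..b} \<times> {c..d}) z * G z))"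
      by (rule integrable_mult_indicator[OF _ T(1)[OF S(2)]]) (auto simp: S(1) borel_open open_Times)
    ultimately have i: "integrable lborel (\<lambda>z. indicator S z * G z)" by simp
    have "AE z in lborel. indicator S z * G z = 0"
    proof (rule AE_eq_0_of_box_integrals[OF i])
      fix u v :: "real \<times> real"
      \<comment> \<open>A box meets \<open>S\<close> in a rectangle of the same kind, to which the
        previous lemma applies.\<close>
      let ?a = "max a (fst u)" and ?b = "min b (fst v)" and ?c = "max c (snd u)" and ?d = "min d (snd v)"
      have sub: "{?a..?b} \<times> {?c..?d} \<subseteq> U" using S(2) by (auto simp: subset_eq)
      have "(\<integral>z. indicator (box u v) z * (indicator S z * G z) \<partial>lborel) = (\<integral>z. indicator ({?a<..<?b} \<times> {?c<..<?d}) z * G z \<partial>lborel)"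
        by (intro Bochner_Integration.integral_cong refl) (auto simp: S(1) box_Times split: split_indicator)
      then show "(\<integral>z. indicator (box u v) z * (indicator S z * G z) \<partial>lborel) = 0" using T(2)[OF sub] by simp
    qed
    then show ?thesis by eventually_elim (auto split: split_indicator_asm)
  qed
  then have "AE z in lborel. \<forall>S\<in>F'. z \<in> S \<longrightarrow> G z = 0" unfolding AE_ball_countable[OF F'(2)] by blast
  then have ae: "AE z in lborel. z \<in> U \<longrightarrow> G z = 0"
    by eventually_elim (use cover F'(3) in blast)
  then show "AE (t, x) in lborel. (t, x) \<in> U \<longrightarrow> forward_equation_at \<Lambda> \<theta> \<mu> \<sigma> p t x"
    by (simp add: G_iff split_beta')
  show "forward_equation_at \<Lambda> \<theta> \<mu> \<sigma> p t x"
    if z: "(t, x) \<in> U" and fin: "\<Lambda> x < \<infinity>" "\<Lambda> (\<theta> * x) < \<infinity>" and cL: "isCont \<Lambda> x" "isCont \<Lambda> (\<theta> * x)"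
      and cp: "isCont (\<lambda>(s, y). p s y) (t, \<theta> * x)"
  proof (rule ccontr)
    assume ne: "\<not> forward_equation_at \<Lambda> \<theta> \<mu> \<sigma> p t x"
    let ?z = "(t, x)"
    have I: "((\<lambda>z. z) \<longlongrightarrow> ?z) (nhds ?z)" by (rule filterlim_ident)
    have lim: "((\<lambda>z. enn2real (\<Lambda> (c * snd z))) \<longlongrightarrow> enn2real (\<Lambda> (c * x))) (nhds ?z)" if "isCont \<Lambda> (c * x)" "\<Lambda> (c * x) < \<infinity>" for c
    proof (rule tendsto_enn2real)
      have "((\<lambda>z. c * snd z) \<longlongrightarrow> c * x) (nhds ?z)"
        using tendsto_mult[OF tendsto_const tendsto_snd[OF I], of c] by simp
      from isCont_tendsto_compose[OF that(1) this]
      show "((\<lambda>z. \<Lambda> (c * snd z)) \<longlongrightarrow> ennreal (enn2real (\<Lambda> (c * x)))) (nhds ?z)" using that(2) by simp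
    qed simp
    have pz: "((\<lambda>z. p (fst z) (\<theta> * snd z)) \<longlongrightarrow> p t (\<theta> * x)) (nhds ?z)"
    proof -
      have "((\<lambda>z. (fst z, \<theta> * snd z)) \<longlongrightarrow> (t, \<theta> * x)) (nhds ?z)"
        using tendsto_Pair[OF tendsto_fst[OF I] tendsto_mult[OF tendsto_const tendsto_snd[OF I], of \<theta>]] by simp
      from isCont_tendsto_compose[OF cp this] show ?thesis by simp
    qed
    have U': "((\<lambda>z. f (fst z) (snd z)) \<longlongrightarrow> f t x) (nhds ?z)" if "continuous_on U (\<lambda>(t, x). f t x)" for f :: "real \<Rightarrow> real \<Rightarrow> real"
    proof -
      have "isCont (\<lambda>z. f (fst z) (snd z)) ?z"
        using that z U(1) by (simp add: continuous_on_eq_continuous_at split_beta')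
      then show ?thesis using tendsto_at_iff_tendsto_nhds[of "\<lambda>z. f (fst z) (snd z)" ?z] by (simp add: isCont_def)
    qed
    have L1: "((\<lambda>z. enn2real (\<Lambda> (snd z))) \<longlongrightarrow> enn2real (\<Lambda> x)) (nhds ?z)" using lim[of 1] cL fin by simp
    have L2: "((\<lambda>z. enn2real (\<Lambda> (\<theta> * snd z))) \<longlongrightarrow> enn2real (\<Lambda> (\<theta> * x))) (nhds ?z)" by (rule lim[OF cL(2) fin(2)])
    have P: "((\<lambda>z. p (fst z) (snd z)) \<longlongrightarrow> p t x) (nhds ?z)" "((\<lambda>z. dt p (fst z) (snd z)) \<longlongrightarrow> dt p t x) (nhds ?z)"
      "((\<lambda>z. dx p (fst z) (snd z)) \<longlongrightarrow> dx p t x) (nhds ?z)" "((\<lambda>z. dx (dx p) (fst z) (snd z)) \<longlongrightarrow> dx (dx p) t x) (nhds ?z)"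
      by (rule U', use p in \<open>simp add: C12_on_def\<close>)+
    have "(G \<longlongrightarrow> G ?z) (nhds ?z)"
      unfolding G_def fst_conv snd_conv
      by (intro tendsto_add tendsto_diff tendsto_mult tendsto_const L1 L2 pz P)
    moreover have "G ?z \<noteq> 0" using ne G_iff by simp
    ultimately have "eventually (\<lambda>w. G w \<noteq> 0) (nhds ?z)" by (rule tendsto_imp_eventually_ne)
    then obtain S where S: "open S" "?z \<in> S" "\<And>w. w \<in> S \<Longrightarrow> G w \<noteq> 0" by (auto simp: eventually_nhds)
    have SU: "open (S \<inter> U)" using S U by auto
    have "AE w in lborel. w \<notin> S \<inter> U" using ae by eventually_elim (use S in auto)
    then have "S \<inter> U \<in> null_sets lborel" using SU by (subst (asm) AE_iff_null_sets[symmetric]) auto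
    then have "negligible (S \<inter> U)" by (simp add: negligible_iff_null_sets null_sets_completionI)
    then show False using open_not_negligible[OF SU] S(2) z by blast
  qed
qed

section \<open>Null sets and the natural filtration\<close>

lemma space_natural_filtration: "space (natural_filtration M X t) = space M"
  by (simp add: natural_filtration_def space_measure_of_conv)

lemma sets_natural_filtration:
  "sets (natural_filtration M X t) =
    sigma_sets (space M) ({X s -` A \<inter> space M |s A. 0 \<le> s \<and> s \<le> t \<and> A \<in> sets borel} \<union> null_sets M)"
  unfolding natural_filtration_def using sets.sets_into_space[of _ M] by (intro sets_measure_of) auto

lemma natural_filtration_mono: "s \<le> t \<Longrightarrow> sets (natural_filtration M X s) \<subseteq> sets (natural_filtration M X t)"
  unfolding sets_natural_filtration by (intro sigma_sets_mono') (auto intro: order_trans)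

lemma natural_filtration_le:
  assumes "\<forall>t\<ge>0. X t \<in> borel_measurable M"
  shows "sets (natural_filtration M X t) \<subseteq> sets M"
  unfolding sets_natural_filtration using assms by (intro sets.sigma_sets_subset) (auto intro: measurable_sets)

lemma null_sets_natural_filtration: "A \<in> null_sets M \<Longrightarrow> A \<in> sets (natural_filtration M X t)"
  unfolding sets_natural_filtration by (auto intro: sigma_sets.Basic)

lemma adapted_natural_filtration: "0 \<le> t \<Longrightarrow> X t \<in> borel_measurable (natural_filtration M X t)"
  by (rule measurableI) (auto simp: space_natural_filtration sets_natural_filtration intro!: sigma_sets.Basic)

lemma distributed_cong_AE:
  assumes "AE \<omega> in M. f \<omega> = g \<omega>" "f \<in> measurable M K" "g \<in> measurable M K"
  shows "distributed M K f \<rho> \<longleftrightarrow> distributed M K g \<rho>"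
  using assms distr_cong_AE[OF refl refl assms] by (auto simp: distributed_def)

theorem theorem3p5:
  fixes M :: "'a measure"
    and W X :: "real \<Rightarrow> 'a \<Rightarrow> real"
    and N :: "'a \<Rightarrow> real set"
    and \<Lambda> :: "real \<Rightarrow> ennreal"
    and \<theta> \<theta>' \<mu> \<sigma> x0 :: real
  assumes "prob_space M"
    and "\<theta> > 1" and "1 / \<theta> + 1 / \<theta>' = 1" and "\<sigma> > 0"
    and "\<forall>t\<ge>0. X t \<in> borel_measurable M"
    and "brownian_motion M (natural_filtration M X) W"
    and "point_process M N"
    and "has_stochastic_intensity M (natural_filtration M X) N (\<lambda>t \<omega>. \<Lambda> (left_lim X t \<omega>))"
    and "solves_jump_sde M \<theta>' \<mu> \<sigma> x0 W N X"
    and "\<Lambda> \<in> borel_measurable borel"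
    and "\<forall>a b. 0 \<le> a \<and> a < b \<longrightarrow> (AE \<omega> in M. (\<integral>\<^sup>+ t\<in>{a..b}. \<Lambda> (X t \<omega>) \<partial>lborel) < \<infinity>)"
  shows "(\<exists>p. density_of_process M X p) \<and>
    (\<forall>p. density_of_process M X p \<longrightarrow>
      forward_equation_distributional \<Lambda> \<theta> \<mu> \<sigma> p \<and>
      (\<forall>U. open U \<and> U \<subseteq> {0<..} \<times> UNIV \<and> C12_on U p \<longrightarrow>
        (AE (t, x) in lborel. (t, x) \<in> U \<and> \<Lambda> x < \<infinity> \<and> \<Lambda> (\<theta> * x) < \<infinity> \<longrightarrow>
           forward_equation_at \<Lambda> \<theta> \<mu> \<sigma> p t x) \<and>
        (\<forall>(t, x)\<in>U. \<Lambda> x < \<infinity> \<and> \<Lambda> (\<theta> * x) < \<infinity> \<and>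
           isCont \<Lambda> x \<and> isCont \<Lambda> (\<theta> * x) \<and> isCont (\<lambda>(s, y). p s y) (t, \<theta> * x) \<longrightarrow>
           forward_equation_at \<Lambda> \<theta> \<mu> \<sigma> p t x)))"
proof -
  interpret prob_space M by fact
  let ?F = "natural_filtration M X"
  note X = assms(5) and BM = assms(6)[unfolded brownian_motion_def] and PP = assms(7)[unfolded point_process_def]
    and SI = assms(8)[unfolded has_stochastic_intensity_def] and SDE = assms(9)[unfolded solves_jump_sde_def]
  let ?eq = "\<lambda>\<omega>. \<forall>t\<ge>0. X t \<omega> = x0 + \<mu> * t + \<sigma> * W t \<omega> - (\<Sum>s\<in>N \<omega> \<inter> {0<..t}. left_lim X s \<omega> / \<theta>')"
  have "AE \<omega> in M. W 0 \<omega> = 0 \<and> continuous_on {0..} (\<lambda>t. W t \<omega>) \<and> ?eq \<omega>"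
    using BM SDE by (intro AE_conjI) auto
  then obtain N0 where N0': "{\<omega> \<in> space M. \<not> (W 0 \<omega> = 0 \<and> continuous_on {0..} (\<lambda>t. W t \<omega>) \<and> ?eq \<omega>)} \<subseteq> N0"
    and N0e: "emeasure M N0 = 0" "N0 \<in> sets M"
    by (rule AE_E)
  have N0: "N0 \<in> null_sets M" using N0e by (rule null_setsI)
  have good: "W 0 \<omega> = 0" "continuous_on {0..} (\<lambda>t. W t \<omega>)" "?eq \<omega>" if "\<omega> \<in> space M" "\<omega> \<notin> N0" for \<omega>
    using N0' that by blast+
  have aeN0: "AE \<omega> in M. \<omega> \<notin> N0" by (rule AE_not_in[OF N0])
  \<comment> \<open>On the exceptional null set \<open>N0\<close> the process is replaced by the
    line x0 + \<mu> t, which solves the equation with vanishing noise and no jumps. The filtration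
    contains the null events, so the modification stays adapted, and neither laws nor integrals
    change.\<close>
  define W' where "W' t \<omega> = (if \<omega> \<in> N0 then 0 else W t \<omega>)" for t \<omega>
  define X' where "X' t \<omega> = (if \<omega> \<in> N0 then x0 + \<mu> * t else X t \<omega>)" for t \<omega>
  define N' where "N' \<omega> = (if \<omega> \<in> N0 then {} else N \<omega>)" for \<omega>
  have N0F: "N0 \<inter> space (?F t) \<in> sets (?F t)" for t
    using null_sets_natural_filtration[OF N0, of X t] by (rule sets.Int) simp
  have mod: "(\<lambda>\<omega>. if \<omega> \<in> N0 then c else f \<omega>) \<in> borel_measurable (?F t)"
    if "f \<in> borel_measurable (?F t)" for c :: real and f t
    by (rule measurable_If_set[OF measurable_const that N0F]) simp
  have toM: "f \<in> borel_measurable M" if "f \<in> borel_measurable (?F t)" for f :: "'a \<Rightarrow> real" and t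
    using that natural_filtration_le[OF X, of t] by (auto simp: measurable_def space_natural_filtration)
  have Wm: "W t \<in> borel_measurable (?F t)" if "0 \<le> t" for t using BM that by auto
  have X'm: "X' t \<in> borel_measurable (?F t)" and W'm: "W' t \<in> borel_measurable (?F t)" if "0 \<le> t" for t
    using mod[OF adapted_natural_filtration[OF that], of "x0 + \<mu> * t"] mod[OF Wm[OF that], of 0]
    by (simp_all add: X'_def[abs_def] W'_def[abs_def])
  have inc: "AE \<omega> in M. W' t \<omega> - W' s \<omega> = W t \<omega> - W s \<omega>" for s t
    using aeN0 by eventually_elim (simp add: W'_def)
  have incm: "(\<lambda>\<omega>. W' t \<omega> - W' s \<omega>) \<in> borel_measurable M" "(\<lambda>\<omega>. W t \<omega> - W s \<omega>) \<in> borel_measurable M" if "0 \<le> s" "s < t" for s t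
    using that toM[OF W'm] toM[OF Wm] by auto
  have ll: "left_lim X' t \<omega> = left_lim X t \<omega>" if "\<omega> \<notin> N0" for t \<omega>
    using that by (simp add: left_lim_def X'_def)
  \<comment> \<open>The filtration remains that of the original \<open>X\<close>; adaptedness of the
    modified processes to it is all that is required.\<close>
  interpret J: jump_diffusion M ?F W' X' N' \<Lambda> \<theta> \<theta>' \<mu> \<sigma> x0
  proof
    show "space (?F t) = space M" for t by (rule space_natural_filtration)
    show "sets (?F t) \<subseteq> sets M" for t by (rule natural_filtration_le[OF X])
    show "sets (?F s) \<subseteq> sets (?F t)" if "s \<le> t" for s t by (rule natural_filtration_mono[OF that])
    show "X' t \<in> borel_measurable (?F t)" "W' t \<in> borel_measurable (?F t)" if "0 \<le> t" for t
      using X'm W'm that by auto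
    show "(\<lambda>\<omega>. real (card (N' \<omega> \<inter> {0<..t}))) \<in> borel_measurable (?F t)" if "0 \<le> t" for t
    proof -
      have "(\<lambda>\<omega>. real (card (N \<omega> \<inter> {0<..t}))) \<in> borel_measurable (?F t)" using SI that by simp
      from mod[OF this, of 0] show ?thesis
        by (rule back_subst[where P = "\<lambda>f. f \<in> borel_measurable (?F t)"]) (auto simp: N'_def fun_eq_iff)
    qed
    show "W' 0 \<omega> = 0" "continuous_on {0..} (\<lambda>t. W' t \<omega>)" if "\<omega> \<in> space M" for \<omega>
      using good(1,2)[OF that] by (cases "\<omega> \<in> N0"; simp add: W'_def)+
    show "distributed M lborel (\<lambda>\<omega>. W' t \<omega> - W' s \<omega>) (\<lambda>x. ennreal (normal_density 0 (sqrt (t - s)) x))" if "0 \<le> s" "s < t" for s t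
    proof -
      have "distributed M lborel (\<lambda>\<omega>. W t \<omega> - W s \<omega>) (\<lambda>x. ennreal (normal_density 0 (sqrt (t - s)) x))"
        using BM that by blast
      then show ?thesis by (subst distributed_cong_AE[OF inc]) (use incm[OF that] in simp_all)
    qed
    show "prob (A \<inter> ((\<lambda>\<omega>. W' t \<omega> - W' s \<omega>) -` B \<inter> space M)) = prob A * prob ((\<lambda>\<omega>. W' t \<omega> - W' s \<omega>) -` B \<inter> space M)"
      if st: "0 \<le> s" "s < t" and A: "A \<in> sets (?F s)" and B: "B \<in> sets borel" for s t A B
    proof -
      let ?b = "(\<lambda>\<omega>. W t \<omega> - W s \<omega>) -` B \<inter> space M" and ?b' = "(\<lambda>\<omega>. W' t \<omega> - W' s \<omega>) -` B \<inter> space M"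
      have AM: "A \<in> sets M" using natural_filtration_le[OF X] A by blast
      have bm: "?b \<in> sets M" "?b' \<in> sets M" using incm[OF st] B by (auto intro: measurable_sets)
      have "indep_set (sets (?F s)) {(\<lambda>\<omega>. W t \<omega> - W s \<omega>) -` B \<inter> space M |B. B \<in> sets borel}"
        using BM st by blast
      then have i: "prob (A \<inter> ?b) = prob A * prob ?b" by (rule indep_setD[OF _ A]) (use B in blast)
      have "prob (A \<inter> ?b') = prob (A \<inter> ?b)"
        by (rule finite_measure_eq_AE) (use AM bm inc[of t s] in \<open>auto elim!: eventually_mono\<close>)
      moreover have "prob ?b' = prob ?b"
        by (rule finite_measure_eq_AE) (use bm inc[of t s] in \<open>auto elim!: eventually_mono\<close>)
      ultimately show ?thesis using i by simp
    qed
    show "N' \<omega> \<subseteq> {0<..}" "finite (N' \<omega> \<inter> {0<..t})" if "\<omega> \<in> space M" for \<omega> t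
      using PP that by (auto simp: N'_def)
    show "(\<integral>\<^sup>+ \<omega>. (\<integral>\<^sup>+ s. C (s, \<omega>) \<partial>count_space (N' \<omega>)) \<partial>M) =
        (\<integral>\<^sup>+ \<omega>. (\<integral>\<^sup>+ s\<in>{0<..}. C (s, \<omega>) * \<Lambda> (left_lim X' s \<omega>) \<partial>lborel) \<partial>M)"
      if C: "C \<in> borel_measurable (predictable_sigma M ?F)" for C
    proof -
      have "(\<integral>\<^sup>+ \<omega>. (\<integral>\<^sup>+ s. C (s, \<omega>) \<partial>count_space (N' \<omega>)) \<partial>M) = (\<integral>\<^sup>+ \<omega>. (\<integral>\<^sup>+ s. C (s, \<omega>) \<partial>count_space (N \<omega>)) \<partial>M)"
        by (rule nn_integral_cong_AE) (use aeN0 in eventually_elim, simp add: N'_def)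
      also have "\<dots> = (\<integral>\<^sup>+ \<omega>. (\<integral>\<^sup>+ s\<in>{0<..}. C (s, \<omega>) * \<Lambda> (left_lim X s \<omega>) \<partial>lborel) \<partial>M)"
        using SI C by blast
      also have "\<dots> = (\<integral>\<^sup>+ \<omega>. (\<integral>\<^sup>+ s\<in>{0<..}. C (s, \<omega>) * \<Lambda> (left_lim X' s \<omega>) \<partial>lborel) \<partial>M)"
        by (rule nn_integral_cong_AE) (use aeN0 in eventually_elim, simp add: ll)
      finally show ?thesis .
    qed
    show "X' t \<omega> = x0 + \<mu> * t + \<sigma> * W' t \<omega> - (\<Sum>s\<in>N' \<omega> \<inter> {0<..t}. left_lim X' s \<omega> / \<theta>')"
      if "\<omega> \<in> space M" "0 \<le> t" for \<omega> t
    proof (cases "\<omega> \<in> N0")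
      case False
      then show ?thesis using good(3)[OF that(1) False] that(2) ll[OF False] by (simp add: X'_def W'_def N'_def)
    qed (simp add: X'_def W'_def N'_def)
    show "AE \<omega> in M. (\<integral>\<^sup>+ t\<in>{a..b}. \<Lambda> (X' t \<omega>) \<partial>lborel) < \<infinity>" if "0 \<le> a" "a < b" for a b
    proof -
      have "AE \<omega> in M. (\<integral>\<^sup>+ t\<in>{a..b}. \<Lambda> (X t \<omega>) \<partial>lborel) < \<infinity>" using assms(11) that by blast
      then show ?thesis using aeN0 by eventually_elim (simp add: X'_def)
    qed
  qed (use assms(2-4,10) in auto)
  have dens: "density_of_process M X' p \<longleftrightarrow> density_of_process M X p" for p
  proof -
    have "distributed M lborel (X' t) f \<longleftrightarrow> distributed M lborel (X t) f" if "0 < t" for t f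
    proof (rule distributed_cong_AE)
      show "AE \<omega> in M. X' t \<omega> = X t \<omega>" using aeN0 by eventually_elim (simp add: X'_def)
    qed (use that X toM[OF X'm, of t] in auto)
    then show ?thesis unfolding density_of_process_def by auto
  qed
  show ?thesis
  proof (intro conjI allI impI)
    show "\<exists>p. density_of_process M X p" using J.ex_joint_density unfolding dens .
    fix p assume d: "density_of_process M X p"
    have fe: "forward_equation_distributional \<Lambda> \<theta> \<mu> \<sigma> p" by (rule J.forward_equation[unfolded dens, OF d])
    then show "forward_equation_distributional \<Lambda> \<theta> \<mu> \<sigma> p" .
    fix U assume U: "open U \<and> U \<subseteq> {0<..} \<times> UNIV \<and> C12_on U p"
    then have U': "open U" "U \<subseteq> {0<..} \<times> UNIV" "C12_on U p" by auto
    note cl = classical_forward_equation[OF fe U']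
    show "AE (t, x) in lborel. (t, x) \<in> U \<and> \<Lambda> x < \<infinity> \<and> \<Lambda> (\<theta> * x) < \<infinity> \<longrightarrow> forward_equation_at \<Lambda> \<theta> \<mu> \<sigma> p t x"
      using cl(1) by (rule eventually_mono) auto
    show "\<forall>(t, x)\<in>U. \<Lambda> x < \<infinity> \<and> \<Lambda> (\<theta> * x) < \<infinity> \<and> isCont \<Lambda> x \<and> isCont \<Lambda> (\<theta> * x) \<and>
        isCont (\<lambda>(s, y). p s y) (t, \<theta> * x) \<longrightarrow> forward_equation_at \<Lambda> \<theta> \<mu> \<sigma> p t x"
      using cl(2) by blast
  qed
qed

end
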